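(* Let $\Omega\subset\mathbb{R}^2$ be a lattice polygon of non-zero area and $P$ a finite non-empty subset of its interior $\Omega^\circ$. For $N\in\mathbb{N}$ let $F_N$ be the toppling function of the relaxation of the state $3+\sum_{p\in P}\delta_{[Np]}$ on $\Gamma_N=N\Omega\cap\mathbb{Z}^2$, and define $\tilde F_N\colon\Omega\to\mathbb{R}$ by $\tilde F_N(x)=\frac1N F_N([Nx])$. Then $\tilde F_N$ converges pointwise on $\Omega$ to the tropical polynomial $F_{\Omega,P}$ described in the context.
   Context: Sandpile model: for $v\in\mathbb{Z}^2$, $n(v)$ is the set of the four closest lattice points. For finite $\Gamma\subset\mathbb{Z}^2$ a state is $\phi\colon\Gamma\to\mathbb{Z}_{\ge0}$; the toppling at $v\in\Gamma$ is $T_v\phi=\phi-4\delta_v+\sum_{w\in\Gamma\cap n(v)}\delta_w$, legal if $\phi(v)\ge4$; $\phi$ is stable if $\phi<4$ everywhere; applying legal topplings until stability terminates in a state $\phi^\circ$ depending only on $\phi$. The toppling function of $\phi$ is the function $F\colon\mathbb{Z}^2\to\mathbb{Z}_{\ge0}$, vanishing outside $\Gamma$, with $F(v)$ equal to the number of topplings at $v$ in any relaxation sequence of $\phi$ (this number does not depend on the relaxation; equivalently $F$ is the pointwise minimum of all $H\colon\mathbb{Z}^2\to\mathbb{Z}_{\ge0}$ vanishing outside $\Gamma$ with $\phi+\Delta H\le3$ on $\Gamma$, where $\Delta H(v)=-4H(v)+\sum_{w\in n(v)}H(w)$). Here $3$ is the constant state and $[p]$ is coordinate-wise floor. Let $\phi_N=(3+\sum_{p\in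 P}\delta_{[Np]})^\circ$ on $\Gamma_N$. The sets $C_N=\frac1N\{v\in\Gamma_N\mid\phi_N(v)<3\}$ converge in Hausdorff sense to a planar graph $\tilde C_{\Omega,P}$ with straight edges of rational slope; $C_{\Omega,P}$ is the closure of $\tilde C_{\Omega,P}\cap\Omega^\circ$, with edge set $E$. With $\phi'_N(x)=N(3-\phi_N([Nx]))$ if $[Nx]\in\Gamma_N$ and $0$ otherwise, there is a unique assignment of weights $m^{\Omega,P}_e\in\mathbb{N}$ such that for every smooth $\psi$ supported on $\Omega^\circ$, $\lim_N\int\phi'_N\psi=\sum_{e\in E}\|l_e\|m^{\Omega,P}_e\int_e\psi$, where $l_e$ is a primitive integer vector parallel to $e$. With these weights $C_{\Omega,P}$ is an $\Omega$-tropical curve, i.e. a finite planar weighted graph in $\Omega$ with rational-slope edges and integer weights, meeting $\partial\Omega$ exactly at the vertices of $\Omega$, satisfying $\sum_{e\in E_v}m_el_e=0$ at each interior vertex $v$ (edges at $v$, primitive vectors oriented out of $v$), and such that there is a unique labeling $d_s\in\mathbb{Z}_{>0}$ of the sides of $\Omega$ with $\sum_{e\in E_v}m_el_e=d_{s_1}l_{s_1}+d_{s_2}l_{s_2}$ at each vertex $v$ of $\Omega$ ($s_1,s_2$ the sides at $v$, $l_{s_i}$ their primitive vectors oriented out of $v$). A tropical polynomial is $F(x_1,x_2)=\min_{(k,l)\in A}(kx_1+lx_2+a_{k,l})$, $A\subset\mathbb{Z}^2$ finite, $a_{k,l}\in\mathbb{R}$; its corner locus (where $F$ is not locally linear) is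 a plane tropical curve, the weight of an edge being the positive integer $m$ such that the jump of the gradient of $F$ across the edge is $m$ times a primitive integer vector; $F$ defines this curve. For an $\Omega$-tropical curve $C$, choose a plane tropical curve $C'$ with $C=C'\cap\Omega$; there is a unique tropical polynomial $F'$ vanishing on $\partial\Omega$ defining $C'$, and $F'|_\Omega$ is independent of $C'$; it is the $\Omega$-tropical polynomial of $C$. $F_{\Omega,P}$ is the $\Omega$-tropical polynomial of $C_{\Omega,P}$. *)

theory Defs
  imports "HOL-Analysis.Analysis"
begin

type_synonym lattice = "int \<times> int"
type_synonym plane = "real \<times> real"

definition of_lattice :: "lattice \<Rightarrow> plane" where
  "of_lattice v = (real_of_int (fst v), real_of_int (snd v))"

definition floor_pt :: "plane \<Rightarrow> lattice" where
  "floor_pt x = (\<lfloor>fst x\<rfloor>, \<lfloor>snd x\<rfloor>)"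

section \<open>The sandpile model\<close>

text \<open>A state on \<open>\<Gamma>\<close> is a nonnegative function on \<^typ>\<open>lattice\<close> of which only the values on \<open>\<Gamma>\<close>
  matter; toppling never changes a value outside \<open>\<Gamma>\<close>.\<close>

definition neighbours :: "lattice \<Rightarrow> lattice set" where
  "neighbours v = {(fst v + 1, snd v), (fst v - 1, snd v), (fst v, snd v + 1), (fst v, snd v - 1)}"

definition delta :: "lattice \<Rightarrow> lattice \<Rightarrow> int" where
  "delta v w = (if w = v then 1 else 0)"

definition topple :: "lattice set \<Rightarrow> lattice \<Rightarrow> (lattice \<Rightarrow> int) \<Rightarrow> (lattice \<Rightarrow> int)" where
  "topple \<Gamma> v \<phi> = (\<lambda>u. \<phi> u - 4 * delta v u + (\<Sum>w\<in>\<Gamma> \<inter> neighbours v. delta w u))"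

inductive legal_topplings ::
  "lattice set \<Rightarrow> (lattice \<Rightarrow> int) \<Rightarrow> lattice list \<Rightarrow> (lattice \<Rightarrow> int) \<Rightarrow> bool"
  for \<Gamma> where
  Nil: "legal_topplings \<Gamma> \<phi> [] \<phi>"
| Cons: "v \<in> \<Gamma> \<Longrightarrow> 4 \<le> \<phi> v \<Longrightarrow> legal_topplings \<Gamma> (topple \<Gamma> v \<phi>) vs \<phi>' \<Longrightarrow>
         legal_topplings \<Gamma> \<phi> (v # vs) \<phi>'"

definition stable :: "lattice set \<Rightarrow> (lattice \<Rightarrow> int) \<Rightarrow> bool" where
  "stable \<Gamma> \<phi> \<longleftrightarrow> (\<forall>v\<in>\<Gamma>. \<phi> v < 4)"

definition relaxation_sequence ::
  "lattice set \<Rightarrow> (lattice \<Rightarrow> int) \<Rightarrow> lattice list \<Rightarrow> (lattice \<Rightarrow> int) \<Rightarrow> bool" where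
  "relaxation_sequence \<Gamma> \<phi> vs \<phi>' \<longleftrightarrow> legal_topplings \<Gamma> \<phi> vs \<phi>' \<and> stable \<Gamma> \<phi>'"

definition relaxation :: "lattice set \<Rightarrow> (lattice \<Rightarrow> int) \<Rightarrow> (lattice \<Rightarrow> int)" where
  "relaxation \<Gamma> \<phi> = (THE \<phi>'. \<exists>vs. relaxation_sequence \<Gamma> \<phi> vs \<phi>')"

definition toppling_function :: "lattice set \<Rightarrow> (lattice \<Rightarrow> int) \<Rightarrow> lattice \<Rightarrow> nat" where
  "toppling_function \<Gamma> \<phi> v =
     (THE k. \<exists>vs \<phi>'. relaxation_sequence \<Gamma> \<phi> vs \<phi>' \<and> k = count_list vs v)"

definition lattice_polygon :: "plane set \<Rightarrow> bool" where
  "lattice_polygon \<Omega> \<longleftrightarrow> (\<exists>S. finite S \<and> \<Omega> = convex hull (of_lattice ` S))"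

definition Gamma :: "plane set \<Rightarrow> nat \<Rightarrow> lattice set" where
  "Gamma \<Omega> N = {v. of_lattice v \<in> (\<lambda>x. real N *\<^sub>R x) ` \<Omega>}"

definition initial_state :: "plane set \<Rightarrow> nat \<Rightarrow> lattice \<Rightarrow> int" where
  "initial_state P N = (\<lambda>v. 3 + (\<Sum>p\<in>P. delta (floor_pt (real N *\<^sub>R p)) v))"

definition final_state :: "plane set \<Rightarrow> plane set \<Rightarrow> nat \<Rightarrow> lattice \<Rightarrow> int" where
  "final_state \<Omega> P N = relaxation (Gamma \<Omega> N) (initial_state P N)"

definition scaled_toppling :: "plane set \<Rightarrow> plane set \<Rightarrow> nat \<Rightarrow> plane \<Rightarrow> real" where
  "scaled_toppling \<Omega> P N x =
     (1 / real N) * real (toppling_function (Gamma \<Omega> N) (initial_state P N) (floor_pt (real N *\<^sub>R x)))"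

definition deviation_set :: "plane set \<Rightarrow> plane set \<Rightarrow> nat \<Rightarrow> plane set" where
  "deviation_set \<Omega> P N =
     (\<lambda>v. (1 / real N) *\<^sub>R of_lattice v) ` {v \<in> Gamma \<Omega> N. final_state \<Omega> P N v < 3}"

definition deviation_density :: "plane set \<Rightarrow> plane set \<Rightarrow> nat \<Rightarrow> plane \<Rightarrow> real" where
  "deviation_density \<Omega> P N x =
     (if floor_pt (real N *\<^sub>R x) \<in> Gamma \<Omega> N
      then real N * (3 - real_of_int (final_state \<Omega> P N (floor_pt (real N *\<^sub>R x))))
      else 0)"

section \<open>Rational planar graphs\<close>

definition primitive :: "lattice \<Rightarrow> bool" where
  "primitive l \<longleftrightarrow> coprime (fst l) (snd l)"

definition rational_direction :: "plane \<Rightarrow> bool" where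
  "rational_direction u \<longleftrightarrow> (\<exists>l t. primitive l \<and> t > 0 \<and> u = t *\<^sub>R of_lattice l)"

definition primitive_vector :: "plane \<Rightarrow> plane" where
  "primitive_vector u = of_lattice (THE l. primitive l \<and> (\<exists>t>0. u = t *\<^sub>R of_lattice l))"

text \<open>An edge is stored as the pair of its endpoints, in an arbitrary order.
  The last condition below excludes storing an edge in both orders.\<close>

type_synonym edge = "plane \<times> plane"

definition edge_segment :: "edge \<Rightarrow> plane set" where
  "edge_segment e = closed_segment (fst e) (snd e)"

definition rational_planar_graph :: "plane set \<Rightarrow> edge set \<Rightarrow> bool" where
  "rational_planar_graph V E \<longleftrightarrow>
     finite V \<and> E \<subseteq> V \<times> V \<and>
     (\<forall>e\<in>E. rational_direction (snd e - fst e)) \<and>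
     (\<forall>e\<in>E. V \<inter> edge_segment e = {fst e, snd e}) \<and>
     (\<forall>e\<in>E. \<forall>e'\<in>E. e \<noteq> e' \<longrightarrow>
        edge_segment e \<inter> edge_segment e' \<subseteq> {fst e, snd e} \<inter> {fst e', snd e'})"

definition graph_support :: "plane set \<Rightarrow> edge set \<Rightarrow> plane set" where
  "graph_support V E = V \<union> (\<Union>e\<in>E. edge_segment e)"

definition edges_at :: "edge set \<Rightarrow> plane \<Rightarrow> edge set" where
  "edges_at E v = {e \<in> E. v = fst e \<or> v = snd e}"

definition outward_vector :: "plane \<Rightarrow> edge \<Rightarrow> plane" where
  "outward_vector v e = primitive_vector (if v = fst e then snd e - v else fst e - v)"

definition edge_norm :: "edge \<Rightarrow> real" where
  "edge_norm e = norm (primitive_vector (snd e - fst e))"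

text \<open>The integral with respect to arc length.\<close>

definition edge_integral :: "edge \<Rightarrow> (plane \<Rightarrow> real) \<Rightarrow> real" where
  "edge_integral e \<psi> =
     dist (fst e) (snd e) * integral {0..1} (\<lambda>t. \<psi> (fst e + t *\<^sub>R (snd e - fst e)))"

section \<open>The limit curve of the sandpile\<close>

definition hausdorff_limit :: "(nat \<Rightarrow> plane set) \<Rightarrow> plane set \<Rightarrow> bool" where
  "hausdorff_limit X Y \<longleftrightarrow>
     (\<forall>\<epsilon>>0. \<forall>\<^sub>F N in sequentially.
        (\<forall>x\<in>X N. \<exists>y\<in>Y. dist x y < \<epsilon>) \<and> (\<forall>y\<in>Y. \<exists>x\<in>X N. dist x y < \<epsilon>))"

primrec C_diff :: "nat \<Rightarrow> (plane \<Rightarrow> real) \<Rightarrow> bool" where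
  "C_diff 0 f \<longleftrightarrow> continuous_on UNIV f"
| "C_diff (Suc k) f \<longleftrightarrow>
     (\<exists>f1 f2. (\<forall>x. (f has_derivative (\<lambda>h. fst h * f1 x + snd h * f2 x)) (at x)) \<and>
              C_diff k f1 \<and> C_diff k f2)"

definition smooth :: "(plane \<Rightarrow> real) \<Rightarrow> bool" where
  "smooth f \<longleftrightarrow> (\<forall>k. C_diff k f)"

text \<open>\<open>sandpile_curve \<Omega> P V E m\<close>: the graph with vertices \<open>V\<close>, edges \<open>E\<close> and weights \<open>m\<close> is
  \<open>C\<^sub>\<Omega>\<^sub>,\<^sub>P\<close>. Restricting to the interior before taking the closure discards the parts of the
  Hausdorff limit that lie along the sides of \<open>\<Omega>\<close>.\<close>

definition sandpile_curve ::
  "plane set \<Rightarrow> plane set \<Rightarrow> plane set \<Rightarrow> edge set \<Rightarrow> (edge \<Rightarrow> nat) \<Rightarrow> bool" where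
  "sandpile_curve \<Omega> P V E m \<longleftrightarrow>
     rational_planar_graph V E \<and>
     (\<exists>V' E'. rational_planar_graph V' E' \<and>
        hausdorff_limit (deviation_set \<Omega> P) (graph_support V' E') \<and>
        graph_support V E = closure (graph_support V' E' \<inter> interior \<Omega>)) \<and>
     (\<forall>\<psi>. smooth \<psi> \<longrightarrow> closure {x. \<psi> x \<noteq> 0} \<subseteq> interior \<Omega> \<longrightarrow>
        (\<lambda>N. \<integral>x. deviation_density \<Omega> P N x * \<psi> x \<partial>lborel)
          \<longlonglongrightarrow> (\<Sum>e\<in>E. edge_norm e * real (m e) * edge_integral e \<psi>))"

section \<open>Tropical curves and tropical polynomials\<close>

definition side_labeling ::
  "plane set \<Rightarrow> edge set \<Rightarrow> (edge \<Rightarrow> nat) \<Rightarrow> (plane set \<Rightarrow> int) \<Rightarrow> bool" where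
  "side_labeling \<Omega> E m d \<longleftrightarrow>
     (\<forall>s. s edge_of \<Omega> \<longrightarrow> 0 < d s) \<and>
     (\<forall>v w1 w2. closed_segment v w1 edge_of \<Omega> \<longrightarrow> closed_segment v w2 edge_of \<Omega> \<longrightarrow> w1 \<noteq> w2 \<longrightarrow>
        (\<Sum>e\<in>edges_at E v. real (m e) *\<^sub>R outward_vector v e) =
        of_int (d (closed_segment v w1)) *\<^sub>R primitive_vector (w1 - v) +
        of_int (d (closed_segment v w2)) *\<^sub>R primitive_vector (w2 - v))"

definition omega_tropical_curve ::
  "plane set \<Rightarrow> plane set \<Rightarrow> edge set \<Rightarrow> (edge \<Rightarrow> nat) \<Rightarrow> bool" where
  "omega_tropical_curve \<Omega> V E m \<longleftrightarrow>
     rational_planar_graph V E \<and>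
     graph_support V E \<subseteq> \<Omega> \<and>
     graph_support V E \<inter> frontier \<Omega> = {v. v extreme_point_of \<Omega>} \<and>
     (\<forall>v \<in> V \<inter> interior \<Omega>. (\<Sum>e\<in>edges_at E v. real (m e) *\<^sub>R outward_vector v e) = 0) \<and>
     (\<exists>d. side_labeling \<Omega> E m d \<and>
        (\<forall>d'. side_labeling \<Omega> E m d' \<longrightarrow> (\<forall>s. s edge_of \<Omega> \<longrightarrow> d' s = d s)))"

definition tropical_polynomial :: "(plane \<Rightarrow> real) \<Rightarrow> bool" where
  "tropical_polynomial F \<longleftrightarrow>
     (\<exists>A a. finite A \<and> A \<noteq> {} \<and>
        F = (\<lambda>x. Min ((\<lambda>k. of_int (fst k) * fst x + of_int (snd k) * snd x + a k) ` (A :: lattice set))))"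

definition corner_locus :: "(plane \<Rightarrow> real) \<Rightarrow> plane set" where
  "corner_locus F = {x. \<not> (\<exists>U g c. open U \<and> x \<in> U \<and> (\<forall>y\<in>U. F y = g \<bullet> y + c))}"

text \<open>Positive on one side of the line spanned by the edge, negative on the other.\<close>

definition side_of_edge :: "edge \<Rightarrow> plane \<Rightarrow> real" where
  "side_of_edge e y =
     fst (snd e - fst e) * snd (y - fst e) - snd (snd e - fst e) * fst (y - fst e)"

text \<open>Every interior point of \<open>e\<close> lies on an edge of weight \<open>m\<close> of the curve defined by \<open>F\<close>:
  the gradients \<open>g1\<close>, \<open>g2\<close> on the two sides of \<open>e\<close> differ by \<open>m\<close> times a primitive vector.\<close>

definition tropical_weight :: "(plane \<Rightarrow> real) \<Rightarrow> edge \<Rightarrow> nat \<Rightarrow> bool" where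
  "tropical_weight F e m \<longleftrightarrow>
     0 < m \<and>
     (\<forall>x \<in> open_segment (fst e) (snd e).
        \<exists>U g1 g2 c1 c2 l. open U \<and> x \<in> U \<and>
          (\<forall>y\<in>U. side_of_edge e y > 0 \<longrightarrow> F y = g1 \<bullet> y + c1) \<and>
          (\<forall>y\<in>U. side_of_edge e y < 0 \<longrightarrow> F y = g2 \<bullet> y + c2) \<and>
          primitive l \<and> g1 - g2 = real m *\<^sub>R of_lattice l)"

text \<open>The tropical polynomial \<open>F'\<close> below stands for the pair of the plane tropical curve \<open>C'\<close>
  and its defining polynomial; \<open>C = C' \<inter> \<Omega>\<close> is required for the sets and for the weights.\<close>

definition omega_tropical_polynomial ::
  "plane set \<Rightarrow> plane set \<Rightarrow> edge set \<Rightarrow> (edge \<Rightarrow> nat) \<Rightarrow> (plane \<Rightarrow> real) \<Rightarrow> bool" where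
  "omega_tropical_polynomial \<Omega> V E m F \<longleftrightarrow>
     omega_tropical_curve \<Omega> V E m \<and>
     (\<exists>F'. tropical_polynomial F' \<and>
        (\<forall>x\<in>frontier \<Omega>. F' x = 0) \<and>
        corner_locus F' \<inter> \<Omega> = graph_support V E \<and>
        (\<forall>e\<in>E. tropical_weight F' e (m e)) \<and>
        (\<forall>x\<in>\<Omega>. F x = F' x))"

end

theory Submission imports Defs begin

text \<open>
  Let \<open>f\<close> be the \<open>\<Omega>\<close>-tropical polynomial and \<open>T\<close> the toppling function, which is the least
  admissible superharmonic function. Its discrete Laplacian is minus the deviation from the state
  \<open>3\<close>, up to the sources, so the weak convergence of the deviations to the weighted curve says
  that the distributional Laplacian of \<open>T/N - f\<close> tends to \<open>0\<close>. Near \<open>\<partial>\<Omega>\<close> an integer rounding of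
  \<open>f\<close>, kinked at the points of \<open>P\<close>, is a barrier for \<open>T\<close>; it exists because \<open>P\<close> lies on the curve.
  Hence mollifications of \<open>T/N - f\<close> tend to \<open>0\<close> by the maximum principle. A Caccioppoli estimate
  for the superharmonic function \<open>T\<close> turns this into convergence in mean square. Subharmonicity of
  \<open>max (c - T) 0\<close> then gives \<open>T \<ge> N f - o(N)\<close> uniformly. Superharmonic functions have no such
  local upper bound, but in the plane a connected set on which one is large has to be small. So each
  component of \<open>{T > N f + \<epsilon> N}\<close> contains at most one source, and there the barrier kinked at this
  source may replace \<open>T\<close>; minimality of \<open>T\<close> gives the upper bound.
\<close>

section \<open>The least action principle\<close>

text \<open>The hypothesis on the curve supplies averages against smooth functions supported inside
  \<Omega>. These control neither single values nor the boundary, and a unit source contributes only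
  O(1/N) to them, so P is invisible in the limit equation. Integrality brings P back: an integer
  function of size O(N), harmonic on a box of size comparable to N except for one unit source, would
  have horizontal and vertical neighbour sums at the source whose difference is odd and yet O(1/N).
  Hence two monomials of f tie at each p in P, and rounding them so that they tie at a lattice site
  gives barriers comparable to N f up to a bounded error, which is what makes them small at the
  boundary. The other obstacle is that only one sign of the Laplacian of T is known, so averages do
  not exclude upward spikes. Planarity enters here: a lattice path crossing a box meets a fixed
  proportion of its rows or columns, which bounds the energy from below at every scale. Distance to
  the boundary is measured by f itself, which vanishes there and is Lipschitz.\<close>

definition lap :: "(lattice \<Rightarrow> 'a::comm_ring_1) \<Rightarrow> lattice \<Rightarrow> 'a" where
  "lap g v = g (fst v + 1, snd v) + g (fst v - 1, snd v) + g (fst v, snd v + 1) + g (fst v, snd v - 1) - 4 * g v"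

lemma lap_neighbours: "lap g v = (\<Sum>w\<in>neighbours v. g w) - 4 * g v"
  by (simp add: lap_def neighbours_def add.assoc)

lemma neighbours_sym: "u \<in> neighbours v \<longleftrightarrow> v \<in> neighbours u"
  by (cases u; cases v) (auto simp: neighbours_def)

lemma finite_neighbours [simp]: "finite (neighbours v)"
  by (simp add: neighbours_def)

lemma topple_apply:
  "topple \<Gamma> v \<phi> u = \<phi> u - 4 * delta v u + (if u \<in> \<Gamma> \<and> u \<in> neighbours v then 1 else 0)"
proof -
  have "(\<Sum>w\<in>\<Gamma> \<inter> neighbours v. delta w u) = (if u \<in> \<Gamma> \<and> u \<in> neighbours v then 1 else 0)"
    by (auto simp: delta_def)
  then show ?thesis by (simp add: topple_def)
qed

lemma lap_delta: "lap (delta v) u = (if u \<in> neighbours v then 1 else 0) - 4 * delta v u"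
proof -
  have "(\<Sum>w\<in>neighbours u. delta v w) = (if v \<in> neighbours u then 1 else 0)"
    by (simp add: delta_def)
  then show ?thesis by (simp add: lap_neighbours neighbours_sym[of u v])
qed

lemma lap_add: "lap (\<lambda>w. f w + g w) v = lap f v + lap g v"
  by (simp add: lap_def algebra_simps)

lemma lap_diff: "lap (\<lambda>w. f w - g w) v = lap f v - lap g v"
  by (simp add: lap_def algebra_simps)

lemma lap_uminus: "lap (\<lambda>w. - g w) v = - lap g v"
  by (simp add: lap_def algebra_simps)

lemma lap_const [simp]: "lap (\<lambda>w. c) v = 0"
  by (simp add: lap_def)

lemma lap_of_int: "lap (\<lambda>w. real_of_int (f w)) v = real_of_int (lap f v)"
  by (simp add: lap_def)

lemma lap_sum: "lap (\<lambda>w. \<Sum>i\<in>I. f i w) v = (\<Sum>i\<in>I. lap (f i) v)"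
  by (simp add: lap_def sum.distrib sum_subtractf sum_distrib_left)

lemma legal_topplings_subset:
  "legal_topplings \<Gamma> \<phi> vs \<phi>' \<Longrightarrow> set vs \<subseteq> \<Gamma>"
  by (induction rule: legal_topplings.induct) auto

text \<open>Each toppling adds, on \<Gamma>, the Laplacian of an indicator function, so by linearity
  the result depends on the counts alone and not on the order.\<close>

lemma legal_topplings_result:
  assumes "legal_topplings \<Gamma> \<phi> vs \<phi>'"
  shows "\<phi>' u = (if u \<in> \<Gamma> then \<phi> u + lap (\<lambda>w. int (count_list vs w)) u else \<phi> u)"
  using assms
proof (induction rule: legal_topplings.induct)
  case (Nil \<phi>)
  then show ?case by simp
next
  case (Cons v \<phi> vs \<phi>')
  have "lap (\<lambda>w. int (count_list (v # vs) w)) u = lap (\<lambda>w. delta v w + int (count_list vs w)) u"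
    by (rule arg_cong[where f = "\<lambda>g. lap g u"]) (auto simp: delta_def)
  also have "\<dots> = lap (delta v) u + lap (\<lambda>w. int (count_list vs w)) u"
    by (rule lap_add)
  finally show ?case
    using Cons by (auto simp: topple_apply lap_delta delta_def)
qed

lemma legal_topplings_snoc:
  assumes "legal_topplings \<Gamma> \<phi> vs \<phi>'" "v \<in> \<Gamma>" "4 \<le> \<phi>' v"
  shows "legal_topplings \<Gamma> \<phi> (vs @ [v]) (topple \<Gamma> v \<phi>')"
  using assms
  by (induction rule: legal_topplings.induct) (auto intro: legal_topplings.intros)

text \<open>Induction on the sequence: an admissible \<open>H\<close> is at least 1 at the first
  toppled site, and once that unit is removed it is admissible for the rest. The bound therefore
  holds along every legal sequence, stabilising or not.\<close>

lemma least_action_principle: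
  assumes "legal_topplings \<Gamma> \<phi> vs \<phi>'"
    and "\<And>w. 0 \<le> H w" and "\<And>u. u \<in> \<Gamma> \<Longrightarrow> \<phi> u + lap H u \<le> 3"
  shows "int (count_list vs w) \<le> H w"
  using assms
proof (induction arbitrary: H rule: legal_topplings.induct)
  case (Nil \<phi>)
  then show ?case by simp
next
  case (Cons v \<phi> vs \<phi>')
  \<comment> \<open>Admissibility at an unstable site makes the Laplacian negative. The neighbours
    contribute nonnegatively to it, so \<open>H v\<close> is positive, and integrality gives
    \<open>1 \<le> H v\<close>.\<close>
  have "lap H v \<le> -1" using Cons.prems(2)[OF Cons.hyps(1)] Cons.hyps(2) by linarith
  moreover have "0 \<le> (\<Sum>w\<in>neighbours v. H w)" using Cons.prems(1) by (simp add: sum_nonneg)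
  ultimately have Hv: "1 \<le> H v" by (simp add: lap_neighbours)
  let ?H = "\<lambda>w. H w - delta v w"
  have "int (count_list vs w) \<le> ?H w"
  proof (rule Cons.IH)
    show "0 \<le> H u - delta v u" for u using Cons.prems(1)[of u] Hv by (auto simp: delta_def)
    show "topple \<Gamma> v \<phi> u + lap ?H u \<le> 3" if "u \<in> \<Gamma>" for u
      using Cons.prems(2)[OF that] that by (simp add: topple_apply lap_diff lap_delta)
  qed
  then show ?case by (auto simp: delta_def)
qed

text \<open>The abelian property: the counts of each stabilising sequence are admissible for the
  other one, so least action gives both inequalities, and the counts determine the final
  state.\<close>

lemma relaxation_sequence_unique:
  assumes "relaxation_sequence \<Gamma> \<phi> vs \<phi>1" "relaxation_sequence \<Gamma> \<phi> ws \<phi>2"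
  shows "count_list vs = count_list ws" "\<phi>1 = \<phi>2"
proof -
  have le: "count_list vs w \<le> count_list ws w"
    if "relaxation_sequence \<Gamma> \<phi> vs \<phi>1" "relaxation_sequence \<Gamma> \<phi> ws \<phi>2" for vs ws \<phi>1 \<phi>2 w
  proof -
    have l: "legal_topplings \<Gamma> \<phi> vs \<phi>1" "legal_topplings \<Gamma> \<phi> ws \<phi>2" "stable \<Gamma> \<phi>2"
      using that by (auto simp: relaxation_sequence_def)
    have "int (count_list vs w) \<le> int (count_list ws w)"
    proof (rule least_action_principle[OF l(1)])
      show "\<phi> u + lap (\<lambda>w. int (count_list ws w)) u \<le> 3" if "u \<in> \<Gamma>" for u
        using legal_topplings_result[OF l(2), of u] l(3) that by (auto simp: stable_def)
    qed simp
    then show ?thesis by simp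
  qed
  show eq: "count_list vs = count_list ws"
    using le[OF assms] le[OF assms(2,1)] by (intro ext antisym) auto
  show "\<phi>1 = \<phi>2"
  proof
    fix u
    show "\<phi>1 u = \<phi>2 u"
      using assms legal_topplings_result[of \<Gamma> \<phi> vs \<phi>1 u] legal_topplings_result[of \<Gamma> \<phi> ws \<phi>2 u] eq
      by (auto simp: relaxation_sequence_def)
  qed
qed

text \<open>Least action bounds the length of every legal sequence by the total of \<open>H\<close>
  over \<Gamma>. A longest legal sequence therefore exists, and it cannot be extended, which is
  stability.\<close>

lemma relaxation_sequence_exists:
  assumes "finite \<Gamma>" and "\<And>w. 0 \<le> H w" and "\<And>u. u \<in> \<Gamma> \<Longrightarrow> \<phi> u + lap H u \<le> 3"
  shows "\<exists>vs \<phi>'. relaxation_sequence \<Gamma> \<phi> vs \<phi>'"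
proof -
  define L where "L = {n. \<exists>vs \<phi>'. legal_topplings \<Gamma> \<phi> vs \<phi>' \<and> length vs = n}"
  have bound: "n \<le> nat (\<Sum>v\<in>\<Gamma>. H v)" if n: "n \<in> L" for n
  proof -
    obtain vs \<phi>' where vs: "legal_topplings \<Gamma> \<phi> vs \<phi>'" "length vs = n"
      using n by (auto simp: L_def)
    have "n = (\<Sum>v\<in>\<Gamma>. count_list vs v)"
      using legal_topplings_subset[OF vs(1)] vs(2) assms(1)
      by (metis sum_count_set)
    then have "int n = (\<Sum>v\<in>\<Gamma>. int (count_list vs v))" by simp
    also have "\<dots> \<le> (\<Sum>v\<in>\<Gamma>. H v)"
      by (intro sum_mono least_action_principle[OF vs(1)] assms(2,3))
    finally show ?thesis by linarith
  qed
  have "L \<noteq> {}" using legal_topplings.Nil[of \<Gamma> \<phi>] by (auto simp: L_def)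
  moreover have fin: "finite L" using bound by (meson finite_nat_set_iff_bounded_le)
  ultimately have "Max L \<in> L" by simp
  then obtain vs \<phi>' where vs: "legal_topplings \<Gamma> \<phi> vs \<phi>'" "length vs = Max L"
    by (auto simp: L_def)
  have "stable \<Gamma> \<phi>'"
  proof (rule ccontr)
    assume "\<not> stable \<Gamma> \<phi>'"
    then obtain v where "v \<in> \<Gamma>" "4 \<le> \<phi>' v" by (auto simp: stable_def not_less)
    then have "legal_topplings \<Gamma> \<phi> (vs @ [v]) (topple \<Gamma> v \<phi>')"
      using legal_topplings_snoc vs(1) by blast
    moreover have "length (vs @ [v]) = Suc (Max L)" using vs(2) by simp
    ultimately have "\<exists>ws \<phi>'. legal_topplings \<Gamma> \<phi> ws \<phi>' \<and> length ws = Suc (Max L)" by blast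
    then have "Suc (Max L) \<in> L" by (subst L_def) simp
    then show False using Max_ge[OF fin] by fastforce
  qed
  then show ?thesis using vs(1) by (auto simp: relaxation_sequence_def)
qed

lemma toppling_function_properties:
  fixes H :: "lattice \<Rightarrow> int"
  assumes fin: "finite \<Gamma>" and H: "\<And>w. 0 \<le> H w" "\<And>u. u \<in> \<Gamma> \<Longrightarrow> \<phi> u + lap H u \<le> 3"
  defines "T \<equiv> \<lambda>v. int (toppling_function \<Gamma> \<phi> v)"
  shows "v \<notin> \<Gamma> \<Longrightarrow> T v = 0"
    and "v \<in> \<Gamma> \<Longrightarrow> relaxation \<Gamma> \<phi> v = \<phi> v + lap T v"
    and "v \<in> \<Gamma> \<Longrightarrow> \<phi> v + lap T v \<le> 3"
    and "T v \<le> H v"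
proof -
  obtain vs \<phi>' where vs: "relaxation_sequence \<Gamma> \<phi> vs \<phi>'"
    using relaxation_sequence_exists[of \<Gamma> H \<phi>] assms by blast
  have rel: "relaxation \<Gamma> \<phi> = \<phi>'"
    unfolding relaxation_def using vs relaxation_sequence_unique(2)[OF vs] by blast
  have "toppling_function \<Gamma> \<phi> v = count_list vs v" for v
    unfolding toppling_function_def
  proof (rule the_equality)
    show "\<exists>ws \<phi>'. relaxation_sequence \<Gamma> \<phi> ws \<phi>' \<and> count_list vs v = count_list ws v"
      using vs by blast
    show "k = count_list vs v" if "\<exists>ws \<phi>'. relaxation_sequence \<Gamma> \<phi> ws \<phi>' \<and> k = count_list ws v" for k
      using that relaxation_sequence_unique(1)[OF vs] by metis
  qed
  then have T: "T = (\<lambda>v. int (count_list vs v))" by (simp add: T_def)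
  have leg: "legal_topplings \<Gamma> \<phi> vs \<phi>'" "stable \<Gamma> \<phi>'"
    using vs by (auto simp: relaxation_sequence_def)
  show "v \<notin> \<Gamma> \<Longrightarrow> T v = 0"
    using legal_topplings_subset[OF leg(1)] by (auto simp: T count_list_0_iff)
  show "v \<in> \<Gamma> \<Longrightarrow> relaxation \<Gamma> \<phi> v = \<phi> v + lap T v"
    using legal_topplings_result[OF leg(1), of v] by (simp add: rel T)
  show "v \<in> \<Gamma> \<Longrightarrow> \<phi> v + lap T v \<le> 3"
    using legal_topplings_result[OF leg(1), of v] leg(2) by (auto simp: T stable_def)
  show "T v \<le> H v"
    unfolding T by (rule least_action_principle[OF leg(1) H])
qed

section \<open>Comparison with admissible functions\<close>

lemma lap_mono_at:
  fixes f g :: "lattice \<Rightarrow> 'a::linordered_idom"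
  assumes "f v = g v" "\<And>w. w \<in> neighbours v \<Longrightarrow> f w \<le> g w"
  shows "lap f v \<le> lap g v"
  unfolding lap_neighbours using assms by (simp add: sum_mono)

lemma lap_cong:
  assumes "f v = g v" "\<And>w. w \<in> neighbours v \<Longrightarrow> f w = g w"
  shows "lap f v = lap g v"
  unfolding lap_neighbours using assms by (simp cong: sum.cong)

text \<open>Barriers made of affine pieces become negative far from \<Gamma>. Truncation at 0 makes
  them nonnegative everywhere and leaves the Laplacian on \<Gamma> unchanged, since every value
  entering it is nonnegative already.\<close>

lemma toppling_function_le:
  fixes H :: "lattice \<Rightarrow> int"
  assumes fin: "finite \<Gamma>"
    and H: "\<And>u w. u \<in> \<Gamma> \<Longrightarrow> w \<in> insert u (neighbours u) \<Longrightarrow> 0 \<le> H w"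
           "\<And>u. u \<in> \<Gamma> \<Longrightarrow> \<phi> u + lap H u \<le> 3" and "v \<in> \<Gamma>"
  shows "int (toppling_function \<Gamma> \<phi> v) \<le> H v"
proof -
  let ?H = "\<lambda>w. max 0 (H w)"
  have "int (toppling_function \<Gamma> \<phi> v) \<le> ?H v"
  proof (rule toppling_function_properties(4)[OF fin])
    fix u assume u: "u \<in> \<Gamma>"
    have "lap ?H u = lap H u"
      using H(1)[OF u] by (intro lap_cong) auto
    then show "\<phi> u + lap ?H u \<le> 3" using H(2)[OF u] by simp
  qed simp
  then show ?thesis using H(1)[OF assms(4)] by (simp add: max_def split: if_splits)
qed

section \<open>Discrete harmonic functions\<close>

lemma neighbours_Pair: "neighbours (x, y) = {(x + 1, y), (x - 1, y), (x, y + 1), (x, y - 1)}"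
  by (simp add: neighbours_def)

lemma lap_cmult: "lap (\<lambda>w. c * g w) v = c * lap g v"
  by (simp add: lap_def algebra_simps)

text \<open>At the rightmost point where the maximum over \<open>S\<close> is attained,
  subharmonicity forces the right neighbour to attain it as well. Both conditions are imposed only
  where \<open>g\<close> exceeds \<open>c\<close>, the only region that this argument
  visits.\<close>

lemma maximum_principle:
  fixes g :: "lattice \<Rightarrow> real"
  assumes fin: "finite S"
    and sub: "\<And>v. v \<in> S \<Longrightarrow> c < g v \<Longrightarrow> 0 \<le> lap g v"
    and bd: "\<And>v w. v \<in> S \<Longrightarrow> c < g v \<Longrightarrow> w \<in> neighbours v \<Longrightarrow> w \<notin> S \<Longrightarrow> g w \<le> c"
    and v: "v \<in> S"
  shows "g v \<le> c"
proof (rule ccontr)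
  assume neg: "\<not> g v \<le> c"
  define m where "m = Max (g ` S)"
  have mS: "m \<in> g ` S" and le_m: "\<And>w. w \<in> S \<Longrightarrow> g w \<le> m"
    using fin v by (auto simp: m_def intro!: Max_in)
  have mc: "c < m" using le_m[OF v] neg by linarith
  define T where "T = {w \<in> S. g w = m}"
  have T: "finite T" "T \<noteq> {}" using fin mS by (auto simp: T_def)
  define x where "x = Max (fst ` T)"
  have "x \<in> fst ` T" using T by (auto simp: x_def)
  then obtain y where xy: "(x, y) \<in> T" by auto
  have "(x, y) \<in> S" "g (x, y) = m" using xy by (auto simp: T_def)
  have nb: "g w \<le> m" if "w \<in> neighbours (x, y)" for w
    using bd[OF \<open>(x, y) \<in> S\<close> _ that] le_m[of w] mc \<open>g (x, y) = m\<close> by (cases "w \<in> S") auto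
  have "0 \<le> lap g (x, y)" using sub \<open>(x, y) \<in> S\<close> \<open>g (x, y) = m\<close> mc by auto
  then have "g (x + 1, y) = m"
    using nb[of "(x + 1, y)"] nb[of "(x - 1, y)"] nb[of "(x, y + 1)"] nb[of "(x, y - 1)"]
      \<open>g (x, y) = m\<close> by (simp add: lap_def neighbours_Pair)
  moreover have "(x + 1, y) \<in> S"
    using bd[OF \<open>(x, y) \<in> S\<close>, of "(x + 1, y)"] mc \<open>g (x, y) = m\<close> calculation
    by (auto simp: neighbours_Pair)
  ultimately have "(x + 1, y) \<in> T" by (simp add: T_def)
  then have "x + 1 \<le> x" unfolding x_def using T by (metis Max_ge finite_imageI fst_conv image_eqI)
  then show False by simp
qed

text \<open>The reflection x -> 1 - x turns the gradient at the origin into the value at (1, 0) of a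
  function that is odd about x = 1/2. On the half box \<open>S\<close> this function is compared
  with a harmonic polynomial whose value at (1, 0) is exactly the asserted bound.\<close>

lemma harmonic_gradient_le:
  fixes h :: "lattice \<Rightarrow> real" and R :: int
  assumes R: "1 \<le> R"
    and bnd: "\<And>x y. \<bar>x\<bar> \<le> R \<Longrightarrow> \<bar>y\<bar> \<le> R \<Longrightarrow> \<bar>h (x, y)\<bar> \<le> M"
    and harm: "\<And>x y. \<bar>x\<bar> < R \<Longrightarrow> \<bar>y\<bar> < R \<Longrightarrow> lap h (x, y) = 0"
  shows "h (1, 0) - h (0, 0) \<le> 2 * M / R"
proof (cases "R = 1")
  case True
  then show ?thesis using bnd[of 0 0] bnd[of 1 0] by simp
next
  case False
  have M: "0 \<le> M" using bnd[of 0 0] R by simp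
  \<comment> \<open>The Laplacians of the two squares cancel, so \<open>b\<close> is discrete
    harmonic. The bracket is at least \<open>R\<^sup>2\<close> on the right, upper and lower sides
    of the half box, where \<open>h\<close> minus its reflection is at most 2M.\<close>
  define b :: "lattice \<Rightarrow> real" where
    "b v = 2 * M / R\<^sup>2 * ((2 * fst v - 1) * R - fst v * (fst v - 1) + (snd v)\<^sup>2)" for v
  define g where "g v = h v - h (1 - fst v, snd v) - b v" for v
  define S where "S = {1..R-1} \<times> {-(R-1)..R-1}"
  have lapb: "lap b v = 0" for v
  proof -
    have "lap (\<lambda>v. (2 * real_of_int (fst v) - 1) * R - fst v * (real_of_int (fst v) - 1) + (real_of_int (snd v))\<^sup>2) v = 0"
      by (simp add: lap_def algebra_simps power2_eq_square)
    moreover have "lap b v = 2 * M / R\<^sup>2 * lap (\<lambda>v. (2 * real_of_int (fst v) - 1) * R - fst v * (real_of_int (fst v) - 1) + (real_of_int (snd v))\<^sup>2) v"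
      unfolding b_def by (simp only: lap_cmult) simp
    ultimately show ?thesis by simp
  qed
  have b_ge: "2 * M \<le> b (x, y)" if "R\<^sup>2 \<le> (2 * x - 1) * R - x * (x - 1) + y\<^sup>2" for x y
  proof -
    have "real_of_int (R\<^sup>2) \<le> real_of_int ((2 * x - 1) * R - x * (x - 1) + y\<^sup>2)"
      using that by (simp only: of_int_le_iff)
    then have "2 * M / R\<^sup>2 * R\<^sup>2 \<le> b (x, y)"
      unfolding b_def using M by (intro mult_left_mono) auto
    then show ?thesis using R by simp
  qed
  have "g (1, 0) \<le> 0"
  proof (rule maximum_principle[of S])
    show "finite S" by (simp add: S_def)
    show "(1, 0) \<in> S" using R False by (simp add: S_def)
  next
    fix v assume v: "v \<in> S"
    have *: "lap (\<lambda>v. h (1 - fst v, snd v)) v = lap h (1 - fst v, snd v)"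
      by (simp add: lap_def algebra_simps)
    have "lap g v = lap h v - lap h (1 - fst v, snd v) - lap b v"
      unfolding g_def by (simp only: lap_diff *)
    also have "\<dots> = 0"
      using harm[of "fst v" "snd v"] harm[of "1 - fst v" "snd v"] v lapb by (auto simp: S_def)
    finally show "0 \<le> lap g v" by simp
  next
    fix v w assume v: "v \<in> S" and gv: "0 < g v" and w: "w \<in> neighbours v" "w \<notin> S"
    obtain x y where v': "v = (x, y)" by (cases v)
    obtain a c where w': "w = (a, c)" by (cases w)
    have xy: "1 \<le> x" "x \<le> R - 1" "\<bar>y\<bar> \<le> R - 1" using v by (auto simp: S_def v')
    have cases: "(a = 0 \<and> c = y \<and> x = 1) \<or> (a = R \<and> \<bar>c\<bar> \<le> R) \<or> (1 \<le> a \<and> a \<le> R \<and> \<bar>c\<bar> = R)"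
      using w xy unfolding S_def v' w' neighbours_Pair by auto
    then consider "a = 0" "c = y" "x = 1" | "a = R" "\<bar>c\<bar> \<le> R" | "1 \<le> a" "a \<le> R" "\<bar>c\<bar> = R" by blast
    then show "g w \<le> 0"
    proof cases
      case 1
      \<comment> \<open>Here \<open>w\<close> is the mirror image of \<open>v\<close>, so the odd
        part changes sign; with b(0, y) + b(1, y) nonnegative, positivity of \<open>g v\<close>
        yields \<open>g w \<le> 0\<close>.\<close>
      have "b (0, y) + b (1, y) = 2 * M / R\<^sup>2 * (2 * (real_of_int y)\<^sup>2)"
        unfolding b_def by (simp add: algebra_simps flip: add_divide_distrib)
      also have "\<dots> \<ge> 0" using M by simp
      finally show ?thesis using gv 1 by (simp add: g_def v' w')
    next
      case 2
      have "2 * M \<le> b (a, c)" using 2 by (intro b_ge) (simp add: algebra_simps power2_eq_square)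
      moreover have "\<bar>h (a, c)\<bar> \<le> M" "\<bar>h (1 - a, c)\<bar> \<le> M" using bnd 2 R by auto
      ultimately show ?thesis by (simp add: g_def w')
    next
      case 3
      have "a * (a - 1) \<le> (2 * a - 1) * R"
        using 3 by (intro mult_mono) auto
      moreover have "c\<^sup>2 = R\<^sup>2" using 3 by (metis power2_abs)
      ultimately have "2 * M \<le> b (a, c)" by (intro b_ge) simp
      moreover have "\<bar>h (a, c)\<bar> \<le> M" "\<bar>h (1 - a, c)\<bar> \<le> M" using bnd 3 R by auto
      ultimately show ?thesis by (simp add: g_def w')
    qed
  qed
  moreover have "b (1, 0) = 2 * M / R" using R by (simp add: b_def power2_eq_square)
  ultimately show ?thesis by (simp add: g_def)
qed

lemma lap_translate: "lap (\<lambda>w. g (fst w + a, snd w + b)) v = lap g (fst v + a, snd v + b)"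
  by (simp add: lap_def algebra_simps)

lemma harmonic_gradient:
  fixes h :: "lattice \<Rightarrow> real" and R :: int
  assumes R: "1 \<le> R"
    and bnd: "\<And>x y. \<bar>x - a\<bar> \<le> R \<Longrightarrow> \<bar>y - b\<bar> \<le> R \<Longrightarrow> \<bar>h (x, y)\<bar> \<le> M"
    and harm: "\<And>x y. \<bar>x - a\<bar> < R \<Longrightarrow> \<bar>y - b\<bar> < R \<Longrightarrow> lap h (x, y) = 0"
  shows "\<bar>h (a + 1, b) - h (a, b)\<bar> \<le> 2 * M / R"
proof -
  let ?k = "\<lambda>v. h (fst v + a, snd v + b)"
  have "?k (1, 0) - ?k (0, 0) \<le> 2 * M / R"
    using R bnd harm by (intro harmonic_gradient_le) (auto simp: lap_translate)
  moreover have "(- ?k (1, 0)) - (- ?k (0, 0)) \<le> 2 * M / R"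
    using R bnd harm by (intro harmonic_gradient_le[where h = "\<lambda>v. - ?k v"]) (auto simp: lap_translate lap_uminus)
  ultimately show ?thesis by (simp add: add.commute)
qed

text \<open>The antisymmetrisation of \<open>F\<close> under the reflection swapping the two axes at the source is
  harmonic, so its second difference at the source is small; but it is an odd integer.\<close>

lemma single_source_growth:
  fixes F :: "lattice \<Rightarrow> int" and K :: int
  assumes K: "2 \<le> K"
    and bnd: "\<And>x y. \<bar>x - fst q\<bar> \<le> 2 * K \<Longrightarrow> \<bar>y - snd q\<bar> \<le> 2 * K \<Longrightarrow> \<bar>real_of_int (F (x, y))\<bar> \<le> M"
    and src: "\<And>x y. \<bar>x - fst q\<bar> < 2 * K \<Longrightarrow> \<bar>y - snd q\<bar> < 2 * K \<Longrightarrow>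
                lap F (x, y) = (if (x, y) = q then -1 else 0)"
  shows "real_of_int (K * (K - 1)) \<le> 8 * M"
proof -
  define S :: "lattice \<Rightarrow> real" where
    "S v = real_of_int (F (fst v + fst q, snd v + snd q)) - real_of_int (F (snd v + fst q, fst v + snd q))" for v
  have Sb: "\<bar>S (x, y)\<bar> \<le> 2 * M" if "\<bar>x\<bar> \<le> 2 * K" "\<bar>y\<bar> \<le> 2 * K" for x y
    using bnd[of "x + fst q" "y + snd q"] bnd[of "y + fst q" "x + snd q"] that by (simp add: S_def)
  have lapS: "lap S (x, y) = 0" if "\<bar>x\<bar> < 2 * K" "\<bar>y\<bar> < 2 * K" for x y
  proof -
    have "lap S (x, y) = real_of_int (lap F (x + fst q, y + snd q)) - real_of_int (lap F (y + fst q, x + snd q))"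
      by (simp add: lap_def S_def algebra_simps)
    also have "\<dots> = 0"
      using src[of "x + fst q" "y + snd q"] src[of "y + fst q" "x + snd q"] that
      by (cases q) auto
    finally show ?thesis .
  qed
  define g where "g v = S (fst v + 1, snd v) - S v" for v
  have gb: "\<bar>g (x, y)\<bar> \<le> 4 * M / K" if "\<bar>x\<bar> \<le> K" "\<bar>y\<bar> \<le> K" for x y
  proof -
    have "\<bar>S (x + 1, y) - S (x, y)\<bar> \<le> 2 * (2 * M) / K"
      using K that by (intro harmonic_gradient Sb lapS) auto
    then show ?thesis by (simp add: g_def)
  qed
  have lapg: "lap g (x, y) = 0" if "\<bar>x\<bar> < K" "\<bar>y\<bar> < K" for x y
  proof -
    have "lap g (x, y) = lap S (x + 1, y) - lap S (x, y)" by (simp add: lap_def g_def algebra_simps)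
    then show ?thesis using lapS[of x y] lapS[of "x + 1" y] that K by simp
  qed
  \<comment> \<open>The gradient estimate is used twice: on boxes of radius K for \<open>S\<close>,
    then on a box of radius K - 1 for its difference \<open>g\<close>. Centring the second box at
    (-1, 0) produces the symmetric second difference of \<open>S\<close> at the origin.\<close>
  have "\<bar>g (-1 + 1, 0) - g (-1, 0)\<bar> \<le> 2 * (4 * M / K) / (K - 1)"
    using harmonic_gradient[of "K - 1" "-1" 0 g "4 * M / K"] K gb lapg by (simp add: abs_le_iff abs_less_iff)
  then have est: "\<bar>S (1, 0) + S (-1, 0) - 2 * S (0, 0)\<bar> \<le> 8 * M / (K * (K - 1))"
    by (simp add: g_def algebra_simps)
  define a where "a = F (fst q + 1, snd q) + F (fst q - 1, snd q)"
  define b where "b = F (fst q, snd q + 1) + F (fst q, snd q - 1)"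
  have "lap F q = -1" using src[of "fst q" "snd q"] K by simp
  then have "a + b = 4 * F q - 1" by (simp add: lap_def a_def b_def)
  \<comment> \<open>Parity: a + b is odd, hence a - b is odd too and cannot vanish.\<close>
  then have "1 \<le> \<bar>a - b\<bar>" by presburger
  then have "1 \<le> \<bar>real_of_int (a - b)\<bar>" by linarith
  moreover have "S (1, 0) + S (-1, 0) - 2 * S (0, 0) = real_of_int (a - b)"
    by (simp add: S_def a_def b_def add.commute)
  ultimately have "1 \<le> 8 * M / (K * (K - 1))" using est by simp
  moreover have "0 < real_of_int K * (real_of_int K - 1)" using K by simp
  ultimately show ?thesis by (simp add: pos_le_divide_eq)
qed

section \<open>Energy estimates on boxes\<close>

definition lbox :: "int \<Rightarrow> lattice set" where
  "lbox R = {-R..R} \<times> {-R..R}"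

definition energy :: "int \<Rightarrow> (lattice \<Rightarrow> real) \<Rightarrow> real" where
  "energy R g = (\<Sum>(x, y)\<in>{-R..R} \<times> {-R..<R}. (g (x, y + 1) - g (x, y))\<^sup>2) +
                (\<Sum>(x, y)\<in>{-R..<R} \<times> {-R..R}. (g (x + 1, y) - g (x, y))\<^sup>2)"

lemma finite_lbox [simp]: "finite (lbox R)"
  by (simp add: lbox_def)

lemma lbox_mono: "R \<le> R' \<Longrightarrow> lbox R \<subseteq> lbox R'"
  by (auto simp: lbox_def)

lemma sum_lbox_shift:
  fixes k :: "lattice \<Rightarrow> real"
  assumes "\<And>v. v \<notin> lbox n \<Longrightarrow> k v = 0" "\<bar>a\<bar> \<le> 1" "\<bar>b\<bar> \<le> 1"
  shows "(\<Sum>v\<in>lbox (n + 1). k (fst v + a, snd v + b)) = (\<Sum>v\<in>lbox (n + 1). k v)"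
proof -
  let ?s = "\<lambda>v :: lattice. (fst v + a, snd v + b)"
  have inj: "inj_on ?s A" for A by (auto simp: inj_on_def prod_eq_iff)
  have "(\<Sum>v\<in>lbox (n + 1). k (?s v)) = (\<Sum>v\<in>?s ` lbox (n + 1). k v)"
    by (simp add: sum.reindex[OF inj])
  also have "\<dots> = (\<Sum>v\<in>lbox n. k v)"
  proof (rule sum.mono_neutral_right)
    show "lbox n \<subseteq> ?s ` lbox (n + 1)"
    proof
      fix v assume "v \<in> lbox n"
      then have "(fst v - a, snd v - b) \<in> lbox (n + 1)" using assms(2,3) by (auto simp: lbox_def)
      then show "v \<in> ?s ` lbox (n + 1)" by (intro image_eqI) auto
    qed
  qed (use assms(1) in auto)
  also have "\<dots> = (\<Sum>v\<in>lbox (n + 1). k v)"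
    by (rule sum.mono_neutral_left) (use assms(1) in \<open>auto simp: lbox_def\<close>)
  finally show ?thesis .
qed

text \<open>Discrete Green formula. The sums run over one layer more than the support of
  \<open>p\<close>, so that index shifts lose no term and no boundary term appears.\<close>

lemma summation_by_parts:
  fixes p g :: "lattice \<Rightarrow> real"
  assumes "\<And>v. v \<notin> lbox n \<Longrightarrow> p v = 0"
  shows "(\<Sum>v\<in>lbox (n + 1). (p (fst v + 1, snd v) - p v) * (g (fst v + 1, snd v) - g v)
            + (p (fst v, snd v + 1) - p v) * (g (fst v, snd v + 1) - g v))
         = - (\<Sum>v\<in>lbox (n + 1). p v * lap g v)"
proof -
  have s1: "(\<Sum>v\<in>lbox (n + 1). p (fst v + 1, snd v) * (g (fst v + 1, snd v) - g v))
     = (\<Sum>v\<in>lbox (n + 1). p v * (g v - g (fst v - 1, snd v)))"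
    using sum_lbox_shift[of n "\<lambda>v. p v * (g v - g (fst v - 1, snd v))" 1 0] assms by simp
  have s2: "(\<Sum>v\<in>lbox (n + 1). p (fst v, snd v + 1) * (g (fst v, snd v + 1) - g v))
     = (\<Sum>v\<in>lbox (n + 1). p v * (g v - g (fst v, snd v - 1)))"
    using sum_lbox_shift[of n "\<lambda>v. p v * (g v - g (fst v, snd v - 1))" 0 1] assms by simp
  have "(\<Sum>v\<in>lbox (n + 1). (p (fst v + 1, snd v) - p v) * (g (fst v + 1, snd v) - g v)
            + (p (fst v, snd v + 1) - p v) * (g (fst v, snd v + 1) - g v))
     = (\<Sum>v\<in>lbox (n + 1). p (fst v + 1, snd v) * (g (fst v + 1, snd v) - g v))
       + (\<Sum>v\<in>lbox (n + 1). p (fst v, snd v + 1) * (g (fst v, snd v + 1) - g v))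
       - (\<Sum>v\<in>lbox (n + 1). p v * (g (fst v + 1, snd v) + g (fst v, snd v + 1) - 2 * g v))"
    unfolding sum.distrib[symmetric] sum_subtractf[symmetric]
    by (rule sum.cong) (auto simp: algebra_simps)
  also have "\<dots> = - (\<Sum>v\<in>lbox (n + 1). p v * lap g v)"
    unfolding s1 s2 unfolding sum.distrib[symmetric] sum_subtractf[symmetric] sum_negf[symmetric]
    by (rule sum.cong) (auto simp: algebra_simps lap_def)
  finally show ?thesis .
qed

lemma lap_self_adjoint:
  fixes p g :: "lattice \<Rightarrow> real"
  assumes "\<And>v. v \<notin> lbox n \<Longrightarrow> p v = 0"
  shows "(\<Sum>v\<in>lbox (n + 1). p v * lap g v) = (\<Sum>v\<in>lbox (n + 1). g v * lap p v)"
proof -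
  have sh: "(\<Sum>v\<in>lbox (n + 1). p v * g (fst v - a, snd v - b)) = (\<Sum>v\<in>lbox (n + 1). p (fst v + a, snd v + b) * g v)"
    if "\<bar>a\<bar> \<le> 1" "\<bar>b\<bar> \<le> 1" for a b
    using sum_lbox_shift[of n "\<lambda>v. p v * g (fst v - a, snd v - b)" a b] assms that by simp
  show ?thesis
    using sh[of 1 0] sh[of "-1" 0] sh[of 0 1] sh[of 0 "-1"]
    by (simp add: lap_def algebra_simps sum.distrib sum_subtractf sum_distrib_left)
qed

text \<open>The contribution of one edge to the Caccioppoli inequality: \<open>a\<close>,
  \<open>b\<close> are the cutoff values and \<open>s\<close>, \<open>t\<close> the function values
  at its ends. In terms of the difference and the mean of \<open>s\<close> and \<open>t\<close>, the
  mixed term is absorbed by completing a square.\<close>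

lemma edge_caccioppoli:
  fixes a b s t :: real
  shows "(a\<^sup>2 + b\<^sup>2) / 4 * (s - t)\<^sup>2 \<le> (a\<^sup>2 * s - b\<^sup>2 * t) * (s - t) + (a - b)\<^sup>2 * (s\<^sup>2 + t\<^sup>2)"
proof -
  define A where "A = (a\<^sup>2 + b\<^sup>2) / 2"
  define d where "d = s - t"
  define m where "m = (s + t) / 2"
  have e: "(a\<^sup>2 * s - b\<^sup>2 * t) * (s - t) = A * d\<^sup>2 + (a - b) * (a + b) * m * d"
    unfolding A_def d_def m_def by (simp add: field_simps power2_eq_square)
  have "0 \<le> ((a + b) * d / 2 + 2 * (a - b) * m / 1)\<^sup>2 / 2" by simp
  also have "\<dots> = (a + b)\<^sup>2 * d\<^sup>2 / 8 + (a - b) * (a + b) * m * d + 2 * (a - b)\<^sup>2 * m\<^sup>2"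
    by (simp add: field_simps power2_eq_square)
  also have "(a + b)\<^sup>2 * d\<^sup>2 / 8 \<le> A * d\<^sup>2 / 2"
  proof -
    have "(a + b)\<^sup>2 \<le> 4 * A" unfolding A_def using sum_squares_bound[of a b] by (simp add: power2_sum)
    then have "(a + b)\<^sup>2 * d\<^sup>2 \<le> 4 * A * d\<^sup>2" by (rule mult_right_mono) simp
    then show ?thesis by (simp add: mult_ac)
  qed
  finally have "- ((a - b) * (a + b) * m * d) \<le> A * d\<^sup>2 / 2 + 2 * (a - b)\<^sup>2 * m\<^sup>2" by simp
  moreover have "2 * (a - b)\<^sup>2 * m\<^sup>2 \<le> (a - b)\<^sup>2 * (s\<^sup>2 + t\<^sup>2)"
  proof -
    have "2 * m\<^sup>2 \<le> s\<^sup>2 + t\<^sup>2"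
      unfolding m_def using sum_squares_bound[of s t] by (simp add: power2_sum power_divide)
    then have "(a - b)\<^sup>2 * (2 * m\<^sup>2) \<le> (a - b)\<^sup>2 * (s\<^sup>2 + t\<^sup>2)" by (rule mult_left_mono) simp
    then show ?thesis by (simp add: algebra_simps)
  qed
  ultimately have "A * d\<^sup>2 / 2 \<le> A * d\<^sup>2 + (a - b) * (a + b) * m * d + (a - b)\<^sup>2 * (s\<^sup>2 + t\<^sup>2)" by simp
  then show ?thesis unfolding e unfolding A_def d_def by simp
qed

text \<open>A parabola cut off at 0. A tent would have a corner at the origin, where the second
  difference of its square is of order 1/R; here it is bounded below by -1/R^2 everywhere, which the
  superharmonic estimate requires.\<close>

definition cut :: "int \<Rightarrow> int \<Rightarrow> real" where
  "cut R x = max 0 (1 - (real_of_int x)\<^sup>2 / (4 * (real_of_int R)\<^sup>2))"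

lemma cut_bounds: "0 \<le> cut R x" "cut R x \<le> 1"
  by (auto simp: cut_def)

lemma cut_eq:
  assumes "1 \<le> R" "\<bar>x\<bar> \<le> 2 * R"
  shows "cut R x = 1 - (real_of_int x)\<^sup>2 / (4 * (real_of_int R)\<^sup>2)"
proof -
  have "\<bar>x\<bar> \<le> \<bar>2 * R\<bar>" using assms by simp
  then have "x\<^sup>2 \<le> (2 * R)\<^sup>2" by (simp only: abs_le_square_iff)
  then have "real_of_int (x\<^sup>2) \<le> real_of_int ((2 * R)\<^sup>2)" by (simp only: of_int_le_iff)
  then have "(real_of_int x)\<^sup>2 \<le> 4 * (real_of_int R)\<^sup>2" by (simp add: power_mult_distrib)
  then show ?thesis using assms by (simp add: cut_def field_simps)
qed

lemma cut_0:
  assumes "1 \<le> R" "2 * R \<le> \<bar>x\<bar>"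
  shows "cut R x = 0"
proof -
  have "\<bar>2 * R\<bar> \<le> \<bar>x\<bar>" using assms by simp
  then have "(2 * R)\<^sup>2 \<le> x\<^sup>2" by (simp only: abs_le_square_iff)
  then have "real_of_int ((2 * R)\<^sup>2) \<le> real_of_int (x\<^sup>2)" by (simp only: of_int_le_iff)
  then have "4 * (real_of_int R)\<^sup>2 \<le> (real_of_int x)\<^sup>2" by (simp add: power_mult_distrib)
  then show ?thesis using assms by (simp add: cut_def field_simps)
qed

lemma cut_ge:
  assumes "1 \<le> R" "\<bar>x\<bar> \<le> R"
  shows "3 / 4 \<le> cut R x"
proof -
  have "x\<^sup>2 \<le> R\<^sup>2" using assms by (simp add: abs_le_square_iff[symmetric])
  then have "real_of_int (x\<^sup>2) \<le> real_of_int (R\<^sup>2)" by (simp only: of_int_le_iff)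
  then show ?thesis using assms by (subst cut_eq) (auto simp: field_simps)
qed

lemma cut_diff:
  assumes "1 \<le> R"
  shows "\<bar>cut R (x + 1) - cut R x\<bar> \<le> (if \<bar>x\<bar> \<le> 2 * R \<and> \<bar>x + 1\<bar> \<le> 2 * R then 1 / R else 0)"
proof (cases "\<bar>x\<bar> \<le> 2 * R \<and> \<bar>x + 1\<bar> \<le> 2 * R")
  case True
  have *: "cut R (x + 1) - cut R x = - (2 * real_of_int x + 1) / (4 * (real_of_int R)\<^sup>2)"
    using True assms by (simp add: cut_eq field_simps power2_eq_square)
  have "\<bar>real_of_int (2 * x + 1)\<bar> \<le> real_of_int (4 * R)"
    using True by (simp only: of_int_abs[symmetric] of_int_le_iff)  linarith
  then have "\<bar>- (2 * real_of_int x + 1)\<bar> \<le> 4 * real_of_int R" by simp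
  with * have "\<bar>cut R (x + 1) - cut R x\<bar> \<le> 4 * real_of_int R / (4 * (real_of_int R)\<^sup>2)"
    unfolding * using assms by (simp only: abs_divide) (simp only: abs_mult abs_numeral abs_power2 divide_right_mono zero_le_mult_iff zero_le_power2 zero_le_numeral simp_thms)
  then show ?thesis using True assms by (simp add: power2_eq_square)
next
  case False
  then have "2 * R \<le> \<bar>x\<bar>" "2 * R \<le> \<bar>x + 1\<bar>" by linarith+
  then show ?thesis using assms by (simp add: cut_0)
qed

text \<open>Inside the support, the square is a quartic polynomial with an explicit second
  difference. From 2R outwards \<open>cut\<close> vanishes at \<open>x\<close>, and the remaining
  squares are nonnegative.\<close>

lemma cut_second_difference:
  assumes "1 \<le> R"
  shows "- 1 / (real_of_int R)\<^sup>2 \<le> (cut R (x + 1))\<^sup>2 + (cut R (x - 1))\<^sup>2 - 2 * (cut R x)\<^sup>2"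
proof (cases "\<bar>x\<bar> < 2 * R")
  case True
  define K where "K = 4 * (real_of_int R)\<^sup>2"
  have K: "0 < K" using assms by (simp add: K_def)
  have "(cut R (x + 1))\<^sup>2 + (cut R (x - 1))\<^sup>2 - 2 * (cut R x)\<^sup>2
     = (12 * (real_of_int x)\<^sup>2 + 2 - 4 * K) / K\<^sup>2"
  proof -
    have e: "(1 - t / K)\<^sup>2 = (K - t)\<^sup>2 / K\<^sup>2" for t
    proof -
      have "1 - t / K = (K - t) / K" using K by (simp add: diff_divide_distrib)
      then show ?thesis by (simp add: power_divide)
    qed
    have "2 * (1 - t / K)\<^sup>2 = (2 * (K - t)\<^sup>2) / K\<^sup>2" for t using e[of t] by simp
    then show ?thesis
      using True assms
      by (simp add: cut_eq K_def[symmetric] e flip: add_divide_distrib diff_divide_distrib)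
        (simp add: power2_eq_square algebra_simps)
  qed
  also have "\<dots> \<ge> (- 4 * K) / K\<^sup>2" by (intro divide_right_mono) auto
  also have "(- 4 * K) / K\<^sup>2 = - 4 / K" using K by (simp add: power2_eq_square)
  also have "- 4 / K = - 1 / (real_of_int R)\<^sup>2" by (simp add: K_def)
  finally show ?thesis .
next
  case False
  then have "cut R x = 0" using assms by (intro cut_0) auto
  moreover have "- 1 / (real_of_int R)\<^sup>2 \<le> 0" by simp
  moreover have "0 \<le> (cut R (x + 1))\<^sup>2 + (cut R (x - 1))\<^sup>2" by simp
  ultimately show ?thesis by (simp only: power_zero_numeral)
qed

definition cutoff :: "int \<Rightarrow> lattice \<Rightarrow> real" where
  "cutoff R v = cut R (fst v) * cut R (snd v)"

lemma cutoff_0: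
  assumes "1 \<le> R" "v \<notin> lbox (2 * R - 1)"
  shows "cutoff R v = 0"
  using assms cut_0[of R "fst v"] cut_0[of R "snd v"]
  by (cases v) (auto simp: cutoff_def lbox_def)

lemma cutoff_ge:
  assumes "1 \<le> R" "v \<in> lbox R"
  shows "1 / 4 \<le> (cutoff R v)\<^sup>2"
proof -
  have "\<bar>fst v\<bar> \<le> R" "\<bar>snd v\<bar> \<le> R" using assms by (auto simp: lbox_def)
  then have "3 / 4 * (3 / 4) \<le> cutoff R v"
    unfolding cutoff_def using assms by (intro mult_mono cut_ge) (auto simp: cut_bounds)
  then have "(9 / 16)\<^sup>2 \<le> (cutoff R v)\<^sup>2" by (intro power_mono) auto
  then show ?thesis by (simp add: power2_eq_square)
qed

lemma cutoff_diff:
  assumes "1 \<le> R"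
  shows "(cutoff R (fst v + 1, snd v) - cutoff R v)\<^sup>2
           \<le> (if v \<in> lbox (2 * R) \<and> (fst v + 1, snd v) \<in> lbox (2 * R) then 1 / (real_of_int R)\<^sup>2 else 0)"
    and "(cutoff R (fst v, snd v + 1) - cutoff R v)\<^sup>2
           \<le> (if v \<in> lbox (2 * R) \<and> (fst v, snd v + 1) \<in> lbox (2 * R) then 1 / (real_of_int R)\<^sup>2 else 0)"
proof -
  have main: "((cut R (x + 1) - cut R x) * cut R y)\<^sup>2
       \<le> (if \<bar>x\<bar> \<le> 2 * R \<and> \<bar>x + 1\<bar> \<le> 2 * R \<and> \<bar>y\<bar> \<le> 2 * R then 1 / (real_of_int R)\<^sup>2 else 0)" for x y
  proof (cases "\<bar>y\<bar> \<le> 2 * R")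
    case True
    have "\<bar>(cut R (x + 1) - cut R x) * cut R y\<bar> \<le> \<bar>cut R (x + 1) - cut R x\<bar> * 1"
      unfolding abs_mult by (intro mult_left_mono) (auto simp: cut_bounds)
    also have "\<dots> \<le> (if \<bar>x\<bar> \<le> 2 * R \<and> \<bar>x + 1\<bar> \<le> 2 * R then 1 / R else 0)"
      using cut_diff[OF assms, of x] by simp
    finally have "\<bar>(cut R (x + 1) - cut R x) * cut R y\<bar>\<^sup>2 \<le> (if \<bar>x\<bar> \<le> 2 * R \<and> \<bar>x + 1\<bar> \<le> 2 * R then 1 / R else 0)\<^sup>2"
      by (rule power_mono) simp
    then show ?thesis using True by (auto simp: power_divide split: if_splits)
  next
    case False
    then show ?thesis using assms by (simp add: cut_0)
  qed
  have e1: "cutoff R (fst v + 1, snd v) - cutoff R v = (cut R (fst v + 1) - cut R (fst v)) * cut R (snd v)"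
    and e2: "cutoff R (fst v, snd v + 1) - cutoff R v = (cut R (snd v + 1) - cut R (snd v)) * cut R (fst v)"
    by (simp_all add: cutoff_def algebra_simps)
  show "(cutoff R (fst v + 1, snd v) - cutoff R v)\<^sup>2
           \<le> (if v \<in> lbox (2 * R) \<and> (fst v + 1, snd v) \<in> lbox (2 * R) then 1 / (real_of_int R)\<^sup>2 else 0)"
    unfolding e1 using main[of "fst v" "snd v"] by (cases v) (auto simp: lbox_def split: if_splits)
  show "(cutoff R (fst v, snd v + 1) - cutoff R v)\<^sup>2
           \<le> (if v \<in> lbox (2 * R) \<and> (fst v, snd v + 1) \<in> lbox (2 * R) then 1 / (real_of_int R)\<^sup>2 else 0)"
    unfolding e2 using main[of "snd v" "fst v"] by (cases v) (auto simp: lbox_def split: if_splits)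
qed

text \<open>The equation is tested with the squared cutoff times \<open>g\<close>. The factor 8
  arises because the squared cutoff is at least 1/4 on the inner box, which gives its edges weight
  at least 1/8. Each edge error costs 1/R^2 times the squares at its two ends, and a vertex ends at
  most four edges: 32 = 8 * 4.\<close>

lemma energy_caccioppoli:
  fixes g :: "lattice \<Rightarrow> real"
  assumes R: "1 \<le> R"
  shows "energy R g \<le> 8 * (\<Sum>v\<in>lbox (2 * R). (cutoff R v)\<^sup>2 * g v * (- lap g v))
           + 32 / (real_of_int R)\<^sup>2 * (\<Sum>v\<in>lbox (2 * R). (g v)\<^sup>2)"
proof -
  let ?B = "lbox (2 * R)"
  define p where "p v = (cutoff R v)\<^sup>2 * g v" for v
  define r where "r v = (fst v + 1, snd v)" for v :: lattice
  define u where "u v = (fst v, snd v + 1)" for v :: lattice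
  define c where "c = 1 / (real_of_int R)\<^sup>2"
  have c0: "0 \<le> c" by (simp add: c_def)
  have parts: "(\<Sum>v\<in>?B. (p (r v) - p v) * (g (r v) - g v) + (p (u v) - p v) * (g (u v) - g v))
      = (\<Sum>v\<in>?B. p v * (- lap g v))"
    using summation_by_parts[of "2 * R - 1" p g] cutoff_0[OF R] by (simp add: p_def r_def u_def sum_negf)
  have edge: "((cutoff R w)\<^sup>2 + (cutoff R v)\<^sup>2) / 4 * (g w - g v)\<^sup>2
       \<le> (p w - p v) * (g w - g v) + (cutoff R w - cutoff R v)\<^sup>2 * ((g w)\<^sup>2 + (g v)\<^sup>2)" for v w
    unfolding p_def by (rule edge_caccioppoli)
  have lower: "(if v \<in> lbox R \<and> w \<in> lbox R then (g w - g v)\<^sup>2 / 8 else 0)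
       \<le> ((cutoff R w)\<^sup>2 + (cutoff R v)\<^sup>2) / 4 * (g w - g v)\<^sup>2" for v w
  proof (cases "v \<in> lbox R \<and> w \<in> lbox R")
    case True
    then have "1 / 8 \<le> ((cutoff R w)\<^sup>2 + (cutoff R v)\<^sup>2) / 4"
      using cutoff_ge[OF R, of v] cutoff_ge[OF R, of w] by simp
    then have "1 / 8 * (g w - g v)\<^sup>2 \<le> ((cutoff R w)\<^sup>2 + (cutoff R v)\<^sup>2) / 4 * (g w - g v)\<^sup>2"
      by (rule mult_right_mono) simp
    then show ?thesis using True by simp
  next
    case False
    then show ?thesis by (simp only: if_False) simp
  qed
  have err: "(cutoff R w - cutoff R v)\<^sup>2 * ((g w)\<^sup>2 + (g v)\<^sup>2)
       \<le> c * (if w \<in> ?B then (g w)\<^sup>2 else 0) + c * (if v \<in> ?B then (g v)\<^sup>2 else 0)"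
    if "w = r v \<or> w = u v" for v w
  proof (cases "v \<in> ?B \<and> w \<in> ?B")
    case True
    then have "(cutoff R w - cutoff R v)\<^sup>2 \<le> c"
      using cutoff_diff[OF R, of v] that by (auto simp: r_def u_def c_def)
    then have "(cutoff R w - cutoff R v)\<^sup>2 * ((g w)\<^sup>2 + (g v)\<^sup>2) \<le> c * ((g w)\<^sup>2 + (g v)\<^sup>2)"
      by (rule mult_right_mono) simp
    then show ?thesis using True by (simp add: algebra_simps)
  next
    case False
    then have "(cutoff R w - cutoff R v)\<^sup>2 \<le> 0"
      using cutoff_diff[OF R, of v] that by (auto simp: r_def u_def)
    then have eq: "(cutoff R w - cutoff R v)\<^sup>2 * ((g w)\<^sup>2 + (g v)\<^sup>2) = 0" by simp
    show ?thesis unfolding eq using c0 by simp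
  qed
  have shift_le: "(\<Sum>v\<in>?B. if s v \<in> ?B then (g (s v))\<^sup>2 else 0) \<le> (\<Sum>v\<in>?B. (g v)\<^sup>2)"
    if "inj s" for s :: "lattice \<Rightarrow> lattice"
  proof -
    have "(\<Sum>v\<in>?B. if s v \<in> ?B then (g (s v))\<^sup>2 else 0) = (\<Sum>v\<in>{v\<in>?B. s v \<in> ?B}. (g (s v))\<^sup>2)"
      by (simp add: sum.inter_filter)
    also have "\<dots> = (\<Sum>v\<in>s ` {v\<in>?B. s v \<in> ?B}. (g v)\<^sup>2)"
      using that by (subst sum.reindex) (auto intro: inj_on_subset)
    also have "\<dots> \<le> (\<Sum>v\<in>?B. (g v)\<^sup>2)"
      by (rule sum_mono2) auto
    finally show ?thesis .
  qed
  have inj: "inj r" "inj u" by (auto simp: inj_def r_def u_def prod_eq_iff)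
  have en: "energy R g = (\<Sum>v\<in>?B. if v \<in> lbox R \<and> r v \<in> lbox R then (g (r v) - g v)\<^sup>2 else 0)
       + (\<Sum>v\<in>?B. if v \<in> lbox R \<and> u v \<in> lbox R then (g (u v) - g v)\<^sup>2 else 0)"
  proof -
    have "(\<Sum>v\<in>?B. if v \<in> lbox R \<and> u v \<in> lbox R then (g (u v) - g v)\<^sup>2 else 0)
        = (\<Sum>v\<in>{v\<in>?B. v \<in> lbox R \<and> u v \<in> lbox R}. (g (u v) - g v)\<^sup>2)"
      by (simp add: sum.inter_filter)
    also have "{v\<in>?B. v \<in> lbox R \<and> u v \<in> lbox R} = {-R..R} \<times> {-R..<R}"
      using R by (auto simp: lbox_def u_def)
    finally have 1: "(\<Sum>v\<in>?B. if v \<in> lbox R \<and> u v \<in> lbox R then (g (u v) - g v)\<^sup>2 else 0)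
       = (\<Sum>(x, y)\<in>{-R..R} \<times> {-R..<R}. (g (x, y + 1) - g (x, y))\<^sup>2)"
      by (simp add: u_def case_prod_unfold)
    have "(\<Sum>v\<in>?B. if v \<in> lbox R \<and> r v \<in> lbox R then (g (r v) - g v)\<^sup>2 else 0)
        = (\<Sum>v\<in>{v\<in>?B. v \<in> lbox R \<and> r v \<in> lbox R}. (g (r v) - g v)\<^sup>2)"
      by (simp add: sum.inter_filter)
    also have "{v\<in>?B. v \<in> lbox R \<and> r v \<in> lbox R} = {-R..<R} \<times> {-R..R}"
      using R by (auto simp: lbox_def r_def)
    finally have 2: "(\<Sum>v\<in>?B. if v \<in> lbox R \<and> r v \<in> lbox R then (g (r v) - g v)\<^sup>2 else 0)
       = (\<Sum>(x, y)\<in>{-R..<R} \<times> {-R..R}. (g (x + 1, y) - g (x, y))\<^sup>2)"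
      by (simp add: r_def case_prod_unfold)
    show ?thesis unfolding energy_def 1 2 by simp
  qed
  have one: "(if v \<in> lbox R \<and> w \<in> lbox R then (g w - g v)\<^sup>2 else 0)
      \<le> 8 * ((p w - p v) * (g w - g v)) + 8 * c * (if w \<in> ?B then (g w)\<^sup>2 else 0) + 8 * c * (if v \<in> ?B then (g v)\<^sup>2 else 0)"
    if "w = r v \<or> w = u v" for v w
  proof -
    define i where "i = (if v \<in> lbox R \<and> w \<in> lbox R then (g w - g v)\<^sup>2 else 0)"
    have "(if v \<in> lbox R \<and> w \<in> lbox R then (g w - g v)\<^sup>2 / 8 else 0) = i / 8" by (simp add: i_def)
    then have "i / 8 \<le> (p w - p v) * (g w - g v) + (c * (if w \<in> ?B then (g w)\<^sup>2 else 0) + c * (if v \<in> ?B then (g v)\<^sup>2 else 0))"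
      using lower[of v w] edge[of w v] err[OF that] by linarith
    then show ?thesis unfolding i_def[symmetric] by (simp add: field_simps)
  qed
  let ?I = "\<lambda>v w. if v \<in> lbox R \<and> w \<in> lbox R then (g w - g v)\<^sup>2 else 0"
  let ?Q = "\<lambda>w. if w \<in> ?B then (g w)\<^sup>2 else 0"
  have "energy R g = (\<Sum>v\<in>?B. ?I v (r v) + ?I v (u v))"
    unfolding en by (simp add: sum.distrib)
  also have "\<dots> \<le> (\<Sum>v\<in>?B. 8 * ((p (r v) - p v) * (g (r v) - g v) + (p (u v) - p v) * (g (u v) - g v))
      + 8 * c * (?Q (r v) + ?Q (u v) + 2 * ?Q v))"
  proof (rule sum_mono)
    fix v
    show "?I v (r v) + ?I v (u v) \<le> 8 * ((p (r v) - p v) * (g (r v) - g v) + (p (u v) - p v) * (g (u v) - g v))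
      + 8 * c * (?Q (r v) + ?Q (u v) + 2 * ?Q v)"
      using one[OF disjI1[OF refl], of v] one[OF disjI2[OF refl], of v]
      unfolding distrib_left mult_2 by linarith
  qed
  also have "\<dots> = 8 * (\<Sum>v\<in>?B. p v * (- lap g v)) + 8 * c * ((\<Sum>v\<in>?B. ?Q (r v)) + (\<Sum>v\<in>?B. ?Q (u v)) + 2 * (\<Sum>v\<in>?B. ?Q v))"
    unfolding parts[symmetric] by (simp only: sum.distrib sum_distrib_left[symmetric])
  also have "\<dots> \<le> 8 * (\<Sum>v\<in>?B. p v * (- lap g v)) + 8 * c * ((\<Sum>v\<in>?B. (g v)\<^sup>2) + (\<Sum>v\<in>?B. (g v)\<^sup>2) + 2 * (\<Sum>v\<in>?B. (g v)\<^sup>2))"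
    by (intro add_left_mono mult_left_mono add_mono shift_le inj) (use c0 in auto)
  finally show ?thesis by (simp add: p_def c_def)
qed

lemma energy_subharmonic:
  fixes g :: "lattice \<Rightarrow> real"
  assumes R: "1 \<le> R" and nn: "\<And>v. v \<in> lbox (2 * R) \<Longrightarrow> 0 \<le> g v"
    and sub: "\<And>v. v \<in> lbox (2 * R - 1) \<Longrightarrow> 0 \<le> lap g v"
  shows "energy R g \<le> 32 / (real_of_int R)\<^sup>2 * (\<Sum>v\<in>lbox (2 * R). (g v)\<^sup>2)"
proof -
  have "(\<Sum>v\<in>lbox (2 * R). (cutoff R v)\<^sup>2 * g v * (- lap g v)) \<le> 0"
  proof (rule sum_nonpos)
    fix v assume v: "v \<in> lbox (2 * R)"
    show "(cutoff R v)\<^sup>2 * g v * (- lap g v) \<le> 0"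
      using sub[of v] nn[OF v] cutoff_0[OF R, of v]
      by (cases "v \<in> lbox (2 * R - 1)") (auto intro: mult_nonneg_nonneg)
  qed
  then show ?thesis using energy_caccioppoli[OF R, of g] by simp
qed

text \<open>Since -lap g is nonnegative, the factor \<open>g\<close> in the tested term may be
  replaced by its upper bound \<open>a\<close>; self-adjointness then moves the Laplacian onto the
  squared cutoff. The outcome is linear in \<open>g\<close>, with 48 = 8 * 2 + 32.\<close>

lemma energy_superharmonic:
  fixes g :: "lattice \<Rightarrow> real"
  assumes R: "1 \<le> R" and nn: "\<And>v. v \<in> lbox (2 * R) \<Longrightarrow> 0 \<le> g v \<and> g v \<le> a"
    and super: "\<And>v. v \<in> lbox (2 * R - 1) \<Longrightarrow> lap g v \<le> 0"
  shows "energy R g \<le> 48 * a / (real_of_int R)\<^sup>2 * (\<Sum>v\<in>lbox (2 * R). g v)"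
proof -
  let ?B = "lbox (2 * R)" and ?z = "\<lambda>v. (cutoff R v)\<^sup>2"
  have a: "0 \<le> a" using nn[of "(0, 0)"] R by (auto simp: lbox_def)
  \<comment> \<open>The squared cutoff is a product of two one-dimensional squares with values in
    [0, 1], so each coordinate direction contributes at most 1/R^2.\<close>
  have lapz: "- lap ?z v \<le> 2 / (real_of_int R)\<^sup>2" for v
  proof -
    define s where "s x = (cut R x)\<^sup>2" for x
    have s: "0 \<le> s x" "s x \<le> 1" for x using cut_bounds[of R x] by (auto simp: s_def power_le_one)
    have sd: "- (1 / (real_of_int R)\<^sup>2) \<le> s (x + 1) + s (x - 1) - 2 * s x" for x
      using cut_second_difference[OF R, of x] by (simp add: s_def)
    have low: "- (1 / (real_of_int R)\<^sup>2) \<le> (s (x + 1) + s (x - 1) - 2 * s x) * s y" for x y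
    proof -
      have "- (1 / (real_of_int R)\<^sup>2) \<le> - (1 / (real_of_int R)\<^sup>2) * s y"
        using s[of y] by (simp add: divide_right_mono)
      also have "\<dots> \<le> (s (x + 1) + s (x - 1) - 2 * s x) * s y"
        using sd[of x] s(1)[of y] by (rule mult_right_mono)
      finally show ?thesis .
    qed
    have "lap ?z v = (s (fst v + 1) + s (fst v - 1) - 2 * s (fst v)) * s (snd v)
        + (s (snd v + 1) + s (snd v - 1) - 2 * s (snd v)) * s (fst v)"
      by (simp add: lap_def cutoff_def s_def power_mult_distrib algebra_simps)
    then show ?thesis using low[of "fst v" "snd v"] low[of "snd v" "fst v"] by simp
  qed
  have "(\<Sum>v\<in>?B. ?z v * g v * (- lap g v)) \<le> (\<Sum>v\<in>?B. a * (?z v * (- lap g v)))"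
  proof (rule sum_mono)
    fix v assume v: "v \<in> ?B"
    show "?z v * g v * (- lap g v) \<le> a * (?z v * (- lap g v))"
    proof (cases "v \<in> lbox (2 * R - 1)")
      case True
      have "g v * (?z v * (- lap g v)) \<le> a * (?z v * (- lap g v))"
        using super[OF True] nn[OF v] by (intro mult_right_mono mult_nonneg_nonneg) auto
      then show ?thesis by (simp add: algebra_simps)
    next
      case False
      then show ?thesis using cutoff_0[OF R] by simp
    qed
  qed
  also have "\<dots> = a * (\<Sum>v\<in>?B. g v * (- lap ?z v))"
    using lap_self_adjoint[of "2 * R - 1" ?z g] cutoff_0[OF R]
    by (simp add: sum_distrib_left[symmetric] sum_negf)
  also have "\<dots> \<le> a * (\<Sum>v\<in>?B. g v * (2 / (real_of_int R)\<^sup>2))"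
    using a nn lapz by (intro mult_left_mono sum_mono) auto
  also have "\<dots> = 2 * a / (real_of_int R)\<^sup>2 * (\<Sum>v\<in>?B. g v)"
    by (simp only: sum_distrib_right[symmetric]) simp
  finally have 1: "(\<Sum>v\<in>?B. ?z v * g v * (- lap g v)) \<le> 2 * a / (real_of_int R)\<^sup>2 * (\<Sum>v\<in>?B. g v)" .
  have "(\<Sum>v\<in>?B. (g v)\<^sup>2) \<le> (\<Sum>v\<in>?B. a * g v)"
    unfolding power2_eq_square using nn by (intro sum_mono mult_right_mono) auto
  then have "(\<Sum>v\<in>?B. (g v)\<^sup>2) \<le> a * (\<Sum>v\<in>?B. g v)" by (simp add: sum_distrib_left)
  then have 2: "32 / (real_of_int R)\<^sup>2 * (\<Sum>v\<in>?B. (g v)\<^sup>2) \<le> 32 / (real_of_int R)\<^sup>2 * (a * (\<Sum>v\<in>?B. g v))"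
    by (rule mult_left_mono) simp
  have "energy R g \<le> 8 * (2 * a / (real_of_int R)\<^sup>2 * (\<Sum>v\<in>?B. g v)) + 32 / (real_of_int R)\<^sup>2 * (a * (\<Sum>v\<in>?B. g v))"
    using energy_caccioppoli[OF R, of g] 1 2 by linarith
  then show ?thesis by (simp add: field_simps)
qed

section \<open>Lattice paths and energy\<close>

text \<open>Reachability by lattice steps inside \<open>S\<close>. Being a reflexive closure, it
  relates every point to itself, also outside \<open>S\<close>; membership of the starting point is
  therefore assumed separately.\<close>

definition conn :: "lattice set \<Rightarrow> lattice \<Rightarrow> lattice \<Rightarrow> bool" where
  "conn S = (\<lambda>a b. a \<in> S \<and> b \<in> S \<and> b \<in> neighbours a)\<^sup>*\<^sup>*"

lemma conn_refl: "conn S v v"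
  by (simp add: conn_def)

lemma conn_step: "conn S v a \<Longrightarrow> a \<in> S \<Longrightarrow> b \<in> S \<Longrightarrow> b \<in> neighbours a \<Longrightarrow> conn S v b"
  unfolding conn_def by (rule rtranclp.rtrancl_into_rtrancl) auto

lemma conn_in: "conn S u v \<Longrightarrow> u \<in> S \<Longrightarrow> v \<in> S"
  unfolding conn_def by (induction rule: rtranclp_induct) auto

text \<open>A discrete intermediate value theorem: the first coordinate changes by at most 1 per
  step.\<close>

lemma conn_between:
  assumes "conn S u v" "u \<in> S"
  shows "x \<in> {min (fst u) (fst v)..max (fst u) (fst v)} \<Longrightarrow> \<exists>w\<in>S. fst w = x"
  using assms(1) unfolding conn_def
proof (induction rule: rtranclp_induct)
  case base
  then show ?case using assms(2) by (intro bexI[of _ u]) auto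
next
  case (step a b)
  then have "fst b \<in> {fst a - 1, fst a, fst a + 1}" by (cases a) (auto simp: neighbours_Pair)
  then show ?case using step by (cases "x = fst b") (auto simp: min_def max_def split: if_splits)
qed

lemma conn_swap:
  assumes "conn S u v"
  shows "conn (prod.swap ` S) (prod.swap u) (prod.swap v)"
  using assms unfolding conn_def
proof (induction rule: rtranclp_induct)
  case base
  then show ?case by simp
next
  case (step a b)
  have "prod.swap b \<in> neighbours (prod.swap a)" using step(2)
    by (cases a; cases b) (auto simp: neighbours_Pair)
  then show ?case using step by (auto intro: rtranclp.rtrancl_into_rtrancl)
qed

text \<open>The difference of two values in a column telescopes, and Cauchy-Schwarz over the 2R
  edges of the column bounds its square by 2R times the energy of that column.\<close>

lemma square_le_column:
  fixes k :: "int \<Rightarrow> real"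
  assumes "w \<in> {-R..R}" "y \<in> {-R..R}"
  shows "(k w)\<^sup>2 \<le> 2 * (k y)\<^sup>2 + 4 * R * (\<Sum>z\<in>{-R..<R}. (k (z + 1) - k z)\<^sup>2)"
proof -
  have tele: "\<bar>k b - k a\<bar> \<le> (\<Sum>z\<in>{a..<b}. \<bar>k (z + 1) - k z\<bar>)" if "a \<le> b" for a b
    using that
  proof (induction b rule: int_ge_induct)
    case base
    then show ?case by simp
  next
    case (step i)
    have "{a..<i + 1} = insert i {a..<i}" using step by auto
    then show ?case using step by simp
  qed
  have sub: "(\<Sum>z\<in>{a..<b}. \<bar>k (z + 1) - k z\<bar>) \<le> (\<Sum>z\<in>{-R..<R}. \<bar>k (z + 1) - k z\<bar>)"
    if "- R \<le> a" "b \<le> R" for a b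
    by (rule sum_mono2) (use that in auto)
  have "\<bar>k w - k y\<bar> \<le> (\<Sum>z\<in>{-R..<R}. \<bar>k (z + 1) - k z\<bar>)"
  proof (cases "w \<le> y")
    case True
    then show ?thesis using tele[of w y] sub[of w y] assms by auto
  next
    case False
    then show ?thesis using tele[of y w] sub[of y w] assms by auto
  qed
  then have "\<bar>k w - k y\<bar>\<^sup>2 \<le> (\<Sum>z\<in>{-R..<R}. \<bar>k (z + 1) - k z\<bar>)\<^sup>2"
    by (rule power_mono) simp
  also have "\<dots> \<le> (\<Sum>z\<in>{-R..<R}. \<bar>k (z + 1) - k z\<bar>\<^sup>2) * card {-R..<R}"
    by (rule sum_squared_le_sum_of_squares)
  finally have "(k w - k y)\<^sup>2 \<le> 2 * R * (\<Sum>z\<in>{-R..<R}. (k (z + 1) - k z)\<^sup>2)"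
    using assms by (simp add: mult_ac)
  moreover have "(k w)\<^sup>2 \<le> 2 * (k y)\<^sup>2 + 2 * (k w - k y)\<^sup>2"
    using zero_le_power2[of "k w - 2 * k y"] by (simp add: power2_eq_square algebra_simps)
  ultimately show ?thesis by simp
qed

text \<open>The column inequality is averaged over the 2R + 1 heights \<open>y\<close> and the R + 1
  columns of \<open>X\<close>. Nothing relates the heights \<open>w\<close> of different columns, so
  any set that meets these columns will do.\<close>

lemma crossing_columns:
  fixes g :: "lattice \<Rightarrow> real"
  assumes R: "1 \<le> R" and X: "X \<subseteq> {-R..R}" "int (card X) = R + 1" and a: "0 \<le> a"
    and W: "\<And>x. x \<in> X \<Longrightarrow> \<exists>w\<in>{-R..R}. a \<le> g (x, w)"
  shows "a\<^sup>2 \<le> (\<Sum>v\<in>lbox R. (g v)\<^sup>2) / (real_of_int R)\<^sup>2 + 4 * energy R g"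
proof -
  let ?e = "\<lambda>x. \<Sum>z\<in>{-R..<R}. (g (x, z + 1) - g (x, z))\<^sup>2"
  have finX: "finite X" using X(1) finite_subset by blast
  have col: "a\<^sup>2 \<le> 2 * (g (x, y))\<^sup>2 + 4 * R * ?e x" if x: "x \<in> X" and y: "y \<in> {-R..R}" for x y
  proof -
    obtain w where w: "w \<in> {-R..R}" "a \<le> g (x, w)" using W[OF x] by blast
    have "a\<^sup>2 \<le> (g (x, w))\<^sup>2" using w a by (intro power_mono) auto
    then show ?thesis using square_le_column[OF w(1) y, of "\<lambda>z. g (x, z)"] by simp
  qed
  have "(\<Sum>x\<in>X. \<Sum>y\<in>{-R..R}. a\<^sup>2) \<le> (\<Sum>x\<in>X. \<Sum>y\<in>{-R..R}. 2 * (g (x, y))\<^sup>2 + 4 * R * ?e x)"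
    by (intro sum_mono col)
  also have "\<dots> = 2 * (\<Sum>x\<in>X. \<Sum>y\<in>{-R..R}. (g (x, y))\<^sup>2) + 4 * R * (2 * R + 1) * (\<Sum>x\<in>X. ?e x)"
    using R by (simp add: sum.distrib sum_distrib_left mult_ac) (simp add: algebra_simps)?
  also have "(\<Sum>x\<in>X. \<Sum>y\<in>{-R..R}. (g (x, y))\<^sup>2) \<le> (\<Sum>x\<in>{-R..R}. \<Sum>y\<in>{-R..R}. (g (x, y))\<^sup>2)"
    by (rule sum_mono2) (use X in \<open>auto intro: sum_nonneg\<close>)
  also have "\<dots> = (\<Sum>v\<in>lbox R. (g v)\<^sup>2)"
    by (simp add: lbox_def sum.cartesian_product case_prod_unfold)
  also have "(\<Sum>x\<in>X. ?e x) \<le> energy R g"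
  proof -
    have "(\<Sum>x\<in>X. ?e x) \<le> (\<Sum>x\<in>{-R..R}. ?e x)"
      by (rule sum_mono2) (use X in \<open>auto intro: sum_nonneg\<close>)
    also have "\<dots> = (\<Sum>(x, y)\<in>{-R..R} \<times> {-R..<R}. (g (x, y + 1) - g (x, y))\<^sup>2)"
      by (simp add: sum.cartesian_product)
    also have "\<dots> \<le> energy R g"
      unfolding energy_def by (simp add: sum_nonneg case_prod_unfold)
    finally show ?thesis .
  qed
  finally have main: "(\<Sum>x\<in>X. \<Sum>y\<in>{-R..R}. a\<^sup>2) \<le> 2 * (\<Sum>v\<in>lbox R. (g v)\<^sup>2) + 4 * R * (2 * R + 1) * energy R g"
    using R by (simp add: mult_left_mono)
  define G where "G = (\<Sum>v\<in>lbox R. (g v)\<^sup>2)"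
  define r where "r = real_of_int R"
  have r: "1 \<le> r" using R by (simp add: r_def)
  have G: "0 \<le> G" and E: "0 \<le> energy R g"
    by (auto simp: G_def energy_def case_prod_unfold intro!: sum_nonneg add_nonneg_nonneg)
  have "real (card X) = r + 1" using X(2) by (simp add: r_def)
  then have S1: "(\<Sum>x\<in>X. \<Sum>y\<in>{-R..R}. a\<^sup>2) = (r + 1) * (2 * r + 1) * a\<^sup>2"
    using R by (simp add: r_def)
  have "(r + 1) * (2 * r + 1) * a\<^sup>2 \<le> 2 * G + 4 * r * (2 * r + 1) * energy R g"
    using main unfolding S1 by (simp add: G_def r_def)
  also have "\<dots> \<le> (r + 1) * (2 * r + 1) * (G / r\<^sup>2 + 4 * energy R g)"
  proof -
    have "2 * r\<^sup>2 \<le> (r + 1) * (2 * r + 1)" using r by (simp add: power2_eq_square algebra_simps)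
    then have "2 * r\<^sup>2 * (G / r\<^sup>2) \<le> (r + 1) * (2 * r + 1) * (G / r\<^sup>2)"
      using G by (intro mult_right_mono) auto
    then have "2 * G \<le> (r + 1) * (2 * r + 1) * (G / r\<^sup>2)" using r by simp
    moreover have "4 * r * (2 * r + 1) * energy R g \<le> (r + 1) * (2 * r + 1) * (4 * energy R g)"
    proof -
      have "r * ((2 * r + 1) * (4 * energy R g)) \<le> (r + 1) * ((2 * r + 1) * (4 * energy R g))"
        using r E by (intro mult_right_mono) auto
      then show ?thesis by (simp add: mult_ac)
    qed
    ultimately show ?thesis by (simp only: distrib_left)
  qed
  finally show ?thesis unfolding G_def r_def using r by (simp add: r_def mult_le_cancel_left_pos)
qed

lemma energy_swap: "energy R (g \<circ> prod.swap) = energy R g"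
proof -
  have "\<And>f :: int \<Rightarrow> int \<Rightarrow> real. \<And>A B. (\<Sum>(x, y)\<in>A \<times> B. f x y) = (\<Sum>(y, x)\<in>B \<times> A. f x y)"
    by (rule sum.reindex_bij_witness[of _ prod.swap prod.swap]) auto
  from this[of "\<lambda>x y. (g (y, x + 1) - g (y, x))\<^sup>2"] this[of "\<lambda>x y. (g (y + 1, x) - g (y, x))\<^sup>2"]
  show ?thesis unfolding energy_def by (simp add: add.commute)
qed

text \<open>A lattice path from the centre to the boundary of a box meets at least half of the columns, or
  half of the rows; Cauchy--Schwarz along each of them bounds the energy from below.\<close>

lemma crossing:
  fixes g :: "lattice \<Rightarrow> real"
  assumes R: "1 \<le> R" and a: "0 \<le> a" and S: "S \<subseteq> lbox R" "\<And>v. v \<in> S \<Longrightarrow> a \<le> g v" "(0, 0) \<in> S"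
    and c: "conn S (0, 0) v" and v: "\<bar>fst v\<bar> = R \<or> \<bar>snd v\<bar> = R"
  shows "a\<^sup>2 \<le> (\<Sum>v\<in>lbox R. (g v)\<^sup>2) / (real_of_int R)\<^sup>2 + 4 * energy R g"
proof -
  have main: "a\<^sup>2 \<le> (\<Sum>v\<in>lbox R. (g v)\<^sup>2) / (real_of_int R)\<^sup>2 + 4 * energy R g"
    if S: "S \<subseteq> lbox R" "\<And>v. v \<in> S \<Longrightarrow> a \<le> g v" "(0, 0) \<in> S" "conn S (0, 0) v" "\<bar>fst v\<bar> = R"
    for S and g :: "lattice \<Rightarrow> real" and v
  proof -
    \<comment> \<open>The columns between the origin and the end point: exactly R + 1 of them,
      because the end point has first coordinate R or -R.\<close>
    define X where "X = {min 0 (fst v)..max 0 (fst v)}"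
    show ?thesis
    proof (rule crossing_columns[OF R _ _ a])
      show "X \<subseteq> {-R..R}" "int (card X) = R + 1" using S(5) by (auto simp: X_def min_def max_def)
      show "\<exists>w\<in>{-R..R}. a \<le> g (x, w)" if x: "x \<in> X" for x
      proof -
        obtain w where w: "w \<in> S" "fst w = x"
          using conn_between[OF S(4,3), of x] x by (auto simp: X_def)
        then have "snd w \<in> {-R..R}" "a \<le> g (x, snd w)" using S(1,2) by (auto simp: lbox_def)
        then show ?thesis by blast
      qed
    qed
  qed
  show ?thesis
  proof (cases "\<bar>fst v\<bar> = R")
    case True
    show ?thesis using main[OF S c True] by simp
  next
    case False
    have swl: "prod.swap ` lbox R = lbox R" by (auto simp: lbox_def)
    have "a\<^sup>2 \<le> (\<Sum>v\<in>lbox R. ((g \<circ> prod.swap) v)\<^sup>2) / (real_of_int R)\<^sup>2 + 4 * energy R (g \<circ> prod.swap)"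
    proof (rule main)
      show "prod.swap ` S \<subseteq> lbox R" using S(1) swl by blast
      show "a \<le> (g \<circ> prod.swap) w" if "w \<in> prod.swap ` S" for w using that S(2) by auto
      show "(0, 0) \<in> prod.swap ` S" using S(3) by force
      show "conn (prod.swap ` S) (0, 0) (prod.swap v)" using conn_swap[OF c] by simp
      show "\<bar>fst (prod.swap v)\<bar> = R" using v False by auto
    qed
    also have "(\<Sum>v\<in>lbox R. ((g \<circ> prod.swap) v)\<^sup>2) = (\<Sum>v\<in>lbox R. (g v)\<^sup>2)"
      using sum.reindex[of prod.swap "lbox R" "\<lambda>v. (g v)\<^sup>2"] swl by simp
    finally show ?thesis by (simp only: energy_swap)
  qed
qed

text \<open>A component of the set where \<open>g\<close> is at least \<open>a\<close> that avoided
  the boundary of the box would be surrounded by values below \<open>a\<close>, against the maximum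
  principle.\<close>

lemma subharmonic_component_exits:
  fixes g :: "lattice \<Rightarrow> real"
  assumes R: "1 \<le> R" and g0: "a \<le> g (0, 0)"
    and sub: "\<And>v. v \<in> lbox (R - 1) \<Longrightarrow> 0 \<le> lap g v"
  shows "\<exists>v. conn {v \<in> lbox R. a \<le> g v} (0, 0) v \<and> (\<bar>fst v\<bar> = R \<or> \<bar>snd v\<bar> = R)"
proof (rule ccontr)
  let ?S = "{v \<in> lbox R. a \<le> g v}"
  assume no: "\<not> ?thesis"
  define W where "W = {v. conn ?S (0, 0) v}"
  have 0: "(0, 0) \<in> ?S" using g0 R by (simp add: lbox_def)
  have WS: "W \<subseteq> ?S"
  proof
    fix v assume "v \<in> W"
    then have "conn ?S (0, 0) v" by (simp only: W_def mem_Collect_eq)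
    then show "v \<in> ?S" by (rule conn_in[OF _ 0])
  qed
  have fin: "finite W" by (rule finite_subset[OF WS]) simp
  have inside: "w \<in> lbox (R - 1)" if w: "w \<in> W" for w
  proof -
    have "w \<in> lbox R" using w WS by blast
    moreover have "conn ?S (0, 0) w" using w by (simp only: W_def mem_Collect_eq)
    then have "\<bar>fst w\<bar> \<noteq> R" "\<bar>snd w\<bar> \<noteq> R" using no by blast+
    ultimately show ?thesis by (cases w) (auto simp: lbox_def)
  qed
  have out: "g w < a" if "v \<in> W" "w \<in> neighbours v" "w \<notin> W" for v w
  proof -
    have "w \<in> lbox R" using inside[OF that(1)] that(2) by (cases v) (auto simp: lbox_def neighbours_Pair)
    show ?thesis
    proof (rule ccontr)
      assume "\<not> g w < a"
      with \<open>w \<in> lbox R\<close> have "w \<in> ?S" by simp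
      moreover have "conn ?S (0, 0) v" using that(1) by (simp only: W_def mem_Collect_eq)
      moreover have "v \<in> ?S" using that(1) WS by blast
      ultimately have "conn ?S (0, 0) w" using that(2) by (metis conn_step)
      then show False using that(3) by (simp only: W_def mem_Collect_eq simp_thms)
    qed
  qed
  \<comment> \<open>The largest value at an outer neighbour of the component; \<open>a - 1\<close>
    keeps the set nonempty. As a maximum of finitely many numbers below \<open>a\<close> it is
    strictly below \<open>a\<close>.\<close>
  define c where "c = Max (insert (a - 1) (g ` {w. w \<notin> W \<and> (\<exists>v\<in>W. w \<in> neighbours v)}))"
  have fin2: "finite {w. w \<notin> W \<and> (\<exists>v\<in>W. w \<in> neighbours v)}"
    by (rule finite_subset[of _ "\<Union>v\<in>W. neighbours v"]) (use fin in auto)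
  have ca: "c < a" unfolding c_def using fin2 out by (subst Max_less_iff) auto
  have "g (0, 0) \<le> c"
  proof (rule maximum_principle[OF fin])
    show "(0, 0) \<in> W" by (simp add: W_def conn_refl)
    show "0 \<le> lap g v" if "v \<in> W" for v using sub inside that by blast
    show "g w \<le> c" if "v \<in> W" "w \<in> neighbours v" "w \<notin> W" for v w
      unfolding c_def using that fin2 by (intro Max_ge) auto
  qed
  then show False using ca g0 by simp
qed

text \<open>From mean square to a pointwise bound: the component of the origin in the superlevel set
  of its own value crosses the box, and the Caccioppoli estimate bounds the energy that such a
  crossing needs. The constant is 129 = 1 + 4 * 32.\<close>

lemma subharmonic_local_bound:
  fixes g :: "lattice \<Rightarrow> real"
  assumes R: "1 \<le> R" and nn: "\<And>v. v \<in> lbox (2 * R) \<Longrightarrow> 0 \<le> g v"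
    and sub: "\<And>v. v \<in> lbox (2 * R - 1) \<Longrightarrow> 0 \<le> lap g v"
  shows "(g (0, 0))\<^sup>2 \<le> 129 / (real_of_int R)\<^sup>2 * (\<Sum>v\<in>lbox (2 * R). (g v)\<^sup>2)"
proof -
  let ?S = "{v \<in> lbox R. g (0, 0) \<le> g v}"
  have "lbox (R - 1) \<subseteq> lbox (2 * R - 1)" using R by (intro lbox_mono) auto
  then obtain v where v: "conn ?S (0, 0) v" "\<bar>fst v\<bar> = R \<or> \<bar>snd v\<bar> = R"
    using subharmonic_component_exits[OF R order_refl, of g] sub by blast
  have z: "(0, 0) \<in> lbox (2 * R)" using R by (simp add: lbox_def)
  have "(g (0, 0))\<^sup>2 \<le> (\<Sum>v\<in>lbox R. (g v)\<^sup>2) / (real_of_int R)\<^sup>2 + 4 * energy R g"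
    by (rule crossing[OF R nn[OF z] _ _ _ v]) (use R in \<open>auto simp: lbox_def\<close>)
  also have "(\<Sum>v\<in>lbox R. (g v)\<^sup>2) / (real_of_int R)\<^sup>2 \<le> (\<Sum>v\<in>lbox (2 * R). (g v)\<^sup>2) / (real_of_int R)\<^sup>2"
    by (intro divide_right_mono sum_mono2 lbox_mono) (use R in auto)
  also have "energy R g \<le> 32 / (real_of_int R)\<^sup>2 * (\<Sum>v\<in>lbox (2 * R). (g v)\<^sup>2)"
    by (rule energy_subharmonic[OF R nn sub])
  finally show ?thesis by (simp add: algebra_simps)
qed

text \<open>A connected set on which \<open>g\<close> reaches its ceiling \<open>a\<close> cannot
  cross the box when the average of \<open>g\<close> is small compared with \<open>a\<close>. Both
  terms of the crossing inequality carry a factor \<open>a\<close>, which cancels; 193 = 1 + 4 *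
  48.\<close>

lemma superharmonic_crossing_bound:
  fixes g :: "lattice \<Rightarrow> real"
  assumes R: "1 \<le> R" and nn: "\<And>v. v \<in> lbox (2 * R) \<Longrightarrow> 0 \<le> g v \<and> g v \<le> a"
    and super: "\<And>v. v \<in> lbox (2 * R - 1) \<Longrightarrow> lap g v \<le> 0"
    and S: "S \<subseteq> lbox R" "\<And>v. v \<in> S \<Longrightarrow> a \<le> g v" "(0, 0) \<in> S"
    and c: "conn S (0, 0) v" and v: "\<bar>fst v\<bar> = R \<or> \<bar>snd v\<bar> = R"
  shows "a \<le> 193 / (real_of_int R)\<^sup>2 * (\<Sum>v\<in>lbox (2 * R). g v)"
proof -
  let ?G = "\<Sum>v\<in>lbox (2 * R). g v"
  have a: "0 \<le> a" using nn[of "(0, 0)"] R by (auto simp: lbox_def)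
  have "a\<^sup>2 \<le> (\<Sum>v\<in>lbox R. (g v)\<^sup>2) / (real_of_int R)\<^sup>2 + 4 * energy R g"
    by (rule crossing[OF R a S c v])
  also have "(\<Sum>v\<in>lbox R. (g v)\<^sup>2) \<le> a * ?G"
  proof -
    have "(\<Sum>v\<in>lbox R. (g v)\<^sup>2) \<le> (\<Sum>v\<in>lbox (2 * R). (g v)\<^sup>2)"
      by (intro sum_mono2 lbox_mono) (use R in auto)
    also have "\<dots> \<le> (\<Sum>v\<in>lbox (2 * R). a * g v)"
      unfolding power2_eq_square using nn by (intro sum_mono mult_right_mono) auto
    finally show ?thesis by (simp add: sum_distrib_left)
  qed
  also have "energy R g \<le> 48 * a / (real_of_int R)\<^sup>2 * ?G"
    by (rule energy_superharmonic[OF R nn super])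
  finally have "a\<^sup>2 \<le> a * ?G / (real_of_int R)\<^sup>2 + 4 * (48 * a / (real_of_int R)\<^sup>2 * ?G)"
    by (simp add: divide_right_mono)
  then have "a * a \<le> a * (193 / (real_of_int R)\<^sup>2 * ?G)" by (simp add: power2_eq_square algebra_simps)
  moreover have "0 \<le> 193 / (real_of_int R)\<^sup>2 * ?G"
    using nn by (intro mult_nonneg_nonneg sum_nonneg) auto
  ultimately show ?thesis
    using a by (metis mult_le_cancel_left_pos order_le_less)
qed

section \<open>Smooth bump functions\<close>

text \<open>The one-variable counterpart of \<open>C_diff\<close>. All test functions are products
  of functions of one coordinate, so smoothness is established on the line and transferred
  afterwards.\<close>

primrec diff_n :: "nat \<Rightarrow> (real \<Rightarrow> real) \<Rightarrow> bool" where
  "diff_n 0 f \<longleftrightarrow> continuous_on UNIV f"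
| "diff_n (Suc n) f \<longleftrightarrow> (\<exists>f'. (\<forall>x. (f has_real_derivative f' x) (at x)) \<and> diff_n n f')"

definition smooth1 :: "(real \<Rightarrow> real) \<Rightarrow> bool" where
  "smooth1 f \<longleftrightarrow> (\<forall>n. diff_n n f)"

lemma diff_n_Suc: "diff_n (Suc n) f \<Longrightarrow> diff_n n f"
proof (induction n arbitrary: f)
  case 0
  then obtain f' where "\<forall>x. (f has_real_derivative f' x) (at x)" by auto
  then have "isCont f x" for x using DERIV_isCont by blast
  then show ?case by (simp add: continuous_at_imp_continuous_on)
next
  case (Suc n)
  from Suc.prems obtain f' where f': "\<forall>x. (f has_real_derivative f' x) (at x)" "diff_n (Suc n) f'"
    unfolding diff_n.simps(2)[of "Suc n"] by blast
  show ?case unfolding diff_n.simps(2) using f'(1) Suc.IH[OF f'(2)] by blast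
qed

lemma diff_n_add: "diff_n n f \<Longrightarrow> diff_n n g \<Longrightarrow> diff_n n (\<lambda>x. f x + g x)"
proof (induction n arbitrary: f g)
  case 0
  then show ?case by (auto intro: continuous_on_add)
next
  case (Suc n)
  obtain f' g' where "\<forall>x. (f has_real_derivative f' x) (at x)" "diff_n n f'"
    "\<forall>x. (g has_real_derivative g' x) (at x)" "diff_n n g'" using Suc.prems by auto
  then show ?case using Suc.IH[of f' g']
    by (auto intro!: exI[of _ "\<lambda>x. f' x + g' x"] derivative_eq_intros)
qed

lemma diff_n_mult: "diff_n n f \<Longrightarrow> diff_n n g \<Longrightarrow> diff_n n (\<lambda>x. f x * g x)"
proof (induction n arbitrary: f g)
  case 0
  then show ?case by (auto intro: continuous_on_mult)
next
  case (Suc n)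
  obtain f' g' where d: "\<forall>x. (f has_real_derivative f' x) (at x)" "diff_n n f'"
    "\<forall>x. (g has_real_derivative g' x) (at x)" "diff_n n g'" using Suc.prems by auto
  have "diff_n n (\<lambda>x. f' x * g x + f x * g' x)"
    using diff_n_Suc[OF Suc.prems(1)] diff_n_Suc[OF Suc.prems(2)] d by (intro diff_n_add Suc.IH) auto
  moreover have "((\<lambda>x. f x * g x) has_real_derivative f' x * g x + f x * g' x) (at x)" for x
    by (rule DERIV_cong[OF DERIV_mult]) (use d in auto)
  ultimately show ?case unfolding diff_n.simps(2) by (intro exI[of _ "\<lambda>x. f' x * g x + f x * g' x"]) simp
qed

lemma diff_n_const: "diff_n n (\<lambda>x. c)"
proof (induction n arbitrary: c)
  case (Suc n)
  show ?case using Suc.IH[of 0] by (auto intro!: exI[of _ "\<lambda>x. 0"])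
qed simp

lemma diff_n_affine: "diff_n n f \<Longrightarrow> diff_n n (\<lambda>x. f (a * x + c))"
proof (induction n arbitrary: f)
  case 0
  then show ?case by (auto intro!: continuous_intros continuous_on_compose2[of UNIV f])
next
  case (Suc n)
  obtain f' where d: "\<forall>x. (f has_real_derivative f' x) (at x)" "diff_n n f'" using Suc.prems by auto
  have "diff_n n (\<lambda>x. f' (a * x + c) * a)"
    by (rule diff_n_mult[OF Suc.IH[OF d(2)] diff_n_const])
  moreover have "((\<lambda>x. f (a * x + c)) has_real_derivative f' (a * x + c) * a) (at x)" for x
    by (rule DERIV_chain2[of f]) (use d in \<open>auto intro!: derivative_eq_intros\<close>)
  ultimately show ?case unfolding diff_n.simps(2) by (intro exI[of _ "\<lambda>x. f' (a * x + c) * a"]) simp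
qed

lemma smooth1_deriv:
  assumes "smooth1 f"
  shows "(f has_real_derivative deriv f x) (at x)" "smooth1 (deriv f)"
proof -
  have ex: "\<exists>f'. (\<forall>x. (f has_real_derivative f' x) (at x)) \<and> diff_n n f'" for n
    using assms by (metis smooth1_def diff_n.simps(2))
  have "f' = deriv f" if "\<forall>x. (f has_real_derivative f' x) (at x)" for f'
    using that by (intro ext) (metis DERIV_imp_deriv)
  then show "(f has_real_derivative deriv f x) (at x)" "smooth1 (deriv f)"
    unfolding smooth1_def using ex by metis+
qed

lemma smooth1_mult: "smooth1 f \<Longrightarrow> smooth1 g \<Longrightarrow> smooth1 (\<lambda>x. f x * g x)"
  by (simp add: smooth1_def diff_n_mult)

lemma smooth1_const: "smooth1 (\<lambda>x. c)"
  by (simp add: smooth1_def diff_n_const)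

lemma smooth1_affine: "smooth1 f \<Longrightarrow> smooth1 (\<lambda>x. f (a * x + c))"
  by (simp add: smooth1_def diff_n_affine)

lemma smooth1_continuous: "smooth1 f \<Longrightarrow> continuous_on S f"
  using smooth1_deriv(1) by (meson DERIV_continuous_on has_field_derivative_at_within)

text \<open>Both partial derivatives of such a product are products of the same form, so the
  induction closes.\<close>

lemma C_diff_product: "smooth1 f \<Longrightarrow> smooth1 g \<Longrightarrow> C_diff k (\<lambda>x. f (fst x) * g (snd x))"
proof (induction k arbitrary: f g)
  case 0
  have "continuous_on UNIV (\<lambda>x :: plane. f (fst x))" "continuous_on UNIV (\<lambda>x :: plane. g (snd x))"
    by (rule continuous_on_compose2[OF smooth1_continuous[OF 0(1), of UNIV]]
             continuous_on_compose2[OF smooth1_continuous[OF 0(2), of UNIV]],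
        auto intro: continuous_intros)+
  then show ?case by (simp add: continuous_on_mult)
next
  case (Suc k)
  have "((\<lambda>x. f (fst x) * g (snd x)) has_derivative
      (\<lambda>h. fst h * (deriv f (fst x) * g (snd x)) + snd h * (f (fst x) * deriv g (snd x)))) (at x)" for x
  proof -
    have "((\<lambda>x. f (fst x)) has_derivative (\<lambda>h. fst h * deriv f (fst x))) (at x)"
      using has_derivative_compose[OF has_derivative_fst[OF has_derivative_ident]
          smooth1_deriv(1)[OF Suc.prems(1), unfolded has_field_derivative_def], of x UNIV]
      by (simp add: mult.commute)
    moreover have "((\<lambda>x. g (snd x)) has_derivative (\<lambda>h. snd h * deriv g (snd x))) (at x)"
      using has_derivative_compose[OF has_derivative_snd[OF has_derivative_ident]
          smooth1_deriv(1)[OF Suc.prems(2), unfolded has_field_derivative_def], of x UNIV]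
      by (simp add: mult.commute)
    ultimately show ?thesis
      by (rule has_derivative_eq_rhs[OF has_derivative_mult]) (auto simp: algebra_simps)
  qed
  moreover have "C_diff k (\<lambda>x. deriv f (fst x) * g (snd x))" "C_diff k (\<lambda>x. f (fst x) * deriv g (snd x))"
    using Suc smooth1_deriv(2) by blast+
  ultimately show ?case
    unfolding C_diff.simps
    by (intro exI[of _ "\<lambda>x. deriv f (fst x) * g (snd x)"] exI[of _ "\<lambda>x. f (fst x) * deriv g (snd x)"]) simp
qed

lemma poly_div_exp_tendsto_0: "((\<lambda>t. poly P t * exp (- t)) \<longlongrightarrow> (0::real)) at_top"
proof -
  have "((\<lambda>t. \<Sum>i\<le>degree P. coeff P i * (t ^ i / exp t)) \<longlongrightarrow> (\<Sum>i\<le>degree P. coeff P i * 0)) at_top"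
    by (intro tendsto_sum tendsto_mult tendsto_const tendsto_power_div_exp_0)
  then show ?thesis by (simp add: poly_altdef sum_distrib_right exp_minus sum_divide_distrib divide_inverse mult.assoc)
qed

text \<open>The functions P(1/x) exp(-1/x), extended by zero to the left, form a class closed under
  differentiation: with t = 1/x, the polynomial P becomes t^2 (P - P').\<close>

definition flat :: "real poly \<Rightarrow> real \<Rightarrow> real" where
  "flat P x = (if x \<le> 0 then 0 else poly P (1 / x) * exp (- (1 / x)))"

lemma flat_deriv:
  "(flat P has_real_derivative flat ([:0, 0, 1:] * (P - pderiv P)) x) (at x)"
proof -
  consider "x < 0" | "x = 0" | "0 < x" by linarith
  then show ?thesis
  proof cases
    case 1
    have "((\<lambda>x. 0) has_real_derivative 0) (at x)" by simp
    then have "(flat P has_real_derivative 0) (at x)"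
      by (rule has_field_derivative_transform_within_open[of _ _ _ "{..<0}"]) (use 1 in \<open>auto simp: flat_def\<close>)
    then show ?thesis using 1 by (simp add: flat_def)
  next
    case 2
    \<comment> \<open>The factor 1/h of the difference quotient is absorbed into the polynomial,
      which becomes \<open>pCons 0 P\<close>; the exponential still dominates it.\<close>
    have R: "((\<lambda>h. (flat P h - flat P 0) / h) \<longlongrightarrow> 0) (at_right 0)"
    proof -
      have "((\<lambda>h. poly (pCons 0 P) (1 / h) * exp (- (1 / h))) \<longlongrightarrow> 0) (at_right 0)"
        by (rule filterlim_compose[OF poly_div_exp_tendsto_0[of "pCons 0 P"]])
          (use filterlim_inverse_at_top_right in \<open>simp add: inverse_eq_divide\<close>)
      moreover have "\<forall>\<^sub>F h in at_right 0. poly (pCons 0 P) (1 / h) * exp (- (1 / h)) = (flat P h - flat P 0) / h"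
        by (auto simp: eventually_at_right_field flat_def intro!: exI[of _ 1])
      ultimately show ?thesis by (rule Lim_transform_eventually)
    qed
    have L: "((\<lambda>h. (flat P h - flat P 0) / h) \<longlongrightarrow> 0) (at_left 0)"
      by (rule tendsto_eventually) (auto simp: eventually_at_left_field flat_def intro!: exI[of _ "-1"])
    have "((\<lambda>h. (flat P h - flat P 0) / h) \<longlongrightarrow> 0) (at 0)"
      by (rule filterlim_split_at[OF L R])
    then have "(flat P has_real_derivative 0) (at 0)"
      by (simp add: has_field_derivative_iff)
    then show ?thesis using 2 by (simp add: flat_def)
  next
    case 3
    have "((\<lambda>x. poly P (1 / x) * exp (- (1 / x))) has_real_derivative
        poly ([:0, 0, 1:] * (P - pderiv P)) (1 / x) * exp (- (1 / x))) (at x)"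
    proof -
      have *: "((\<lambda>x. 1 / x) has_real_derivative - (1 / x) * (1 / x)) (at x)"
        using 3 by (auto intro!: derivative_eq_intros simp: field_simps power2_eq_square)
      have "((\<lambda>x. poly P (1 / x)) has_real_derivative poly (pderiv P) (1 / x) * (- (1 / x) * (1 / x))) (at x)"
        by (rule DERIV_chain2[OF poly_DERIV *])
      moreover have "((\<lambda>x. exp (- (1 / x))) has_real_derivative exp (- (1 / x)) * ((1 / x) * (1 / x))) (at x)"
        using DERIV_chain2[OF DERIV_exp DERIV_minus[OF *]] by simp
      ultimately show ?thesis
        by (rule DERIV_cong[OF DERIV_mult]) (simp add: algebra_simps)
    qed
    then have "(flat P has_real_derivative poly ([:0, 0, 1:] * (P - pderiv P)) (1 / x) * exp (- (1 / x))) (at x)"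
      by (rule has_field_derivative_transform_within_open[of _ _ _ "{0<..}"]) (use 3 in \<open>auto simp: flat_def\<close>)
    then show ?thesis using 3 by (simp add: flat_def)
  qed
qed

lemma smooth1_flat: "smooth1 (flat P)"
proof -
  have "diff_n n (flat P)" for n
  proof (induction n arbitrary: P)
    case 0
    show ?case using DERIV_isCont[OF flat_deriv[of P]] by (simp add: continuous_at_imp_continuous_on)
  next
    case (Suc n)
    then show ?case
      unfolding diff_n.simps(2)
      by (intro exI[of _ "flat ([:0, 0, 1:] * (P - pderiv P))"] conjI allI flat_deriv)
  qed
  then show ?thesis by (simp add: smooth1_def)
qed

lemma bump_exists:
  fixes r :: real
  assumes "0 < r"
  obtains b where "smooth1 b" "\<And>x. 0 \<le> b x" "\<And>x. r \<le> \<bar>x\<bar> \<Longrightarrow> b x = 0" "integral {-r..r} b = 1"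
proof -
  \<comment> \<open>The first factor vanishes for x \<le> -r, the second for x \<ge> r, and both are
    positive in between.\<close>
  define b0 where "b0 x = flat 1 (1 * x + r) * flat 1 ((- 1) * x + r)" for x
  have sm: "smooth1 b0" unfolding b0_def by (intro smooth1_mult smooth1_affine smooth1_flat)
  have nn: "0 \<le> b0 x" for x by (simp add: b0_def flat_def)
  have z: "b0 x = 0" if "r \<le> \<bar>x\<bar>" for x using that by (auto simp: b0_def flat_def)
  define I where "I = integral {-r..r} b0"
  have "0 < b0 0" using assms by (simp add: b0_def flat_def)
  moreover have "b0 0 = 0" if "I = 0"
    using integral_eq_0_iff[of "-r" r b0] smooth1_continuous[OF sm] nn assms that by (auto simp: I_def)
  ultimately have "I \<noteq> 0" by auto
  moreover have "0 \<le> I" unfolding I_def using nn smooth1_continuous[OF sm]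
    by (intro integral_nonneg integrable_continuous_interval) auto
  ultimately have I: "0 < I" by simp
  define b where "b x = (1 / I) * b0 x" for x
  have "smooth1 b" unfolding b_def by (intro smooth1_mult smooth1_const sm)
  moreover have "0 \<le> b x" for x using nn I by (simp add: b_def)
  moreover have "b x = 0" if "r \<le> \<bar>x\<bar>" for x using z[OF that] by (simp add: b_def)
  moreover have "integral {-r..r} b = 1" unfolding b_def using I by (simp add: I_def)
  ultimately show ?thesis using that by blast
qed

text \<open>At the end points, \<open>f\<close> is known to vanish only on the outer side. As the
  derivative exists, the outer one-sided difference quotient already determines it.\<close>

lemma deriv_zero_outside:
  fixes f :: "real \<Rightarrow> real"
  assumes d: "(f has_real_derivative D) (at x)" and z: "\<And>x. r \<le> \<bar>x\<bar> \<Longrightarrow> f x = 0" and x: "r \<le> \<bar>x\<bar>"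
  shows "D = 0"
proof -
  have lim: "((\<lambda>h. (f (x + h) - f x) / h) \<longlongrightarrow> D) (at 0)" using d by (simp add: DERIV_def)
  show ?thesis
  proof (cases "0 \<le> x")
    case True
    have "((\<lambda>h. (f (x + h) - f x) / h) \<longlongrightarrow> 0) (at_right 0)"
      by (rule tendsto_eventually) (use True x z in \<open>auto simp: eventually_at_right_field intro!: exI[of _ 1]\<close>)
    moreover have "((\<lambda>h. (f (x + h) - f x) / h) \<longlongrightarrow> D) (at_right 0)"
      by (rule tendsto_mono[OF at_le lim]) simp
    ultimately show ?thesis using tendsto_unique trivial_limit_at_right_real by blast
  next
    case False
    have "((\<lambda>h. (f (x + h) - f x) / h) \<longlongrightarrow> 0) (at_left 0)"
      by (rule tendsto_eventually) (use False x z in \<open>auto simp: eventually_at_left_field intro!: exI[of _ "-1"]\<close>)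
    moreover have "((\<lambda>h. (f (x + h) - f x) / h) \<longlongrightarrow> D) (at_left 0)"
      by (rule tendsto_mono[OF at_le lim]) simp
    ultimately show ?thesis using tendsto_unique trivial_limit_at_left_real by blast
  qed
qed

text \<open>Taylor expansion of order two on both sides. The first-order terms cancel, and the two
  remainders evaluate the second derivative at distance less than \<open>h\<close> from
  \<open>x\<close>.\<close>

lemma second_difference:
  fixes b :: "real \<Rightarrow> real"
  assumes sm: "smooth1 b" and lip: "\<And>x y. \<bar>deriv (deriv b) x - deriv (deriv b) y\<bar> \<le> K * \<bar>x - y\<bar>" and h: "0 < h"
  shows "\<bar>(b (x + h) + b (x - h) - 2 * b x) / h\<^sup>2 - deriv (deriv b) x\<bar> \<le> K * h"
proof -
  let ?b1 = "deriv b" let ?b2 = "deriv ?b1"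
  have K: "0 \<le> K" using lip[of 0 1] by simp
  define D where "D = (\<lambda>n::nat. if n = 0 then b else if n = 1 then ?b1 else ?b2)"
  have DD: "\<forall>m t. m < 2 \<and> x - h \<le> t \<and> t \<le> x + h \<longrightarrow> (D m has_real_derivative D (Suc m) t) (at t)"
    using smooth1_deriv(1)[OF sm] smooth1_deriv(1)[OF smooth1_deriv(2)[OF sm]]
    by (auto simp: D_def less_2_cases_iff)
  obtain s where s: "x < s" "s < x + h" "b (x + h) = b x + ?b1 x * h + ?b2 s / 2 * h\<^sup>2"
    using Taylor[of 2 D b "x - h" "x + h" x "x + h"] DD h
    by (auto simp: D_def eval_nat_numeral lessThan_Suc)
  obtain t where t: "x - h < t" "t < x" "b (x - h) = b x - ?b1 x * h + ?b2 t / 2 * h\<^sup>2"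
    using Taylor[of 2 D b "x - h" "x + h" x "x - h"] DD h
    by (auto simp: D_def eval_nat_numeral lessThan_Suc)
  have "b (x + h) + b (x - h) - 2 * b x = (?b2 s + ?b2 t) / 2 * h\<^sup>2"
    unfolding s(3) t(3) by (simp add: field_simps)
  then have "(b (x + h) + b (x - h) - 2 * b x) / h\<^sup>2 = (?b2 s + ?b2 t) / 2"
    using h by simp
  then have e: "(b (x + h) + b (x - h) - 2 * b x) / h\<^sup>2 - ?b2 x = ((?b2 s - ?b2 x) + (?b2 t - ?b2 x)) / 2"
    by (simp add: field_simps)
  have "\<bar>?b2 s - ?b2 x\<bar> \<le> K * h" "\<bar>?b2 t - ?b2 x\<bar> \<le> K * h"
    using s t K by (auto intro!: order_trans[OF lip] mult_left_mono)
  then have "\<bar>(?b2 s - ?b2 x) + (?b2 t - ?b2 x)\<bar> \<le> 2 * (K * h)"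
    using abs_triangle_ineq[of "?b2 s - ?b2 x" "?b2 t - ?b2 x"] by linarith
  then show ?thesis unfolding e abs_divide by simp
qed

lemma smooth1_compact_bounds:
  assumes sm: "smooth1 b" and z: "\<And>x. r \<le> \<bar>x\<bar> \<Longrightarrow> b x = 0"
  obtains K where "\<And>x. \<bar>b x\<bar> \<le> K" "\<And>x y. \<bar>b x - b y\<bar> \<le> K * \<bar>x - y\<bar>"
proof -
  have bd: "\<exists>K\<ge>0. \<forall>x. \<bar>f x\<bar> \<le> K" if f: "smooth1 f" "\<And>x. r \<le> \<bar>x\<bar> \<Longrightarrow> f x = 0" for f
  proof -
    have "compact (f ` {-r..r})" using smooth1_continuous[OF f(1)] by (intro compact_continuous_image) auto
    then obtain K where K: "0 < K" "\<forall>y\<in>f ` {-r..r}. norm y \<le> K"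
      using bounded_pos compact_imp_bounded by blast
    have "\<bar>f x\<bar> \<le> K" for x
    proof (cases "r \<le> \<bar>x\<bar>")
      case False
      then have "x \<in> {-r..r}" by auto
      then show ?thesis using K(2) by auto
    qed (use K(1) f(2)[of x] in auto)
    then show ?thesis using K(1) less_imp_le by blast
  qed
  obtain K0 where K0: "0 \<le> K0" "\<And>x. \<bar>b x\<bar> \<le> K0" using bd[OF sm z] by blast
  have "smooth1 (deriv b)" "\<And>x. r \<le> \<bar>x\<bar> \<Longrightarrow> deriv b x = 0"
    using smooth1_deriv[OF sm] deriv_zero_outside[OF smooth1_deriv(1)[OF sm] z] by auto
  then obtain K1 where K1: "0 \<le> K1" "\<And>x. \<bar>deriv b x\<bar> \<le> K1" using bd by blast
  have "\<bar>b x - b y\<bar> \<le> K1 * \<bar>x - y\<bar>" for x y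
    using field_differentiable_bound[of UNIV b "deriv b" K1 x y] smooth1_deriv(1)[OF sm] K1
    by (auto simp: has_field_derivative_at_within)
  then have "\<bar>b x - b y\<bar> \<le> max K0 K1 * \<bar>x - y\<bar>" for x y
    by (meson abs_ge_zero max.cobounded2 mult_right_mono order_trans)
  moreover have "\<bar>b x\<bar> \<le> max K0 K1" for x using K0(2)[of x] by simp
  ultimately show ?thesis using that by blast
qed

section \<open>Slices of the weighted graph\<close>

lemma smooth1_shift_deriv:
  assumes "smooth1 f"
  shows "((\<lambda>t. f (t - \<alpha>)) has_real_derivative deriv f (t - \<alpha>)) (at t)"
proof -
  have "((\<lambda>t. f (t - \<alpha>)) has_real_derivative deriv f (t - \<alpha>) * 1) (at t)"
    by (rule DERIV_chain2[where f = f and g = "\<lambda>t. t - \<alpha>"])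
      (auto intro: smooth1_deriv(1)[OF assms] intro!: derivative_eq_intros)
  then show ?thesis by simp
qed

text \<open>\<open>max 0 (t - a)\<close> is a fundamental solution of the second derivative on the
  line, so pairing it with a second derivative returns the value at \<open>a\<close>.\<close>

lemma integral_ramp:
  fixes b :: "real \<Rightarrow> real"
  assumes sm: "smooth1 b" and z: "\<And>x. r \<le> \<bar>x\<bar> \<Longrightarrow> b x = 0" and r: "0 < r"
  shows "((\<lambda>t. max 0 (t - a) * deriv (deriv b) (t - \<alpha>)) has_integral b (a - \<alpha>)) {\<alpha>-r..\<alpha>+r}"
proof -
  let ?b = "\<lambda>t. b (t - \<alpha>)" let ?b1 = "\<lambda>t. deriv b (t - \<alpha>)" let ?b2 = "\<lambda>t. deriv (deriv b) (t - \<alpha>)"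
  have d: "(?b has_real_derivative ?b1 t) (at t)" "(?b1 has_real_derivative ?b2 t) (at t)" for t
    by (intro smooth1_shift_deriv sm smooth1_deriv(2))+
  have z1: "deriv b x = 0" if "r \<le> \<bar>x\<bar>" for x
    using deriv_zero_outside[OF smooth1_deriv(1)[OF sm] z that] .
  \<comment> \<open>The primitive obtained by integration by parts. Writing \<open>max a t\<close>
    makes it vanish to the left of \<open>a\<close> and keeps it continuous there, so
    \<open>a\<close> is the only exceptional point.\<close>
  define G where "G t = max 0 (t - a) * ?b1 t - (?b (max a t) - ?b a)" for t
  have "((\<lambda>t. max 0 (t - a) * ?b2 t) has_integral (G (\<alpha> + r) - G (\<alpha> - r))) {\<alpha>-r..\<alpha>+r}"
  proof (rule fundamental_theorem_of_calculus_interior_strong[of "{a}"])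
    have "continuous_on UNIV b" "continuous_on UNIV (deriv b)"
      using smooth1_continuous sm smooth1_deriv(2) by blast+
    then have "continuous_on {\<alpha>-r..\<alpha>+r} ?b1" "continuous_on {\<alpha>-r..\<alpha>+r} (\<lambda>t. ?b (max a t))"
      by (auto intro: continuous_on_compose2[OF _ continuous_on_diff[OF continuous_on_id continuous_on_const]]
          continuous_on_compose2[OF _ continuous_on_diff[OF continuous_on_max[OF continuous_on_const continuous_on_id] continuous_on_const]])
    then show "continuous_on {\<alpha>-r..\<alpha>+r} G"
      unfolding G_def
      by (intro continuous_on_diff continuous_on_mult continuous_on_max continuous_on_id continuous_on_const)
    fix t assume t: "t \<in> {\<alpha>-r<..<\<alpha>+r} - {a}"
    have "(G has_real_derivative max 0 (t - a) * ?b2 t) (at t)"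
    proof (cases "t < a")
      case True
      have "((\<lambda>t. 0) has_real_derivative 0) (at t)" by simp
      then have "(G has_real_derivative 0) (at t)"
        by (rule has_field_derivative_transform_within_open[of _ _ _ "{..<a}"]) (use True in \<open>auto simp: G_def\<close>)
      then show ?thesis using True by simp
    next
      case False
      then have at: "a < t" using t by auto
      have "((\<lambda>t. (t - a) * ?b1 t - (?b t - ?b a)) has_real_derivative (t - a) * ?b2 t) (at t)"
        by (rule DERIV_cong[OF DERIV_diff[OF DERIV_mult[OF _ d(2)] DERIV_diff[OF d(1) DERIV_const]], of _ 1])
          (auto intro!: derivative_eq_intros)
      then have "(G has_real_derivative (t - a) * ?b2 t) (at t)"
        by (rule has_field_derivative_transform_within_open[of _ _ _ "{a<..}"]) (use at in \<open>auto simp: G_def max_def\<close>)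
      then show ?thesis using at by simp
    qed
    then show "(G has_vector_derivative max 0 (t - a) * ?b2 t) (at t)"
      by (simp add: has_real_derivative_iff_has_vector_derivative)
  qed (use r in auto)
  moreover have "G (\<alpha> + r) - G (\<alpha> - r) = b (a - \<alpha>)"
    using z1[of r] z1[of "-r"] z[of r] z[of "-r"] z[of "a - \<alpha>"] r
    by (auto simp: G_def max_def)
  ultimately show ?thesis by simp
qed

text \<open>Subtracting \<open>\<Sum> J\<^sub>i max 0 (t - a\<^sub>i)\<close> removes all the kinks of \<open>c\<close>; the rest is locally affine and
  pairs to zero with a compactly supported second derivative.\<close>

lemma integral_kinks:
  fixes b c :: "real \<Rightarrow> real"
  assumes sm: "smooth1 b" and z: "\<And>x. r \<le> \<bar>x\<bar> \<Longrightarrow> b x = 0" and r: "0 < r" and fin: "finite I"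
    and loc: "\<And>x. x \<in> {\<alpha>-r..\<alpha>+r} \<Longrightarrow> \<exists>\<delta>>0. \<exists>k1 k2. (\<forall>t\<in>{x-\<delta><..x}. c t = c x + k1 * (t - x)) \<and>
        (\<forall>t\<in>{x..<x+\<delta>}. c t = c x + k2 * (t - x)) \<and> k2 - k1 = (\<Sum>i\<in>{i\<in>I. a i = x}. J i)"
  shows "((\<lambda>t. c t * deriv (deriv b) (t - \<alpha>)) has_integral (\<Sum>i\<in>I. J i * b (a i - \<alpha>))) {\<alpha>-r..\<alpha>+r}"
proof -
  let ?b = "\<lambda>t. b (t - \<alpha>)" let ?b1 = "\<lambda>t. deriv b (t - \<alpha>)" let ?b2 = "\<lambda>t. deriv (deriv b) (t - \<alpha>)"
  have d: "(?b has_real_derivative ?b1 t) (at t)" "(?b1 has_real_derivative ?b2 t) (at t)" for t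
    by (intro smooth1_shift_deriv sm smooth1_deriv(2))+
  have z1: "deriv b x = 0" if "r \<le> \<bar>x\<bar>" for x
    using deriv_zero_outside[OF smooth1_deriv(1)[OF sm] z that] .
  define h where "h t = c t - (\<Sum>i\<in>I. J i * max 0 (t - a i))" for t
  have hloc: "\<exists>\<delta>>0. \<exists>k. \<forall>t\<in>{x-\<delta><..<x+\<delta>}. h t = h x + k * (t - x)" if x: "x \<in> {\<alpha>-r..\<alpha>+r}" for x
  proof -
    obtain \<delta> k1 k2 where l: "\<delta> > 0" "\<And>t. t \<in> {x-\<delta><..x} \<Longrightarrow> c t = c x + k1 * (t - x)"
      "\<And>t. t \<in> {x..<x+\<delta>} \<Longrightarrow> c t = c x + k2 * (t - x)" "k2 - k1 = (\<Sum>i\<in>{i\<in>I. a i = x}. J i)"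
      using loc[OF x] by blast
    \<comment> \<open>Small enough that no other kink is met, so every ramp not based at
      \<open>x\<close> is affine on the interval.\<close>
    define \<epsilon> where "\<epsilon> = Min (insert \<delta> ((\<lambda>i. \<bar>x - a i\<bar>) ` {i\<in>I. a i \<noteq> x}))"
    have \<epsilon>: "\<epsilon> > 0" "\<epsilon> \<le> \<delta>" "\<And>i. i \<in> I \<Longrightarrow> a i \<noteq> x \<Longrightarrow> \<epsilon> \<le> \<bar>x - a i\<bar>"
      unfolding \<epsilon>_def using fin l(1) by (auto simp: Min_gr_iff)
    define k where "k = k1 - (\<Sum>i\<in>{i\<in>I. a i < x}. J i)"
    have "h t = h x + k * (t - x)" if t: "t \<in> {x-\<epsilon><..<x+\<epsilon>}" for t
    proof -
      have split: "J i * max 0 (t - a i) - J i * max 0 (x - a i)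
          = (if a i < x then J i else 0) * (t - x) + (if a i = x then J i else 0) * max 0 (t - x)" if i: "i \<in> I" for i
        using \<epsilon>(3)[OF i] t by (cases "a i = x") (auto simp: max_def algebra_simps)
      have "(\<Sum>i\<in>I. J i * max 0 (t - a i)) - (\<Sum>i\<in>I. J i * max 0 (x - a i))
          = (\<Sum>i\<in>I. if a i < x then J i else 0) * (t - x) + (\<Sum>i\<in>I. if a i = x then J i else 0) * max 0 (t - x)"
        by (simp add: sum_subtractf[symmetric] split sum.distrib sum_distrib_right)
      also have "(\<Sum>i\<in>I. if a i < x then J i else 0) = k1 - k"
        using fin by (simp add: k_def sum.inter_filter)
      also have "(\<Sum>i\<in>I. if a i = x then J i else 0) = k2 - k1"
        using fin l(4) by (simp add: sum.inter_filter)
      finally have "h t - h x = c t - c x - (k1 - k) * (t - x) - (k2 - k1) * max 0 (t - x)"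
        by (simp add: h_def)
      also have "\<dots> = k * (t - x)"
        using l(2)[of t] l(3)[of t] t \<epsilon>(2) by (cases "t \<le> x") (auto simp: algebra_simps)
      finally show ?thesis by simp
    qed
    then show ?thesis using \<epsilon>(1) by blast
  qed
  have hd: "(h has_real_derivative deriv h x) (at x)" "(deriv h has_real_derivative 0) (at x)"
    if x: "x \<in> {\<alpha>-r..\<alpha>+r}" for x
  proof -
    obtain \<delta> k where k: "\<delta> > 0" "\<And>t. t \<in> {x-\<delta><..<x+\<delta>} \<Longrightarrow> h t = h x + k * (t - x)"
      using hloc[OF x] by blast
    have D: "(h has_real_derivative k) (at t)" if "t \<in> {x-\<delta><..<x+\<delta>}" for t
    proof -
      have "((\<lambda>t. h x + k * (t - x)) has_real_derivative k) (at t)" by (auto intro!: derivative_eq_intros)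
      then show ?thesis
        by (rule has_field_derivative_transform_within_open[of _ _ _ "{x-\<delta><..<x+\<delta>}"])
          (use that in simp, use that in simp, rule k(2)[symmetric])
    qed
    then show "(h has_real_derivative deriv h x) (at x)" using k(1) DERIV_imp_deriv[OF D[of x]] by simp
    have "((\<lambda>t. k) has_real_derivative 0) (at x)" by simp
    then show "(deriv h has_real_derivative 0) (at x)"
      by (rule has_field_derivative_transform_within_open[of _ _ _ "{x-\<delta><..<x+\<delta>}"])
        (use k(1) DERIV_imp_deriv[OF D] in auto)
  qed
  \<comment> \<open>A Wronskian: its derivative is \<open>h\<close> times the second derivative of
    the bump, because \<open>deriv h\<close> is locally constant. It vanishes at both ends together
    with the bump and its derivative.\<close>
  define G where "G t = h t * ?b1 t - deriv h t * ?b t" for t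
  have "((\<lambda>t. h t * ?b2 t) has_integral (G (\<alpha> + r) - G (\<alpha> - r))) {\<alpha>-r..\<alpha>+r}"
  proof (rule fundamental_theorem_of_calculus)
    fix t assume t: "t \<in> {\<alpha>-r..\<alpha>+r}"
    have "(G has_real_derivative h t * ?b2 t) (at t)"
      unfolding G_def
      by (rule DERIV_cong[OF DERIV_diff[OF DERIV_mult[OF hd(1)[OF t] d(2)] DERIV_mult[OF hd(2)[OF t] d(1)]]]) simp
    then show "(G has_vector_derivative h t * ?b2 t) (at t within {\<alpha>-r..\<alpha>+r})"
      by (simp add: has_real_derivative_iff_has_vector_derivative has_vector_derivative_at_within)
  qed (use r in auto)
  moreover have "G (\<alpha> + r) - G (\<alpha> - r) = 0"
    using z1[of r] z1[of "-r"] z[of r] z[of "-r"] r by (simp add: G_def)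
  moreover have "((\<lambda>t. \<Sum>i\<in>I. J i * (max 0 (t - a i) * ?b2 t)) has_integral (\<Sum>i\<in>I. J i * b (a i - \<alpha>))) {\<alpha>-r..\<alpha>+r}"
    by (intro has_integral_sum fin has_integral_mult_right integral_ramp[OF sm z r])
  ultimately have "((\<lambda>t. h t * ?b2 t + (\<Sum>i\<in>I. J i * (max 0 (t - a i) * ?b2 t))) has_integral 0 + (\<Sum>i\<in>I. J i * b (a i - \<alpha>))) {\<alpha>-r..\<alpha>+r}"
    by (intro has_integral_add) auto
  then show ?thesis by (simp add: h_def algebra_simps sum_distrib_left)
qed

text \<open>The inequalities are strict, so horizontal edges and the heights of end points never
  count, and \<open>crossing_at\<close> divides by a nonzero number whenever \<open>crosses\<close>
  holds.\<close>

definition crosses :: "edge \<Rightarrow> real \<Rightarrow> bool" where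
  "crosses e s \<longleftrightarrow> (snd (fst e) < s \<and> s < snd (snd e)) \<or> (snd (snd e) < s \<and> s < snd (fst e))"

definition crossing_at :: "edge \<Rightarrow> real \<Rightarrow> real" where
  "crossing_at e s = fst (fst e) + (s - snd (fst e)) / (snd (snd e) - snd (fst e)) * (fst (snd e) - fst (fst e))"

text \<open>Change of variables from the edge parameter to the height. A horizontal edge is never
  crossed and has factor zero on the right, so it fits the same formula.\<close>

lemma integral_along_edge:
  fixes \<psi> :: "plane \<Rightarrow> real"
  assumes cont: "continuous_on UNIV \<psi>"
  shows "((\<lambda>s. if crosses e s then \<psi> (crossing_at e s, s) else 0) has_integral
      \<bar>snd (snd e) - snd (fst e)\<bar> * integral {0..1} (\<lambda>t. \<psi> (fst e + t *\<^sub>R (snd e - fst e)))) UNIV"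
proof (cases "snd (fst e) = snd (snd e)")
  case True
  then have "\<not> crosses e s" for s by (auto simp: crosses_def)
  then show ?thesis using True by simp
next
  case False
  define p q where "p = snd (fst e)" and "q = snd (snd e)"
  have pq: "p \<noteq> q" using False by (simp add: p_def q_def)
  define g where "g t = \<psi> (fst e + t *\<^sub>R (snd e - fst e))" for t
  have cg: "continuous_on {0..1} g"
    unfolding g_def by (intro continuous_on_compose2[OF cont] continuous_intros) auto
  have "(g has_integral integral {0..1} g) (cbox 0 1)"
    using integrable_continuous_interval[OF cg] by (simp add: integrable_integral)
  then have "((\<lambda>s. g ((1 / (q - p)) *\<^sub>R s + (- p / (q - p)))) has_integral
      (1 / \<bar>1 / (q - p)\<bar> ^ DIM(real)) *\<^sub>R integral {0..1} g)
      ((\<lambda>x. (1 / (1 / (q - p))) *\<^sub>R x + -((1 / (1 / (q - p))) *\<^sub>R (- p / (q - p)))) ` cbox 0 1)"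
    by (rule has_integral_affinity) (use pq in auto)
  moreover have "(\<lambda>x. (1 / (1 / (q - p))) *\<^sub>R x + -((1 / (1 / (q - p))) *\<^sub>R (- p / (q - p)))) ` cbox 0 1 = {min p q..max p q}"
  proof -
    have "(\<lambda>x. (1 / (1 / (q - p))) *\<^sub>R x + -((1 / (1 / (q - p))) *\<^sub>R (- p / (q - p)))) = (\<lambda>x. (q - p) * x + p)"
      using pq by (auto simp: fun_eq_iff)
    then show ?thesis
      using pq by (simp add: image_affinity_atLeastAtMost min_def max_def)
  qed
  ultimately have 1: "((\<lambda>s. g ((s - p) / (q - p))) has_integral \<bar>q - p\<bar> * integral {0..1} g) {min p q..max p q}"
    by (simp add: diff_divide_distrib)
  have "((\<lambda>s. if crosses e s then \<psi> (crossing_at e s, s) else 0) has_integral \<bar>q - p\<bar> * integral {0..1} g) {min p q..max p q}"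
  proof (rule has_integral_spike_finite[OF _ _ 1, of "{p, q}"])
    fix s assume s: "s \<in> {min p q..max p q} - {p, q}"
    then have "crosses e s" by (auto simp: crosses_def p_def q_def)
    moreover have "fst e + ((s - p) / (q - p)) *\<^sub>R (snd e - fst e) = (crossing_at e s, s)"
      using pq by (auto simp: prod_eq_iff crossing_at_def p_def q_def)
    ultimately show "(if crosses e s then \<psi> (crossing_at e s, s) else 0) = g ((s - p) / (q - p))"
      by (simp add: g_def)
  qed simp
  then have "((\<lambda>s. if crosses e s then \<psi> (crossing_at e s, s) else 0) has_integral \<bar>q - p\<bar> * integral {0..1} g) UNIV"
    by (rule has_integral_on_superset) (auto simp: crosses_def p_def q_def)
  then show ?thesis by (simp add: p_def q_def g_def[abs_def])
qed

lemma integrable_compact_support: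
  fixes f :: "'a::euclidean_space \<Rightarrow> real"
  assumes "continuous_on UNIV f" "compact K" "\<And>x. x \<notin> K \<Longrightarrow> f x = 0"
  shows "integrable lborel f"
proof -
  have "integrable lborel (\<lambda>x. indicator K x *\<^sub>R f x)"
    by (rule borel_integrable_compact[OF assms(2)]) (use assms(1) continuous_on_subset in blast)
  moreover have "(\<lambda>x. indicator K x *\<^sub>R f x) = f" using assms(3) by (auto simp: indicator_def fun_eq_iff)
  ultimately show ?thesis by simp
qed

text \<open>Fubini over horizontal lines. On a line whose height avoids the finite set
  \<open>Z\<close>, the function is piecewise affine with kinks at the crossings, and the
  one-dimensional pairing collects these kinks; integrating over heights turns crossings into edge
  integrals.\<close>

lemma slice_integral:
  fixes F :: "plane \<Rightarrow> real"
  assumes sm: "smooth1 b" and z: "\<And>x. r \<le> \<bar>x\<bar> \<Longrightarrow> b x = 0" and r: "0 < r"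
    and fin: "finite E" and cont: "continuous_on UNIV F" and finZ: "finite Z"
    and loc: "\<And>x s. x \<in> {\<alpha>-r..\<alpha>+r} \<Longrightarrow> s \<in> {\<gamma>-r..\<gamma>+r} \<Longrightarrow> s \<notin> Z \<Longrightarrow>
        \<exists>\<delta>>0. \<exists>k1 k2. (\<forall>t\<in>{x-\<delta><..x}. F (t, s) = F (x, s) + k1 * (t - x)) \<and>
        (\<forall>t\<in>{x..<x+\<delta>}. F (t, s) = F (x, s) + k2 * (t - x)) \<and>
        k2 - k1 = (\<Sum>e\<in>{e\<in>{e\<in>E. crosses e s}. crossing_at e s = x}. J e)"
  shows "(\<integral>x. F x * (deriv (deriv b) (fst x - \<alpha>) * b (snd x - \<gamma>)) \<partial>lborel)
    = (\<Sum>e\<in>E. J e * (\<bar>snd (snd e) - snd (fst e)\<bar> *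
        integral {0..1} (\<lambda>t. b (fst (fst e + t *\<^sub>R (snd e - fst e)) - \<alpha>) * b (snd (fst e + t *\<^sub>R (snd e - fst e)) - \<gamma>))))"
proof -
  let ?b2 = "deriv (deriv b)"
  let ?\<psi> = "\<lambda>x :: plane. b (fst x - \<alpha>) * b (snd x - \<gamma>)"
  let ?f = "\<lambda>x :: plane. F x * (?b2 (fst x - \<alpha>) * b (snd x - \<gamma>))"
  have cb: "continuous_on UNIV b" "continuous_on UNIV ?b2"
    using smooth1_continuous sm smooth1_deriv(2) by blast+
  have z1: "deriv b x = 0" if "r \<le> \<bar>x\<bar>" for x
    using deriv_zero_outside[OF smooth1_deriv(1)[OF sm] z that] .
  have z2: "?b2 x = 0" if "r \<le> \<bar>x\<bar>" for x
    using deriv_zero_outside[OF smooth1_deriv(1)[OF smooth1_deriv(2)[OF sm]] z1 that] .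
  have contf: "continuous_on UNIV ?f"
    by (intro continuous_intros cont continuous_on_compose2[OF cb(1)] continuous_on_compose2[OF cb(2)]) auto
  have intf: "integrable lborel ?f"
  proof (rule integrable_compact_support[OF contf])
    show "compact ({\<alpha>-r..\<alpha>+r} \<times> {\<gamma>-r..\<gamma>+r})" by (intro compact_Times) auto
    show "?f x = 0" if "x \<notin> {\<alpha>-r..\<alpha>+r} \<times> {\<gamma>-r..\<gamma>+r}" for x
    proof -
      have "r \<le> \<bar>fst x - \<alpha>\<bar> \<or> r \<le> \<bar>snd x - \<gamma>\<bar>" using that by (cases x) auto
      then show ?thesis using z z2 by auto
    qed
  qed
  have inner: "(\<integral>x. ?f (x, s) \<partial>lborel) = (\<Sum>e\<in>E. J e * (if crosses e s then ?\<psi> (crossing_at e s, s) else 0))"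
    if s: "s \<notin> Z" for s
  proof (cases "s \<in> {\<gamma>-r..\<gamma>+r}")
    case True
    have "((\<lambda>t. F (t, s) * ?b2 (t - \<alpha>)) has_integral
        (\<Sum>e\<in>{e\<in>E. crosses e s}. J e * b (crossing_at e s - \<alpha>))) {\<alpha>-r..\<alpha>+r}"
      by (rule integral_kinks[OF sm z r]) (use fin loc[OF _ True s] in auto)
    then have "((\<lambda>t. F (t, s) * ?b2 (t - \<alpha>)) has_integral
        (\<Sum>e\<in>{e\<in>E. crosses e s}. J e * b (crossing_at e s - \<alpha>))) UNIV"
      by (rule has_integral_on_superset) (auto intro!: z2)
    then have "((\<lambda>t. F (t, s) * ?b2 (t - \<alpha>) * b (s - \<gamma>)) has_integral
        (\<Sum>e\<in>{e\<in>E. crosses e s}. J e * b (crossing_at e s - \<alpha>)) * b (s - \<gamma>)) UNIV"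
      by (rule has_integral_mult_left)
    moreover have "((\<lambda>t. ?f (t, s)) has_integral (\<integral>x. ?f (x, s) \<partial>lborel)) UNIV"
    proof (rule has_integral_integral_lborel)
      have "continuous_on UNIV (\<lambda>t. ?f (t, s))"
        by (rule continuous_on_compose2[OF contf]) (auto intro: continuous_intros)
      then show "integrable lborel (\<lambda>t. ?f (t, s))"
        by (rule integrable_compact_support[of _ "{\<alpha>-r..\<alpha>+r}"]) (auto intro!: z2)
    qed
    ultimately have "(\<integral>x. ?f (x, s) \<partial>lborel) = (\<Sum>e\<in>{e\<in>E. crosses e s}. J e * b (crossing_at e s - \<alpha>)) * b (s - \<gamma>)"
      by (simp add: has_integral_iff mult.assoc)
    also have "\<dots> = (\<Sum>e\<in>{e\<in>E. crosses e s}. J e * ?\<psi> (crossing_at e s, s))"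
      by (simp add: sum_distrib_right mult.assoc)
    also have "\<dots> = (\<Sum>e\<in>E. J e * (if crosses e s then ?\<psi> (crossing_at e s, s) else 0))"
      using fin by (simp add: sum.inter_filter) (rule sum.cong, auto)
    finally show ?thesis .
  next
    case False
    then have "b (s - \<gamma>) = 0" by (intro z) auto
    then show ?thesis by (simp cong: if_cong)
  qed
  have "integrable (lborel \<Otimes>\<^sub>M lborel) (\<lambda>(x, y). ?f (x, y))"
    using intf by (simp add: lborel_prod case_prod_unfold)
  then have int_s: "integrable lborel (\<lambda>s. \<integral>x. ?f (x, s) \<partial>lborel)"
    and fub: "(\<integral>s. (\<integral>x. ?f (x, s) \<partial>lborel) \<partial>lborel) = (\<integral>x. ?f x \<partial>lborel)"
    using lborel_pair.integrable_snd[of "\<lambda>x y. ?f (x, y)"] lborel_pair.integral_snd[of "\<lambda>x y. ?f (x, y)"]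
    by (simp_all add: lborel_prod case_prod_unfold)
  have "continuous_on UNIV ?\<psi>"
    by (intro continuous_intros continuous_on_compose2[OF cb(1)]) auto
  then have "((\<lambda>s. \<Sum>e\<in>E. J e * (if crosses e s then ?\<psi> (crossing_at e s, s) else 0)) has_integral
      (\<Sum>e\<in>E. J e * (\<bar>snd (snd e) - snd (fst e)\<bar> * integral {0..1} (\<lambda>t. ?\<psi> (fst e + t *\<^sub>R (snd e - fst e)))))) UNIV"
    by (intro has_integral_sum fin has_integral_mult_right integral_along_edge)
  then have "((\<lambda>s. \<integral>x. ?f (x, s) \<partial>lborel) has_integral
      (\<Sum>e\<in>E. J e * (\<bar>snd (snd e) - snd (fst e)\<bar> * integral {0..1} (\<lambda>t. ?\<psi> (fst e + t *\<^sub>R (snd e - fst e)))))) UNIV"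
    by (rule has_integral_spike_finite[OF finZ, rotated]) (use inner in auto)
  moreover have "((\<lambda>s. \<integral>x. ?f (x, s) \<partial>lborel) has_integral (\<integral>s. (\<integral>x. ?f (x, s) \<partial>lborel) \<partial>lborel)) UNIV"
    using has_integral_integral_lborel[OF int_s] .
  ultimately show ?thesis using fub by (simp add: has_integral_iff)
qed

section \<open>Tropical polynomials\<close>

definition lin :: "lattice \<Rightarrow> plane \<Rightarrow> real" where
  "lin k x = of_int (fst k) * fst x + of_int (snd k) * snd x"

definition trop :: "lattice set \<Rightarrow> (lattice \<Rightarrow> real) \<Rightarrow> plane \<Rightarrow> real" where
  "trop A a x = Min ((\<lambda>k. lin k x + a k) ` A)"

lemma tropical_polynomial_trop:
  "tropical_polynomial F \<longleftrightarrow> (\<exists>A a. finite A \<and> A \<noteq> {} \<and> F = trop A a)"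
  by (simp add: tropical_polynomial_def trop_def[abs_def] lin_def)

context
  fixes A :: "lattice set" and a :: "lattice \<Rightarrow> real"
  assumes finA: "finite A" and neA: "A \<noteq> {}"
begin

lemma trop_le: "k \<in> A \<Longrightarrow> trop A a x \<le> lin k x + a k"
  unfolding trop_def using finA by (intro Min_le) auto

lemma trop_attained: "\<exists>k\<in>A. trop A a x = lin k x + a k"
proof -
  have "trop A a x \<in> (\<lambda>k. lin k x + a k) ` A"
    unfolding trop_def using finA neA by (intro Min_in) auto
  then show ?thesis by auto
qed

lemma trop_concave:
  assumes "0 \<le> t" "t \<le> 1"
  shows "(1 - t) * trop A a x + t * trop A a y \<le> trop A a ((1 - t) *\<^sub>R x + t *\<^sub>R y)"
proof -
  obtain k where k: "k \<in> A" "trop A a ((1 - t) *\<^sub>R x + t *\<^sub>R y) = lin k ((1 - t) *\<^sub>R x + t *\<^sub>R y) + a k"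
    using trop_attained by blast
  have "(1 - t) * trop A a x + t * trop A a y \<le> (1 - t) * (lin k x + a k) + t * (lin k y + a k)"
    using assms trop_le[OF k(1)] by (intro add_mono mult_left_mono) auto
  also have "\<dots> = lin k ((1 - t) *\<^sub>R x + t *\<^sub>R y) + a k"
    by (simp add: lin_def algebra_simps)
  finally show ?thesis using k(2) by simp
qed

definition slope_bound :: real where
  "slope_bound = 1 + (\<Sum>k\<in>A. \<bar>real_of_int (fst k)\<bar> + \<bar>real_of_int (snd k)\<bar>)"

lemma slope_le: "k \<in> A \<Longrightarrow> \<bar>real_of_int (fst k)\<bar> + \<bar>real_of_int (snd k)\<bar> \<le> slope_bound"
  unfolding slope_bound_def
  using member_le_sum[of k A "\<lambda>k. \<bar>real_of_int (fst k)\<bar> + \<bar>real_of_int (snd k)\<bar>"] finA by auto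

lemma slope_bound_pos: "0 < slope_bound"
  unfolding slope_bound_def by (intro add_pos_nonneg sum_nonneg) auto

lemma lin_diff:
  assumes "k \<in> A"
  shows "\<bar>lin k x - lin k y\<bar> \<le> slope_bound * dist x y"
proof -
  have "lin k x - lin k y = of_int (fst k) * (fst x - fst y) + of_int (snd k) * (snd x - snd y)"
    by (simp add: lin_def algebra_simps)
  then have "\<bar>lin k x - lin k y\<bar> \<le> \<bar>of_int (fst k)\<bar> * \<bar>fst x - fst y\<bar> + \<bar>of_int (snd k)\<bar> * \<bar>snd x - snd y\<bar>"
    by (metis abs_mult abs_triangle_ineq)
  also have "\<dots> \<le> \<bar>of_int (fst k)\<bar> * dist x y + \<bar>of_int (snd k)\<bar> * dist x y"
    using dist_fst_le[of x y] dist_snd_le[of x y]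
    by (intro add_mono mult_left_mono) (auto simp: dist_real_def)
  also have "\<dots> = (\<bar>of_int (fst k)\<bar> + \<bar>of_int (snd k)\<bar>) * dist x y" by (simp add: algebra_simps)
  also have "\<dots> \<le> slope_bound * dist x y" using slope_le[OF assms] by (intro mult_right_mono) auto
  finally show ?thesis .
qed

lemma trop_lipschitz: "\<bar>trop A a x - trop A a y\<bar> \<le> slope_bound * dist x y"
proof -
  have "trop A a x - trop A a y \<le> slope_bound * dist x y" for x y
  proof -
    obtain k where k: "k \<in> A" "trop A a y = lin k y + a k" using trop_attained by blast
    show ?thesis using trop_le[OF k(1), of x] k(2) lin_diff[OF k(1), of x y] by linarith
  qed
  from this[of x y] this[of y x] show ?thesis by (simp add: dist_commute abs_le_iff)
qed

lemma trop_continuous: "continuous_on S (trop A a)"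
proof (rule continuous_on_subset[of UNIV])
  have "slope_bound-lipschitz_on UNIV (trop A a)"
    by (rule lipschitz_onI) (use trop_lipschitz slope_bound_pos in \<open>auto simp: dist_real_def\<close>)
  then show "continuous_on UNIV (trop A a)" by (rule lipschitz_on_continuous_on)
qed simp

text \<open>If a single monomial attained the minimum at \<open>x\<close>, finitely many strict
  inequalities would persist nearby and the polynomial would be affine around
  \<open>x\<close>.\<close>

lemma corner_two_monomials:
  assumes "x \<in> corner_locus (trop A a)"
  shows "\<exists>k1\<in>A. \<exists>k2\<in>A. k1 \<noteq> k2 \<and> trop A a x = lin k1 x + a k1 \<and> trop A a x = lin k2 x + a k2"
proof (rule ccontr)
  assume no: "\<not> ?thesis"
  obtain k where k: "k \<in> A" "trop A a x = lin k x + a k" using trop_attained by blast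
  have strict: "lin k x + a k < lin j x + a j" if "j \<in> A" "j \<noteq> k" for j
    using no k trop_le[OF that(1), of x] that by force
  define U where "U = (\<Inter>j\<in>A - {k}. {y. lin k y + a k < lin j y + a j})"
  have "open U" unfolding U_def
    using finA by (intro open_INT ballI open_Collect_less) (auto simp: lin_def intro!: continuous_intros)
  moreover have "x \<in> U" using strict by (auto simp: U_def)
  moreover have "trop A a y = (of_int (fst k), of_int (snd k)) \<bullet> y + a k" if "y \<in> U" for y
  proof -
    obtain j where j: "j \<in> A" "trop A a y = lin j y + a j" using trop_attained by blast
    have "j = k"
    proof (rule ccontr)
      assume "j \<noteq> k"
      then have "lin k y + a k < lin j y + a j" using that j(1) by (auto simp: U_def)
      then show False using trop_le[OF k(1), of y] j(2) by simp
    qed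
    then show ?thesis using j(2) by (simp add: lin_def inner_prod_def)
  qed
  ultimately have "x \<notin> corner_locus (trop A a)" unfolding corner_locus_def by blast
  then show False using assms by simp
qed

end

section \<open>Primitive vectors and gradient jumps across an edge\<close>

lemma primitive_parallel:
  fixes a b c d :: int
  assumes "coprime a b" "coprime c d" "a * d = b * c"
  shows "(c = a \<and> d = b) \<or> (c = - a \<and> d = - b)"
proof -
  have "a dvd c" using assms by (metis coprime_dvd_mult_right_iff dvd_triv_left)
  moreover have "c dvd a" using assms by (metis coprime_dvd_mult_left_iff dvd_triv_right)
  ultimately have ac: "\<bar>a\<bar> = \<bar>c\<bar>" using zdvd_antisym_abs by blast
  have "b dvd d" using assms by (metis coprime_commute coprime_dvd_mult_right_iff dvd_triv_left)
  moreover have "d dvd b" using assms by (metis coprime_commute coprime_dvd_mult_left_iff dvd_triv_right)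
  ultimately have bd: "\<bar>b\<bar> = \<bar>d\<bar>" using zdvd_antisym_abs by blast
  have "c = a \<or> c = - a" "d = b \<or> d = - b" using ac bd by auto
  then show ?thesis using assms(3) by auto
qed

lemma primitive_vector_eq:
  assumes "primitive l" "t > 0" "u = t *\<^sub>R of_lattice l"
  shows "primitive_vector u = of_lattice l"
proof -
  have "(THE l. primitive l \<and> (\<exists>t>0. u = t *\<^sub>R of_lattice l)) = l"
  proof (rule the_equality)
    show "primitive l \<and> (\<exists>t>0. u = t *\<^sub>R of_lattice l)" using assms by blast
    fix k assume "primitive k \<and> (\<exists>t>0. u = t *\<^sub>R of_lattice k)"
    then obtain s where k: "primitive k" "s > 0" "u = s *\<^sub>R of_lattice k" by blast
    have e: "t * real_of_int (fst l) = s * real_of_int (fst k)" "t * real_of_int (snd l) = s * real_of_int (snd k)"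
      using k(3) assms(3) by (auto simp: of_lattice_def)
    have "(t * real_of_int (fst l)) * (s * real_of_int (snd k)) = (s * real_of_int (fst k)) * (t * real_of_int (snd l))"
      by (simp only: e)
    then have "(t * s) * (real_of_int (fst l) * real_of_int (snd k)) = (t * s) * (real_of_int (snd l) * real_of_int (fst k))"
      by (simp only: mult_ac)
    then have "real_of_int (fst l * snd k) = real_of_int (snd l * fst k)" using k(2) assms(2) by simp
    then have "fst l * snd k = snd l * fst k" by (simp only: of_int_eq_iff)
    then have "(fst k = fst l \<and> snd k = snd l) \<or> (fst k = - fst l \<and> snd k = - snd l)"
      using assms(1) k(1) primitive_parallel[of "fst l" "snd l" "fst k" "snd k"] by (simp add: primitive_def)
    then show "k = l"
    proof
      assume n: "fst k = - fst l \<and> snd k = - snd l"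
      then have "(t + s) * real_of_int (fst l) = 0" "(t + s) * real_of_int (snd l) = 0"
        using e by (auto simp: algebra_simps)
      then have "fst l = 0" "snd l = 0" using assms(2) k(2) by auto
      then show "k = l" using n by (simp add: prod_eq_iff)
    qed (simp add: prod_eq_iff)
  qed
  then show ?thesis by (simp add: primitive_vector_def)
qed

definition edge_vec :: "edge \<Rightarrow> plane" where
  "edge_vec e = snd e - fst e"

lemma side_of_edge_inner: "side_of_edge e y = (- snd (edge_vec e), fst (edge_vec e)) \<bullet> (y - fst e)"
  by (simp add: side_of_edge_def edge_vec_def inner_prod_def algebra_simps)

text \<open>Continuity makes the gradient jump orthogonal to the edge, primitivity fixes its length,
  and concavity its sign.\<close>

lemma gradient_jump:
  assumes cont: "continuous_on UNIV F" and conc: "\<And>x w. F (x + w) + F (x - w) \<le> 2 * F x"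
    and rat: "rational_direction (snd e - fst e)" and tw: "tropical_weight F e m"
    and z: "z \<in> open_segment (fst e) (snd e)"
  shows "\<exists>\<delta>>0. \<exists>g1 g2. (\<forall>y\<in>ball z \<delta>. side_of_edge e y \<ge> 0 \<longrightarrow> F y = F z + g1 \<bullet> (y - z)) \<and>
      (\<forall>y\<in>ball z \<delta>. side_of_edge e y \<le> 0 \<longrightarrow> F y = F z + g2 \<bullet> (y - z)) \<and>
      g1 - g2 = (real m * edge_norm e / norm (edge_vec e)) *\<^sub>R (snd (edge_vec e), - fst (edge_vec e))"
proof -
  define \<Delta> where "\<Delta> = edge_vec e"
  define \<nu> where "\<nu> = (- snd \<Delta>, fst \<Delta>)"
  have side: "side_of_edge e y = \<nu> \<bullet> (y - fst e)" for y
    by (simp add: side_of_edge_inner \<nu>_def \<Delta>_def)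
  obtain l0 t where l0: "primitive l0" "t > 0" "\<Delta> = t *\<^sub>R of_lattice l0"
    using rat by (auto simp: rational_direction_def \<Delta>_def edge_vec_def)
  have l0n: "of_lattice l0 \<noteq> 0"
    using l0(1) by (auto simp: of_lattice_def primitive_def zero_prod_def)
  have \<nu>\<nu>: "\<nu> \<bullet> \<nu> = \<Delta> \<bullet> \<Delta>" by (simp add: \<nu>_def inner_prod_def)
  have \<Delta>0: "\<Delta> \<noteq> 0" using l0 l0n by simp
  then have \<nu>pos: "\<nu> \<bullet> \<nu> > 0" using \<nu>\<nu> by simp
  obtain U g1 g2 c1 c2 l where U: "open U" "z \<in> U" "\<And>y. y \<in> U \<Longrightarrow> side_of_edge e y > 0 \<Longrightarrow> F y = g1 \<bullet> y + c1"
    "\<And>y. y \<in> U \<Longrightarrow> side_of_edge e y < 0 \<Longrightarrow> F y = g2 \<bullet> y + c2"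
    and l: "primitive l" "g1 - g2 = real m *\<^sub>R of_lattice l" and m: "0 < m"
    using tw z unfolding tropical_weight_def by blast
  obtain \<delta> where \<delta>: "\<delta> > 0" "ball z \<delta> \<subseteq> U" using U(1,2) open_contains_ball by blast
  \<comment> \<open>The weight condition gives the affine formulas only strictly on either side of
    the edge. A point of the edge is approached along the normal, on the side chosen by the sign of
    \<sigma>, and continuity carries the formula over.\<close>
  have closure: "F y = g \<bullet> y + c"
    if y: "y \<in> U" "0 \<le> \<sigma> * side_of_edge e y" and \<sigma>: "\<sigma> \<noteq> 0"
      and g: "\<And>y. y \<in> U \<Longrightarrow> 0 < \<sigma> * side_of_edge e y \<Longrightarrow> F y = g \<bullet> y + c" for y g c \<sigma>
  proof -
    have "((\<lambda>t. y + (t * \<sigma>) *\<^sub>R \<nu>) \<longlongrightarrow> y + (0 * \<sigma>) *\<^sub>R \<nu>) (at_right 0)"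
      by (intro tendsto_intros)
    then have lim: "((\<lambda>t. y + (t * \<sigma>) *\<^sub>R \<nu>) \<longlongrightarrow> y) (at_right 0)" by simp
    have "isCont F y" using cont continuous_on_eq_continuous_at[OF open_UNIV] by blast
    then have lim2: "((\<lambda>t. F (y + (t * \<sigma>) *\<^sub>R \<nu>) - (g \<bullet> (y + (t * \<sigma>) *\<^sub>R \<nu>) + c)) \<longlongrightarrow> F y - (g \<bullet> y + c)) (at_right 0)"
      using lim by (intro tendsto_intros isCont_tendsto_compose[of y F])
    have ev: "\<forall>\<^sub>F t in at_right 0. F (y + (t * \<sigma>) *\<^sub>R \<nu>) - (g \<bullet> (y + (t * \<sigma>) *\<^sub>R \<nu>) + c) = 0"
    proof -
      have "\<forall>\<^sub>F t in at_right 0. y + (t * \<sigma>) *\<^sub>R \<nu> \<in> U"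
        using topological_tendstoD[OF lim U(1) y(1)] .
      moreover have "\<forall>\<^sub>F t in at_right (0::real). t > 0" by (simp add: eventually_at_right_less)
      ultimately show ?thesis
      proof eventually_elim
        case (elim t)
        have "\<sigma> * side_of_edge e (y + (t * \<sigma>) *\<^sub>R \<nu>) = \<sigma> * side_of_edge e y + t * (\<sigma> * \<sigma>) * (\<nu> \<bullet> \<nu>)"
          by (simp add: side inner_add_right inner_diff_right algebra_simps)
        also have "\<dots> > 0"
        proof -
          have "0 < \<sigma> * \<sigma>" using \<sigma> not_real_square_gt_zero by blast
          from mult_pos_pos[OF mult_pos_pos[OF elim(2) this] \<nu>pos] y(2) show ?thesis by linarith
        qed
        finally show ?case using g[OF elim(1)] by simp
      qed
    qed
    have "F y - (g \<bullet> y + c) = 0"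
      by (rule tendsto_unique[OF trivial_limit_at_right_real lim2 tendsto_eventually[OF ev]])
    then show ?thesis by simp
  qed
  have pos: "F y = g1 \<bullet> y + c1" if "y \<in> U" "side_of_edge e y \<ge> 0" for y
    using closure[of y 1 g1 c1] U(3) that by simp
  have neg: "F y = g2 \<bullet> y + c2" if "y \<in> U" "side_of_edge e y \<le> 0" for y
    using closure[of y "-1" g2 c2] U(4) that by simp
  obtain \<tau> where \<tau>: "z = (1 - \<tau>) *\<^sub>R fst e + \<tau> *\<^sub>R snd e" using z by (auto simp: in_segment)
  have sz: "side_of_edge e (z + w) = \<nu> \<bullet> w" for w
  proof -
    have "z - fst e = \<tau> *\<^sub>R \<Delta>" by (simp add: \<tau> \<Delta>_def edge_vec_def algebra_simps)
    then have e1: "z + w - fst e = \<tau> *\<^sub>R \<Delta> + w" by (metis add_diff_eq add.commute diff_add_eq)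
    have "\<nu> \<bullet> \<Delta> = 0" by (simp add: \<nu>_def inner_prod_def)
    then show ?thesis unfolding side e1 by (simp add: inner_add_right)
  qed
  have Fz: "F z = g1 \<bullet> z + c1" "F z = g2 \<bullet> z + c2"
    using pos[of z] neg[of z] sz[of 0] U(2) by auto
  have small: "\<exists>s>0. z + s *\<^sub>R w \<in> U \<and> z - s *\<^sub>R w \<in> U" for w
  proof -
    define s where "s = \<delta> / (2 * (norm w + 1))"
    have np: "0 < 2 * (norm w + 1)" by (simp add: add_nonneg_pos)
    have s: "s > 0" unfolding s_def using \<delta>(1) np by simp
    have "s * norm w = \<delta> * (norm w / (2 * (norm w + 1)))" by (simp add: s_def)
    also have "\<dots> < \<delta> * 1"
    proof (rule mult_strict_left_mono)
      have "norm w < 2 * (norm w + 1)" by (smt (verit) norm_ge_zero)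
      then show "norm w / (2 * (norm w + 1)) < 1" using np by (simp only: divide_less_eq_1_pos)
    qed (rule \<delta>(1))
    finally have "s * norm w < \<delta>" by simp
    then have "z + s *\<^sub>R w \<in> ball z \<delta>" "z - s *\<^sub>R w \<in> ball z \<delta>" using s by (auto simp: dist_norm)
    then show ?thesis using s \<delta>(2) by blast
  qed
  obtain s1 where s1: "s1 > 0" "z + s1 *\<^sub>R \<Delta> \<in> U" using small by blast
  have "side_of_edge e (z + s1 *\<^sub>R \<Delta>) = 0" unfolding sz by (simp add: \<nu>_def inner_prod_def)
  then have "g1 \<bullet> (z + s1 *\<^sub>R \<Delta>) + c1 = g2 \<bullet> (z + s1 *\<^sub>R \<Delta>) + c2"
    using pos[OF s1(2)] neg[OF s1(2)] by simp
  then have "s1 * (g1 \<bullet> \<Delta>) - s1 * (g2 \<bullet> \<Delta>) = 0"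
    using Fz unfolding inner_add_right inner_scaleR_right by linarith
  then have "s1 * ((g1 - g2) \<bullet> \<Delta>) = 0" by (simp add: inner_diff_left algebra_simps)
  then have "of_lattice l \<bullet> of_lattice l0 = 0" using s1(1) l(2) l0 m by simp
  then have "real_of_int (fst l0 * fst l) = real_of_int (snd l0 * (- snd l))"
    by (simp add: of_lattice_def inner_prod_def algebra_simps)
  then have "fst l0 * fst l = snd l0 * (- snd l)" by (simp only: of_int_eq_iff)
  then have ll: "(- snd l = fst l0 \<and> fst l = snd l0) \<or> (- snd l = - fst l0 \<and> fst l = - snd l0)"
    using primitive_parallel[of "fst l0" "snd l0" "- snd l" "fst l"] l(1) l0(1)
    by (auto simp: primitive_def coprime_commute)
  obtain s2 where s2: "s2 > 0" "z + s2 *\<^sub>R \<nu> \<in> U" "z - s2 *\<^sub>R \<nu> \<in> U" using small by blast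
  have "side_of_edge e (z + s2 *\<^sub>R \<nu>) \<ge> 0" "side_of_edge e (z - s2 *\<^sub>R \<nu>) \<le> 0"
    using s2(1) \<nu>pos sz[of "s2 *\<^sub>R \<nu>"] sz[of "- s2 *\<^sub>R \<nu>"] by auto
  then have "F (z + s2 *\<^sub>R \<nu>) = g1 \<bullet> (z + s2 *\<^sub>R \<nu>) + c1" "F (z - s2 *\<^sub>R \<nu>) = g2 \<bullet> (z - s2 *\<^sub>R \<nu>) + c2"
    using pos neg s2 by auto
  then have "s2 * (g1 \<bullet> \<nu>) - s2 * (g2 \<bullet> \<nu>) \<le> 0"
    using conc[of z "s2 *\<^sub>R \<nu>"] Fz unfolding inner_add_right inner_diff_right inner_scaleR_right by linarith
  then have "s2 * ((g1 - g2) \<bullet> \<nu>) \<le> 0" by (simp add: inner_diff_left algebra_simps)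
  then have "(g1 - g2) \<bullet> \<nu> \<le> 0" using s2(1) by (simp add: mult_le_0_iff)
  then have sgn: "of_lattice l \<bullet> \<nu> \<le> 0" using l(2) m by (simp add: mult_le_0_iff)
  have "fst l = snd l0 \<and> snd l = - fst l0"
  proof (rule ccontr)
    assume "\<not> ?thesis"
    then have "fst l = - snd l0" "snd l = fst l0" using ll by auto
    then have "of_lattice l \<bullet> \<nu> = t * (of_lattice l0 \<bullet> of_lattice l0)"
      by (simp add: \<nu>_def l0(3) of_lattice_def inner_prod_def algebra_simps)
    moreover have "\<dots> > 0" using l0(2) l0n by simp
    ultimately show False using sgn by simp
  qed
  then have "t *\<^sub>R of_lattice l = (snd \<Delta>, - fst \<Delta>)" by (simp add: l0(3) of_lattice_def)
  then have l': "of_lattice l = (1 / t) *\<^sub>R (snd \<Delta>, - fst \<Delta>)" using l0(2)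
    by (metis divide_self_if less_irrefl scaleR_one scaleR_scaleR times_divide_eq_left mult_1)
  have "edge_norm e = norm (of_lattice l0)"
    using primitive_vector_eq[OF l0] by (simp add: edge_norm_def \<Delta>_def edge_vec_def)
  then have "edge_norm e / norm \<Delta> = 1 / t" using l0 l0n by simp
  then have "g1 - g2 = (real m * edge_norm e / norm \<Delta>) *\<^sub>R (snd \<Delta>, - fst \<Delta>)"
    unfolding l(2) l' by (metis scaleR_scaleR times_divide_eq_right)
  moreover have "\<forall>y\<in>ball z \<delta>. side_of_edge e y \<ge> 0 \<longrightarrow> F y = F z + g1 \<bullet> (y - z)"
    using pos Fz(1) \<delta>(2) by (auto simp: inner_diff_right)
  moreover have "\<forall>y\<in>ball z \<delta>. side_of_edge e y \<le> 0 \<longrightarrow> F y = F z + g2 \<bullet> (y - z)"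
    using neg Fz(2) \<delta>(2) by (auto simp: inner_diff_right)
  ultimately show ?thesis using \<delta>(1) unfolding \<Delta>_def by blast
qed

definition cross2 :: "plane \<Rightarrow> plane \<Rightarrow> real" where
  "cross2 u v = fst u * snd v - snd u * fst v"

text \<open>Normalised so that the gradient jump across \<open>e\<close> is \<open>jump m e\<close>
  times the edge vector turned by a right angle, whatever the length of the edge.\<close>

definition jump :: "(edge \<Rightarrow> nat) \<Rightarrow> edge \<Rightarrow> real" where
  "jump m e = real (m e) * edge_norm e / norm (edge_vec e)"

definition swap_edge :: "edge \<Rightarrow> edge" where
  "swap_edge e = (prod.swap (fst e), prod.swap (snd e))"

lemma swap_edge_swap_edge [simp]: "swap_edge (swap_edge e) = e"
  by (simp add: swap_edge_def)

lemma inj_swap_edge: "inj_on swap_edge S"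
  by (metis inj_on_inverseI swap_edge_swap_edge)

lemma swap_in_segment: "(x, s) \<in> closed_segment (prod.swap p) (prod.swap q) \<longleftrightarrow> (s, x) \<in> closed_segment p q"
  by (cases p; cases q) (auto simp: in_segment)

lemma integral_lborel_swap:
  fixes f :: "plane \<Rightarrow> real"
  assumes "f \<in> borel_measurable borel"
  shows "(\<integral>x. f (prod.swap x) \<partial>lborel) = (\<integral>x. f x \<partial>lborel)"
proof -
  have "f \<in> borel_measurable (lborel \<Otimes>\<^sub>M lborel)" using assms by (simp add: lborel_prod)
  from lborel_pair.integral_product_swap[OF this]
  show ?thesis by (simp add: lborel_prod case_prod_unfold prod.swap_def)
qed

section \<open>The distributional Laplacian of a tropical polynomial\<close>

context
  fixes \<Omega> V :: "plane set" and E :: "edge set" and m :: "edge \<Rightarrow> nat" and A a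
  assumes graph: "rational_planar_graph V E" and finA: "finite A" and neA: "A \<noteq> {}"
    and corner: "corner_locus (trop A a) \<inter> \<Omega> = graph_support V E"
    and weights: "\<And>e. e \<in> E \<Longrightarrow> tropical_weight (trop A a) e (m e)"
begin

lemma finite_edges: "finite E"
  using graph unfolding rational_planar_graph_def by (meson finite_SigmaI finite_subset)

lemma edge_ends: "e \<in> E \<Longrightarrow> fst e \<in> V" "e \<in> E \<Longrightarrow> snd e \<in> V"
  using graph by (auto simp: rational_planar_graph_def mem_Times_iff dest!: subsetD)

lemma trop_midpoint: "trop A a (x + w) + trop A a (x - w) \<le> 2 * trop A a x"
proof -
  have "(1 - 1 / 2) * trop A a (x + w) + 1 / 2 * trop A a (x - w)
      \<le> trop A a ((1 - 1 / 2) *\<^sub>R (x + w) + (1 / 2) *\<^sub>R (x - w))"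
    by (rule trop_concave[OF finA neA]) auto
  also have "(1 - 1 / 2) *\<^sub>R (x + w) + (1 / 2) *\<^sub>R (x - w) = x"
    by (simp add: prod_eq_iff field_simps)
  finally show ?thesis by simp
qed

text \<open>Off the curve the polynomial is locally affine and the sum is empty. On the curve, a
  point that is not a vertex lies on exactly one edge, and pairing the gradient jump with
  \<open>u\<close> gives a cross product. The slope decreases in whichever direction the edge is
  crossed, hence the absolute value.\<close>

lemma directional_slopes:
  assumes z: "z \<in> \<Omega>" "z \<notin> V" and u: "norm u = 1"
    and transversal: "\<And>e. e \<in> E \<Longrightarrow> z \<in> edge_segment e \<Longrightarrow> cross2 (edge_vec e) u \<noteq> 0"
  shows "\<exists>\<delta>>0. \<exists>k1 k2. (\<forall>t\<in>{-\<delta><..0}. trop A a (z + t *\<^sub>R u) = trop A a z + k1 * t) \<and>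
      (\<forall>t\<in>{0..<\<delta>}. trop A a (z + t *\<^sub>R u) = trop A a z + k2 * t) \<and>
      k2 - k1 = (\<Sum>e\<in>{e\<in>E. z \<in> edge_segment e}. - (jump m e * \<bar>cross2 (edge_vec e) u\<bar>))"
proof (cases "z \<in> graph_support V E")
  case False
  then have "z \<notin> corner_locus (trop A a)" using corner z(1) by blast
  then obtain U g c where U: "open U" "z \<in> U" "\<forall>y\<in>U. trop A a y = g \<bullet> y + c"
    by (auto simp: corner_locus_def)
  then obtain \<delta> where \<delta>: "\<delta> > 0" "ball z \<delta> \<subseteq> U" using open_contains_ball by blast
  have *: "trop A a (z + t *\<^sub>R u) = trop A a z + (g \<bullet> u) * t" if "\<bar>t\<bar> < \<delta>" for t
  proof -
    have "z + t *\<^sub>R u \<in> U" using that u \<delta>(2) by (auto simp: dist_norm)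
    then show ?thesis using U(2,3) by (simp add: inner_add_right)
  qed
  have emp: "{e\<in>E. z \<in> edge_segment e} = {}" using False by (auto simp: graph_support_def)
  have "g \<bullet> u - g \<bullet> u = (\<Sum>e\<in>{e\<in>E. z \<in> edge_segment e}. - (jump m e * \<bar>cross2 (edge_vec e) u\<bar>))"
    unfolding emp by simp
  moreover have "\<forall>t\<in>{-\<delta><..0}. trop A a (z + t *\<^sub>R u) = trop A a z + (g \<bullet> u) * t"
    "\<forall>t\<in>{0..<\<delta>}. trop A a (z + t *\<^sub>R u) = trop A a z + (g \<bullet> u) * t" using * by auto
  ultimately show ?thesis using \<delta>(1) by blast
next
  case True
  then obtain e where e: "e \<in> E" "z \<in> edge_segment e" using z(2) by (auto simp: graph_support_def)
  have eV: "fst e \<in> V" "snd e \<in> V" using graph e(1) by (auto simp: rational_planar_graph_def)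
  have "z \<noteq> fst e" "z \<noteq> snd e" using z(2) eV by auto
  then have op: "z \<in> open_segment (fst e) (snd e)" using e(2) by (simp add: edge_segment_def open_segment_def)
  have single: "{e\<in>E. z \<in> edge_segment e} = {e}"
  proof -
    have "e' = e" if "e' \<in> E" "z \<in> edge_segment e'" for e'
    proof (rule ccontr)
      assume "e' \<noteq> e"
      then have "edge_segment e' \<inter> edge_segment e \<subseteq> {fst e', snd e'} \<inter> {fst e, snd e}"
        using graph that(1) e(1) by (auto simp: rational_planar_graph_def)
      then show False using that(2) e(2) \<open>z \<noteq> fst e\<close> \<open>z \<noteq> snd e\<close> by blast
    qed
    then show ?thesis using e by blast
  qed
  have rat: "rational_direction (snd e - fst e)" using graph e(1) by (auto simp: rational_planar_graph_def)
  obtain \<delta> g1 g2 where \<delta>: "\<delta> > 0"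
    and g1: "\<And>y. y \<in> ball z \<delta> \<Longrightarrow> side_of_edge e y \<ge> 0 \<Longrightarrow> trop A a y = trop A a z + g1 \<bullet> (y - z)"
    and g2: "\<And>y. y \<in> ball z \<delta> \<Longrightarrow> side_of_edge e y \<le> 0 \<Longrightarrow> trop A a y = trop A a z + g2 \<bullet> (y - z)"
    and gg: "g1 - g2 = jump m e *\<^sub>R (snd (edge_vec e), - fst (edge_vec e))"
    using gradient_jump[OF trop_continuous[OF finA neA] trop_midpoint rat weights[OF e(1)] op]
    unfolding jump_def by blast
  have gu: "(g1 - g2) \<bullet> u = - (jump m e * cross2 (edge_vec e) u)"
    unfolding gg by (simp add: inner_prod_def cross2_def algebra_simps)
  obtain \<tau> where \<tau>: "z = (1 - \<tau>) *\<^sub>R fst e + \<tau> *\<^sub>R snd e" using op by (auto simp: in_segment)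
  have side: "side_of_edge e (z + t *\<^sub>R u) = t * cross2 (edge_vec e) u" for t
    by (simp add: side_of_edge_def \<tau> cross2_def edge_vec_def algebra_simps)
  have inb: "z + t *\<^sub>R u \<in> ball z \<delta>" if "\<bar>t\<bar> < \<delta>" for t using that u by (simp add: dist_norm)
  show ?thesis
  proof (cases "cross2 (edge_vec e) u > 0")
    case True
    have "trop A a (z + t *\<^sub>R u) = trop A a z + (g2 \<bullet> u) * t" if "t \<in> {-\<delta><..0}" for t
      using g2[OF inb[of t]] side[of t] that True by (auto simp: mult_le_0_iff)
    moreover have "trop A a (z + t *\<^sub>R u) = trop A a z + (g1 \<bullet> u) * t" if "t \<in> {0..<\<delta>}" for t
      using g1[OF inb[of t]] side[of t] that True by auto
    moreover have "g1 \<bullet> u - g2 \<bullet> u = - (jump m e * \<bar>cross2 (edge_vec e) u\<bar>)"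
      using gu True by (simp add: inner_diff_left)
    moreover have "g1 \<bullet> u - g2 \<bullet> u = (\<Sum>e\<in>{e}. - (jump m e * \<bar>cross2 (edge_vec e) u\<bar>))"
      using calculation(3) by simp
    ultimately show ?thesis unfolding single using \<delta> by blast
  next
    case False
    then have neg: "cross2 (edge_vec e) u < 0" using transversal[OF e] by simp
    have "trop A a (z + t *\<^sub>R u) = trop A a z + (g1 \<bullet> u) * t" if "t \<in> {-\<delta><..0}" for t
      using g1[OF inb[of t]] side[of t] that neg by (auto simp: zero_le_mult_iff)
    moreover have "trop A a (z + t *\<^sub>R u) = trop A a z + (g2 \<bullet> u) * t" if "t \<in> {0..<\<delta>}" for t
      using g2[OF inb[of t]] side[of t] that neg by (auto simp: mult_le_0_iff)
    moreover have "g2 \<bullet> u - g1 \<bullet> u = - (jump m e * \<bar>cross2 (edge_vec e) u\<bar>)"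
      using gu neg by (simp add: inner_diff_left)
    moreover have "g2 \<bullet> u - g1 \<bullet> u = (\<Sum>e\<in>{e}. - (jump m e * \<bar>cross2 (edge_vec e) u\<bar>))"
      using calculation(3) by simp
    ultimately show ?thesis unfolding single using \<delta> by blast
  qed
qed

lemma crossing_iff_segment:
  assumes "s \<noteq> snd (fst e)" "s \<noteq> snd (snd e)"
  shows "(crosses e s \<and> crossing_at e s = x) \<longleftrightarrow> (x, s) \<in> closed_segment (fst e) (snd e)"
proof
  assume c: "crosses e s \<and> crossing_at e s = x"
  define \<tau> where "\<tau> = (s - snd (fst e)) / (snd (snd e) - snd (fst e))"
  have "0 \<le> \<tau>" "\<tau> \<le> 1" "snd (snd e) \<noteq> snd (fst e)" using c by (auto simp: \<tau>_def crosses_def field_simps)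
  moreover have "(x, s) = (1 - \<tau>) *\<^sub>R fst e + \<tau> *\<^sub>R snd e"
    using c \<open>snd (snd e) \<noteq> snd (fst e)\<close> unfolding crossing_at_def \<tau>_def[symmetric]
    by (auto simp: prod_eq_iff algebra_simps) (simp add: \<tau>_def field_simps)
  ultimately show "(x, s) \<in> closed_segment (fst e) (snd e)" by (auto simp: in_segment)
next
  assume "(x, s) \<in> closed_segment (fst e) (snd e)"
  then obtain \<tau> where \<tau>: "0 \<le> \<tau>" "\<tau> \<le> 1" "(x, s) = (1 - \<tau>) *\<^sub>R fst e + \<tau> *\<^sub>R snd e"
    by (auto simp: in_segment)
  have x: "x = fst (fst e) + \<tau> * (fst (snd e) - fst (fst e))" and s: "s = snd (fst e) + \<tau> * (snd (snd e) - snd (fst e))"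
    using arg_cong[OF \<tau>(3), of fst] arg_cong[OF \<tau>(3), of snd] by (auto simp: algebra_simps)
  have ne: "snd (snd e) \<noteq> snd (fst e)" "\<tau> \<noteq> 0" "\<tau> \<noteq> 1" using assms s by auto
  then have "0 < \<tau>" "\<tau> < 1" using \<tau> by auto
  then have "crosses e s"
  proof -
    define d where "d = snd (snd e) - snd (fst e)"
    have "snd (snd e) = snd (fst e) + d" "s = snd (fst e) + \<tau> * d" using s by (simp_all add: d_def)
    moreover have "(0 < \<tau> * d \<and> \<tau> * d < d) \<or> (d < \<tau> * d \<and> \<tau> * d < 0)"
      using \<open>0 < \<tau>\<close> \<open>\<tau> < 1\<close> ne(1) by (cases "0 < d") (auto simp: d_def mult_less_0_iff mult_less_cancel_right1 mult_less_cancel_right2)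
    ultimately show ?thesis by (auto simp: crosses_def)
  qed
  moreover have "crossing_at e s = x" unfolding crossing_at_def s x using ne by simp
  ultimately show "crosses e s \<and> crossing_at e s = x" by simp
qed

text \<open>One factor \<open>snd (edge_vec e)\<close> is the change of slope along a horizontal
  line, the other is the Jacobian between edge parameter and height; together they give the
  square.\<close>

lemma trop_slice_x:
  assumes sm: "smooth1 b" and z: "\<And>x. r \<le> \<bar>x\<bar> \<Longrightarrow> b x = 0" and r: "0 < r"
    and square: "{\<alpha>-r..\<alpha>+r} \<times> {\<gamma>-r..\<gamma>+r} \<subseteq> \<Omega>"
  shows "(\<integral>x. trop A a x * (deriv (deriv b) (fst x - \<alpha>) * b (snd x - \<gamma>)) \<partial>lborel)
    = (\<Sum>e\<in>E. - (jump m e * (snd (edge_vec e))\<^sup>2) *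
        integral {0..1} (\<lambda>t. b (fst (fst e + t *\<^sub>R (snd e - fst e)) - \<alpha>) * b (snd (fst e + t *\<^sub>R (snd e - fst e)) - \<gamma>)))"
proof -
  let ?J = "\<lambda>e. - (jump m e * \<bar>snd (edge_vec e)\<bar>)"
  have "(\<integral>x. trop A a x * (deriv (deriv b) (fst x - \<alpha>) * b (snd x - \<gamma>)) \<partial>lborel)
    = (\<Sum>e\<in>E. ?J e * (\<bar>snd (snd e) - snd (fst e)\<bar> *
        integral {0..1} (\<lambda>t. b (fst (fst e + t *\<^sub>R (snd e - fst e)) - \<alpha>) * b (snd (fst e + t *\<^sub>R (snd e - fst e)) - \<gamma>))))"
  \<comment> \<open>At heights other than those of the vertices, every crossing is an interior point
    of an edge and transversal to it.\<close>
  proof (rule slice_integral[OF sm z r finite_edges trop_continuous[OF finA neA], of "snd ` V"])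
    show "finite (snd ` V)" using graph by (simp add: rational_planar_graph_def)
    fix x s assume xs: "x \<in> {\<alpha>-r..\<alpha>+r}" "s \<in> {\<gamma>-r..\<gamma>+r}" "s \<notin> snd ` V"
    define w where "w = (x, s)"
    have w: "w \<in> \<Omega>" "w \<notin> V" using xs square by (auto simp: w_def image_iff)
    have sne: "s \<noteq> snd (fst e)" "s \<noteq> snd (snd e)" if "e \<in> E" for e
      using edge_ends[OF that] xs(3) by auto
    have iff: "(crosses e s \<and> crossing_at e s = x) \<longleftrightarrow> w \<in> edge_segment e" if "e \<in> E" for e
      using crossing_iff_segment[OF sne[OF that]] by (simp add: w_def edge_segment_def)
    have "\<exists>\<delta>>0. \<exists>k1 k2. (\<forall>t\<in>{-\<delta><..0}. trop A a (w + t *\<^sub>R (1, 0)) = trop A a w + k1 * t) \<and>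
      (\<forall>t\<in>{0..<\<delta>}. trop A a (w + t *\<^sub>R (1, 0)) = trop A a w + k2 * t) \<and>
      k2 - k1 = (\<Sum>e\<in>{e\<in>E. w \<in> edge_segment e}. - (jump m e * \<bar>cross2 (edge_vec e) (1, 0)\<bar>))"
    proof (rule directional_slopes[OF w])
      show "cross2 (edge_vec e) (1, 0) \<noteq> 0" if "e \<in> E" "w \<in> edge_segment e" for e
        using iff[OF that(1)] that(2) by (auto simp: crosses_def cross2_def edge_vec_def)
    qed simp
    then obtain \<delta> k1 k2 where \<delta>: "\<delta> > 0"
      and k1: "\<And>t. t \<in> {-\<delta><..0} \<Longrightarrow> trop A a (w + t *\<^sub>R (1, 0)) = trop A a w + k1 * t"
      and k2: "\<And>t. t \<in> {0..<\<delta>} \<Longrightarrow> trop A a (w + t *\<^sub>R (1, 0)) = trop A a w + k2 * t"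
      and k: "k2 - k1 = (\<Sum>e\<in>{e\<in>E. w \<in> edge_segment e}. - (jump m e * \<bar>cross2 (edge_vec e) (1, 0)\<bar>))"
      by blast
    have "{e\<in>{e\<in>E. crosses e s}. crossing_at e s = x} = {e\<in>E. w \<in> edge_segment e}" using iff by blast
    then have "k2 - k1 = (\<Sum>e\<in>{e\<in>{e\<in>E. crosses e s}. crossing_at e s = x}. ?J e)"
      using k by (simp add: cross2_def)
    moreover have "\<forall>t\<in>{x-\<delta><..x}. trop A a (t, s) = trop A a (x, s) + k1 * (t - x)"
    proof
      fix t assume "t \<in> {x-\<delta><..x}"
      then show "trop A a (t, s) = trop A a (x, s) + k1 * (t - x)" using k1[of "t - x"] by (simp add: w_def)
    qed
    moreover have "\<forall>t\<in>{x..<x+\<delta>}. trop A a (t, s) = trop A a (x, s) + k2 * (t - x)"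
    proof
      fix t assume "t \<in> {x..<x+\<delta>}"
      then show "trop A a (t, s) = trop A a (x, s) + k2 * (t - x)" using k2[of "t - x"] by (simp add: w_def)
    qed
    ultimately show "\<exists>\<delta>>0. \<exists>k1 k2. (\<forall>t\<in>{x-\<delta><..x}. trop A a (t, s) = trop A a (x, s) + k1 * (t - x)) \<and>
        (\<forall>t\<in>{x..<x+\<delta>}. trop A a (t, s) = trop A a (x, s) + k2 * (t - x)) \<and>
        k2 - k1 = (\<Sum>e\<in>{e\<in>{e\<in>E. crosses e s}. crossing_at e s = x}. ?J e)"
      using \<delta> by blast
  qed
  also have "\<dots> = (\<Sum>e\<in>E. - (jump m e * (snd (edge_vec e))\<^sup>2) *
        integral {0..1} (\<lambda>t. b (fst (fst e + t *\<^sub>R (snd e - fst e)) - \<alpha>) * b (snd (fst e + t *\<^sub>R (snd e - fst e)) - \<gamma>)))"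
  proof (rule sum.cong[OF refl])
    fix e
    have "\<bar>snd (snd e) - snd (fst e)\<bar> = \<bar>snd (edge_vec e)\<bar>" by (simp add: edge_vec_def)
    moreover have "(snd (edge_vec e))\<^sup>2 = \<bar>snd (edge_vec e)\<bar> * \<bar>snd (edge_vec e)\<bar>" by (simp add: power2_eq_square)
    ultimately show "?J e * (\<bar>snd (snd e) - snd (fst e)\<bar> *
        integral {0..1} (\<lambda>t. b (fst (fst e + t *\<^sub>R (snd e - fst e)) - \<alpha>) * b (snd (fst e + t *\<^sub>R (snd e - fst e)) - \<gamma>)))
      = - (jump m e * (snd (edge_vec e))\<^sup>2) *
        integral {0..1} (\<lambda>t. b (fst (fst e + t *\<^sub>R (snd e - fst e)) - \<alpha>) * b (snd (fst e + t *\<^sub>R (snd e - fst e)) - \<gamma>))"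
      by simp
  qed
  finally show ?thesis .
qed

lemma trop_slice_y:
  assumes sm: "smooth1 b" and z: "\<And>x. r \<le> \<bar>x\<bar> \<Longrightarrow> b x = 0" and r: "0 < r"
    and square: "{\<alpha>-r..\<alpha>+r} \<times> {\<gamma>-r..\<gamma>+r} \<subseteq> \<Omega>"
  shows "(\<integral>x. trop A a x * (b (fst x - \<alpha>) * deriv (deriv b) (snd x - \<gamma>)) \<partial>lborel)
    = (\<Sum>e\<in>E. - (jump m e * (fst (edge_vec e))\<^sup>2) *
        integral {0..1} (\<lambda>t. b (fst (fst e + t *\<^sub>R (snd e - fst e)) - \<alpha>) * b (snd (fst e + t *\<^sub>R (snd e - fst e)) - \<gamma>)))"
proof -
  let ?J = "\<lambda>e. - (jump m (swap_edge e) * \<bar>fst (edge_vec (swap_edge e))\<bar>)"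
  let ?f = "\<lambda>x. trop A a x * (b (fst x - \<alpha>) * deriv (deriv b) (snd x - \<gamma>))"
  have cb: "continuous_on UNIV b" "continuous_on UNIV (deriv (deriv b))"
    using smooth1_continuous sm smooth1_deriv(2) by blast+
  have "continuous_on UNIV ?f"
    by (intro continuous_intros trop_continuous[OF finA neA] continuous_on_compose2[OF cb(1)] continuous_on_compose2[OF cb(2)]) auto
  \<comment> \<open>Exchanging the coordinates turns vertical slices into horizontal ones, with
    every edge replaced by its mirror image.\<close>
  then have "(\<integral>x. ?f x \<partial>lborel) = (\<integral>x. ?f (prod.swap x) \<partial>lborel)"
    by (intro integral_lborel_swap[symmetric] borel_measurable_continuous_onI)
  also have "\<dots> = (\<integral>x. (trop A a \<circ> prod.swap) x * (deriv (deriv b) (fst x - \<gamma>) * b (snd x - \<alpha>)) \<partial>lborel)"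
    by (simp add: mult.commute)
  also have "\<dots> = (\<Sum>e\<in>swap_edge ` E. ?J e * (\<bar>snd (snd e) - snd (fst e)\<bar> *
        integral {0..1} (\<lambda>t. b (fst (fst e + t *\<^sub>R (snd e - fst e)) - \<gamma>) * b (snd (fst e + t *\<^sub>R (snd e - fst e)) - \<alpha>))))"
  proof (rule slice_integral[OF sm z r, of _ _ "fst ` V"])
    show "finite (swap_edge ` E)" using finite_edges by simp
    show "finite (fst ` V)" using graph by (simp add: rational_planar_graph_def)
    show "continuous_on UNIV (trop A a \<circ> prod.swap)"
      by (intro continuous_on_compose trop_continuous[OF finA neA] continuous_on_swap)
    fix x s assume xs: "x \<in> {\<gamma>-r..\<gamma>+r}" "s \<in> {\<alpha>-r..\<alpha>+r}" "s \<notin> fst ` V"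
    define w where "w = (s, x)"
    have w: "w \<in> \<Omega>" "w \<notin> V" using xs square by (auto simp: w_def image_iff)
    have sne: "s \<noteq> snd (fst (swap_edge e))" "s \<noteq> snd (snd (swap_edge e))" if "e \<in> E" for e
      using edge_ends[OF that] xs(3) by (auto simp: swap_edge_def)
    have iff: "(crosses (swap_edge e) s \<and> crossing_at (swap_edge e) s = x) \<longleftrightarrow> w \<in> edge_segment e" if "e \<in> E" for e
      using crossing_iff_segment[OF sne[OF that]]
      by (simp add: w_def edge_segment_def swap_edge_def swap_in_segment)
    have "\<exists>\<delta>>0. \<exists>k1 k2. (\<forall>t\<in>{-\<delta><..0}. trop A a (w + t *\<^sub>R (0, 1)) = trop A a w + k1 * t) \<and>
      (\<forall>t\<in>{0..<\<delta>}. trop A a (w + t *\<^sub>R (0, 1)) = trop A a w + k2 * t) \<and>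
      k2 - k1 = (\<Sum>e\<in>{e\<in>E. w \<in> edge_segment e}. - (jump m e * \<bar>cross2 (edge_vec e) (0, 1)\<bar>))"
    proof (rule directional_slopes[OF w])
      show "cross2 (edge_vec e) (0, 1) \<noteq> 0" if "e \<in> E" "w \<in> edge_segment e" for e
        using iff[OF that(1)] that(2) by (auto simp: crosses_def cross2_def edge_vec_def swap_edge_def)
    qed simp
    then obtain \<delta> k1 k2 where \<delta>: "\<delta> > 0"
      and k1: "\<And>t. t \<in> {-\<delta><..0} \<Longrightarrow> trop A a (w + t *\<^sub>R (0, 1)) = trop A a w + k1 * t"
      and k2: "\<And>t. t \<in> {0..<\<delta>} \<Longrightarrow> trop A a (w + t *\<^sub>R (0, 1)) = trop A a w + k2 * t"
      and k: "k2 - k1 = (\<Sum>e\<in>{e\<in>E. w \<in> edge_segment e}. - (jump m e * \<bar>cross2 (edge_vec e) (0, 1)\<bar>))"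
      by blast
    have "{e\<in>{e\<in>swap_edge ` E. crosses e s}. crossing_at e s = x} = swap_edge ` {e\<in>E. w \<in> edge_segment e}"
      using iff by blast
    then have "k2 - k1 = (\<Sum>e\<in>{e\<in>{e\<in>swap_edge ` E. crosses e s}. crossing_at e s = x}. ?J e)"
      using k by (simp add: cross2_def sum.reindex[OF inj_swap_edge])
    moreover have "\<forall>t\<in>{x-\<delta><..x}. (trop A a \<circ> prod.swap) (t, s) = (trop A a \<circ> prod.swap) (x, s) + k1 * (t - x)"
    proof
      fix t assume "t \<in> {x-\<delta><..x}"
      then show "(trop A a \<circ> prod.swap) (t, s) = (trop A a \<circ> prod.swap) (x, s) + k1 * (t - x)"
        using k1[of "t - x"] by (simp add: w_def)
    qed
    moreover have "\<forall>t\<in>{x..<x+\<delta>}. (trop A a \<circ> prod.swap) (t, s) = (trop A a \<circ> prod.swap) (x, s) + k2 * (t - x)"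
    proof
      fix t assume "t \<in> {x..<x+\<delta>}"
      then show "(trop A a \<circ> prod.swap) (t, s) = (trop A a \<circ> prod.swap) (x, s) + k2 * (t - x)"
        using k2[of "t - x"] by (simp add: w_def)
    qed
    ultimately show "\<exists>\<delta>>0. \<exists>k1 k2. (\<forall>t\<in>{x-\<delta><..x}. (trop A a \<circ> prod.swap) (t, s) = (trop A a \<circ> prod.swap) (x, s) + k1 * (t - x)) \<and>
        (\<forall>t\<in>{x..<x+\<delta>}. (trop A a \<circ> prod.swap) (t, s) = (trop A a \<circ> prod.swap) (x, s) + k2 * (t - x)) \<and>
        k2 - k1 = (\<Sum>e\<in>{e\<in>{e\<in>swap_edge ` E. crosses e s}. crossing_at e s = x}. ?J e)"
      using \<delta> by blast
  qed
  also have "\<dots> = (\<Sum>e\<in>E. - (jump m e * \<bar>fst (edge_vec e)\<bar>) * (\<bar>fst (edge_vec e)\<bar> *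
        integral {0..1} (\<lambda>t. b (snd (fst e + t *\<^sub>R (snd e - fst e)) - \<gamma>) * b (fst (fst e + t *\<^sub>R (snd e - fst e)) - \<alpha>))))"
    by (simp add: sum.reindex[OF inj_swap_edge]) (simp add: swap_edge_def edge_vec_def)
  also have "\<dots> = (\<Sum>e\<in>E. - (jump m e * (fst (edge_vec e))\<^sup>2) *
        integral {0..1} (\<lambda>t. b (fst (fst e + t *\<^sub>R (snd e - fst e)) - \<alpha>) * b (snd (fst e + t *\<^sub>R (snd e - fst e)) - \<gamma>)))"
  proof (rule sum.cong[OF refl])
    fix e
    have "(fst (edge_vec e))\<^sup>2 = \<bar>fst (edge_vec e)\<bar> * \<bar>fst (edge_vec e)\<bar>" by (simp add: power2_eq_square)
    then show "- (jump m e * \<bar>fst (edge_vec e)\<bar>) * (\<bar>fst (edge_vec e)\<bar> *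
        integral {0..1} (\<lambda>t. b (snd (fst e + t *\<^sub>R (snd e - fst e)) - \<gamma>) * b (fst (fst e + t *\<^sub>R (snd e - fst e)) - \<alpha>)))
      = - (jump m e * (fst (edge_vec e))\<^sup>2) *
        integral {0..1} (\<lambda>t. b (fst (fst e + t *\<^sub>R (snd e - fst e)) - \<alpha>) * b (snd (fst e + t *\<^sub>R (snd e - fst e)) - \<gamma>))"
      by (simp add: mult.commute)
  qed
  finally show ?thesis .
qed

text \<open>The squared components of the edge vector add up to its squared length, and one factor
  of length cancels against the denominator of \<open>jump\<close>. What remains is
  \<open>edge_norm\<close> times weight times arc length, so the Laplacian of the polynomial is
  minus the limit measure in \<open>sandpile_curve\<close>.\<close>

lemma tropical_laplacian:
  assumes sm: "smooth1 b" and z: "\<And>x. r \<le> \<bar>x\<bar> \<Longrightarrow> b x = 0" and r: "0 < r"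
    and square: "{\<alpha>-r..\<alpha>+r} \<times> {\<gamma>-r..\<gamma>+r} \<subseteq> \<Omega>"
  shows "(\<integral>x. trop A a x * (deriv (deriv b) (fst x - \<alpha>) * b (snd x - \<gamma>)) \<partial>lborel)
      + (\<integral>x. trop A a x * (b (fst x - \<alpha>) * deriv (deriv b) (snd x - \<gamma>)) \<partial>lborel)
    = - (\<Sum>e\<in>E. edge_norm e * real (m e) * edge_integral e (\<lambda>x. b (fst x - \<alpha>) * b (snd x - \<gamma>)))"
proof -
  let ?I = "\<lambda>e. integral {0..1} (\<lambda>t. b (fst (fst e + t *\<^sub>R (snd e - fst e)) - \<alpha>) * b (snd (fst e + t *\<^sub>R (snd e - fst e)) - \<gamma>))"
  have e: "- (jump m e * (snd (edge_vec e))\<^sup>2) * ?I e + - (jump m e * (fst (edge_vec e))\<^sup>2) * ?I e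
      = - (edge_norm e * real (m e) * edge_integral e (\<lambda>x. b (fst x - \<alpha>) * b (snd x - \<gamma>)))" for e
  proof -
    have nn: "(snd (edge_vec e))\<^sup>2 + (fst (edge_vec e))\<^sup>2 = norm (edge_vec e) * norm (edge_vec e)"
      by (simp add: norm_prod_def)
    have "- (jump m e * (snd (edge_vec e))\<^sup>2) * ?I e + - (jump m e * (fst (edge_vec e))\<^sup>2) * ?I e
        = - (jump m e * ((snd (edge_vec e))\<^sup>2 + (fst (edge_vec e))\<^sup>2)) * ?I e"
      by (simp only: distrib_left distrib_right minus_add_distrib)
    then have "- (jump m e * (snd (edge_vec e))\<^sup>2) * ?I e + - (jump m e * (fst (edge_vec e))\<^sup>2) * ?I e
        = - (jump m e * (norm (edge_vec e) * norm (edge_vec e))) * ?I e"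
      unfolding nn .
    also have "jump m e * (norm (edge_vec e) * norm (edge_vec e)) = real (m e) * edge_norm e * dist (fst e) (snd e)"
      by (simp add: jump_def edge_vec_def dist_norm norm_minus_commute)
    finally show ?thesis by (simp add: edge_integral_def)
  qed
  have "(\<integral>x. trop A a x * (deriv (deriv b) (fst x - \<alpha>) * b (snd x - \<gamma>)) \<partial>lborel)
      + (\<integral>x. trop A a x * (b (fst x - \<alpha>) * deriv (deriv b) (snd x - \<gamma>)) \<partial>lborel)
    = (\<Sum>e\<in>E. - (jump m e * (snd (edge_vec e))\<^sup>2) * ?I e) + (\<Sum>e\<in>E. - (jump m e * (fst (edge_vec e))\<^sup>2) * ?I e)"
    by (rule arg_cong2[where f = "(+)", OF trop_slice_x[OF sm z r square] trop_slice_y[OF sm z r square]])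
  also have "\<dots> = (\<Sum>e\<in>E. - (edge_norm e * real (m e) * edge_integral e (\<lambda>x. b (fst x - \<alpha>) * b (snd x - \<gamma>))))"
    unfolding sum.distrib[symmetric] by (rule sum.cong[OF refl e])
  finally show ?thesis by (simp only: sum_negf)
qed

end

section \<open>Barriers for the toppling function\<close>

definition sc :: "nat \<Rightarrow> lattice \<Rightarrow> plane" where
  "sc N v = (1 / real N) *\<^sub>R of_lattice v"

lemma dist_prod_le: "dist x y \<le> \<bar>fst x - fst y\<bar> + \<bar>snd x - snd y\<bar>" for x y :: plane
proof -
  have "dist x y = sqrt ((dist (fst x) (fst y))\<^sup>2 + (dist (snd x) (snd y))\<^sup>2)" by (simp add: dist_prod_def)
  also have "\<dots> \<le> dist (fst x) (fst y) + dist (snd x) (snd y)" by (rule sqrt_sum_squares_le_sum) auto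
  finally show ?thesis by (simp add: dist_real_def)
qed

lemma abs_fst_le_norm: "\<bar>fst z\<bar> \<le> norm z" and abs_snd_le_norm: "\<bar>snd z\<bar> \<le> norm z" for z :: plane
  using norm_fst_le[of "fst z" "snd z"] norm_snd_le[of "snd z" "fst z"] by simp_all

lemma fst_sc [simp]: "fst (sc N v) = real_of_int (fst v) / real N"
  and snd_sc [simp]: "snd (sc N v) = real_of_int (snd v) / real N"
  by (simp_all add: sc_def of_lattice_def)

lemma dist_sc: "dist (sc N v) (sc N w) \<le> (\<bar>real_of_int (fst v - fst w)\<bar> + \<bar>real_of_int (snd v - snd w)\<bar>) / real N"
  using dist_prod_le[of "sc N v" "sc N w"] by (simp add: abs_divide flip: diff_divide_distrib add_divide_distrib)

lemma dist_sc_neighbour: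
  assumes "w \<in> neighbours v"
  shows "dist (sc N w) (sc N v) \<le> 1 / real N"
  using assms dist_sc[of N w v] by (cases v) (auto simp: neighbours_Pair)

lemma dist_sc_floor:
  assumes "1 \<le> N"
  shows "dist (sc N (floor_pt (real N *\<^sub>R x))) x \<le> 2 / real N"
proof -
  have fl: "\<bar>real_of_int \<lfloor>real N * t\<rfloor> / real N - t\<bar> \<le> 1 / real N" for t
  proof -
    have "\<bar>real_of_int \<lfloor>real N * t\<rfloor> - real N * t\<bar> \<le> 1" by linarith
    then have "\<bar>real_of_int \<lfloor>real N * t\<rfloor> - real N * t\<bar> / real N \<le> 1 / real N" by (rule divide_right_mono) simp
    moreover have "\<bar>real_of_int \<lfloor>real N * t\<rfloor> - real N * t\<bar> / real N = \<bar>(real_of_int \<lfloor>real N * t\<rfloor> - real N * t) / real N\<bar>"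
      by (simp add: abs_divide)
    moreover have "(real_of_int \<lfloor>real N * t\<rfloor> - real N * t) / real N = real_of_int \<lfloor>real N * t\<rfloor> / real N - t"
      using assms by (simp add: diff_divide_distrib)
    ultimately show ?thesis by simp
  qed
  show ?thesis
    using dist_prod_le[of "sc N (floor_pt (real N *\<^sub>R x))" x] fl[of "fst x"] fl[of "snd x"]
    by (simp add: floor_pt_def)
qed

lemma Gamma_sc:
  assumes "1 \<le> N"
  shows "v \<in> Gamma \<Omega> N \<longleftrightarrow> sc N v \<in> \<Omega>"
proof
  assume "v \<in> Gamma \<Omega> N"
  then obtain x where "x \<in> \<Omega>" "of_lattice v = real N *\<^sub>R x" by (auto simp: Gamma_def)
  then show "sc N v \<in> \<Omega>" using assms by (simp add: sc_def)
next
  assume "sc N v \<in> \<Omega>"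
  moreover have "of_lattice v = real N *\<^sub>R sc N v" using assms by (simp add: sc_def)
  ultimately show "v \<in> Gamma \<Omega> N" by (auto simp: Gamma_def)
qed

text \<open>The polynomial is carried as \<open>trop A a\<close> on the whole plane: the barriers
  round its coefficients, and its Lipschitz bound is applied at lattice points just outside
  \<Omega>.\<close>

locale sandpile_limit =
  fixes \<Omega> P V :: "plane set" and E :: "edge set" and m :: "edge \<Rightarrow> nat"
    and A :: "lattice set" and a :: "lattice \<Rightarrow> real"
  assumes cpt: "compact \<Omega>" and cvx: "convex \<Omega>"
    and finP: "finite P" and neP: "P \<noteq> {}" and P_int: "P \<subseteq> interior \<Omega>"
    and graph: "rational_planar_graph V E" and finA: "finite A" and neA: "A \<noteq> {}"
    and corner: "corner_locus (trop A a) \<inter> \<Omega> = graph_support V E"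
    and weights: "\<And>e. e \<in> E \<Longrightarrow> tropical_weight (trop A a) e (m e)"
    and bdry: "\<And>x. x \<in> frontier \<Omega> \<Longrightarrow> trop A a x = 0"
    and curve: "sandpile_curve \<Omega> P V E m"
begin

abbreviation f :: "plane \<Rightarrow> real" where "f \<equiv> trop A a"

definition L :: real where "L = slope_bound A"

lemma L_pos: "0 < L"
  unfolding L_def by (rule slope_bound_pos[OF finA neA])

lemma f_lipschitz: "\<bar>f x - f y\<bar> \<le> L * dist x y"
  unfolding L_def by (rule trop_lipschitz[OF finA neA])

text \<open>By concavity the set where \<open>f\<close> is nonnegative is convex. It contains the
  frontier, whose convex hull is \<Omega>.\<close>

lemma f_nonneg: "x \<in> \<Omega> \<Longrightarrow> 0 \<le> f x"
proof -
  have "convex {x. 0 \<le> f x}"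
    unfolding convex_alt
  proof (intro ballI allI impI)
    fix x y and u :: real assume *: "x \<in> {x. 0 \<le> f x}" "y \<in> {x. 0 \<le> f x}" "0 \<le> u \<and> u \<le> 1"
    then have "0 \<le> (1 - u) * f x + u * f y" by simp
    also have "\<dots> \<le> f ((1 - u) *\<^sub>R x + u *\<^sub>R y)" using * by (intro trop_concave[OF finA neA]) auto
    finally show "(1 - u) *\<^sub>R x + u *\<^sub>R y \<in> {x. 0 \<le> f x}" by simp
  qed
  moreover have "frontier \<Omega> \<subseteq> {x. 0 \<le> f x}" using bdry by auto
  ultimately have "convex hull (frontier \<Omega>) \<subseteq> {x. 0 \<le> f x}" by (simp add: hull_minimal)
  then show "x \<in> \<Omega> \<Longrightarrow> 0 \<le> f x" using Krein_Milman_frontier[OF cvx cpt] by auto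
qed

definition q :: "nat \<Rightarrow> plane \<Rightarrow> lattice" where
  "q N p = floor_pt (real N *\<^sub>R p)"

definition src :: "nat \<Rightarrow> lattice \<Rightarrow> int" where
  "src N v = (\<Sum>p\<in>P. delta (q N p) v)"

definition T :: "nat \<Rightarrow> lattice \<Rightarrow> int" where
  "T N v = int (toppling_function (Gamma \<Omega> N) (initial_state P N) v)"

lemma initial: "initial_state P N v = 3 + src N v"
  by (simp add: initial_state_def src_def q_def)

lemma src_nonneg: "0 \<le> src N v"
  by (simp add: src_def sum_nonneg delta_def)

lemma T_nonneg: "0 \<le> T N v"
  by (simp add: T_def)

definition D :: real where
  "D = (SOME D. 0 < D \<and> (\<forall>x\<in>\<Omega>. norm x \<le> D))"

lemma D: "0 < D" "x \<in> \<Omega> \<Longrightarrow> norm x \<le> D"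
proof -
  have "\<exists>D>0. \<forall>x\<in>\<Omega>. norm x \<le> D" using compact_imp_bounded[OF cpt] bounded_pos by blast
  then have "0 < D \<and> (\<forall>x\<in>\<Omega>. norm x \<le> D)" unfolding D_def by (rule someI_ex)
  then show "0 < D" "x \<in> \<Omega> \<Longrightarrow> norm x \<le> D" by auto
qed

lemma P_Omega: "p \<in> P \<Longrightarrow> p \<in> \<Omega>"
  using P_int interior_subset by blast

lemma Gamma_coord:
  assumes "1 \<le> N" "v \<in> Gamma \<Omega> N"
  shows "\<bar>real_of_int (fst v)\<bar> \<le> D * N" "\<bar>real_of_int (snd v)\<bar> \<le> D * N"
proof -
  have "norm (sc N v) \<le> D" using assms D(2) Gamma_sc by blast
  then have "\<bar>fst (sc N v)\<bar> \<le> D" "\<bar>snd (sc N v)\<bar> \<le> D"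
    using abs_fst_le_norm[of "sc N v"] abs_snd_le_norm[of "sc N v"] by linarith+
  then show "\<bar>real_of_int (fst v)\<bar> \<le> D * N" "\<bar>real_of_int (snd v)\<bar> \<le> D * N"
    using assms(1) by (auto simp: abs_divide pos_divide_le_eq)
qed

lemma finite_Gamma:
  assumes "1 \<le> N"
  shows "finite (Gamma \<Omega> N)"
proof (rule finite_subset)
  show "Gamma \<Omega> N \<subseteq> {-\<lceil>D * N\<rceil>..\<lceil>D * N\<rceil>} \<times> {-\<lceil>D * N\<rceil>..\<lceil>D * N\<rceil>}"
  proof
    fix v assume "v \<in> Gamma \<Omega> N"
    from Gamma_coord[OF assms this] show "v \<in> {-\<lceil>D * N\<rceil>..\<lceil>D * N\<rceil>} \<times> {-\<lceil>D * N\<rceil>..\<lceil>D * N\<rceil>}"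
      by (cases v) (auto, linarith+)
  qed
qed simp

definition C0 :: real where
  "C0 = card P * (2 * D + 4)"

lemma C0_pos: "0 < C0"
  using D(1) finP neP by (simp add: C0_def card_gt_0_iff)

text \<open>A sum of concave tents with ridges through the points of \<open>P\<close>.\<close>

lemma crude_barrier:
  assumes N: "1 \<le> N"
  obtains H :: "lattice \<Rightarrow> int" where "\<And>v. 0 \<le> H v" "\<And>v. real_of_int (H v) \<le> C0 * N"
    "\<And>u. u \<in> Gamma \<Omega> N \<Longrightarrow> initial_state P N u + lap H u \<le> 3"
proof -
  \<comment> \<open>An upper bound for the distance, in the first coordinate, from
    \<open>q N p\<close> to any point of \<Gamma> or a neighbour of one: twice D N, one step, and
    one unit of rounding. The truncation of the tents at 0 is thus inactive there.\<close>
  define M where "M = \<lceil>2 * D * N\<rceil> + 2"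
  define h where "h p v = max 0 (M - \<bar>fst v - fst (q N p)\<bar>)" for p and v :: lattice
  have "0 \<le> 2 * D * N" using D(1) by simp
  then have M0: "0 \<le> M" unfolding M_def by linarith
  have lap_h: "lap (h p) u \<le> - delta (q N p) u" if "u \<in> Gamma \<Omega> N" "p \<in> P" for p u
  proof -
    have "\<bar>fst p\<bar> \<le> D" using D(2)[OF P_Omega[OF that(2)]] abs_fst_le_norm[of p] by simp
    then have "\<bar>real N * fst p\<bar> \<le> D * N" using N by (simp add: abs_mult mult.commute)
    then have q: "\<bar>real_of_int (fst (q N p))\<bar> \<le> D * N + 1" by (simp add: q_def floor_pt_def) linarith
    have inside: "\<bar>fst w - fst (q N p)\<bar> \<le> M" if w: "w \<in> insert u (neighbours u)" for w
    proof -
      have "\<bar>fst w - fst u\<bar> \<le> 1" using w by (cases u) (auto simp: neighbours_Pair)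
      then have "\<bar>real_of_int (fst w - fst u)\<bar> \<le> 1" by linarith
      then have "\<bar>real_of_int (fst w - fst (q N p))\<bar> \<le> D * N + (D * N + 2)"
        using Gamma_coord(1)[OF N \<open>u \<in> Gamma \<Omega> N\<close>] q unfolding of_int_diff by linarith
      then have "\<bar>real_of_int (fst w - fst (q N p))\<bar> \<le> 2 * D * N + 2" by (simp add: algebra_simps)
      then show ?thesis unfolding M_def by linarith
    qed
    have "lap (h p) u = lap (\<lambda>v. M - \<bar>fst v - fst (q N p)\<bar>) u"
      by (rule lap_cong) (use inside in \<open>auto simp: h_def\<close>)
    also have "\<dots> \<le> - delta (q N p) u" by (auto simp: lap_def delta_def abs_if)
    finally show ?thesis .
  qed
  have "lap (\<lambda>v. \<Sum>p\<in>P. h p v) u \<le> - src N u" if "u \<in> Gamma \<Omega> N" for u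
    unfolding lap_sum src_def sum_negf[symmetric] using lap_h[OF that] by (rule sum_mono)
  then have "initial_state P N u + lap (\<lambda>v. \<Sum>p\<in>P. h p v) u \<le> 3" if "u \<in> Gamma \<Omega> N" for u
    using that by (fastforce simp: initial)
  moreover have "real_of_int (\<Sum>p\<in>P. h p v) \<le> C0 * N" for v
  proof -
    have "(\<Sum>p\<in>P. h p v) \<le> (\<Sum>p\<in>P. M)" using M0 by (intro sum_mono) (auto simp: h_def)
    then have "real_of_int (\<Sum>p\<in>P. h p v) \<le> card P * real_of_int M"
      by (metis of_int_le_iff of_int_mult of_int_of_nat_eq sum_constant)
    also have "\<dots> \<le> card P * ((2 * D + 4) * N)"
    proof (rule mult_left_mono)
      have "real_of_int M \<le> 2 * D * N + 3" unfolding M_def by linarith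
      also have "\<dots> \<le> (2 * D + 4) * N" using N by (simp add: distrib_right)
      finally show "real_of_int M \<le> (2 * D + 4) * N" .
    qed simp
    finally show ?thesis by (simp add: C0_def mult.assoc)
  qed
  moreover have "0 \<le> (\<Sum>p\<in>P. h p v)" for v by (simp add: sum_nonneg h_def)
  ultimately show ?thesis using that[of "\<lambda>v. \<Sum>p\<in>P. h p v"] by blast
qed

text \<open>The crude barrier is an admissible function, so relaxation terminates and the abstract
  properties of the toppling function apply; its height gives the a priori bound of order N.\<close>

lemma T_properties:
  assumes N: "1 \<le> N"
  shows "v \<notin> Gamma \<Omega> N \<Longrightarrow> T N v = 0"
    and "v \<in> Gamma \<Omega> N \<Longrightarrow> final_state \<Omega> P N v = 3 + src N v + lap (T N) v"
    and "v \<in> Gamma \<Omega> N \<Longrightarrow> lap (T N) v \<le> - src N v"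
    and "real_of_int (T N v) \<le> C0 * N"
proof -
  obtain H :: "lattice \<Rightarrow> int" where H: "\<And>v. 0 \<le> H v" "\<And>v. real_of_int (H v) \<le> C0 * N"
    "\<And>u. u \<in> Gamma \<Omega> N \<Longrightarrow> initial_state P N u + lap H u \<le> 3"
    using crude_barrier[OF N] by blast
  note props = toppling_function_properties[OF finite_Gamma[OF N] H(1,3)]
  show "v \<notin> Gamma \<Omega> N \<Longrightarrow> T N v = 0" using props(1)[of v] by (simp add: T_def)
  have TT: "T N = (\<lambda>v. int (toppling_function (Gamma \<Omega> N) (initial_state P N) v))" by (simp add: T_def fun_eq_iff)
  show "v \<in> Gamma \<Omega> N \<Longrightarrow> final_state \<Omega> P N v = 3 + src N v + lap (T N) v"
    using props(2)[of v] by (simp only: TT final_state_def initial[of N v])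
  show "v \<in> Gamma \<Omega> N \<Longrightarrow> lap (T N) v \<le> - src N v"
    using props(3)[of v] unfolding TT initial[of N v] by linarith
  show "real_of_int (T N v) \<le> C0 * N"
    using props(4)[of v] H(2)[of v] unfolding T_def by linarith
qed

lemma T_le:
  assumes N: "1 \<le> N"
    and H: "\<And>u w. u \<in> Gamma \<Omega> N \<Longrightarrow> w \<in> insert u (neighbours u) \<Longrightarrow> 0 \<le> H w"
           "\<And>u. u \<in> Gamma \<Omega> N \<Longrightarrow> lap H u \<le> - src N u" and v: "v \<in> Gamma \<Omega> N"
  shows "T N v \<le> H v"
  unfolding T_def
  by (rule toppling_function_le[OF finite_Gamma[OF N] H(1) _ v]) (use H(2) in \<open>force simp: initial\<close>)+

text \<open>Otherwise no grain is lost near \<open>q N p\<close> by the Hausdorff convergence, so there \<open>T N\<close> is an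
  integer function of size \<open>O(N)\<close> that is harmonic except for one unit source, against
  \<open>single_source_growth\<close>.\<close>

lemma P_corner:
  assumes p: "p \<in> P"
  shows "p \<in> corner_locus f"
proof (rule ccontr)
  assume "p \<notin> corner_locus f"
  then have "p \<notin> graph_support V E" using corner by blast
  obtain V' E' where VE': "hausdorff_limit (deviation_set \<Omega> P) (graph_support V' E')"
    "graph_support V E = closure (graph_support V' E' \<inter> interior \<Omega>)"
    using curve by (auto simp: sandpile_curve_def)
  define G' where "G' = graph_support V' E'"
  have "open (interior \<Omega> - closure (G' \<inter> interior \<Omega>))" by (intro open_Diff) auto
  moreover have "p \<in> interior \<Omega> - closure (G' \<inter> interior \<Omega>)"
    using p P_int \<open>p \<notin> graph_support V E\<close> VE'(2) by (auto simp: G'_def)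
  ultimately obtain r0 where r0: "r0 > 0" "ball p r0 \<subseteq> interior \<Omega> - closure (G' \<inter> interior \<Omega>)"
    using open_contains_ball by meson
  \<comment> \<open>Keeps away from the other sources as well as from the curve. The ball of radius
    \<open>r0\<close> lies in the interior, so a point of the full Hausdorff limit in it would
    belong to the closure that forms the curve.\<close>
  define r where "r = Min (insert r0 ((\<lambda>p'. dist p p') ` (P - {p})))"
  have r: "r > 0" "r \<le> r0" "\<And>p'. p' \<in> P \<Longrightarrow> p' \<noteq> p \<Longrightarrow> r \<le> dist p p'"
    unfolding r_def using finP r0(1) by (auto simp: Min_gr_iff)
  have noG: "y \<notin> G'" if "dist p y < r" for y
  proof
    assume "y \<in> G'"
    moreover have "y \<in> ball p r0" using that r(2) by simp
    ultimately show False using r0(2) closure_subset[of "G' \<inter> interior \<Omega>"] by blast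
  qed
  have "\<forall>\<^sub>F N in sequentially. \<forall>x\<in>deviation_set \<Omega> P N. \<exists>y\<in>G'. dist x y < r / 2"
  proof -
    have "\<forall>\<^sub>F N in sequentially. (\<forall>x\<in>deviation_set \<Omega> P N. \<exists>y\<in>G'. dist x y < r / 2) \<and>
        (\<forall>y\<in>G'. \<exists>x\<in>deviation_set \<Omega> P N. dist x y < r / 2)"
      using VE'(1)[unfolded hausdorff_limit_def, rule_format, of "r / 2"] r(1) unfolding G'_def by simp
    then show ?thesis by (rule eventually_mono) simp
  qed
  then obtain N0 where N0: "\<And>N x. N0 \<le> N \<Longrightarrow> x \<in> deviation_set \<Omega> P N \<Longrightarrow> \<exists>y\<in>G'. dist x y < r / 2"
    by (auto simp: eventually_sequentially)
  \<comment> \<open>The box around \<open>q N p\<close> has half side 2K with K at most c N - 1, so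
    after rescaling its points lie within 4c = r/4 of the source, rounding included.\<close>
  define c where "c = r / 16"
  have c: "c > 0" using r(1) by (simp add: c_def)
  \<comment> \<open>The second bound prepares the contradiction: (c N / 4)^2 \<le> K (K - 1) \<le> 8
    C0 N would give c^2 N \<le> 128 C0.\<close>
  obtain N1 :: nat where N1: "16 / c < N1" "128 * C0 / c\<^sup>2 < N1" using reals_Archimedean2[of "max (16 / c) (128 * C0 / c\<^sup>2)"] by auto
  define N where "N = max N0 (max 1 N1)"
  have N: "1 \<le> N" "N0 \<le> N" and "16 / c < N" "128 * C0 / c\<^sup>2 < N" using N1 by (auto simp: N_def)
  then have cN: "16 < c * N" "128 * C0 < c\<^sup>2 * N" using c by (auto simp: field_simps)
  define K where "K = \<lfloor>c * N\<rfloor> - 1"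
  have Kr: "c * N - 2 < K" "K \<le> c * N - 1" and K: "2 \<le> K" unfolding K_def using cN(1) by linarith+
  have near: "dist (sc N v) p < r / 2 \<and> v \<in> Gamma \<Omega> N \<and> lap (T N) v = - src N v"
    if v: "\<bar>fst v - fst (q N p)\<bar> \<le> 2 * K" "\<bar>snd v - snd (q N p)\<bar> \<le> 2 * K" for v
  proof -
    have "\<bar>real_of_int (fst v - fst (q N p))\<bar> \<le> real_of_int (2 * K)" "\<bar>real_of_int (snd v - snd (q N p))\<bar> \<le> real_of_int (2 * K)"
      using v by (simp_all only: of_int_abs[symmetric] of_int_le_iff)
    then have "(\<bar>real_of_int (fst v - fst (q N p))\<bar> + \<bar>real_of_int (snd v - snd (q N p))\<bar>) / N \<le> (4 * (c * N) - 4) / N"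
      using Kr by (intro divide_right_mono) auto
    then have "dist (sc N v) (sc N (q N p)) \<le> (4 * (c * N) - 4) / N" using dist_sc[of N v "q N p"] by linarith
    moreover have "dist (sc N (q N p)) p \<le> 2 / N" unfolding q_def by (rule dist_sc_floor[OF N(1)])
    ultimately have "dist (sc N v) p \<le> (4 * (c * N) - 4) / N + 2 / N"
      using dist_triangle[of "sc N v" p "sc N (q N p)"] by linarith
    also have "\<dots> = 4 * c - 2 / N" using N(1) by (simp add: field_simps)
    also have "\<dots> < r / 2"
    proof -
      have "0 < 2 / real N" "4 * c = r / 4" using N(1) by (simp_all add: c_def)
      then show ?thesis using r(1) by linarith
    qed
    finally have d: "dist (sc N v) p < r / 2" .
    then have "sc N v \<in> ball p r0" using r by (simp add: dist_commute)
    then have "sc N v \<in> \<Omega>" using r0(2) interior_subset by blast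
    then have G: "v \<in> Gamma \<Omega> N" using Gamma_sc[OF N(1)] by blast
    have "\<not> final_state \<Omega> P N v < 3"
    proof
      assume "final_state \<Omega> P N v < 3"
      then have "sc N v \<in> deviation_set \<Omega> P N" using G by (auto simp: deviation_set_def sc_def)
      then obtain y where "y \<in> G'" "dist (sc N v) y < r / 2" using N0[OF N(2)] by blast
      then have "dist p y < r" using d dist_triangle2[of p y "sc N v"] by (simp add: dist_commute)
      then show False using noG \<open>y \<in> G'\<close> by blast
    qed
    then have "lap (T N) v = - src N v" using T_properties(2,3)[OF N(1) G] by linarith
    then show ?thesis using d G by blast
  qed
  have srcv: "src N v = delta (q N p) v"
    if v: "\<bar>fst v - fst (q N p)\<bar> \<le> 2 * K" "\<bar>snd v - snd (q N p)\<bar> \<le> 2 * K" for v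
  proof -
    have "delta (q N p') v = 0" if p': "p' \<in> P - {p}" for p'
    proof -
      have "v \<noteq> q N p'"
      proof
        assume "v = q N p'"
        then have "dist (sc N v) p' \<le> 2 / N" unfolding q_def using dist_sc_floor[OF N(1)] by simp
        moreover have "2 / N < r / 2" using cN(1) N(1) r(1) by (simp add: c_def field_simps)
        ultimately have "dist p p' < r" using near[OF v] dist_triangle2[of p p' "sc N v"] by (simp add: dist_commute)
        then show False using r(3)[of p'] p' by auto
      qed
      then show ?thesis by (simp add: delta_def)
    qed
    then have "(\<Sum>p'\<in>P. delta (q N p') v) = (\<Sum>p'\<in>{p}. delta (q N p') v)"
      using p finP by (intro sum.mono_neutral_right) auto
    then show ?thesis by (simp add: src_def)
  qed
  have "real_of_int (K * (K - 1)) \<le> 8 * (C0 * N)"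
  proof (rule single_source_growth[OF K, where F = "T N" and q = "q N p"])
    show "\<bar>real_of_int (T N (x, y))\<bar> \<le> C0 * N" for x y
      using T_properties(4)[OF N(1)] T_nonneg[of N "(x, y)"] by simp
    show "lap (T N) (x, y) = (if (x, y) = q N p then -1 else 0)"
      if "\<bar>x - fst (q N p)\<bar> < 2 * K" "\<bar>y - snd (q N p)\<bar> < 2 * K" for x y
      using near[of "(x, y)"] srcv[of "(x, y)"] that by (auto simp: delta_def)
  qed
  moreover have "(c * N / 4) * (c * N / 4) \<le> real_of_int (K * (K - 1))"
  proof -
    have "c * N / 4 \<le> K - 1" "c * N / 4 \<le> K" using Kr cN(1) by linarith+
    then have "(c * N / 4) * (c * N / 4) \<le> real_of_int K * (real_of_int K - 1)"
      using c K by (intro mult_mono) auto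
    then show ?thesis by simp
  qed
  ultimately have "c\<^sup>2 * N * N \<le> 128 * C0 * N" by (simp add: power2_eq_square field_simps)
  then have "c\<^sup>2 * N \<le> 128 * C0" using N(1) by simp
  then show False using cN(2) by simp
qed

text \<open>A monomial attaining the minimum at p exceeds N f at the lattice point of p by at most
  4L + 1 after rounding: 2L from moving the monomial over a distance 2/N, 2L from moving
  \<open>f\<close>, and 1 from rounding up its constant.\<close>

definition C1 :: int where "C1 = \<lceil>4 * L + 1\<rceil>"

text \<open>Rounding the coefficients of the tropical polynomial so that the two monomials meeting at \<open>p\<close>
  agree exactly at the lattice point \<open>q N p\<close>.\<close>

lemma kinked_approximation:
  fixes E0 :: int
  assumes p: "p \<in> P" and N: "1 \<le> N"
  obtains Y :: "lattice \<Rightarrow> int" where "\<And>v. lap Y v \<le> 0" "lap Y (q N p) \<le> -1"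
    "\<And>v. N * f (sc N v) + E0 \<le> Y v" "\<And>v. Y v \<le> N * f (sc N v) + E0 + C1 + 1"
proof -
  obtain k1 k2 where k: "k1 \<in> A" "k2 \<in> A" "k1 \<noteq> k2" "f p = lin k1 p + a k1" "f p = lin k2 p + a k2"
    using corner_two_monomials[OF finA neA P_corner[OF p]] by blast
  define dot where "dot k v = fst k * fst v + snd k * snd v" for k v :: lattice
  have dot: "real_of_int (dot k v) = N * lin k (sc N v)" for k v
    using N by (simp add: dot_def lin_def field_simps)
  define b where "b k = \<lceil>N * a k\<rceil>" for k
  have b: "N * a k \<le> b k" "b k \<le> N * a k + 1" for k unfolding b_def by linarith+
  define Q where "Q = q N p"
  define val where "val k = dot k Q + b k" for k
  have Nf_le: "N * f (sc N v) \<le> dot k v + N * a k" if "k \<in> A" for k v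
    using mult_left_mono[OF trop_le[OF finA neA that, of a "sc N v"], of "real N"] by (simp add: dot distrib_left)
  have dQ: "dist (sc N Q) p \<le> 2 / N" unfolding Q_def q_def by (rule dist_sc_floor[OF N])
  have val_le: "val k \<le> N * f (sc N Q) + (4 * L + 1)" if "k \<in> A" "f p = lin k p + a k" for k
  proof -
    have LN: "L * dist (sc N Q) p \<le> L * (2 / N)" using dQ L_pos by (intro mult_left_mono) auto
    have "lin k (sc N Q) - lin k p \<le> L * (2 / N)"
      using lin_diff[OF finA neA that(1), of "sc N Q" p] LN by (simp add: L_def)
    moreover have "f p - f (sc N Q) \<le> L * (2 / N)"
      using f_lipschitz[of p "sc N Q"] LN by (simp add: dist_commute)
    ultimately have "lin k (sc N Q) + a k \<le> f (sc N Q) + (L * (2 / N) + L * (2 / N))" using that(2) by linarith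
    also have "L * (2 / N) + L * (2 / N) = L * (4 / N)" by simp
    finally have "lin k (sc N Q) + a k \<le> f (sc N Q) + L * (4 / N)" .
    then have "N * (lin k (sc N Q) + a k) \<le> N * (f (sc N Q) + L * (4 / N))" by (rule mult_left_mono) simp
    also have "\<dots> = N * f (sc N Q) + 4 * L" using N by (simp add: distrib_left)
    finally have "N * lin k (sc N Q) + N * a k \<le> N * f (sc N Q) + 4 * L" by (simp add: distrib_left)
    then show ?thesis using b(2)[of k] dot[of k Q] unfolding val_def by simp
  qed
  have C1: "4 * L + 1 \<le> C1" unfolding C1_def by linarith
  \<comment> \<open>The larger of the two rounded monomials at Q, raised by \<open>E0\<close>; both
    are adjusted to take this value there.\<close>
  define mx where "mx = max (val k1) (val k2) + E0"
  have mx_le: "mx \<le> N * f (sc N Q) + (4 * L + 1) + E0"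
    using val_le[OF k(1,4)] val_le[OF k(2,5)] by (auto simp: mx_def max_def)
  \<comment> \<open>The two chosen monomials are forced to tie at Q, and all others are raised by
    \<open>C1\<close>, enough to stay at or above \<open>mx\<close> there. The tie is thus the
    minimum at Q.\<close>
  define c where "c k = (if k = k1 \<or> k = k2 then mx - dot k Q else b k + E0 + C1)" for k
  have c_ge: "b k + E0 \<le> c k" for k
    using C1 L_pos by (auto simp: c_def mx_def val_def max_def)
  have c_le: "c k \<le> b k + E0 + C1" if "k \<in> A" for k
  proof (cases "k = k1 \<or> k = k2")
    case True
    have "N * f (sc N Q) \<le> dot k Q + b k" using Nf_le[OF that, of Q] b(1)[of k] by linarith
    then have "real_of_int (mx - dot k Q) \<le> real_of_int (b k + E0 + C1)" using mx_le C1 by simp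
    then show ?thesis using True by (simp add: c_def)
  next
    case False
    then show ?thesis by (simp add: c_def)
  qed
  define Y where "Y v = Min ((\<lambda>k. dot k v + c k) ` A)" for v
  have Y_le: "Y v \<le> dot k v + c k" if "k \<in> A" for k v
    unfolding Y_def using finA that by (intro Min_le) auto
  have Y_att: "\<exists>k\<in>A. Y v = dot k v + c k" for v
  proof -
    have "Y v \<in> (\<lambda>k. dot k v + c k) ` A" unfolding Y_def using finA neA by (intro Min_in) auto
    then show ?thesis by auto
  qed
  have YQ: "Y Q = mx"
  proof (rule antisym)
    show "Y Q \<le> mx" using Y_le[OF k(1), of Q] by (simp add: c_def)
    obtain k where k': "k \<in> A" "Y Q = dot k Q + c k" using Y_att by blast
    show "mx \<le> Y Q"
    proof (cases "k = k1 \<or> k = k2")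
      case True
      then show ?thesis using k'(2) by (simp add: c_def)
    next
      case False
      have "N * f (sc N Q) \<le> dot k Q + b k" using Nf_le[OF k'(1), of Q] b(1)[of k] by linarith
      then have "real_of_int mx \<le> real_of_int (dot k Q + b k + E0 + C1)" using mx_le C1 by simp
      then have "mx \<le> dot k Q + b k + E0 + C1" by (simp only: of_int_le_iff)
      then show ?thesis using k'(2) False by (simp add: c_def)
    qed
  qed
  have lapY: "lap Y v \<le> 0" for v
  proof -
    obtain k where k': "k \<in> A" "Y v = dot k v + c k" using Y_att by blast
    have "lap Y v \<le> lap (\<lambda>w. dot k w + c k) v" by (rule lap_mono_at) (use k' Y_le in auto)
    also have "\<dots> = 0" by (simp add: lap_def dot_def algebra_simps)
    finally show ?thesis .
  qed
  have lapQ: "lap Y Q \<le> -1"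
  proof -
    have e1: "dot k1 w + c k1 = mx + dot k1 (w - Q)" "dot k2 w + c k2 = mx + dot k2 (w - Q)" for w
      by (simp_all add: c_def dot_def algebra_simps)
    have "lap Y Q \<le> lap (\<lambda>w. min (dot k1 w + c k1) (dot k2 w + c k2)) Q"
    proof (rule lap_mono_at)
      show "Y Q = min (dot k1 Q + c k1) (dot k2 Q + c k2)" by (simp add: YQ c_def)
    qed (use Y_le[OF k(1)] Y_le[OF k(2)] in auto)
    also have "\<dots> = lap (\<lambda>w. min (mx + dot k1 (w - Q)) (mx + dot k2 (w - Q))) Q" by (simp only: e1)
    \<comment> \<open>In each coordinate direction min(s, t) + min(-s, -t) = -|s - t|. The exponents
      are distinct integer vectors, so the total is at most -1.\<close>
    also have "\<dots> = - \<bar>fst k1 - fst k2\<bar> - \<bar>snd k1 - snd k2\<bar>"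
      by (simp add: lap_def dot_def min_def)
    also have "\<dots> \<le> -1" using k(3) by (cases k1; cases k2) auto
    finally show ?thesis .
  qed
  have low: "N * f (sc N v) + E0 \<le> Y v" for v
  proof -
    obtain k where k': "k \<in> A" "Y v = dot k v + c k" using Y_att by blast
    have "real_of_int (b k + E0) \<le> real_of_int (c k)" using c_ge by (simp only: of_int_le_iff)
    then show ?thesis using Nf_le[OF k'(1), of v] b(1)[of k] k'(2) by simp
  qed
  have up: "Y v \<le> N * f (sc N v) + E0 + C1 + 1" for v
  proof -
    obtain k where k': "k \<in> A" "f (sc N v) = lin k (sc N v) + a k" using trop_attained[OF finA neA] by blast
    have "N * f (sc N v) = dot k v + N * a k" unfolding k'(2) by (simp add: dot distrib_left)
    moreover have "real_of_int (Y v) \<le> real_of_int (dot k v + c k)" using Y_le[OF k'(1)] by (simp only: of_int_le_iff)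
    moreover have "real_of_int (c k) \<le> real_of_int (b k + E0 + C1)" using c_le[OF k'(1)] by (simp only: of_int_le_iff)
    ultimately show ?thesis using b(2)[of k] by simp
  qed
  show ?thesis by (rule that[OF lapY lapQ[unfolded Q_def] low up])
qed

definition C2 :: real where "C2 = card P * (\<lceil>L\<rceil> + C1 + 1)"

text \<open>One kinked approximation for each source, added up. Unlike the crude barrier it is of
  bounded size where \<open>f\<close> vanishes; the factor \<open>card P\<close> is harmless in a
  thin boundary layer. The shift by \<lceil>L\<rceil> keeps the barrier nonnegative at neighbours of
  \<Gamma>, where \<open>f\<close> may drop to -L/N.\<close>

lemma fine_barrier:
  assumes N: "1 \<le> N" and v: "v \<in> Gamma \<Omega> N"
  shows "T N v \<le> card P * (N * f (sc N v)) + C2"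
proof -
  have "\<exists>Y :: lattice \<Rightarrow> int. (\<forall>v. lap Y v \<le> 0) \<and> lap Y (q N p) \<le> -1 \<and> (\<forall>v. N * f (sc N v) + \<lceil>L\<rceil> \<le> Y v) \<and>
     (\<forall>v. Y v \<le> N * f (sc N v) + \<lceil>L\<rceil> + C1 + 1)" if "p \<in> P" for p
    by (rule kinked_approximation[OF that N, where ?E0.0 = "\<lceil>L\<rceil>"]) blast
  then obtain Y :: "plane \<Rightarrow> lattice \<Rightarrow> int" where Y: "\<And>p v. p \<in> P \<Longrightarrow> lap (Y p) v \<le> 0"
    "\<And>p. p \<in> P \<Longrightarrow> lap (Y p) (q N p) \<le> -1" "\<And>p v. p \<in> P \<Longrightarrow> N * f (sc N v) + \<lceil>L\<rceil> \<le> Y p v"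
    "\<And>p v. p \<in> P \<Longrightarrow> Y p v \<le> N * f (sc N v) + \<lceil>L\<rceil> + C1 + 1"
    by metis
  define H where "H v = (\<Sum>p\<in>P. Y p v)" for v
  have "T N v \<le> H v"
  proof (rule T_le[OF N _ _ v])
    fix u w assume u: "u \<in> Gamma \<Omega> N" and w: "w \<in> insert u (neighbours u)"
    have "0 \<le> f (sc N u)" using u Gamma_sc[OF N] f_nonneg by blast
    moreover have "dist (sc N w) (sc N u) \<le> 1 / N" using w dist_sc_neighbour[of w u N] by auto
    then have "L * dist (sc N w) (sc N u) \<le> L * (1 / N)" using L_pos by (intro mult_left_mono) auto
    ultimately have "- (L * (1 / N)) \<le> f (sc N w)" using f_lipschitz[of "sc N w" "sc N u"] by linarith
    then have "N * (- (L * (1 / N))) \<le> N * f (sc N w)" by (rule mult_left_mono) simp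
    then have "- L \<le> N * f (sc N w)" using N by simp
    then have "0 \<le> real_of_int (Y p w)" if "p \<in> P" for p using Y(3)[OF that, of w] by linarith
    then show "0 \<le> H w" unfolding H_def by (intro sum_nonneg) simp
  next
    fix u
    have "lap H u = (\<Sum>p\<in>P. lap (Y p) u)" unfolding H_def by (rule lap_sum)
    also have "\<dots> \<le> (\<Sum>p\<in>P. - delta (q N p) u)"
      using Y(1,2) by (intro sum_mono) (auto simp: delta_def)
    finally show "lap H u \<le> - src N u" by (simp add: src_def sum_negf)
  qed
  also have "real_of_int (H v) = (\<Sum>p\<in>P. real_of_int (Y p v))" by (simp add: H_def)
  also have "\<dots> \<le> (\<Sum>p\<in>P. N * f (sc N v) + \<lceil>L\<rceil> + C1 + 1)" using Y(4) by (rule sum_mono)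
  also have "\<dots> = card P * (N * f (sc N v)) + C2" by (simp add: C2_def algebra_simps)
  finally show ?thesis by simp
qed

lemma C2_nonneg: "0 \<le> C2"
proof -
  have "0 \<le> \<lceil>L\<rceil>" "0 \<le> C1" unfolding C1_def using L_pos by linarith+
  then show ?thesis unfolding C2_def by simp
qed

end

section \<open>Mollification\<close>

definition bump :: "real \<Rightarrow> (real \<Rightarrow> real) \<Rightarrow> bool" where
  "bump r b \<longleftrightarrow> 0 < r \<and> smooth1 b \<and> (\<forall>x. 0 \<le> b x) \<and> (\<forall>x. r \<le> \<bar>x\<bar> \<longrightarrow> b x = 0) \<and> integral {-r..r} b = 1"

definition sq :: "real \<Rightarrow> plane \<Rightarrow> plane set" where
  "sq r y = {fst y - r..fst y + r} \<times> {snd y - r..snd y + r}"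

definition psi :: "(real \<Rightarrow> real) \<Rightarrow> plane \<Rightarrow> plane \<Rightarrow> real" where
  "psi b y x = b (fst x - fst y) * b (snd x - snd y)"

definition lap_psi :: "(real \<Rightarrow> real) \<Rightarrow> plane \<Rightarrow> plane \<Rightarrow> real" where
  "lap_psi b y x = deriv (deriv b) (fst x - fst y) * b (snd x - snd y)
                 + b (fst x - fst y) * deriv (deriv b) (snd x - snd y)"

definition D2 :: "real \<Rightarrow> (plane \<Rightarrow> real) \<Rightarrow> plane \<Rightarrow> real" where
  "D2 h g x = (g (x + (h, 0)) + g (x - (h, 0)) + g (x + (0, h)) + g (x - (0, h)) - 4 * g x) / h\<^sup>2"

lemma compact_sq [simp]: "compact (sq r y)"
  unfolding sq_def by (intro compact_Times) auto

lemma sq_mono: "r \<le> r' \<Longrightarrow> sq r y \<subseteq> sq r' y"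
  by (auto simp: sq_def)

lemma notin_sq: "x \<notin> sq r y \<Longrightarrow> r \<le> \<bar>fst x - fst y\<bar> \<or> r \<le> \<bar>snd x - snd y\<bar>"
  by (cases x) (auto simp: sq_def)

lemma dist_sq: "x \<in> sq r y \<Longrightarrow> dist x y \<le> 2 * r"
  using dist_prod_le[of x y] by (cases x) (auto simp: sq_def)

lemma measure_sq: "0 \<le> r \<Longrightarrow> measure lborel (sq r y) = (2 * r)\<^sup>2"
proof -
  assume r: "0 \<le> r"
  have "sq r y = cbox (fst y - r, snd y - r) (fst y + r, snd y + r)" by (simp add: sq_def cbox_Pair_eq)
  then show ?thesis using r by (simp add: content_Pair power2_eq_square)
qed

lemma integral_abs_le_sq:
  fixes g :: "plane \<Rightarrow> real"
  assumes "0 \<le> r" and bd: "\<And>x. \<bar>g x\<bar> \<le> C" and z: "\<And>x. x \<notin> sq r y \<Longrightarrow> g x = 0" and C: "0 \<le> C"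
  shows "\<bar>\<integral>x. g x \<partial>lborel\<bar> \<le> C * (2 * r)\<^sup>2"
proof (cases "integrable lborel g")
  case True
  have fin: "emeasure lborel (sq r y) < \<infinity>" by (rule emeasure_compact_finite) simp
  have int: "integrable lborel (\<lambda>x. C * indicat_real (sq r y) x)"
    using fin by (intro integrable_mult_right integrable_real_indicator) (auto simp: borel_compact)
  have "\<bar>\<integral>x. g x \<partial>lborel\<bar> \<le> (\<integral>x. \<bar>g x\<bar> \<partial>lborel)" by (rule integral_abs_bound)
  also have "\<dots> \<le> (\<integral>x. C * indicat_real (sq r y) x \<partial>lborel)"
    using True int bd z by (intro integral_mono) (auto simp: indicator_def)
  also have "\<dots> = C * (2 * r)\<^sup>2" using measure_sq[OF assms(1)] fin by (simp add: borel_compact)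
  finally show ?thesis .
next
  case False
  then show ?thesis using C by (simp add: not_integrable_integral_eq)
qed

lemma integral_lborel_translate:
  fixes g :: "plane \<Rightarrow> real"
  assumes "g \<in> borel_measurable borel"
  shows "(\<integral>x. g (x + c) \<partial>lborel) = (\<integral>x. g x \<partial>lborel)"
proof -
  have "(\<integral>x. g x \<partial>lborel) = (\<integral>x. g x \<partial>distr lborel borel ((+) c))" by (simp add: lborel_distr_plus)
  also have "\<dots> = (\<integral>x. g (c + x) \<partial>lborel)" using assms by (intro integral_distr) auto
  finally show ?thesis by (simp add: add.commute)
qed

lemma integrable_times_compact:
  fixes g h :: "plane \<Rightarrow> real"
  assumes g: "g \<in> borel_measurable borel" "\<And>x. \<bar>g x\<bar> \<le> C" and h: "continuous_on UNIV h" "compact K" "\<And>x. x \<notin> K \<Longrightarrow> h x = 0"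
  shows "integrable lborel (\<lambda>x. g x * h x)"
proof (rule Bochner_Integration.integrable_bound)
  show "integrable lborel (\<lambda>x. C * h x)" by (intro integrable_mult_right integrable_compact_support[OF h])
  show "(\<lambda>x. g x * h x) \<in> borel_measurable lborel"
    using g(1) borel_measurable_continuous_onI[OF h(1)] by simp
  have "0 \<le> C" using g(2)[of 0] by linarith
  then show "AE x in lborel. norm (g x * h x) \<le> norm (C * h x)"
    using g(2) by (intro AE_I2) (auto simp: abs_mult intro!: mult_right_mono)
qed

section \<open>Calculus with the translates of one bump\<close>

context
  fixes r :: real and b :: "real \<Rightarrow> real"
  assumes bump: "bump r b"
begin

lemma bump_facts:
  shows r_pos: "0 < r" and b_smooth: "smooth1 b" and b_nonneg: "0 \<le> b x"
    and b_zero: "r \<le> \<bar>x\<bar> \<Longrightarrow> b x = 0" and b_int: "integral {-r..r} b = 1"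
  using bump by (auto simp: bump_def)

lemma b2_zero: "r \<le> \<bar>x\<bar> \<Longrightarrow> deriv (deriv b) x = 0"
proof -
  have z1: "deriv b x = 0" if "r \<le> \<bar>x\<bar>" for x
    using deriv_zero_outside[OF smooth1_deriv(1)[OF b_smooth] b_zero that] .
  show "r \<le> \<bar>x\<bar> \<Longrightarrow> deriv (deriv b) x = 0"
    using deriv_zero_outside[OF smooth1_deriv(1)[OF smooth1_deriv(2)[OF b_smooth]] z1] by blast
qed

lemma bump_constant:
  obtains K where "0 < K" "\<And>x. \<bar>b x\<bar> \<le> K" "\<And>x y. \<bar>b x - b y\<bar> \<le> K * \<bar>x - y\<bar>"
    "\<And>x. \<bar>deriv (deriv b) x\<bar> \<le> K" "\<And>x y. \<bar>deriv (deriv b) x - deriv (deriv b) y\<bar> \<le> K * \<bar>x - y\<bar>"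
proof -
  obtain K0 where K0: "\<And>x. \<bar>b x\<bar> \<le> K0" "\<And>x y. \<bar>b x - b y\<bar> \<le> K0 * \<bar>x - y\<bar>"
    using smooth1_compact_bounds[OF b_smooth b_zero] by blast
  have s2: "smooth1 (deriv (deriv b))" using b_smooth smooth1_deriv(2) by blast
  obtain K1 where K1: "\<And>x. \<bar>deriv (deriv b) x\<bar> \<le> K1"
     "\<And>x y. \<bar>deriv (deriv b) x - deriv (deriv b) y\<bar> \<le> K1 * \<bar>x - y\<bar>"
    by (rule smooth1_compact_bounds[OF s2, of r]) (use b2_zero in blast)+
  define K where "K = max 1 (max K0 K1)"
  have K: "0 < K" "K0 \<le> K" "K1 \<le> K" by (auto simp: K_def)
  show ?thesis
  proof (rule that[OF K(1)])
    show "\<bar>b x\<bar> \<le> K" "\<bar>deriv (deriv b) x\<bar> \<le> K" for x using K0(1)[of x] K1(1)[of x] K by linarith+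
    show "\<bar>b x - b y\<bar> \<le> K * \<bar>x - y\<bar>" for x y
      using K0(2)[of x y] mult_right_mono[OF K(2), of "\<bar>x - y\<bar>"] by simp
    show "\<bar>deriv (deriv b) x - deriv (deriv b) y\<bar> \<le> K * \<bar>x - y\<bar>" for x y
      using K1(2)[of x y] mult_right_mono[OF K(3), of "\<bar>x - y\<bar>"] by simp
  qed
qed

lemma smooth1_coordinate_continuous:
  assumes "smooth1 g"
  shows "continuous_on UNIV (\<lambda>x :: plane. g (fst x - c))" "continuous_on UNIV (\<lambda>x :: plane. g (snd x - c))"
  by (rule continuous_on_compose2[OF smooth1_continuous[OF assms, of UNIV]], auto intro!: continuous_intros)+

lemma psi_continuous: "continuous_on UNIV (psi b y)"
  unfolding psi_def by (intro continuous_on_mult smooth1_coordinate_continuous b_smooth)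

lemma lap_psi_continuous: "continuous_on UNIV (lap_psi b y)"
  unfolding lap_psi_def
  by (intro continuous_on_add continuous_on_mult smooth1_coordinate_continuous b_smooth smooth1_deriv(2))

lemma psi_zero: "x \<notin> sq r y \<Longrightarrow> psi b y x = 0"
  using notin_sq[of x r y] b_zero by (auto simp: psi_def)

lemma lap_psi_zero: "x \<notin> sq r y \<Longrightarrow> lap_psi b y x = 0"
  using notin_sq[of x r y] b_zero b2_zero by (auto simp: lap_psi_def)

lemma psi_nonneg: "0 \<le> psi b y x"
  by (simp add: psi_def b_nonneg)

lemma psi_bound:
  assumes "\<And>x. \<bar>b x\<bar> \<le> K"
  shows "\<bar>psi b y x\<bar> \<le> K * K"
proof -
  have "0 \<le> K" using assms[of 0] by linarith
  then show ?thesis unfolding psi_def abs_mult by (intro mult_mono assms) auto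
qed

text \<open>For a product, the consistency error of the five-point Laplacian splits into two
  one-dimensional second differences, each multiplied by the other factor.\<close>

lemma D2_psi:
  assumes h: "0 < h" and K: "\<And>x. \<bar>b x\<bar> \<le> K" "\<And>x y. \<bar>deriv (deriv b) x - deriv (deriv b) y\<bar> \<le> K * \<bar>x - y\<bar>"
  shows "\<bar>D2 h (psi b y) x - lap_psi b y x\<bar> \<le> 2 * K * K * h"
proof -
  let ?s = "fst x - fst y" let ?t = "snd x - snd y" let ?b2 = "deriv (deriv b)"
  have K0: "0 \<le> K" using K(1)[of 0] by linarith
  have sd: "\<bar>(b (u + h) + b (u - h) - 2 * b u) / h\<^sup>2 - ?b2 u\<bar> \<le> K * h" for u
    by (rule second_difference[OF b_smooth K(2) h])
  have "D2 h (psi b y) x - lap_psi b y x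
      = ((b (?s + h) + b (?s - h) - 2 * b ?s) / h\<^sup>2 - ?b2 ?s) * b ?t + b ?s * ((b (?t + h) + b (?t - h) - 2 * b ?t) / h\<^sup>2 - ?b2 ?t)"
    using h by (simp add: D2_def psi_def lap_psi_def field_simps)
  also have "\<bar>\<dots>\<bar> \<le> \<bar>(b (?s + h) + b (?s - h) - 2 * b ?s) / h\<^sup>2 - ?b2 ?s\<bar> * \<bar>b ?t\<bar> + \<bar>b ?s\<bar> * \<bar>(b (?t + h) + b (?t - h) - 2 * b ?t) / h\<^sup>2 - ?b2 ?t\<bar>"
    unfolding abs_mult[symmetric] by (rule abs_triangle_ineq)
  also have "\<dots> \<le> (K * h) * K + K * (K * h)"
    using sd K(1) K0 h by (intro add_mono mult_mono) auto
  finally show ?thesis by (simp add: algebra_simps)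
qed

lemma D2_psi_zero:
  assumes "0 < h" "h \<le> 1" "x \<notin> sq (r + 1) y"
  shows "D2 h (psi b y) x = 0"
proof -
  have "psi b y (x + c) = 0" if "\<bar>fst c\<bar> \<le> 1" "\<bar>snd c\<bar> \<le> 1" for c
  proof -
    have "r \<le> \<bar>fst (x + c) - fst y\<bar> \<or> r \<le> \<bar>snd (x + c) - snd y\<bar>"
      using notin_sq[OF assms(3)] that unfolding fst_add snd_add by linarith
    then show ?thesis by (auto simp: psi_def b_zero)
  qed
  from this[of "(h, 0)"] this[of "(- h, 0)"] this[of "(0, h)"] this[of "(0, - h)"] this[of 0]
  show ?thesis using assms by (simp add: D2_def minus_prod_def plus_prod_def)
qed

lemma smooth_psi: "smooth (psi b y)"
proof -
  have "smooth1 (\<lambda>t. b (t - c))" for c using smooth1_affine[OF b_smooth, of 1 "- c"] by simp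
  then show ?thesis
    unfolding smooth_def psi_def using C_diff_product[of "\<lambda>t. b (t - fst y)" "\<lambda>t. b (t - snd y)"] by blast
qed

lemma support_psi: "closure {x. psi b y x \<noteq> 0} \<subseteq> sq r y"
proof (rule closure_minimal)
  show "{x. psi b y x \<noteq> 0} \<subseteq> sq r y" using psi_zero by blast
  show "closed (sq r y)" by (simp add: compact_imp_closed)
qed

lemma integral_psi: "(\<integral>x. psi b y x \<partial>lborel) = 1"
proof -
  have one: "integrable lborel (\<lambda>t. b (t - c))" "(\<integral>t. b (t - c) \<partial>lborel) = 1" for c
  proof -
    have cont: "continuous_on UNIV (\<lambda>t. b (t - c))"
      by (rule continuous_on_compose2[OF smooth1_continuous[OF b_smooth, of UNIV]]) (auto intro: continuous_intros)
    show "integrable lborel (\<lambda>t. b (t - c))"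
      by (rule integrable_compact_support[OF cont, of "{c - r..c + r}"]) (auto intro!: b_zero)
    have ib: "integrable lborel b"
      by (rule integrable_compact_support[OF smooth1_continuous[OF b_smooth], of "{- r..r}"]) (auto intro!: b_zero)
    have "(\<integral>t. b (t - c) \<partial>lborel) = (\<integral>t. b t \<partial>lborel)"
      using lborel_integral_real_affine[of 1 b "- c"] by simp
    also have "\<dots> = integral UNIV b" using has_integral_integral_lborel[OF ib] by (simp add: has_integral_iff)
    also have "\<dots> = integral {-r..r} b"
    proof -
      have "(b has_integral 1) {-r..r}"
        using integrable_integral[OF integrable_continuous_interval[OF smooth1_continuous[OF b_smooth]], of "-r" r] b_int by simp
      then have "(b has_integral 1) UNIV" by (rule has_integral_on_superset) (auto intro!: b_zero)
      then show ?thesis using b_int by (simp add: has_integral_iff)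
    qed
    finally show "(\<integral>t. b (t - c) \<partial>lborel) = 1" using b_int by simp
  qed
  have "integrable lborel (psi b y)"
    by (rule integrable_compact_support[OF psi_continuous, of "sq r y"]) (auto simp: psi_zero)
  then have "integrable (lborel \<Otimes>\<^sub>M lborel) (\<lambda>(s, t). b (s - fst y) * b (t - snd y))"
    by (simp add: lborel_prod psi_def[abs_def] case_prod_unfold)
  from lborel_pair.integral_fst[OF this] show ?thesis
    by (simp add: lborel_prod psi_def case_prod_unfold one)
qed

lemma psi_average_bound:
  assumes g: "g \<in> borel_measurable borel" "\<And>x. \<bar>g x\<bar> \<le> C" and c: "\<And>x. x \<in> sq r y \<Longrightarrow> \<bar>g x\<bar> \<le> c"
  shows "\<bar>\<integral>x. g x * psi b y x \<partial>lborel\<bar> \<le> c"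
proof -
  note pc = psi_continuous[of y] compact_sq[of r y] psi_zero[of _ y]
  have i: "integrable lborel (\<lambda>x. g x * psi b y x)" by (rule integrable_times_compact[OF g pc])
  have ip: "integrable lborel (psi b y)" by (rule integrable_compact_support[OF pc])
  have "\<bar>\<integral>x. g x * psi b y x \<partial>lborel\<bar> \<le> (\<integral>x. \<bar>g x * psi b y x\<bar> \<partial>lborel)" by (rule integral_abs_bound)
  also have "\<dots> \<le> (\<integral>x. c * psi b y x \<partial>lborel)"
  proof (rule integral_mono)
    show "\<bar>g x * psi b y x\<bar> \<le> c * psi b y x" for x
    proof (cases "x \<in> sq r y")
      case True
      then show ?thesis using c[OF True] psi_nonneg[of y x] by (simp add: abs_mult mult_right_mono)
    next
      case False
      then show ?thesis using pc(3) by simp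
    qed
  qed (use i ip in auto)
  also have "\<dots> = c" using integral_psi by simp
  finally show ?thesis .
qed

text \<open>The variance with respect to the probability density \<open>psi b y\<close> is
  nonnegative.\<close>

lemma psi_jensen:
  assumes g: "g \<in> borel_measurable borel" "\<And>x. \<bar>g x\<bar> \<le> C"
  shows "(\<integral>x. g x * psi b y x \<partial>lborel)\<^sup>2 \<le> (\<integral>x. (g x)\<^sup>2 * psi b y x \<partial>lborel)"
proof -
  note pc = psi_continuous[of y] compact_sq[of r y] psi_zero[of _ y]
  have i1: "integrable lborel (\<lambda>x. g x * psi b y x)" by (rule integrable_times_compact[OF g pc])
  have i2: "integrable lborel (\<lambda>x. (g x)\<^sup>2 * psi b y x)"
  proof (rule integrable_times_compact[OF _ _ pc])
    show "(\<lambda>x. (g x)\<^sup>2) \<in> borel_measurable borel" using g(1) by measurable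
    show "\<bar>(g x)\<^sup>2\<bar> \<le> C\<^sup>2" for x using power_mono[OF g(2)[of x], of 2] by simp
  qed
  have ip: "integrable lborel (psi b y)" by (rule integrable_compact_support[OF pc])
  define c where "c = (\<integral>x. g x * psi b y x \<partial>lborel)"
  have "0 \<le> (\<integral>x. (g x - c)\<^sup>2 * psi b y x \<partial>lborel)"
    by (rule integral_nonneg_AE) (simp add: psi_nonneg)
  also have "(\<lambda>x. (g x - c)\<^sup>2 * psi b y x) = (\<lambda>x. (g x)\<^sup>2 * psi b y x - 2 * c * (g x * psi b y x) + c\<^sup>2 * psi b y x)"
    by (simp add: fun_eq_iff power2_diff algebra_simps)
  also have "(\<integral>x. (g x)\<^sup>2 * psi b y x - 2 * c * (g x * psi b y x) + c\<^sup>2 * psi b y x \<partial>lborel)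
      = (\<integral>x. (g x)\<^sup>2 * psi b y x \<partial>lborel) - 2 * c * c + c\<^sup>2"
    using i1 i2 ip integral_psi[of y] by (simp add: c_def[symmetric])
  finally show ?thesis unfolding c_def[symmetric] by (simp add: power2_eq_square)
qed

end

text \<open>Each shift is moved from one factor to the other by translation invariance of Lebesgue
  measure. Continuity is asked of \<open>h\<close> only, because the lemma is applied to the step
  functions \<open>fN N\<close>.\<close>

lemma D2_adjoint:
  fixes g h :: "plane \<Rightarrow> real"
  assumes g: "g \<in> borel_measurable borel" "\<And>x. \<bar>g x\<bar> \<le> C"
    and h: "continuous_on UNIV h" "compact K" "\<And>x. x \<notin> K \<Longrightarrow> h x = 0"
  shows "(\<integral>x. D2 t g x * h x \<partial>lborel) = (\<integral>x. g x * D2 t h x \<partial>lborel)"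
    and "integrable lborel (\<lambda>x. D2 t g x * h x)" and "integrable lborel (\<lambda>x. g x * D2 t h x)"
proof -
  have hm: "h \<in> borel_measurable borel" by (rule borel_measurable_continuous_onI[OF h(1)])
  have i0: "integrable lborel (\<lambda>x. g x * h x)" by (rule integrable_times_compact[OF g h])
  have i1: "integrable lborel (\<lambda>x. g (x + c) * h x)" for c
  proof (rule integrable_times_compact[OF _ _ h])
    have "(\<lambda>x. x + c) \<in> borel_measurable borel" by (intro borel_measurable_continuous_onI continuous_intros)
    then show "(\<lambda>x. g (x + c)) \<in> borel_measurable borel" by (rule measurable_compose[OF _ g(1)])
    show "\<bar>g (x + c)\<bar> \<le> C" for x by (rule g(2))
  qed
  have i2: "integrable lborel (\<lambda>x. g x * h (x + c))" for c
  proof (rule integrable_times_compact[OF g])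
    show "continuous_on UNIV (\<lambda>x. h (x + c))"
      by (rule continuous_on_compose2[OF h(1)]) (auto intro: continuous_intros)
    show "compact ((+) (- c) ` K)" by (rule compact_translation[OF h(2)])
    show "h (x + c) = 0" if "x \<notin> (+) (- c) ` K" for x
    proof (rule h(3))
      show "x + c \<notin> K"
      proof
        assume "x + c \<in> K"
        then have "- c + (x + c) \<in> (+) (- c) ` K" by blast
        then show False using that by simp
      qed
    qed
  qed
  have tr: "(\<integral>x. g (x + c) * h x \<partial>lborel) = (\<integral>x. g x * h (x + (- c)) \<partial>lborel)" for c
    using integral_lborel_translate[of "\<lambda>x. g x * h (x + (- c))" c] g(1) hm by simp
  have e1: "D2 t g x * h x = (g (x + (t, 0)) * h x + g (x + (- t, 0)) * h x + g (x + (0, t)) * h x + g (x + (0, - t)) * h x - 4 * (g x * h x)) / t\<^sup>2" for x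
    by (cases x) (simp add: D2_def algebra_simps add_divide_distrib diff_divide_distrib)
  have e2: "g x * D2 t h x = (g x * h (x + (t, 0)) + g x * h (x + (- t, 0)) + g x * h (x + (0, t)) + g x * h (x + (0, - t)) - 4 * (g x * h x)) / t\<^sup>2" for x
    by (cases x) (simp add: D2_def algebra_simps add_divide_distrib diff_divide_distrib)
  have ia: "integrable lborel (\<lambda>x. g (x + (t, 0)) * h x + g (x + (- t, 0)) * h x + g (x + (0, t)) * h x + g (x + (0, - t)) * h x - 4 * (g x * h x))"
    by (intro Bochner_Integration.integrable_add Bochner_Integration.integrable_diff integrable_mult_right i0 i1)
  have ib: "integrable lborel (\<lambda>x. g x * h (x + (t, 0)) + g x * h (x + (- t, 0)) + g x * h (x + (0, t)) + g x * h (x + (0, - t)) - 4 * (g x * h x))"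
    by (intro Bochner_Integration.integrable_add Bochner_Integration.integrable_diff integrable_mult_right i0 i2)
  show "integrable lborel (\<lambda>x. D2 t g x * h x)" unfolding e1 using ia by simp
  show "integrable lborel (\<lambda>x. g x * D2 t h x)" unfolding e2 using ib by simp
  have "(\<integral>x. D2 t g x * h x \<partial>lborel) = ((\<integral>x. g (x + (t, 0)) * h x \<partial>lborel) + (\<integral>x. g (x + (- t, 0)) * h x \<partial>lborel)
      + (\<integral>x. g (x + (0, t)) * h x \<partial>lborel) + (\<integral>x. g (x + (0, - t)) * h x \<partial>lborel) - 4 * (\<integral>x. g x * h x \<partial>lborel)) / t\<^sup>2"
    unfolding e1 using i0 i1 by simp
  also have "\<dots> = ((\<integral>x. g x * h (x + (- t, 0)) \<partial>lborel) + (\<integral>x. g x * h (x + (t, 0)) \<partial>lborel)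
      + (\<integral>x. g x * h (x + (0, - t)) \<partial>lborel) + (\<integral>x. g x * h (x + (0, t)) \<partial>lborel) - 4 * (\<integral>x. g x * h x \<partial>lborel)) / t\<^sup>2"
    by (simp add: tr)
  also have "\<dots> = (\<integral>x. g x * D2 t h x \<partial>lborel)"
    unfolding e2 using i0 i2 by simp
  finally show "(\<integral>x. D2 t g x * h x \<partial>lborel) = (\<integral>x. g x * D2 t h x \<partial>lborel)" .
qed

lemma floor_measurable:
  "(\<lambda>x :: plane. \<lfloor>c * fst x\<rfloor>) \<in> measurable borel (count_space UNIV)"
  "(\<lambda>x :: plane. \<lfloor>c * snd x\<rfloor>) \<in> measurable borel (count_space UNIV)"
  by (rule measurable_compose[OF _ measurable_real_floor], intro borel_measurable_continuous_onI continuous_intros)+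

section \<open>The weak limit equation for the rescaled toppling function\<close>

context sandpile_limit
begin

definition fN :: "nat \<Rightarrow> plane \<Rightarrow> real" where
  "fN N x = real_of_int (T N (floor_pt (real N *\<^sub>R x))) / real N"

lemma scaled_toppling_fN: "scaled_toppling \<Omega> P N x = fN N x"
  by (simp add: scaled_toppling_def fN_def T_def)

lemma fN_bounds: "0 \<le> fN N x" "1 \<le> N \<Longrightarrow> fN N x \<le> C0"
  using T_nonneg T_properties(4)[of N] by (auto simp: fN_def pos_divide_le_eq)

lemma fN_measurable: "fN N \<in> borel_measurable borel"
proof -
  have "(\<lambda>x. real_of_int (T N (\<lfloor>real N * fst x\<rfloor>, \<lfloor>real N * snd x\<rfloor>)) / real N) \<in> borel_measurable borel"
    by (rule measurable_compose_countable[OF _ floor_measurable(1)], rule measurable_compose_countable[OF _ floor_measurable(2)]) simp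
  then show ?thesis by (simp add: fN_def[abs_def] floor_pt_def)
qed

lemma floor_shift:
  assumes "1 \<le> N"
  shows "floor_pt (real N *\<^sub>R (x + (1 / N, 0))) = (fst (floor_pt (real N *\<^sub>R x)) + 1, snd (floor_pt (real N *\<^sub>R x)))"
    "floor_pt (real N *\<^sub>R (x - (1 / N, 0))) = (fst (floor_pt (real N *\<^sub>R x)) - 1, snd (floor_pt (real N *\<^sub>R x)))"
    "floor_pt (real N *\<^sub>R (x + (0, 1 / N))) = (fst (floor_pt (real N *\<^sub>R x)), snd (floor_pt (real N *\<^sub>R x)) + 1)"
    "floor_pt (real N *\<^sub>R (x - (0, 1 / N))) = (fst (floor_pt (real N *\<^sub>R x)), snd (floor_pt (real N *\<^sub>R x)) - 1)"
  using assms by (simp_all add: floor_pt_def distrib_left right_diff_distrib)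

text \<open>A step of 1/N moves the floor by exactly one site, so there is no discretisation error:
  N^2 comes from the step and 1/N from the rescaling of values.\<close>

lemma D2_fN:
  assumes N: "1 \<le> N"
  shows "D2 (1 / N) (fN N) x = N * real_of_int (lap (T N) (floor_pt (real N *\<^sub>R x)))"
  using N unfolding D2_def fN_def floor_shift[OF N] lap_def
  by (simp add: field_simps power2_eq_square)

lemma deviation_density_eq:
  assumes N: "1 \<le> N" and G: "floor_pt (real N *\<^sub>R x) \<in> Gamma \<Omega> N"
  shows "deviation_density \<Omega> P N x = - D2 (1 / N) (fN N) x - N * real_of_int (src N (floor_pt (real N *\<^sub>R x)))"
  using G T_properties(2)[OF N G] by (simp add: deviation_density_def D2_fN[OF N] algebra_simps)

lemma floor_deep:
  assumes "compact K" "K \<subseteq> interior \<Omega>"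
  shows "\<forall>\<^sub>F N in sequentially. \<forall>x\<in>K. floor_pt (real N *\<^sub>R x) \<in> Gamma \<Omega> N"
proof -
  obtain e where e: "e > 0" "(\<Union>x\<in>K. ball x e) \<subseteq> interior \<Omega>"
    using compact_subset_open_imp_ball_epsilon_subset[OF assms(1) open_interior assms(2)] by blast
  obtain N0 :: nat where N0: "2 / e < N0" using reals_Archimedean2 by blast
  show ?thesis
    unfolding eventually_sequentially
  proof (intro exI[of _ "max 1 N0"] allI impI ballI)
    fix N x assume N: "max 1 N0 \<le> N" and x: "x \<in> K"
    have "2 / e < N" using N N0 by linarith
    then have "2 / N < e" using e(1) N by (simp add: field_simps)
    then have "sc N (floor_pt (real N *\<^sub>R x)) \<in> ball x e"
      using dist_sc_floor[of N x] N by (simp add: dist_commute)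
    then have "sc N (floor_pt (real N *\<^sub>R x)) \<in> \<Omega>" using e(2) x interior_subset by blast
    then show "floor_pt (real N *\<^sub>R x) \<in> Gamma \<Omega> N" using Gamma_sc N by simp
  qed
qed

lemma cell_in_sq:
  assumes N: "1 \<le> N" and x: "floor_pt (real N *\<^sub>R x) = v"
  shows "x \<in> sq (1 / N) (sc N v)"
proof -
  have "\<bar>t - real_of_int \<lfloor>real N * t\<rfloor> / N\<bar> \<le> 1 / N" for t
  proof -
    have "t - real_of_int \<lfloor>real N * t\<rfloor> / N = (real N * t - real_of_int \<lfloor>real N * t\<rfloor>) / N"
      using N by (simp add: diff_divide_distrib)
    moreover have "\<bar>real N * t - real_of_int \<lfloor>real N * t\<rfloor>\<bar> \<le> 1" by linarith
    ultimately show ?thesis by (simp add: abs_divide divide_right_mono)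
  qed
  from this[of "fst x"] this[of "snd x"] show ?thesis
    unfolding sq_def mem_Times_iff x[symmetric] by (auto simp: floor_pt_def abs_le_iff)
qed

text \<open>Each source acts with density N on a cell contained in a square of area 4/N^2. Tested
  against a bounded function it contributes O(1/N), so the sources leave no trace in the weak
  limit.\<close>

lemma src_integral:
  assumes N: "1 \<le> N" and h: "\<And>x. \<bar>h x\<bar> \<le> C" "continuous_on UNIV h" "compact K" "\<And>x. x \<notin> K \<Longrightarrow> h x = 0"
  shows "\<bar>\<integral>x. N * real_of_int (src N (floor_pt (real N *\<^sub>R x))) * h x \<partial>lborel\<bar> \<le> card P * (4 * C / N)"
    and "integrable lborel (\<lambda>x. N * real_of_int (src N (floor_pt (real N *\<^sub>R x))) * h x)"
proof -
  let ?d = "\<lambda>p x. real N * real_of_int (delta (q N p) (floor_pt (real N *\<^sub>R x)))"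
  have C: "0 \<le> C" using h(1)[of 0] by linarith
  have meas: "?d p \<in> borel_measurable borel" for p
    unfolding floor_pt_def fst_scaleR snd_scaleR real_scaleR_def
    by (rule measurable_compose_countable[OF _ floor_measurable(1)], rule measurable_compose_countable[OF _ floor_measurable(2)]) simp
  have int: "integrable lborel (\<lambda>x. ?d p x * h x)" for p
    by (rule integrable_times_compact[OF meas _ h(2-4), of _ "real N"]) (auto simp: delta_def)
  have e: "N * real_of_int (src N (floor_pt (real N *\<^sub>R x))) * h x = (\<Sum>p\<in>P. ?d p x * h x)" for x
    by (simp add: src_def sum_distrib_left sum_distrib_right)
  show "integrable lborel (\<lambda>x. N * real_of_int (src N (floor_pt (real N *\<^sub>R x))) * h x)"
    unfolding e by (rule Bochner_Integration.integrable_sum) (rule int)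
  have "\<bar>\<integral>x. ?d p x * h x \<partial>lborel\<bar> \<le> 4 * C / N" for p
  proof -
    have "\<bar>\<integral>x. ?d p x * h x \<partial>lborel\<bar> \<le> N * C * (2 * (1 / N))\<^sup>2"
    proof (rule integral_abs_le_sq[of _ _ _ "sc N (q N p)"])
      show "\<bar>?d p x * h x\<bar> \<le> N * C" for x
        using h(1)[of x] C by (auto simp: delta_def abs_mult intro!: mult_left_mono)
      show "?d p x * h x = 0" if "x \<notin> sq (1 / N) (sc N (q N p))" for x
        using cell_in_sq[OF N, of x] that by (auto simp: delta_def)
    qed (use C in auto)
    also have "\<dots> = 4 * C / N" using N by (simp add: power2_eq_square)
    finally show ?thesis .
  qed
  then have S1: "(\<Sum>p\<in>P. \<bar>\<integral>x. ?d p x * h x \<partial>lborel\<bar>) \<le> card P * (4 * C / N)"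
    using sum_bounded_above[of P "\<lambda>p. \<bar>\<integral>x. ?d p x * h x \<partial>lborel\<bar>" "4 * C / N"] by simp
  have S2: "(\<integral>x. N * real_of_int (src N (floor_pt (real N *\<^sub>R x))) * h x \<partial>lborel) = (\<Sum>p\<in>P. \<integral>x. ?d p x * h x \<partial>lborel)"
    unfolding e by (rule Bochner_Integration.integral_sum) (rule int)
  show "\<bar>\<integral>x. N * real_of_int (src N (floor_pt (real N *\<^sub>R x))) * h x \<partial>lborel\<bar> \<le> card P * (4 * C / N)"
    unfolding S2 by (rule order_trans[OF sum_abs S1])
qed

text \<open>\<open>f\<close> need not vanish outside \<open>\<Omega>\<close>, whereas \<open>fN N\<close> does.\<close>

definition F0 :: "plane \<Rightarrow> real" where
  "F0 x = (if x \<in> \<Omega> then f x else 0)"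

definition w :: "nat \<Rightarrow> plane \<Rightarrow> real" where
  "w N x = fN N x - F0 x"

definition C3 :: real where
  "C3 = C0 + \<bar>f 0\<bar> + L * D"

lemma F0_bound: "\<bar>F0 x\<bar> \<le> \<bar>f 0\<bar> + L * D"
proof (cases "x \<in> \<Omega>")
  case True
  have "L * dist x 0 \<le> L * D" using D(2)[OF True] L_pos by (intro mult_left_mono) auto
  then show ?thesis using f_lipschitz[of x 0] True by (simp add: F0_def)
next
  case False
  then show ?thesis using L_pos D(1) by (simp add: F0_def)
qed

lemma w_bound: "1 \<le> N \<Longrightarrow> \<bar>w N x\<bar> \<le> C3"
  using fN_bounds[of N x] F0_bound[of x] by (simp add: w_def C3_def abs_le_iff)

lemma C3_nonneg: "0 \<le> C3"
  using C0_pos L_pos D(1) by (simp add: C3_def)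

lemma F0_measurable: "F0 \<in> borel_measurable borel"
proof -
  have "f \<in> borel_measurable borel" by (rule borel_measurable_continuous_onI[OF trop_continuous[OF finA neA]])
  moreover have "\<Omega> \<in> sets borel" using cpt by (simp add: borel_compact)
  ultimately show ?thesis unfolding F0_def[abs_def] by simp
qed

lemma w_measurable: "w N \<in> borel_measurable borel"
  unfolding w_def[abs_def] using fN_measurable F0_measurable by (rule borel_measurable_diff)

context
  fixes r :: real and b :: "real \<Rightarrow> real"
  assumes bump: "bump r b"
begin

text \<open>Up to the sources, the deviation density is minus the discrete Laplacian of
  \<open>fN N\<close>. Moving that Laplacian onto the test function is exact, and exchanging it
  there for the continuous one costs O(1/N).\<close>

lemma fN_weak:
  assumes y: "sq r y \<subseteq> interior \<Omega>"
  shows "(\<lambda>N. \<integral>x. fN N x * lap_psi b y x \<partial>lborel) \<longlonglongrightarrow>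
      - (\<Sum>e\<in>E. edge_norm e * real (m e) * edge_integral e (psi b y))"
proof -
  let ?\<psi> = "psi b y" let ?S = "\<Sum>e\<in>E. edge_norm e * real (m e) * edge_integral e ?\<psi>"
  obtain K where K: "0 < K" "\<And>x. \<bar>b x\<bar> \<le> K" "\<And>x y. \<bar>deriv (deriv b) x - deriv (deriv b) y\<bar> \<le> K * \<bar>x - y\<bar>"
    using bump_constant[OF bump] by metis
  have r: "0 < r" by (rule r_pos[OF bump])
  note pc = psi_continuous[OF bump, of y] compact_sq[of r y] psi_zero[OF bump, of _ y]
  have supp: "closure {x. ?\<psi> x \<noteq> 0} \<subseteq> interior \<Omega>" using support_psi[OF bump, of y] y by blast
  have lim: "(\<lambda>N. \<integral>x. deviation_density \<Omega> P N x * ?\<psi> x \<partial>lborel) \<longlonglongrightarrow> ?S"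
    using curve smooth_psi[OF bump, of y] supp unfolding sandpile_curve_def by blast
  have ev: "\<forall>\<^sub>F N in sequentially. 1 \<le> N \<and> (\<forall>x\<in>sq r y. floor_pt (real N *\<^sub>R x) \<in> Gamma \<Omega> N)"
    using floor_deep[OF compact_sq y] eventually_ge_at_top[of 1] by eventually_elim simp
  \<comment> \<open>The first summand bounds the sources, the second the consistency error of the
    five-point Laplacian; the square is enlarged by 1 to contain all shifted supports.\<close>
  have est: "\<bar>(\<integral>x. fN N x * lap_psi b y x \<partial>lborel) + (\<integral>x. deviation_density \<Omega> P N x * ?\<psi> x \<partial>lborel)\<bar>
      \<le> card P * (4 * (K * K) / N) + C0 * (2 * K * K * (1 / N)) * (2 * (r + 1))\<^sup>2"
    if N: "1 \<le> N" and deep: "\<And>x. x \<in> sq r y \<Longrightarrow> floor_pt (real N *\<^sub>R x) \<in> Gamma \<Omega> N" for N :: nat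
  proof -
    have h: "0 < 1 / real N" "1 / real N \<le> 1" using N by auto
    have fb: "\<bar>fN N x\<bar> \<le> C0" for x using fN_bounds[of N x] N by simp
    let ?s = "\<lambda>x. N * real_of_int (src N (floor_pt (real N *\<^sub>R x))) * ?\<psi> x"
    have pw: "deviation_density \<Omega> P N x * ?\<psi> x = - (D2 (1 / N) (fN N) x * ?\<psi> x) - ?s x" for x
    proof (cases "x \<in> sq r y")
      case True
      show ?thesis unfolding deviation_density_eq[OF N deep[OF True]] by (simp add: algebra_simps)
    next
      case False
      then show ?thesis using pc(3) by simp
    qed
    note adj = D2_adjoint[OF fN_measurable fb pc, of "1 / N"]
    note si = src_integral[OF N psi_bound[OF bump K(2)] pc]
    have "(\<integral>x. deviation_density \<Omega> P N x * ?\<psi> x \<partial>lborel) = - (\<integral>x. fN N x * D2 (1 / N) ?\<psi> x \<partial>lborel) - (\<integral>x. ?s x \<partial>lborel)"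
      unfolding pw using adj si(2) by simp
    moreover have "(\<integral>x. fN N x * lap_psi b y x \<partial>lborel) - (\<integral>x. fN N x * D2 (1 / N) ?\<psi> x \<partial>lborel)
        = (\<integral>x. fN N x * (lap_psi b y x - D2 (1 / N) ?\<psi> x) \<partial>lborel)"
    proof -
      have "integrable lborel (\<lambda>x. fN N x * lap_psi b y x)"
        by (rule integrable_times_compact[OF fN_measurable fb lap_psi_continuous[OF bump] compact_sq[of r y]])
          (rule lap_psi_zero[OF bump])
      then show ?thesis using adj(3) by (simp add: right_diff_distrib)
    qed
    moreover have "\<bar>\<integral>x. fN N x * (lap_psi b y x - D2 (1 / N) ?\<psi> x) \<partial>lborel\<bar> \<le> C0 * (2 * K * K * (1 / N)) * (2 * (r + 1))\<^sup>2"
    proof (rule integral_abs_le_sq)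
      show "\<bar>fN N x * (lap_psi b y x - D2 (1 / N) ?\<psi> x)\<bar> \<le> C0 * (2 * K * K * (1 / N))" for x
        unfolding abs_mult
      proof (rule mult_mono)
        show "\<bar>lap_psi b y x - D2 (1 / N) ?\<psi> x\<bar> \<le> 2 * K * K * (1 / N)"
          using D2_psi[OF bump h(1) K(2,3), of y x] by (simp add: abs_minus_commute)
      qed (use fb C0_pos in auto)
      show "fN N x * (lap_psi b y x - D2 (1 / N) ?\<psi> x) = 0" if "x \<notin> sq (r + 1) y" for x
      proof -
        have "x \<notin> sq r y" using that sq_mono[of r "r + 1" y] by auto
        then show ?thesis using lap_psi_zero[OF bump] D2_psi_zero[OF bump h that] by simp
      qed
    qed (use r C0_pos K(1) in auto)
    ultimately show ?thesis using si(1) by linarith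
  qed
  have "(\<lambda>N. (\<integral>x. fN N x * lap_psi b y x \<partial>lborel) + (\<integral>x. deviation_density \<Omega> P N x * ?\<psi> x \<partial>lborel)) \<longlonglongrightarrow> 0"
  proof (rule Lim_null_comparison)
    show "\<forall>\<^sub>F N in sequentially. norm ((\<integral>x. fN N x * lap_psi b y x \<partial>lborel) + (\<integral>x. deviation_density \<Omega> P N x * ?\<psi> x \<partial>lborel))
        \<le> (card P * (4 * (K * K)) + C0 * (2 * K * K) * (2 * (r + 1))\<^sup>2) / real N"
      using ev
    proof eventually_elim
      case (elim N)
      then show ?case using est[of N] by (simp add: add_divide_distrib)
    qed
    show "(\<lambda>N. (card P * (4 * (K * K)) + C0 * (2 * K * K) * (2 * (r + 1))\<^sup>2) / real N) \<longlonglongrightarrow> 0"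
      by (rule lim_const_over_n)
  qed
  from tendsto_diff[OF this lim] show ?thesis by simp
qed

text \<open>Both Laplacians equal minus the same weighted curve: that of \<open>fN N\<close> in the
  limit, by \<open>fN_weak\<close>, and that of \<open>f\<close> exactly, by
  \<open>tropical_laplacian\<close>.\<close>

lemma w_weak:
  assumes y: "sq r y \<subseteq> interior \<Omega>"
  shows "(\<lambda>N. \<integral>x. w N x * lap_psi b y x \<partial>lborel) \<longlonglongrightarrow> 0"
proof -
  have yO: "sq r y \<subseteq> \<Omega>" using y interior_subset by blast
  have cb: "smooth1 b" "smooth1 (deriv (deriv b))" using b_smooth[OF bump] smooth1_deriv(2) by blast+
  note r = r_pos[OF bump]
  let ?g1 = "\<lambda>x. f x * (deriv (deriv b) (fst x - fst y) * b (snd x - snd y))"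
  let ?g2 = "\<lambda>x. f x * (b (fst x - fst y) * deriv (deriv b) (snd x - snd y))"
  have tl: "(\<integral>x. ?g1 x \<partial>lborel) + (\<integral>x. ?g2 x \<partial>lborel) = - (\<Sum>e\<in>E. edge_norm e * real (m e) * edge_integral e (psi b y))"
    using tropical_laplacian[OF graph finA neA corner weights cb(1) b_zero[OF bump] r, of "fst y" "snd y"] yO
    by (simp add: sq_def psi_def[abs_def])
  have c: "continuous_on UNIV ?g1" "continuous_on UNIV ?g2"
    by (intro continuous_on_mult trop_continuous[OF finA neA] smooth1_coordinate_continuous[OF bump] cb)+
  have z: "?g1 x = 0" "?g2 x = 0" if "x \<notin> sq r y" for x
    using notin_sq[OF that] b_zero[OF bump] b2_zero[OF bump] by auto
  have i: "integrable lborel ?g1" "integrable lborel ?g2"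
    using integrable_compact_support[OF c(1) compact_sq[of r y] z(1)] integrable_compact_support[OF c(2) compact_sq[of r y] z(2)] by blast+
  have F0f: "F0 x * lap_psi b y x = ?g1 x + ?g2 x" for x
  proof (cases "x \<in> sq r y")
    case True
    then show ?thesis using yO by (auto simp: F0_def lap_psi_def algebra_simps)
  next
    case False
    show ?thesis by (simp only: z[OF False] lap_psi_zero[OF bump False] mult_zero_right add_0)
  qed
  have iF: "integrable lborel (\<lambda>x. F0 x * lap_psi b y x)" unfolding F0f using i by simp
  have eF: "(\<integral>x. F0 x * lap_psi b y x \<partial>lborel) = - (\<Sum>e\<in>E. edge_norm e * real (m e) * edge_integral e (psi b y))"
    unfolding F0f tl[symmetric] using i by simp
  have "(\<integral>x. w N x * lap_psi b y x \<partial>lborel) = (\<integral>x. fN N x * lap_psi b y x \<partial>lborel) - (\<integral>x. F0 x * lap_psi b y x \<partial>lborel)" if N: "1 \<le> N" for N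
  proof -
    have fb: "\<bar>fN N x\<bar> \<le> C0" for x using fN_bounds[of N x] N by simp
    have "integrable lborel (\<lambda>x. fN N x * lap_psi b y x)"
      by (rule integrable_times_compact[OF fN_measurable fb lap_psi_continuous[OF bump] compact_sq[of r y]])
        (rule lap_psi_zero[OF bump])
    then show ?thesis using iF by (simp add: w_def left_diff_distrib)
  qed
  then have "\<forall>\<^sub>F N in sequentially. (\<integral>x. fN N x * lap_psi b y x \<partial>lborel) - (\<integral>x. F0 x * lap_psi b y x \<partial>lborel) = (\<integral>x. w N x * lap_psi b y x \<partial>lborel)"
    by (intro eventually_sequentiallyI[of 1]) simp
  moreover have "(\<lambda>N. (\<integral>x. fN N x * lap_psi b y x \<partial>lborel) - (\<integral>x. F0 x * lap_psi b y x \<partial>lborel)) \<longlonglongrightarrow> 0"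
    using tendsto_diff[OF fN_weak[OF y] tendsto_const[of "\<integral>x. F0 x * lap_psi b y x \<partial>lborel"]] eF by simp
  ultimately show ?thesis by (rule Lim_transform_eventually[rotated])
qed

end

text \<open>A segment from \<open>y\<close> to a point outside the interior meets the frontier,
  where \<open>f\<close> is zero, so the Lipschitz bound makes f(y)/L a lower bound for the distance
  to be covered. Level sets of \<open>f\<close> thus replace distances to the boundary in all later
  estimates.\<close>

lemma deep:
  assumes y: "y \<in> \<Omega>" and z: "L * dist y z < f y"
  shows "z \<in> interior \<Omega>"
proof (rule ccontr)
  assume nz: "z \<notin> interior \<Omega>"
  have "\<exists>x\<in>closed_segment y z. x \<in> frontier \<Omega>"
  proof (cases "z \<in> \<Omega>")
    case True
    then have "z \<in> frontier \<Omega>" using nz closure_subset[of \<Omega>] by (auto simp: frontier_def)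
    then show ?thesis by blast
  next
    case False
    then have "closed_segment y z \<inter> frontier \<Omega> \<noteq> {}"
      using y by (intro connected_Int_frontier) auto
    then show ?thesis by blast
  qed
  then obtain x where x: "x \<in> closed_segment y z" "x \<in> frontier \<Omega>" by blast
  have "dist y x \<le> dist y z" using x(1) dist_in_closed_segment[of x y z] by (simp add: dist_commute)
  then have "L * dist y x \<le> L * dist y z" using L_pos by (intro mult_left_mono) auto
  then show False using f_lipschitz[of y x] bdry[OF x(2)] z by linarith
qed

section \<open>The mollified difference\<close>

context
  fixes r :: real and b :: "real \<Rightarrow> real"
  assumes bump: "bump r b"
begin

definition u :: "nat \<Rightarrow> plane \<Rightarrow> real" where
  "u N y = (\<integral>x. w N x * psi b y x \<partial>lborel)"

text \<open>The integrals are Lipschitz in the centre \<open>y\<close> with a constant independent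
  of N, since \<open>w N\<close> is uniformly bounded. Convergence on a finite net therefore gives
  convergence on the whole compact set.\<close>

lemma w_weak_uniform:
  assumes Kc: "compact Kc" "\<And>y. y \<in> Kc \<Longrightarrow> sq r y \<subseteq> interior \<Omega>" and \<theta>: "0 < \<theta>"
  shows "\<forall>\<^sub>F N in sequentially. \<forall>y\<in>Kc. \<bar>\<integral>x. w N x * lap_psi b y x \<partial>lborel\<bar> \<le> \<theta>"
proof -
  obtain K where K: "0 < K" "\<And>x. \<bar>b x\<bar> \<le> K" "\<And>x y. \<bar>b x - b y\<bar> \<le> K * \<bar>x - y\<bar>"
    "\<And>x. \<bar>deriv (deriv b) x\<bar> \<le> K" "\<And>x y. \<bar>deriv (deriv b) x - deriv (deriv b) y\<bar> \<le> K * \<bar>x - y\<bar>"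
    using bump_constant[OF bump] by metis
  note r = r_pos[OF bump]
  have prod: "\<bar>s * t - s' * t'\<bar> \<le> K * (K * d) + K * (K * d)"
    if "\<bar>s\<bar> \<le> K" "\<bar>t'\<bar> \<le> K" "\<bar>s - s'\<bar> \<le> K * d" "\<bar>t - t'\<bar> \<le> K * d" for s t s' t' d
  proof -
    have "s * t - s' * t' = s * (t - t') + (s - s') * t'" by (simp add: algebra_simps)
    also have "\<bar>\<dots>\<bar> \<le> \<bar>s * (t - t')\<bar> + \<bar>(s - s') * t'\<bar>" by (rule abs_triangle_ineq)
    also have "\<dots> = \<bar>s\<bar> * \<bar>t - t'\<bar> + \<bar>t'\<bar> * \<bar>s - s'\<bar>" by (simp add: abs_mult mult.commute)
    also have "\<dots> \<le> K * (K * d) + K * (K * d)" using that K(1) by (intro add_mono mult_mono) auto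
    finally show ?thesis .
  qed
  have lip: "\<bar>lap_psi b y x - lap_psi b y' x\<bar> \<le> 4 * K * K * dist y y'" for x y y'
  proof -
    have c1: "\<bar>g (fst x - fst y) - g (fst x - fst y')\<bar> \<le> K * dist y y'" "\<bar>g (snd x - snd y) - g (snd x - snd y')\<bar> \<le> K * dist y y'"
      if g: "\<And>x y. \<bar>g x - g y\<bar> \<le> K * \<bar>x - y\<bar>" for g :: "real \<Rightarrow> real"
    proof -
      have d: "\<bar>fst y' - fst y\<bar> \<le> dist y y'" "\<bar>snd y' - snd y\<bar> \<le> dist y y'"
        using dist_fst_le[of y' y] dist_snd_le[of y' y] by (auto simp: dist_real_def dist_commute)
      show "\<bar>g (fst x - fst y) - g (fst x - fst y')\<bar> \<le> K * dist y y'"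
        by (rule order_trans[OF g]) (use d K(1) in \<open>auto intro!: mult_left_mono\<close>)
      show "\<bar>g (snd x - snd y) - g (snd x - snd y')\<bar> \<le> K * dist y y'"
        by (rule order_trans[OF g]) (use d K(1) in \<open>auto intro!: mult_left_mono\<close>)
    qed
    have "\<bar>deriv (deriv b) (fst x - fst y) * b (snd x - snd y) - deriv (deriv b) (fst x - fst y') * b (snd x - snd y')\<bar> \<le> K * (K * dist y y') + K * (K * dist y y')"
      "\<bar>b (fst x - fst y) * deriv (deriv b) (snd x - snd y) - b (fst x - fst y') * deriv (deriv b) (snd x - snd y')\<bar> \<le> K * (K * dist y y') + K * (K * dist y y')"
      by (intro prod c1 K)+
    then show ?thesis unfolding lap_psi_def by (simp add: algebra_simps)
  qed
  define M where "M = C3 * (4 * K * K) * (2 * (r + 1))\<^sup>2"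
  have M: "0 \<le> M" using C3_nonneg K(1) by (simp add: M_def)
  define \<delta> where "\<delta> = min 1 (\<theta> / (2 * (M + 1)))"
  have \<delta>: "0 < \<delta>" "\<delta> \<le> 1" "M * \<delta> \<le> \<theta> / 2"
  proof -
    show "0 < \<delta>" "\<delta> \<le> 1" using \<theta> M by (auto simp: \<delta>_def)
    have "M * \<delta> \<le> M * (\<theta> / (2 * (M + 1)))" using M by (intro mult_left_mono) (auto simp: \<delta>_def)
    also have "\<dots> \<le> \<theta> / 2" using M \<theta> by (simp add: field_simps)
    finally show "M * \<delta> \<le> \<theta> / 2" .
  qed
  have close: "\<bar>(\<integral>x. w N x * lap_psi b y x \<partial>lborel) - (\<integral>x. w N x * lap_psi b y' x \<partial>lborel)\<bar> \<le> \<theta> / 2"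
    if N: "1 \<le> N" and d: "dist y y' < \<delta>" for N y y'
  proof -
    have i: "integrable lborel (\<lambda>x. w N x * lap_psi b y x)" for y
      by (rule integrable_times_compact[OF w_measurable w_bound[OF N] lap_psi_continuous[OF bump] compact_sq[of r y]])
        (rule lap_psi_zero[OF bump])
    have "(\<integral>x. w N x * lap_psi b y x \<partial>lborel) - (\<integral>x. w N x * lap_psi b y' x \<partial>lborel)
        = (\<integral>x. w N x * (lap_psi b y x - lap_psi b y' x) \<partial>lborel)"
      using i by (simp add: right_diff_distrib)
    also have "\<bar>\<dots>\<bar> \<le> C3 * (4 * K * K * \<delta>) * (2 * (r + 1))\<^sup>2"
    proof (rule integral_abs_le_sq)
      show "\<bar>w N x * (lap_psi b y x - lap_psi b y' x)\<bar> \<le> C3 * (4 * K * K * \<delta>)" for x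
        unfolding abs_mult
      proof (rule mult_mono[OF w_bound[OF N]])
        have "4 * K * K * dist y y' \<le> 4 * K * K * \<delta>" using d K(1) by (intro mult_left_mono) auto
        then show "\<bar>lap_psi b y x - lap_psi b y' x\<bar> \<le> 4 * K * K * \<delta>" using lip[of y x y'] by simp
      qed (use C3_nonneg in auto)
      show "w N x * (lap_psi b y x - lap_psi b y' x) = 0" if x: "x \<notin> sq (r + 1) y" for x
      proof -
        have "x \<notin> sq r y" using x sq_mono[of r "r + 1" y] by auto
        moreover have "x \<notin> sq r y'"
        proof
          assume "x \<in> sq r y'"
          moreover have "\<bar>fst y - fst y'\<bar> \<le> 1" "\<bar>snd y - snd y'\<bar> \<le> 1"
            using dist_fst_le[of y y'] dist_snd_le[of y y'] d \<delta>(2) by (auto simp: dist_real_def)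
          ultimately have "x \<in> sq (r + 1) y" unfolding sq_def mem_Times_iff by auto
          then show False using x by blast
        qed
        ultimately show ?thesis using lap_psi_zero[OF bump] by simp
      qed
    qed (use r C3_nonneg K(1) \<delta> in auto)
    also have "\<dots> = M * \<delta>" by (simp add: M_def)
    finally show ?thesis using \<delta>(3) by simp
  qed
  obtain Y where Y: "finite Y" "Y \<subseteq> Kc" "Kc \<subseteq> (\<Union>y\<in>Y. ball y \<delta>)"
    using compactE_image[OF Kc(1), of Kc "\<lambda>y. ball y \<delta>"] \<delta>(1) by (metis UN_I centre_in_ball open_ball subsetI)
  have "\<forall>\<^sub>F N in sequentially. \<forall>y\<in>Y. \<bar>\<integral>x. w N x * lap_psi b y x \<partial>lborel\<bar> < \<theta> / 2"
  proof (rule eventually_ball_finite[OF Y(1)], rule ballI)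
    fix y assume "y \<in> Y"
    then have "(\<lambda>N. \<integral>x. w N x * lap_psi b y x \<partial>lborel) \<longlonglongrightarrow> 0"
      using w_weak[OF bump Kc(2)] Y(2) by blast
    then have "\<forall>\<^sub>F N in sequentially. dist (\<integral>x. w N x * lap_psi b y x \<partial>lborel) 0 < \<theta> / 2"
      using \<theta> by (intro tendstoD) auto
    then show "\<forall>\<^sub>F N in sequentially. \<bar>\<integral>x. w N x * lap_psi b y x \<partial>lborel\<bar> < \<theta> / 2" by simp
  qed
  then show ?thesis using eventually_ge_at_top[of 1]
  proof eventually_elim
    case (elim N)
    show ?case
    proof
      fix y assume "y \<in> Kc"
      then obtain y' where y': "y' \<in> Y" "dist y' y < \<delta>" using Y(3) by auto
      then have "\<bar>\<integral>x. w N x * lap_psi b y' x \<partial>lborel\<bar> < \<theta> / 2" using elim(1) by blast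
      then show "\<bar>\<integral>x. w N x * lap_psi b y x \<partial>lborel\<bar> \<le> \<theta>"
        using close[OF elim(2) y'(2)] by linarith
    qed
  qed
qed

text \<open>Finite differences in the centre of the mollifier can be taken on \<open>psi\<close>
  under the integral, where they approximate the continuous Laplacian up to O(1/N).\<close>

lemma D2_u:
  assumes Kc: "compact Kc" "\<And>y. y \<in> Kc \<Longrightarrow> sq r y \<subseteq> interior \<Omega>" and \<theta>: "0 < \<theta>"
  shows "\<forall>\<^sub>F N in sequentially. \<forall>y\<in>Kc. \<bar>D2 (1 / N) (u N) y\<bar> \<le> \<theta>"
proof -
  obtain K where K: "0 < K" "\<And>x. \<bar>b x\<bar> \<le> K" "\<And>x y. \<bar>deriv (deriv b) x - deriv (deriv b) y\<bar> \<le> K * \<bar>x - y\<bar>"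
    using bump_constant[OF bump] by metis
  note r = r_pos[OF bump]
  define M where "M = C3 * (2 * K * K) * (2 * (r + 1))\<^sup>2"
  have est: "\<bar>D2 (1 / N) (u N) y - (\<integral>x. w N x * lap_psi b y x \<partial>lborel)\<bar> \<le> M / N" if N: "1 \<le> N" for N :: nat and y
  proof -
    have h: "0 < 1 / real N" "1 / real N \<le> 1" using N by auto
    note pc = psi_continuous[OF bump] compact_sq psi_zero[OF bump]
    have i: "integrable lborel (\<lambda>x. w N x * psi b y x)" for y
      by (rule integrable_times_compact[OF w_measurable w_bound[OF N] pc])
    have iD: "integrable lborel (\<lambda>x. w N x * D2 (1 / N) (psi b y) x)"
      by (rule D2_adjoint(3)[OF w_measurable w_bound[OF N] pc])
    have il: "integrable lborel (\<lambda>x. w N x * lap_psi b y x)"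
      by (rule integrable_times_compact[OF w_measurable w_bound[OF N] lap_psi_continuous[OF bump] compact_sq[of r y]])
        (rule lap_psi_zero[OF bump])
    have sh: "psi b (y + c) x = psi b y (x - c)" "psi b (y - c) x = psi b y (x + c)" for c x
      by (simp_all add: psi_def algebra_simps)
    have "D2 (1 / N) (u N) y = (\<integral>x. w N x * D2 (1 / N) (psi b y) x \<partial>lborel)"
    proof -
      have e: "w N x * D2 (1 / N) (psi b y) x = (w N x * psi b (y + (1 / N, 0)) x + w N x * psi b (y - (1 / N, 0)) x
          + w N x * psi b (y + (0, 1 / N)) x + w N x * psi b (y - (0, 1 / N)) x - 4 * (w N x * psi b y x)) / (1 / N)\<^sup>2" for x
        unfolding D2_def sh by (simp add: algebra_simps add_divide_distrib diff_divide_distrib)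
      show ?thesis unfolding e unfolding D2_def u_def using i by simp
    qed
    then have "D2 (1 / N) (u N) y - (\<integral>x. w N x * lap_psi b y x \<partial>lborel) = (\<integral>x. w N x * (D2 (1 / N) (psi b y) x - lap_psi b y x) \<partial>lborel)"
      using iD il by (simp add: right_diff_distrib)
    also have "\<bar>\<dots>\<bar> \<le> C3 * (2 * K * K * (1 / N)) * (2 * (r + 1))\<^sup>2"
    proof (rule integral_abs_le_sq)
      show "\<bar>w N x * (D2 (1 / N) (psi b y) x - lap_psi b y x)\<bar> \<le> C3 * (2 * K * K * (1 / N))" for x
        unfolding abs_mult using D2_psi[OF bump h(1) K(2,3), of y x] w_bound[OF N, of x] C3_nonneg
        by (intro mult_mono) auto
      show "w N x * (D2 (1 / N) (psi b y) x - lap_psi b y x) = 0" if "x \<notin> sq (r + 1) y" for x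
      proof -
        have "x \<notin> sq r y" using that sq_mono[of r "r + 1" y] by auto
        then show ?thesis using lap_psi_zero[OF bump] D2_psi_zero[OF bump h that] by simp
      qed
    qed (use r C3_nonneg K(1) in auto)
    also have "\<dots> = M / N" by (simp add: M_def)
    finally show ?thesis .
  qed
  have "(\<lambda>N. M / real N) \<longlonglongrightarrow> 0" by (rule lim_const_over_n)
  then have "\<forall>\<^sub>F N in sequentially. dist (M / real N) 0 < \<theta> / 2" using \<theta> by (intro tendstoD) auto
  then have "\<forall>\<^sub>F N in sequentially. \<bar>M / real N\<bar> < \<theta> / 2" by simp
  moreover have "\<forall>\<^sub>F N in sequentially. \<forall>y\<in>Kc. \<bar>\<integral>x. w N x * lap_psi b y x \<partial>lborel\<bar> \<le> \<theta> / 2"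
    using w_weak_uniform[OF Kc(1) _ half_gt_zero[OF \<theta>]] Kc(2) by blast
  ultimately show ?thesis using eventually_ge_at_top[of 1]
  proof eventually_elim
    case (elim N)
    show ?case
    proof
      fix y assume "y \<in> Kc"
      then have "\<bar>\<integral>x. w N x * lap_psi b y x \<partial>lborel\<bar> \<le> \<theta> / 2" using elim(2) by blast
      then show "\<bar>D2 (1 / N) (u N) y\<bar> \<le> \<theta>" using est[OF elim(3), of y] elim(1) by linarith
    qed
  qed
qed

lemma u_bound:
  assumes N: "1 \<le> N" and c: "\<And>x. x \<in> sq r y \<Longrightarrow> \<bar>w N x\<bar> \<le> c"
  shows "\<bar>u N y\<bar> \<le> c"
  unfolding u_def by (rule psi_average_bound[OF bump w_measurable w_bound[OF N] c])

end

end

lemma sc_shift: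
  "sc N (fst v + 1, snd v) = sc N v + (1 / N, 0)" "sc N (fst v - 1, snd v) = sc N v - (1 / N, 0)"
  "sc N (fst v, snd v + 1) = sc N v + (0, 1 / N)" "sc N (fst v, snd v - 1) = sc N v - (0, 1 / N)"
  by (simp_all add: prod_eq_iff add_divide_distrib diff_divide_distrib)

lemma lap_sc:
  assumes "1 \<le> N"
  shows "lap (\<lambda>v. g (sc N v)) v = D2 (1 / N) g (sc N v) / (real N)\<^sup>2"
  using assms unfolding lap_def D2_def sc_shift by (simp add: power_divide)

lemma D2_square:
  assumes "h \<noteq> 0"
  shows "D2 h (\<lambda>y. (fst y)\<^sup>2 + (snd y)\<^sup>2) y = 4"
  using assms by (simp add: D2_def power2_eq_square field_simps)

context sandpile_limit
begin

definition K1 :: real where "K1 = card P + 1"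

text \<open>\<open>fine_barrier\<close> bounds the toppling function, and \<open>f\<close> bounds
  itself; hence the factor card P + 1 in \<open>K1\<close>. The term 2/N accounts for passing from
  \<open>x\<close> to its lattice point.\<close>

lemma w_near_boundary:
  assumes N: "1 \<le> N" and v: "v \<in> Gamma \<Omega> N" and r: "0 \<le> r" and x: "x \<in> sq r (sc N v)"
  shows "\<bar>w N x\<bar> \<le> K1 * (f (sc N v) + L * (2 * r + 2 / N)) + C2 / N"
proof -
  define B where "B = f (sc N v) + L * (2 * r + 2 / N)"
  have fv: "0 \<le> f (sc N v)" using f_nonneg v Gamma_sc[OF N] by blast
  have dx: "dist x (sc N v) \<le> 2 * r" by (rule dist_sq[OF x])
  have B0: "0 \<le> B" using fv r L_pos by (simp add: B_def)
  have C2N: "0 \<le> C2 / N" using C2_nonneg by simp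
  have fB: "f z \<le> B" if "dist z x \<le> 2 / N" for z
  proof -
    have "dist z (sc N v) \<le> 2 * r + 2 / N" using dist_triangle[of z "sc N v" x] that dx by linarith
    then have "L * dist z (sc N v) \<le> L * (2 * r + 2 / N)" using L_pos by (intro mult_left_mono) auto
    then show ?thesis using f_lipschitz[of z "sc N v"] by (simp add: B_def)
  qed
  have F0: "0 \<le> F0 x" "F0 x \<le> B"
    using f_nonneg[of x] fB[of x] B0 by (auto simp: F0_def)
  have fN: "fN N x \<le> card P * B + C2 / N"
  proof (cases "floor_pt (real N *\<^sub>R x) \<in> Gamma \<Omega> N")
    case True
    have "f (sc N (floor_pt (real N *\<^sub>R x))) \<le> B" by (rule fB[OF dist_sc_floor[OF N]])
    then have "card P * (N * f (sc N (floor_pt (real N *\<^sub>R x)))) \<le> card P * (N * B)" by (intro mult_left_mono) auto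
    then have "real_of_int (T N (floor_pt (real N *\<^sub>R x))) \<le> card P * (N * B) + C2"
      using fine_barrier[OF N True] by linarith
    then have "fN N x \<le> (card P * (N * B) + C2) / N" unfolding fN_def by (intro divide_right_mono) auto
    then show ?thesis using N by (simp add: add_divide_distrib)
  next
    case False
    then have "fN N x = 0" using T_properties(1)[OF N] by (simp add: fN_def)
    then show ?thesis using B0 C2N by simp
  qed
  have "\<bar>w N x\<bar> \<le> (card P * B + C2 / N) + B"
    unfolding w_def using F0 fN fN_bounds(1)[of N x] B0 C2N by (simp add: abs_le_iff add_nonneg_nonneg)
  then have "\<bar>w N x\<bar> \<le> (card P + 1) * B + C2 / N" by (simp add: algebra_simps)
  then show ?thesis unfolding K1_def B_def by simp
qed

text \<open>The maximum principle for \<open>\<plusminus> u + \<theta> |y|\<^sup>2\<close>; near the boundary \<open>fine_barrier\<close> applies.\<close>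

lemma mollified_small:
  assumes \<epsilon>: "0 < \<epsilon>"
  obtains r b where "bump r b" "r < \<epsilon>"
    "\<forall>\<^sub>F N in sequentially. \<forall>v\<in>Gamma \<Omega> N. \<epsilon> \<le> f (sc N v) \<longrightarrow> \<bar>u b N (sc N v)\<bar> \<le> \<epsilon>"
proof -
  have K1: "1 \<le> K1" by (simp add: K1_def)
  \<comment> \<open>Defines the boundary layer where \<open>f\<close> is at most \<kappa>. There the
    mollified difference is at most K1 (\<kappa> + \<kappa>/2) = 3\<epsilon>/16 plus a term that
    vanishes with N, below \<epsilon>/2 altogether.\<close>
  define \<kappa> where "\<kappa> = \<epsilon> / (8 * K1)"
  have \<kappa>: "0 < \<kappa>" "K1 * \<kappa> = \<epsilon> / 8" using \<epsilon> K1 by (auto simp: \<kappa>_def)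
  have \<kappa>\<epsilon>: "\<kappa> < \<epsilon>"
  proof -
    have "1 * \<kappa> \<le> K1 * \<kappa>" using K1 \<kappa>(1) by (intro mult_right_mono) auto
    then show ?thesis using \<kappa>(2) \<epsilon> by simp
  qed
  \<comment> \<open>Over the support of the mollifier \<open>f\<close> changes by at most
    \<kappa>/2, so squares around points with f \<ge> \<kappa> stay in the interior.\<close>
  define r where "r = min (\<epsilon> / 2) (\<kappa> / (4 * L))"
  have r: "0 < r" "r < \<epsilon>" using \<epsilon> \<kappa>(1) L_pos by (auto simp: r_def)
  have Lr: "L * (2 * r) \<le> \<kappa> / 2"
  proof -
    have "L * (2 * r) \<le> L * (2 * (\<kappa> / (4 * L)))" using L_pos by (intro mult_left_mono) (auto simp: r_def)
    then show ?thesis using L_pos by simp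
  qed
  obtain b where b: "smooth1 b" "\<And>x. 0 \<le> b x" "\<And>x. r \<le> \<bar>x\<bar> \<Longrightarrow> b x = 0" "integral {-r..r} b = 1"
    using bump_exists[OF r(1)] by blast
  then have bump: "bump r b" using r(1) by (simp add: bump_def)
  define Kc where "Kc = \<Omega> \<inter> {y. \<kappa> \<le> f y}"
  have "closed {y. \<kappa> \<le> f y}"
    using trop_continuous[OF finA neA, of UNIV] by (intro closed_Collect_le) auto
  then have Kc: "compact Kc" unfolding Kc_def using cpt by (rule compact_Int_closed[rotated])
  have Kcsq: "sq r y \<subseteq> interior \<Omega>" if "y \<in> Kc" for y
  proof
    fix z assume "z \<in> sq r y"
    then have "dist y z \<le> 2 * r" using dist_sq[of z r y] by (simp add: dist_commute)
    then have "L * dist y z \<le> L * (2 * r)" using L_pos by (intro mult_left_mono) auto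
    then have "L * dist y z < f y" using Lr \<kappa>(1) that by (simp add: Kc_def)
    then show "z \<in> interior \<Omega>" using that by (intro deep[of y z]) (simp_all add: Kc_def)
  qed
  define \<theta> where "\<theta> = \<epsilon> / D\<^sup>2"
  have \<theta>: "0 < \<theta>" "\<theta> * D\<^sup>2 = \<epsilon>" using \<epsilon> D(1) by (auto simp: \<theta>_def)
  have "\<forall>\<^sub>F N in sequentially. \<forall>y\<in>Kc. \<bar>D2 (1 / N) (u b N) y\<bar> \<le> \<theta>"
    using D2_u[OF bump Kc Kcsq \<theta>(1)] by blast
  moreover have "\<forall>\<^sub>F N in sequentially. (K1 * L * 2 + C2) / real N < \<epsilon> / 4"
    using order_tendstoD(2)[OF lim_const_over_n[of "K1 * L * 2 + C2"], of "\<epsilon> / 4"] \<epsilon> by simp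
  \<comment> \<open>Ensures that the neighbours of \<open>S\<close> still belong to \<Gamma>, so the
    boundary values in the maximum principle are taken inside \<Omega>.\<close>
  moreover have "\<forall>\<^sub>F N in sequentially. L / real N < \<kappa>"
    using order_tendstoD(2)[OF lim_const_over_n[of L] \<kappa>(1)] by simp
  ultimately have "\<forall>\<^sub>F N in sequentially. \<forall>v\<in>Gamma \<Omega> N. \<epsilon> \<le> f (sc N v) \<longrightarrow> \<bar>u b N (sc N v)\<bar> \<le> \<epsilon>"
    using eventually_ge_at_top[of 1]
  proof eventually_elim
    case (elim N)
    note D2b = elim(1) and small = elim(2) and LN = elim(3) and N = elim(4)
    define S where "S = {v \<in> Gamma \<Omega> N. \<kappa> < f (sc N v)}"
    have finS: "finite S" using finite_Gamma[OF N] by (simp add: S_def)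
    have nsq: "(fst (sc N v))\<^sup>2 + (snd (sc N v))\<^sup>2 \<le> D\<^sup>2" if "sc N v \<in> \<Omega>" for v
    proof -
      have "norm (sc N v) ^ 2 \<le> D\<^sup>2" using D(2)[OF that] by (intro power_mono) auto
      then show ?thesis by (simp add: norm_prod_def power_divide)
    qed
    have main: "\<sigma> * u b N (sc N v) \<le> 3 * \<epsilon> / 4" if v: "v \<in> S" and \<sigma>: "\<bar>\<sigma>\<bar> = 1" for v \<sigma>
    proof -
      \<comment> \<open>The five-point Laplacian of |y|^2 is 4, so the quadratic term adds \<theta>
        and compensates the error of size at most \<theta>. On \<Omega> this term is at most
        \<epsilon>/4.\<close>
      define g where "g v = \<sigma> * u b N (sc N v) + \<theta> / 4 * ((fst (sc N v))\<^sup>2 + (snd (sc N v))\<^sup>2)" for v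
      have "g v \<le> 3 * \<epsilon> / 4"
      proof (rule maximum_principle[OF finS _ _ v])
        fix v assume vS: "v \<in> S"
        have "sc N v \<in> Kc" using vS Gamma_sc[OF N] by (auto simp: S_def Kc_def)
        then have "\<bar>D2 (1 / N) (u b N) (sc N v)\<bar> \<le> \<theta>" using D2b by blast
        moreover have "\<bar>\<sigma> * D2 (1 / N) (u b N) (sc N v)\<bar> = \<bar>D2 (1 / N) (u b N) (sc N v)\<bar>" using \<sigma> by (simp add: abs_mult)
        ultimately have nn: "0 \<le> \<sigma> * D2 (1 / N) (u b N) (sc N v) + \<theta> / 4 * 4" by linarith
        have sq: "lap (\<lambda>v. (fst (sc N v))\<^sup>2 + (snd (sc N v))\<^sup>2) v = 4 / (real N)\<^sup>2"
          using lap_sc[OF N, of "\<lambda>y. (fst y)\<^sup>2 + (snd y)\<^sup>2" v] N D2_square[of "1 / real N" "sc N v"]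
          by (simp del: fst_sc snd_sc)
        have "lap g v = lap (\<lambda>v. \<sigma> * u b N (sc N v)) v + lap (\<lambda>v. \<theta> / 4 * ((fst (sc N v))\<^sup>2 + (snd (sc N v))\<^sup>2)) v"
          unfolding g_def by (rule lap_add)
        also have "\<dots> = \<sigma> * (D2 (1 / N) (u b N) (sc N v) / (real N)\<^sup>2) + \<theta> / 4 * (4 / (real N)\<^sup>2)"
          by (simp only: lap_cmult lap_sc[OF N, of "u b N"] sq)
        also have "\<dots> = (\<sigma> * D2 (1 / N) (u b N) (sc N v) + \<theta> / 4 * 4) / (real N)\<^sup>2"
          by (simp add: add_divide_distrib)
        also have "\<dots> \<ge> 0" using nn by simp
        finally show "0 \<le> lap g v" .
      next
        fix v w' assume vS: "v \<in> S" and w': "w' \<in> neighbours v" "w' \<notin> S"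
        have "dist (sc N v) (sc N w') \<le> 1 / N" using dist_sc_neighbour[OF w'(1), of N] by (simp add: dist_commute)
        then have "L * dist (sc N v) (sc N w') \<le> L * (1 / N)" using L_pos by (intro mult_left_mono) auto
        then have "L * dist (sc N v) (sc N w') < f (sc N v)" using LN vS by (simp add: S_def)
        then have "sc N w' \<in> interior \<Omega>" using vS Gamma_sc[OF N, of v \<Omega>] by (intro deep[of "sc N v"]) (simp_all add: S_def)
        then have w'O: "sc N w' \<in> \<Omega>" using interior_subset by blast
        then have w'G: "w' \<in> Gamma \<Omega> N" using Gamma_sc[OF N] by blast
        then have fw': "f (sc N w') \<le> \<kappa>" using w'(2) by (simp add: S_def not_less)
        have "\<bar>u b N (sc N w')\<bar> \<le> K1 * (f (sc N w') + L * (2 * r + 2 / N)) + C2 / N"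
          by (rule u_bound[OF bump N w_near_boundary[OF N w'G less_imp_le[OF r(1)]]])
        also have "\<dots> \<le> K1 * (\<kappa> + (\<kappa> / 2 + L * (2 / N))) + C2 / N"
          using fw' Lr K1 by (intro add_right_mono mult_left_mono add_mono) (auto simp: distrib_left)
        also have "\<dots> = 3 / 2 * (K1 * \<kappa>) + (K1 * L * 2 + C2) / N" by (simp add: field_simps flip: add_divide_distrib)
        also have "\<dots> \<le> \<epsilon> / 2" unfolding \<kappa>(2) using small \<epsilon> by linarith
        finally have "\<bar>\<sigma> * u b N (sc N w')\<bar> \<le> \<epsilon> / 2" using \<sigma> by (simp add: abs_mult)
        moreover have "\<theta> / 4 * ((fst (sc N w'))\<^sup>2 + (snd (sc N w'))\<^sup>2) \<le> \<theta> / 4 * D\<^sup>2"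
          using nsq[OF w'O] \<theta>(1) by (intro mult_left_mono) auto
        ultimately show "g w' \<le> 3 * \<epsilon> / 4" unfolding g_def using \<theta>(2) by simp
      qed
      moreover have "0 \<le> \<theta> / 4 * ((fst (sc N v))\<^sup>2 + (snd (sc N v))\<^sup>2)" using \<theta>(1) by simp
      ultimately show ?thesis unfolding g_def by linarith
    qed
    show ?case
    proof (intro ballI impI)
      fix v assume "v \<in> Gamma \<Omega> N" "\<epsilon> \<le> f (sc N v)"
      then have "v \<in> S" using \<kappa>\<epsilon> by (simp add: S_def)
      from main[OF this, of 1] main[OF this, of "-1"] show "\<bar>u b N (sc N v)\<bar> \<le> \<epsilon>" using \<epsilon> by simp
    qed
  qed
  then show ?thesis using that[OF bump r(2)] by blast
qed

end

section \<open>Mean square convergence\<close>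

lemma energy_nonneg: "0 \<le> energy R g"
  unfolding energy_def by (intro add_nonneg_nonneg sum_nonneg) auto

lemma energy_mono:
  assumes "R \<le> R'"
  shows "energy R g \<le> energy R' g"
  unfolding energy_def by (intro add_mono sum_mono2) (use assms in auto)

lemma energy_reflect: "energy R (\<lambda>v. c - g v) = energy R g"
  unfolding energy_def by (simp add: power2_commute)

text \<open>A shift by \<open>j\<close> telescopes into \<open>j\<close> unit steps. Cauchy-Schwarz
  yields one factor \<open>j\<close>, and adding up the energies of the shifted boxes yields the
  other.\<close>

lemma translation_right:
  fixes g :: "lattice \<Rightarrow> real"
  shows "(\<Sum>v\<in>lbox M. (g (fst v + int j, snd v) - g v)\<^sup>2) \<le> (real j)\<^sup>2 * energy (M + int j) g"
proof -
  let ?d = "\<lambda>i v. g (fst v + int i + 1, snd v) - g (fst v + int i, snd v)"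
  have one: "(\<Sum>v\<in>lbox M. (?d i v)\<^sup>2) \<le> energy (M + int j) g" if i: "i < j" for i
  proof -
    let ?s = "\<lambda>v :: lattice. (fst v + int i, snd v)"
    have inj: "inj_on ?s (lbox M)" by (auto simp: inj_on_def prod_eq_iff)
    have "(\<Sum>v\<in>lbox M. (?d i v)\<^sup>2) = (\<Sum>(x, y)\<in>?s ` lbox M. (g (x + 1, y) - g (x, y))\<^sup>2)"
      by (simp add: sum.reindex[OF inj] case_prod_unfold)
    also have "\<dots> \<le> (\<Sum>(x, y)\<in>{-(M + int j)..<M + int j} \<times> {-(M + int j)..M + int j}. (g (x + 1, y) - g (x, y))\<^sup>2)"
      by (rule sum_mono2) (use i in \<open>auto simp: lbox_def\<close>)
    also have "\<dots> \<le> energy (M + int j) g"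
      unfolding energy_def by (simp add: sum_nonneg case_prod_unfold)
    finally show ?thesis .
  qed
  have pt: "(g (fst v + int j, snd v) - g v)\<^sup>2 \<le> real j * (\<Sum>i<j. (?d i v)\<^sup>2)" for v
  proof -
    have "(\<Sum>i<j. ?d i v) = g (fst v + int j, snd v) - g v"
      using sum_lessThan_telescope[of "\<lambda>i. g (fst v + int i, snd v)" j] by (simp add: algebra_simps)
    then show ?thesis
      using sum_squared_le_sum_of_squares[of "\<lambda>i. ?d i v" "{..<j}"] by (simp add: mult.commute)
  qed
  have "(\<Sum>v\<in>lbox M. (g (fst v + int j, snd v) - g v)\<^sup>2) \<le> (\<Sum>v\<in>lbox M. real j * (\<Sum>i<j. (?d i v)\<^sup>2))"
    by (rule sum_mono[OF pt])
  also have "\<dots> = real j * (\<Sum>i<j. \<Sum>v\<in>lbox M. (?d i v)\<^sup>2)"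
    unfolding sum_distrib_left[symmetric] by (subst sum.swap) simp
  also have "\<dots> \<le> real j * (\<Sum>i<j. energy (M + int j) g)"
    by (intro mult_left_mono sum_mono one) auto
  finally show ?thesis by (simp add: power2_eq_square)
qed

lemma translation_x:
  fixes g :: "lattice \<Rightarrow> real"
  assumes z: "\<bar>z\<bar> \<le> int J"
  shows "(\<Sum>v\<in>lbox M. (g (fst v + z, snd v) - g v)\<^sup>2) \<le> (real J)\<^sup>2 * energy (M + 2 * int J) g"
proof -
  define j where "j = nat \<bar>z\<bar>"
  have j: "int j = \<bar>z\<bar>" "j \<le> J" using z by (auto simp: j_def)
  have fin: "(real j)\<^sup>2 * energy R g \<le> (real J)\<^sup>2 * energy (M + 2 * int J) g" if "R \<le> M + 2 * int J" for R
    using j(2) energy_mono[OF that, of g] energy_nonneg by (intro mult_mono power_mono) auto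
  show ?thesis
  proof (cases "0 \<le> z")
    case True
    then show ?thesis using translation_right[of g j M] fin[of "M + int j"] j by simp
  next
    case False
    \<comment> \<open>A shift to the left is a shift to the right seen from the translated box,
      hence the larger box.\<close>
    let ?s = "\<lambda>v :: lattice. (fst v + z, snd v)"
    have inj: "inj_on ?s (lbox M)" by (auto simp: inj_on_def prod_eq_iff)
    have zj: "z = - int j" using False j(1) by simp
    have "(\<Sum>v\<in>lbox M. (g (fst v + z, snd v) - g v)\<^sup>2) = (\<Sum>v\<in>?s ` lbox M. (g (fst v + int j, snd v) - g v)\<^sup>2)"
      unfolding sum.reindex[OF inj] comp_def by (rule sum.cong[OF refl], subst power2_commute, simp add: zj)
    also have "\<dots> \<le> (\<Sum>v\<in>lbox (M + int j). (g (fst v + int j, snd v) - g v)\<^sup>2)"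
      by (rule sum_mono2) (auto simp: lbox_def zj)
    also have "\<dots> \<le> (real j)\<^sup>2 * energy (M + int j + int j) g" by (rule translation_right)
    also have "\<dots> \<le> (real J)\<^sup>2 * energy (M + 2 * int J) g" using j by (intro fin) auto
    finally show ?thesis .
  qed
qed

lemma translation_y:
  fixes g :: "lattice \<Rightarrow> real"
  assumes z: "\<bar>z\<bar> \<le> int J"
  shows "(\<Sum>v\<in>lbox M. (g (fst v, snd v + z) - g v)\<^sup>2) \<le> (real J)\<^sup>2 * energy (M + 2 * int J) g"
proof -
  have sw: "prod.swap ` lbox M = lbox M" by (auto simp: lbox_def)
  have "(\<Sum>v\<in>lbox M. (g (fst v, snd v + z) - g v)\<^sup>2) = (\<Sum>v\<in>prod.swap ` lbox M. (g (fst v, snd v + z) - g v)\<^sup>2)"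
    by (simp only: sw)
  also have "\<dots> = (\<Sum>v\<in>lbox M. ((g \<circ> prod.swap) (fst v + z, snd v) - (g \<circ> prod.swap) v)\<^sup>2)"
    by (subst sum.reindex) (auto simp: prod.swap_def)
  also have "\<dots> \<le> (real J)\<^sup>2 * energy (M + 2 * int J) (g \<circ> prod.swap)" by (rule translation_x[OF z])
  finally show ?thesis by (simp only: energy_swap)
qed

lemma translation_estimate:
  fixes g :: "lattice \<Rightarrow> real"
  assumes z: "\<bar>z1\<bar> \<le> int J" "\<bar>z2\<bar> \<le> int J"
  shows "(\<Sum>v\<in>lbox M. (g (fst v + z1, snd v + z2) - g v)\<^sup>2) \<le> 4 * (real J)\<^sup>2 * energy (M + 3 * int J) g"
proof -
  let ?h = "\<lambda>v. (g (fst v, snd v + z2) - g v)\<^sup>2"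
  let ?s = "\<lambda>v :: lattice. (fst v + z1, snd v)"
  have inj: "inj_on ?s (lbox M)" by (auto simp: inj_on_def prod_eq_iff)
  have sq: "(s - t)\<^sup>2 \<le> 2 * (s - c)\<^sup>2 + 2 * (c - t)\<^sup>2" for s t c :: real
    using zero_le_power2[of "(s - c) - (c - t)"] by (simp add: power2_eq_square algebra_simps)
  have "(\<Sum>v\<in>lbox M. (g (fst v + z1, snd v + z2) - g v)\<^sup>2)
      \<le> (\<Sum>v\<in>lbox M. 2 * ?h (?s v) + 2 * (g (?s v) - g v)\<^sup>2)"
    by (intro sum_mono) (simp add: sq)
  also have "\<dots> = 2 * (\<Sum>v\<in>?s ` lbox M. ?h v) + 2 * (\<Sum>v\<in>lbox M. (g (?s v) - g v)\<^sup>2)"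
    by (simp add: sum.distrib sum_distrib_left sum.reindex[OF inj])
  finally have split: "(\<Sum>v\<in>lbox M. (g (fst v + z1, snd v + z2) - g v)\<^sup>2)
      \<le> 2 * (\<Sum>v\<in>?s ` lbox M. ?h v) + 2 * (\<Sum>v\<in>lbox M. (g (?s v) - g v)\<^sup>2)" .
  have "(\<Sum>v\<in>?s ` lbox M. ?h v) \<le> (\<Sum>v\<in>lbox (M + int J). ?h v)"
    by (rule sum_mono2) (use z in \<open>auto simp: lbox_def\<close>)
  also have "\<dots> \<le> (real J)\<^sup>2 * energy (M + int J + 2 * int J) g" by (rule translation_y[OF z(2)])
  also have "M + int J + 2 * int J = M + 3 * int J" by simp
  finally have s1: "(\<Sum>v\<in>?s ` lbox M. ?h v) \<le> (real J)\<^sup>2 * energy (M + 3 * int J) g" .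
  have "(\<Sum>v\<in>lbox M. (g (?s v) - g v)\<^sup>2) \<le> (real J)\<^sup>2 * energy (M + 2 * int J) g" by (rule translation_x[OF z(1)])
  also have "\<dots> \<le> (real J)\<^sup>2 * energy (M + 3 * int J) g" by (intro mult_left_mono energy_mono) simp_all
  finally show ?thesis using split s1 by linarith
qed

definition tr :: "lattice \<Rightarrow> lattice \<Rightarrow> lattice" where
  "tr c v = (fst v + fst c, snd v + snd c)"

lemma lap_tr: "lap (\<lambda>v. g (tr c v)) v = lap g (tr c v)"
  by (simp add: tr_def lap_translate)

lemma card_lbox: "0 \<le> R \<Longrightarrow> real (card (lbox R)) = (2 * real_of_int R + 1)\<^sup>2"
  by (simp add: lbox_def card_cartesian_product power2_eq_square)

lemma lbox_coord: "v \<in> lbox R \<longleftrightarrow> \<bar>fst v\<bar> \<le> R \<and> \<bar>snd v\<bar> \<le> R"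
  by (cases v) (auto simp: lbox_def)

section \<open>Mean square distance from the limit function\<close>

context sandpile_limit
begin

text \<open>A point of the box is at rescaled distance at most 2M/N from its centre, so
  \<open>f\<close> changes by at most 2 L M / N. The size condition makes this at most half of the
  central value.\<close>

lemma box_deep:
  assumes N: "1 \<le> N" and c: "c \<in> Gamma \<Omega> N" "0 < f (sc N c)" and v: "v \<in> lbox M"
    and M: "4 * L * real_of_int M \<le> N * f (sc N c)"
  shows "tr c v \<in> Gamma \<Omega> N" "f (sc N c) / 2 \<le> f (sc N (tr c v))"
    "\<bar>f (sc N (tr c v)) - f (sc N c)\<bar> \<le> 2 * L * M / N"
proof -
  have "\<bar>real_of_int (fst v)\<bar> \<le> M" "\<bar>real_of_int (snd v)\<bar> \<le> M" using v unfolding lbox_coord by linarith+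
  then have "(\<bar>real_of_int (fst v)\<bar> + \<bar>real_of_int (snd v)\<bar>) / N \<le> (2 * real_of_int M) / N"
    by (intro divide_right_mono) auto
  then have d: "dist (sc N (tr c v)) (sc N c) \<le> 2 * real_of_int M / N"
    using dist_sc[of N "tr c v" c] by (simp add: tr_def)
  have "L * dist (sc N (tr c v)) (sc N c) \<le> L * (2 * real_of_int M / N)" using d L_pos by (intro mult_left_mono) auto
  then have Ld: "L * dist (sc N (tr c v)) (sc N c) \<le> 2 * L * M / N" by (simp add: mult_ac)
  moreover have "2 * L * M / N \<le> f (sc N c) / 2" using M N by (simp add: field_simps)
  ultimately have half: "L * dist (sc N (tr c v)) (sc N c) \<le> f (sc N c) / 2" by linarith
  have "sc N (tr c v) \<in> interior \<Omega>"
    by (rule deep[of "sc N c"]) (use c half Gamma_sc[OF N] in \<open>auto simp: dist_commute\<close>)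
  then show "tr c v \<in> Gamma \<Omega> N" using interior_subset Gamma_sc[OF N] by blast
  have lip: "\<bar>f (sc N (tr c v)) - f (sc N c)\<bar> \<le> L * dist (sc N (tr c v)) (sc N c)" by (rule f_lipschitz)
  then show "\<bar>f (sc N (tr c v)) - f (sc N c)\<bar> \<le> 2 * L * M / N" using Ld by linarith
  show "f (sc N c) / 2 \<le> f (sc N (tr c v))" using lip half by linarith
qed

text \<open>The Caccioppoli inequality for the subharmonic function C0 N - T, which lies between 0
  and C0 N. The number of sites cancels the factor 1/R^2, so the bound does not depend on the box;
  800 = 32 * 25.\<close>

lemma energy_T:
  assumes N: "1 \<le> N" and R: "1 \<le> R" and box: "\<And>v. v \<in> lbox (2 * R) \<Longrightarrow> tr c v \<in> Gamma \<Omega> N"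
  shows "energy R (\<lambda>v. real_of_int (T N (tr c v))) \<le> 800 * C0\<^sup>2 * (real N)\<^sup>2"
proof -
  let ?g = "\<lambda>v. C0 * N - real_of_int (T N (tr c v))"
  have R0: "1 \<le> real_of_int R" using R by simp
  have b: "0 \<le> ?g v \<and> ?g v \<le> C0 * N" for v
    using T_properties(4)[OF N, of "tr c v"] T_nonneg[of N "tr c v"] by simp
  have "0 \<le> lap ?g v" if "v \<in> lbox (2 * R - 1)" for v
  proof -
    have "lap (T N) (tr c v) \<le> - src N (tr c v)"
      using box[of v] that by (intro T_properties(3)[OF N]) (auto simp: lbox_def)
    then have "lap (T N) (tr c v) \<le> 0" using src_nonneg[of N "tr c v"] by linarith
    moreover have "lap ?g v = - real_of_int (lap (T N) (tr c v))"
      unfolding lap_diff lap_of_int lap_tr by simp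
    ultimately show ?thesis by simp
  qed
  then have "energy R ?g \<le> 32 / (real_of_int R)\<^sup>2 * (\<Sum>v\<in>lbox (2 * R). (?g v)\<^sup>2)"
    using b by (intro energy_subharmonic[OF R]) auto
  also have "\<dots> \<le> 32 / (real_of_int R)\<^sup>2 * (\<Sum>v\<in>lbox (2 * R). (C0 * N)\<^sup>2)"
    using b by (intro mult_left_mono sum_mono power_mono) auto
  also have "\<dots> = 32 / (real_of_int R)\<^sup>2 * ((4 * real_of_int R + 1)\<^sup>2 * (C0 * N)\<^sup>2)"
    using R by (simp add: card_lbox)
  also have "\<dots> \<le> 32 / (real_of_int R)\<^sup>2 * ((5 * real_of_int R)\<^sup>2 * (C0 * N)\<^sup>2)"
    using R0 by (intro mult_left_mono mult_right_mono power_mono) auto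
  also have "\<dots> = 800 * C0\<^sup>2 * (real N)\<^sup>2" using R0 by (simp add: power_mult_distrib)
  finally show ?thesis by (simp only: energy_reflect)
qed

lemma fN_translate:
  assumes "1 \<le> N"
  shows "fN N (x + sc N z) = real_of_int (T N (tr z (floor_pt (real N *\<^sub>R x)))) / N"
proof -
  have "floor_pt (real N *\<^sub>R (x + sc N z)) = tr z (floor_pt (real N *\<^sub>R x))"
    using assms by (simp add: floor_pt_def tr_def distrib_left)
  then show ?thesis by (simp add: fN_def)
qed

text \<open>Every displacement \<open>x\<close> in the support of the mollifier acts on the lattice
  as a shift with coordinates at most \<open>J\<close>. Jensen moves the square inside the average,
  and for each displacement the sum over the box is bounded by the translation estimate.\<close>

lemma mollification_error:
  assumes bump: "bump r b" and N: "1 \<le> N" and J: "r * N + 1 \<le> real J"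
  shows "(\<Sum>v\<in>lbox M. (real_of_int (T N (tr c v)) / N - (\<integral>x. fN N x * psi b (sc N (tr c v)) x \<partial>lborel))\<^sup>2)
      \<le> 4 * (real J)\<^sup>2 * energy (M + 3 * int J) (\<lambda>v. real_of_int (T N (tr c v))) / (real N)\<^sup>2"
proof -
  let ?g = "\<lambda>v. real_of_int (T N (tr c v))"
  define h where "h v x = ?g v / N - fN N (x + sc N (tr c v))" for v x
  have h_meas: "h v \<in> borel_measurable borel" for v
  proof -
    have "(\<lambda>x. x + sc N (tr c v)) \<in> borel_measurable borel" by simp
    from measurable_compose[OF this fN_measurable] show ?thesis unfolding h_def[abs_def] by simp
  qed
  have T01: "0 \<le> ?g v / N" "?g v / N \<le> C0" for v
    using T_nonneg T_properties(4)[OF N, of "tr c v"] N by (auto simp: pos_divide_le_eq)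
  have h_bd: "\<bar>h v x\<bar> \<le> C0" for v x
    using T01[of v] fN_bounds(1)[of N "x + sc N (tr c v)"] fN_bounds(2)[OF N, of "x + sc N (tr c v)"]
    by (simp add: h_def abs_le_iff)
  have h2: "(\<lambda>x. (h v x)\<^sup>2) \<in> borel_measurable borel" "\<bar>(h v x)\<^sup>2\<bar> \<le> C0\<^sup>2" for v x
    using h_meas[of v] power_mono[OF h_bd[of v x], of 2] by simp_all
  note pc = psi_continuous[OF bump, of 0] compact_sq[of r 0] psi_zero[OF bump, of _ 0]
  have int2: "integrable lborel (\<lambda>x. (h v x)\<^sup>2 * psi b 0 x)" for v by (rule integrable_times_compact[OF h2 pc])
  have one: "(?g v / N - (\<integral>x. fN N x * psi b (sc N (tr c v)) x \<partial>lborel))\<^sup>2 \<le> (\<integral>x. (h v x)\<^sup>2 * psi b 0 x \<partial>lborel)" for v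
  proof -
    let ?y = "sc N (tr c v)"
    have ft: "(\<lambda>x. fN N (x + ?y)) \<in> borel_measurable borel" "\<bar>fN N (x + ?y)\<bar> \<le> C0" for x
    proof -
      have "(\<lambda>x. x + ?y) \<in> borel_measurable borel" by simp
      from measurable_compose[OF this fN_measurable] show "(\<lambda>x. fN N (x + ?y)) \<in> borel_measurable borel" .
      show "\<bar>fN N (x + ?y)\<bar> \<le> C0" using fN_bounds(1)[of N "x + ?y"] fN_bounds(2)[OF N, of "x + ?y"] by simp
    qed
    have ps: "psi b ?y (x + ?y) = psi b 0 x" for x by (simp add: psi_def)
    have "(\<lambda>x. fN N x * psi b ?y x) \<in> borel_measurable borel"
      using fN_measurable borel_measurable_continuous_onI[OF psi_continuous[OF bump]] by simp
    from integral_lborel_translate[OF this, of ?y]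
    have "(\<integral>x. fN N x * psi b ?y x \<partial>lborel) = (\<integral>x. fN N (x + ?y) * psi b 0 x \<partial>lborel)" by (simp only: ps)
    moreover have "(\<integral>x. h v x * psi b 0 x \<partial>lborel) = ?g v / N - (\<integral>x. fN N (x + ?y) * psi b 0 x \<partial>lborel)"
    proof -
      have "(\<integral>x. h v x * psi b 0 x \<partial>lborel) = (\<integral>x. ?g v / N * psi b 0 x - fN N (x + ?y) * psi b 0 x \<partial>lborel)"
        by (simp add: h_def left_diff_distrib)
      also have "\<dots> = (\<integral>x. ?g v / N * psi b 0 x \<partial>lborel) - (\<integral>x. fN N (x + ?y) * psi b 0 x \<partial>lborel)"
        using integrable_compact_support[OF pc] integrable_times_compact[OF ft pc]
        by (intro Bochner_Integration.integral_diff integrable_mult_right) auto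
      finally show ?thesis using integral_psi[OF bump, of 0] by simp
    qed
    ultimately show ?thesis using psi_jensen[OF bump h_meas h_bd, of v 0] by simp
  qed
  define G where "G x = (\<Sum>v\<in>lbox M. (h v x)\<^sup>2)" for x
  have "(\<Sum>v\<in>lbox M. (?g v / N - (\<integral>x. fN N x * psi b (sc N (tr c v)) x \<partial>lborel))\<^sup>2)
      \<le> (\<Sum>v\<in>lbox M. \<integral>x. (h v x)\<^sup>2 * psi b 0 x \<partial>lborel)" by (rule sum_mono[OF one])
  also have "\<dots> = (\<integral>x. G x * psi b 0 x \<partial>lborel)"
    unfolding G_def sum_distrib_right using int2 by (subst Bochner_Integration.integral_sum) auto
  also have "\<dots> \<le> \<bar>\<integral>x. G x * psi b 0 x \<partial>lborel\<bar>" by simp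
  also have "\<dots> \<le> 4 * (real J)\<^sup>2 * energy (M + 3 * int J) ?g / (real N)\<^sup>2"
  proof (rule psi_average_bound[OF bump])
    show "G \<in> borel_measurable borel" unfolding G_def[abs_def] using h2(1) by (intro borel_measurable_sum) auto
    have G0: "0 \<le> G x" for x by (simp add: G_def sum_nonneg)
    show "\<bar>G x\<bar> \<le> (\<Sum>v\<in>lbox M. C0\<^sup>2)" for x
    proof -
      have "G x \<le> (\<Sum>v\<in>lbox M. C0\<^sup>2)" unfolding G_def using h2(2) by (intro sum_mono) simp
      then show ?thesis using G0[of x] by simp
    qed
    fix x :: plane assume x: "x \<in> sq r 0"
    obtain z1 z2 where z: "floor_pt (real N *\<^sub>R x) = (z1, z2)" by (cases "floor_pt (real N *\<^sub>R x)")
    have bd: "\<bar>\<lfloor>real N * t\<rfloor>\<bar> \<le> int J" if "\<bar>t\<bar> \<le> r" for t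
    proof -
      have "\<bar>real N * t\<bar> \<le> r * N" using mult_left_mono[OF that, of "real N"] by (simp add: abs_mult mult.commute)
      then have "\<bar>real_of_int \<lfloor>real N * t\<rfloor>\<bar> \<le> r * N + 1" by linarith
      then show ?thesis using J by linarith
    qed
    have "\<bar>fst x\<bar> \<le> r" "\<bar>snd x\<bar> \<le> r" using x by (cases x, auto simp: sq_def)+
    then have zJ: "\<bar>z1\<bar> \<le> int J" "\<bar>z2\<bar> \<le> int J" using bd z by (auto simp: floor_pt_def)
    have hz: "(h v x)\<^sup>2 = (?g (fst v + z1, snd v + z2) - ?g v)\<^sup>2 / (real N)\<^sup>2" for v
    proof -
      have "fN N (x + sc N (tr c v)) = ?g (fst v + z1, snd v + z2) / N"
        unfolding fN_translate[OF N] z by (simp add: tr_def algebra_simps)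
      then have "h v x = - ((?g (fst v + z1, snd v + z2) - ?g v) / N)" by (simp add: h_def diff_divide_distrib)
      then show ?thesis by (simp only: power2_minus power_divide)
    qed
    have "G x = (\<Sum>v\<in>lbox M. (?g (fst v + z1, snd v + z2) - ?g v)\<^sup>2) / (real N)\<^sup>2"
      unfolding G_def hz by (rule sum_divide_distrib[symmetric])
    also have "\<dots> \<le> 4 * (real J)\<^sup>2 * energy (M + 3 * int J) ?g / (real N)\<^sup>2"
      using translation_estimate[OF zJ, where g = ?g and M = M] by (intro divide_right_mono) auto
    finally show "\<bar>G x\<bar> \<le> 4 * (real J)\<^sup>2 * energy (M + 3 * int J) ?g / (real N)\<^sup>2" using G0[of x] by simp
  qed
  finally show ?thesis .
qed

text \<open>The mollification of \<open>fN N\<close> is \<open>u\<close> plus the mollification of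
  \<open>F0\<close>; over a square of radius \<open>r\<close> in the interior, the latter averages
  values of \<open>f\<close> that differ from the central one by at most 2 L r.\<close>

lemma mollified_close:
  assumes bump: "bump r b" and N: "1 \<le> N" and y: "y \<in> \<Omega>" "2 * L * r < f y"
  shows "\<bar>(\<integral>x. fN N x * psi b y x \<partial>lborel) - f y\<bar> \<le> \<bar>u b N y\<bar> + 2 * L * r"
proof -
  note pc = psi_continuous[OF bump, of y] compact_sq[of r y] psi_zero[OF bump, of _ y]
  have iw: "integrable lborel (\<lambda>x. w N x * psi b y x)" by (rule integrable_times_compact[OF w_measurable w_bound[OF N] pc])
  have iF: "integrable lborel (\<lambda>x. F0 x * psi b y x)" by (rule integrable_times_compact[OF F0_measurable F0_bound pc])
  have ip: "integrable lborel (psi b y)" by (rule integrable_compact_support[OF pc])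
  have "(\<integral>x. fN N x * psi b y x \<partial>lborel) = (\<integral>x. w N x * psi b y x + F0 x * psi b y x \<partial>lborel)"
    by (simp add: w_def algebra_simps)
  also have "\<dots> = u b N y + (\<integral>x. F0 x * psi b y x \<partial>lborel)" unfolding u_def[OF bump] using iw iF by simp
  finally have e: "(\<integral>x. fN N x * psi b y x \<partial>lborel) = u b N y + (\<integral>x. F0 x * psi b y x \<partial>lborel)" .
  have "(\<integral>x. (F0 x - f y) * psi b y x \<partial>lborel) = (\<integral>x. F0 x * psi b y x - f y * psi b y x \<partial>lborel)"
    by (simp add: algebra_simps)
  also have "\<dots> = (\<integral>x. F0 x * psi b y x \<partial>lborel) - f y"
    using iF ip integral_psi[OF bump, of y] by simp
  finally have e2: "(\<integral>x. F0 x * psi b y x \<partial>lborel) - f y = (\<integral>x. (F0 x - f y) * psi b y x \<partial>lborel)" by simp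
  have "\<bar>\<integral>x. (F0 x - f y) * psi b y x \<partial>lborel\<bar> \<le> 2 * L * r"
  proof (rule psi_average_bound[OF bump])
    show "(\<lambda>x. F0 x - f y) \<in> borel_measurable borel" using F0_measurable by simp
    show "\<bar>F0 x - f y\<bar> \<le> \<bar>f 0\<bar> + L * D + \<bar>f y\<bar>" for x using F0_bound[of x] by linarith
    fix x assume "x \<in> sq r y"
    then have "L * dist x y \<le> L * (2 * r)" using dist_sq L_pos by (intro mult_left_mono) auto
    then have d: "L * dist x y \<le> 2 * L * r" by simp
    then have "x \<in> interior \<Omega>" using y by (intro deep[OF y(1)]) (simp add: dist_commute)
    then have "F0 x = f x" using interior_subset by (auto simp: F0_def)
    then show "\<bar>F0 x - f y\<bar> \<le> 2 * L * r" using f_lipschitz[of x y] d by simp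
  qed
  then show ?thesis using e e2 by linarith
qed

text \<open>The energy bound makes \<open>T N\<close> almost constant, in mean square, at the scale \<open>r N\<close> of the mollifier,
  and the mollification is already close to \<open>f\<close>.\<close>

lemma L2_small:
  assumes \<epsilon>: "0 < \<epsilon>" and \<tau>: "0 < \<tau>"
  shows "\<forall>\<^sub>F N in sequentially. \<forall>c\<in>Gamma \<Omega> N. \<epsilon> \<le> f (sc N c) \<longrightarrow>
     (\<forall>R\<ge>1. 64 * L * real_of_int R \<le> \<epsilon> * N \<longrightarrow>
       (\<Sum>v\<in>lbox (2 * R). (real_of_int (T N (tr c v)) / N - f (sc N (tr c v)))\<^sup>2) \<le> \<tau> * (real N)\<^sup>2)"
proof -
  \<comment> \<open>The constant of the final estimate: 57600 = 2 * 28800 comes from the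
    mollification error, 50 = 2 * 25 from the number of sites times the squared distance between the
    mollification and \<open>f\<close>.\<close>
  define Cb where "Cb = 57600 * C0\<^sup>2 + 50 * (\<epsilon> / (64 * L))\<^sup>2 * (1 + 2 * L)\<^sup>2"
  have Cb: "0 \<le> Cb" by (simp add: Cb_def)
  \<comment> \<open>The last bound yields \<open>Cb * e\<^sup>2 \<le> \<tau>\<close>; the middle one
    keeps the enlarged boxes and the mollifier inside the region where \<open>f\<close> is at least
    \<epsilon>/2.\<close>
  define e where "e = min 1 (min (\<epsilon> / (512 * (L + 1))) (\<tau> / (Cb + 1)))"
  have e0: "0 < e" using \<epsilon> \<tau> Cb L_pos by (simp add: e_def)
  have e1: "e \<le> 1" by (simp add: e_def)
  have "e \<le> \<epsilon> / (512 * (L + 1))" by (simp add: e_def)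
  then have e2: "512 * (L * e) + 512 * e \<le> \<epsilon>" using L_pos by (simp add: pos_le_divide_eq algebra_simps)
  have "e \<le> \<tau> / (Cb + 1)" by (simp add: e_def)
  then have "Cb * e + e \<le> \<tau>" using Cb by (simp add: pos_le_divide_eq algebra_simps)
  moreover have "Cb * e\<^sup>2 \<le> Cb * e" using e0 e1 Cb by (intro mult_left_mono) (auto simp: power2_eq_square mult_left_le_one_le)
  ultimately have e3: "Cb * e\<^sup>2 \<le> \<tau>" using e0 by linarith
  obtain r b where bump: "bump r b" and re: "r < e"
    and us: "\<forall>\<^sub>F N in sequentially. \<forall>v\<in>Gamma \<Omega> N. e \<le> f (sc N v) \<longrightarrow> \<bar>u b N (sc N v)\<bar> \<le> e"
    using mollified_small[OF e0] by blast
  have r0: "0 < r" by (rule r_pos[OF bump])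
  have "L * r \<le> L * e" using re L_pos by (intro mult_left_mono) auto
  then have Lr: "512 * (L * r) + 512 * e \<le> \<epsilon>" "L * r \<le> L * e" using e2 by linarith+
  obtain N0 :: nat where N0: "1 / r < N0" using reals_Archimedean2 by blast
  show ?thesis
    using us eventually_ge_at_top[of "max 1 N0"]
  proof eventually_elim
    case (elim N)
    then have N: "1 \<le> N" and N0N: "N0 \<le> N" by auto
    have "1 / r \<le> N" using N0 N0N by linarith
    then have rN: "1 \<le> r * N" using r0 by (simp add: pos_divide_le_eq mult.commute)
    define J where "J = nat \<lceil>r * N\<rceil> + 1"
    have "int J = \<lceil>r * N\<rceil> + 1" using rN by (simp add: J_def)
    then have J: "r * N + 1 \<le> real J" "real J \<le> 3 * (r * N)"
      using rN ceiling_correct[of "r * N"] by linarith+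
    show ?case
    proof (intro ballI impI allI)
      fix c and R :: int assume c: "c \<in> Gamma \<Omega> N" "\<epsilon> \<le> f (sc N c)" and R: "1 \<le> R" "64 * L * real_of_int R \<le> \<epsilon> * N"
      have fc: "0 < f (sc N c)" using c \<epsilon> by linarith
      \<comment> \<open>Radius 2R, enlarged by 3J for the translation estimate. The energy bound
        uses the box of twice this radius, which has to lie in \<Gamma>.\<close>
      let ?R = "2 * R + 3 * int J"
      have "L * real J \<le> L * (3 * (r * N))" using J L_pos by (intro mult_left_mono) auto
      then have "L * real J \<le> 3 * (L * r * N)" by (simp add: mult_ac)
      moreover have "512 * (L * r * N) \<le> \<epsilon> * N"
        using Lr(1) e0 mult_right_mono[of "512 * (L * r)" \<epsilon> "real N"] by (simp add: mult_ac)
      moreover have "\<epsilon> * N \<le> N * f (sc N c)" using mult_right_mono[OF c(2), of "real N"] by (simp add: mult.commute)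
      moreover have "4 * L * real_of_int (2 * ?R) = 16 * (L * R) + 24 * (L * real J)" by (simp add: algebra_simps)
      moreover have "0 \<le> \<epsilon> * N" using \<epsilon> by simp
      ultimately have dp: "4 * L * real_of_int (2 * ?R) \<le> N * f (sc N c)" using R(2) by linarith
      note bd = box_deep[OF N c(1) fc _ dp]
      have box: "v \<in> lbox (2 * ?R)" if "v \<in> lbox (2 * R)" for v using that R(1) by (auto simp: lbox_def)
      let ?t = "\<lambda>v. real_of_int (T N (tr c v)) / N" and ?y = "\<lambda>v. sc N (tr c v)"
      let ?I = "\<lambda>v. \<integral>x. fN N x * psi b (?y v) x \<partial>lborel"
      have close: "(?I v - f (?y v))\<^sup>2 \<le> ((1 + 2 * L) * e)\<^sup>2" if v: "v \<in> lbox (2 * R)" for v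
      proof -
        note b = bd(1,2)[OF box[OF v]]
        have h: "\<epsilon> / 2 \<le> f (?y v)" using b(2) c(2) by linarith
        have "e \<le> f (?y v)" "2 * L * r < f (?y v)" using h Lr e0 r0 L_pos mult_pos_pos[OF L_pos r0] by linarith+
        then have "\<bar>?I v - f (?y v)\<bar> \<le> e + 2 * L * r"
          using mollified_close[OF bump N, of "?y v"] b(1) Gamma_sc[OF N] elim(1) by fastforce
        also have "\<dots> \<le> (1 + 2 * L) * e" using Lr(2) by (simp add: algebra_simps)
        finally show ?thesis using abs_le_square_iff[of "?I v - f (?y v)" "(1 + 2 * L) * e"] L_pos e0 by simp
      qed
      have sq2: "(s - t)\<^sup>2 \<le> 2 * (s - z)\<^sup>2 + 2 * (z - t)\<^sup>2" for s t z :: real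
        using zero_le_power2[of "(s - z) - (z - t)"] by (simp add: power2_eq_square algebra_simps)
      have "(\<Sum>v\<in>lbox (2 * R). (?t v - f (?y v))\<^sup>2) \<le> (\<Sum>v\<in>lbox (2 * R). 2 * (?t v - ?I v)\<^sup>2 + 2 * ((1 + 2 * L) * e)\<^sup>2)"
      proof (rule sum_mono)
        fix v assume "v \<in> lbox (2 * R)"
        from close[OF this] sq2[of "?t v" "f (?y v)" "?I v"]
        show "(?t v - f (?y v))\<^sup>2 \<le> 2 * (?t v - ?I v)\<^sup>2 + 2 * ((1 + 2 * L) * e)\<^sup>2" by linarith
      qed
      also have "\<dots> = 2 * (\<Sum>v\<in>lbox (2 * R). (?t v - ?I v)\<^sup>2) + 2 * ((4 * real_of_int R + 1)\<^sup>2 * ((1 + 2 * L) * e)\<^sup>2)"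
        using R(1) by (simp add: sum.distrib sum_distrib_left card_lbox)
      finally have total: "(\<Sum>v\<in>lbox (2 * R). (?t v - f (?y v))\<^sup>2)
         \<le> 2 * (\<Sum>v\<in>lbox (2 * R). (?t v - ?I v)\<^sup>2) + 2 * ((4 * real_of_int R + 1)\<^sup>2 * ((1 + 2 * L) * e)\<^sup>2)" .
      have "(\<Sum>v\<in>lbox (2 * R). (?t v - ?I v)\<^sup>2) \<le> 4 * (real J)\<^sup>2 * energy ?R (\<lambda>v. real_of_int (T N (tr c v))) / (real N)\<^sup>2"
        by (rule mollification_error[OF bump N J(1)])
      also have "\<dots> \<le> 4 * (real J)\<^sup>2 * (800 * C0\<^sup>2 * (real N)\<^sup>2) / (real N)\<^sup>2"
        using R(1) bd(1) by (intro divide_right_mono mult_left_mono energy_T[OF N]) auto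
      also have "\<dots> = 3200 * C0\<^sup>2 * (real J)\<^sup>2" using N by simp
      also have "\<dots> \<le> 3200 * C0\<^sup>2 * (3 * (e * N))\<^sup>2"
      proof (intro mult_left_mono power_mono)
        have "r * N \<le> e * N" using re by (intro mult_right_mono) auto
        then show "real J \<le> 3 * (e * N)" using J(2) by linarith
      qed auto
      also have "\<dots> = 28800 * C0\<^sup>2 * e\<^sup>2 * (real N)\<^sup>2" by (simp add: power_mult_distrib)
      finally have p1: "(\<Sum>v\<in>lbox (2 * R). (?t v - ?I v)\<^sup>2) \<le> 28800 * C0\<^sup>2 * e\<^sup>2 * (real N)\<^sup>2" .
      have "real_of_int R \<le> \<epsilon> / (64 * L) * N" using R(2) L_pos by (simp add: field_simps)
      then have "4 * real_of_int R + 1 \<le> 5 * (\<epsilon> / (64 * L) * N)" using R(1) by linarith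
      then have "(4 * real_of_int R + 1)\<^sup>2 \<le> (5 * (\<epsilon> / (64 * L) * N))\<^sup>2" using R(1) by (intro power_mono) auto
      then have "(4 * real_of_int R + 1)\<^sup>2 * ((1 + 2 * L) * e)\<^sup>2 \<le> (5 * (\<epsilon> / (64 * L) * N))\<^sup>2 * ((1 + 2 * L) * e)\<^sup>2"
        by (rule mult_right_mono) simp
      also have "\<dots> = 25 * (\<epsilon> / (64 * L))\<^sup>2 * (1 + 2 * L)\<^sup>2 * e\<^sup>2 * (real N)\<^sup>2" by (simp only: power_mult_distrib) simp
      finally have "(\<Sum>v\<in>lbox (2 * R). (?t v - f (?y v))\<^sup>2)
          \<le> 2 * (28800 * C0\<^sup>2 * e\<^sup>2 * (real N)\<^sup>2) + 2 * (25 * (\<epsilon> / (64 * L))\<^sup>2 * (1 + 2 * L)\<^sup>2 * e\<^sup>2 * (real N)\<^sup>2)"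
        using total p1 by linarith
      also have "\<dots> = Cb * e\<^sup>2 * (real N)\<^sup>2" unfolding Cb_def by (simp add: algebra_simps)
      also have "\<dots> \<le> \<tau> * (real N)\<^sup>2" using e3 by (rule mult_right_mono) simp
      finally show "(\<Sum>v\<in>lbox (2 * R). (?t v - f (?y v))\<^sup>2) \<le> \<tau> * (real N)\<^sup>2" .
    qed
  qed
qed

end

section \<open>Uniform bounds\<close>

context sandpile_limit
begin

lemma lap_T_nonpos:
  assumes "1 \<le> N" "v \<in> Gamma \<Omega> N"
  shows "lap (\<lambda>w. real_of_int (T N w)) v \<le> 0"
proof -
  have "lap (T N) v \<le> 0" using T_properties(3)[OF assms] src_nonneg[of N v] by linarith
  then show ?thesis by (simp add: lap_of_int)
qed

lemma floor_radius:
  fixes s :: real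
  assumes s: "0 < s"
  shows "\<forall>\<^sub>F N in sequentially. 1 \<le> \<lfloor>s * real N\<rfloor> \<and> s * real N / 2 \<le> real_of_int \<lfloor>s * real N\<rfloor>"
proof -
  obtain N0 :: nat where N0: "2 / s < N0" using reals_Archimedean2 by blast
  show ?thesis
    using eventually_ge_at_top[of N0]
  proof eventually_elim
    case (elim N)
    have "2 / s \<le> N" using N0 elim by linarith
    then have "2 \<le> s * N" using s by (simp add: pos_divide_le_eq mult.commute)
    then show ?case by linarith
  qed
qed

text \<open>Truncating \<open>T N\<close> from above by a constant and reflecting gives a nonnegative subharmonic function,
  whose value at the centre of a box is controlled by its mean square.\<close>

lemma lower_bound:
  fixes \<epsilon> :: real
  assumes \<epsilon>: "0 < \<epsilon>"
  shows "\<forall>\<^sub>F N in sequentially. \<forall>c\<in>Gamma \<Omega> N. N * f (sc N c) - \<epsilon> * N \<le> T N c"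
proof -
  define s where "s = \<epsilon> / (64 * L)"
  have s: "0 < s" using \<epsilon> L_pos by (simp add: s_def)
  \<comment> \<open>2064 = 16 * 129, chosen so that the local bound on a box of radius at least s N
    / 2 turns the mean square bound into exactly (\<epsilon> N / 2)^2.\<close>
  define \<tau> where "\<tau> = s\<^sup>2 * \<epsilon>\<^sup>2 / 2064"
  have \<tau>: "0 < \<tau>" using s \<epsilon> by (simp add: \<tau>_def)
  show ?thesis
    using L2_small[OF \<epsilon> \<tau>] floor_radius[OF s] eventually_ge_at_top[of 1]
  proof eventually_elim
    case (elim N)
    note N = elim(3)
    define R where "R = \<lfloor>s * real N\<rfloor>"
    have R: "1 \<le> R" "s * N / 2 \<le> real_of_int R" using elim(2) by (auto simp: R_def)
    have "real_of_int R \<le> s * N" by (simp add: R_def)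
    then have LR: "64 * L * real_of_int R \<le> \<epsilon> * N" using L_pos by (simp add: s_def field_simps)
    have LR0: "0 \<le> L * real_of_int R" using L_pos R(1) by simp
    show ?case
    proof
      fix c assume c: "c \<in> Gamma \<Omega> N"
      show "N * f (sc N c) - \<epsilon> * N \<le> T N c"
      proof (cases "\<epsilon> \<le> f (sc N c)")
        case False
        then have "N * f (sc N c) \<le> N * \<epsilon>" by (intro mult_left_mono) auto
        then have "N * f (sc N c) - \<epsilon> * N \<le> 0" by (simp add: mult.commute)
        moreover have "0 \<le> real_of_int (T N c)" using T_nonneg by simp
        ultimately show ?thesis by linarith
      next
        case True
        have "4 * L * real_of_int (2 * R) \<le> \<epsilon> * N" using LR LR0 by (simp add: mult.assoc)
        also have "\<dots> \<le> N * f (sc N c)" using mult_right_mono[OF True, of "real N"] by (simp add: mult.commute)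
        finally have dp: "4 * L * real_of_int (2 * R) \<le> N * f (sc N c)" .
        note bd = box_deep[OF N c _ _ dp]
        have fc: "0 < f (sc N c)" using True \<epsilon> by linarith
        \<comment> \<open>Half of the allowed loss pays for the oscillation of \<open>f\<close>: on
          the box, \<open>c1\<close> is at most N f, so the truncated difference \<open>d\<close> is
          bounded by |T - N f|.\<close>
        define c1 where "c1 = N * f (sc N c) - \<epsilon> * N / 2"
        define d where "d v = max (c1 - real_of_int (T N (tr c v))) 0" for v
        have "0 \<le> lap d v" if v: "v \<in> lbox (2 * R - 1)" for v
        proof (cases "0 \<le> c1 - real_of_int (T N (tr c v))")
          case True
          have "v \<in> lbox (2 * R)" using v by (auto simp: lbox_def)
          then have "lap (\<lambda>w. real_of_int (T N w)) (tr c v) \<le> 0" using lap_T_nonpos[OF N] bd(1)[OF fc] by blast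
          then have "0 \<le> lap (\<lambda>v. c1 - real_of_int (T N (tr c v))) v"
            by (simp add: lap_diff lap_tr[of "\<lambda>w. real_of_int (T N w)"])
          also have "\<dots> \<le> lap d v" using True by (intro lap_mono_at) (auto simp: d_def)
          finally show ?thesis .
        next
          case False
          then have "lap (\<lambda>_. 0) v \<le> lap d v" by (intro lap_mono_at) (auto simp: d_def)
          then show ?thesis by simp
        qed
        moreover have "0 \<le> d v" for v by (simp add: d_def)
        ultimately have loc: "(d (0, 0))\<^sup>2 \<le> 129 / (real_of_int R)\<^sup>2 * (\<Sum>v\<in>lbox (2 * R). (d v)\<^sup>2)"
          by (intro subharmonic_local_bound[OF R(1)])
        have "(\<Sum>v\<in>lbox (2 * R). (d v)\<^sup>2)
            \<le> (\<Sum>v\<in>lbox (2 * R). (real N)\<^sup>2 * (real_of_int (T N (tr c v)) / N - f (sc N (tr c v)))\<^sup>2)"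
        proof (rule sum_mono)
          fix v assume v: "v \<in> lbox (2 * R)"
          have "2 * L * real_of_int (2 * R) / N \<le> \<epsilon> / 2"
            using LR LR0 N by (simp add: pos_divide_le_eq mult.assoc)
          then have "f (sc N c) - \<epsilon> / 2 \<le> f (sc N (tr c v))" using bd(3)[OF fc v] by linarith
          then have "N * (f (sc N c) - \<epsilon> / 2) \<le> N * f (sc N (tr c v))" by (intro mult_left_mono) auto
          then have "c1 - T N (tr c v) \<le> N * f (sc N (tr c v)) - T N (tr c v)" by (simp add: c1_def algebra_simps)
          then have "d v \<le> \<bar>T N (tr c v) - N * f (sc N (tr c v))\<bar>" by (simp add: d_def)
          then have "(d v)\<^sup>2 \<le> \<bar>T N (tr c v) - N * f (sc N (tr c v))\<bar>\<^sup>2" by (intro power_mono) (simp_all add: d_def)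
          also have "\<dots> = (N * (real_of_int (T N (tr c v)) / N - f (sc N (tr c v))))\<^sup>2"
            using N by (simp add: right_diff_distrib)
          finally show "(d v)\<^sup>2 \<le> (real N)\<^sup>2 * (real_of_int (T N (tr c v)) / N - f (sc N (tr c v)))\<^sup>2"
            by (simp only: power_mult_distrib)
        qed
        also have "\<dots> \<le> (real N)\<^sup>2 * (\<tau> * (real N)\<^sup>2)"
          unfolding sum_distrib_left[symmetric] using elim(1) c True R(1) LR by (intro mult_left_mono) auto
        finally have sm: "(\<Sum>v\<in>lbox (2 * R). (d v)\<^sup>2) \<le> (real N)\<^sup>2 * (\<tau> * (real N)\<^sup>2)" .
        note loc
        also have "129 / (real_of_int R)\<^sup>2 * (\<Sum>v\<in>lbox (2 * R). (d v)\<^sup>2)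
            \<le> 129 / (real_of_int R)\<^sup>2 * ((real N)\<^sup>2 * (\<tau> * (real N)\<^sup>2))" by (rule mult_left_mono[OF sm]) simp
        also have "\<dots> \<le> 129 / (s * N / 2)\<^sup>2 * ((real N)\<^sup>2 * (\<tau> * (real N)\<^sup>2))"
          using R s N \<tau> by (intro mult_right_mono divide_left_mono power_mono) auto
        also have "\<dots> = (\<epsilon> * N / 2)\<^sup>2" using s N by (simp add: \<tau>_def power_mult_distrib power_divide)
        finally have "d (0, 0) \<le> \<epsilon> * N / 2" by (rule power2_le_imp_le) (use \<epsilon> in simp)
        moreover have "c1 - real_of_int (T N c) \<le> d (0, 0)" by (simp add: d_def tr_def)
        ultimately show ?thesis unfolding c1_def by linarith
      qed
    qed
  qed
qed

end

text \<open>A path that never reached the boundary of the box centred at \<open>c\<close> would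
  remain strictly inside by induction, contrary to \<open>far\<close>. Only the part inside the box
  is retained, translated to the origin.\<close>

lemma conn_exits_box:
  assumes R: "1 \<le> R" and c: "c \<in> S" and v: "conn S c v" and far: "\<not> (\<bar>fst v - fst c\<bar> < R \<and> \<bar>snd v - snd c\<bar> < R)"
  shows "\<exists>v'. conn {w \<in> lbox R. tr c w \<in> S} (0, 0) v' \<and> (\<bar>fst v'\<bar> = R \<or> \<bar>snd v'\<bar> = R)"
proof (rule ccontr)
  let ?S = "{w \<in> lbox R. tr c w \<in> S}"
  let ?d = "\<lambda>w :: lattice. (fst w - fst c, snd w - snd c)"
  assume no: "\<not> ?thesis"
  have z: "(0, 0) \<in> ?S" using R c by (simp add: lbox_def tr_def)
  have "conn ?S (0, 0) (?d v)"
    using v unfolding conn_def[of S]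
  proof (induction rule: rtranclp_induct)
    case base
    then show ?case by (simp add: conn_refl)
  next
    case (step a b)
    have "?d a \<in> ?S" using conn_in[OF step(3) z] .
    moreover from this have in_box: "\<bar>fst a - fst c\<bar> < R" "\<bar>snd a - snd c\<bar> < R"
      using no step(3) by (auto simp: lbox_coord order.strict_iff_order)
    have "?d b \<in> neighbours (?d a)" using step(2) by (cases a; cases b) (auto simp: neighbours_Pair)
    moreover from this have "?d b \<in> ?S"
      using in_box step(2) by (cases a; cases b) (auto simp: neighbours_Pair lbox_coord tr_def)
    ultimately show ?case using conn_step[OF step(3)] by blast
  qed
  moreover from this have "?d v \<in> lbox R" using conn_in[OF _ z] by blast
  ultimately show False using no far by (auto simp: lbox_coord order.strict_iff_order)
qed

section \<open>Excess components and the upper bound\<close>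

context sandpile_limit
begin

definition Hi :: "real \<Rightarrow> nat \<Rightarrow> lattice set" where
  "Hi \<epsilon> N = {v \<in> Gamma \<Omega> N. N * f (sc N v) + \<epsilon> * N < T N v}"

text \<open>By \<open>fine_barrier\<close>, T is at most card P times N f plus \<open>C2\<close>. An
  excess of \<epsilon> N is therefore possible only where \<open>f\<close> is bounded below, which
  keeps the excess set off the boundary.\<close>

lemma Hi_deep:
  fixes \<epsilon> :: real
  assumes \<epsilon>: "0 < \<epsilon>"
  shows "\<forall>\<^sub>F N in sequentially. \<forall>v\<in>Hi \<epsilon> N. \<epsilon> / (2 * card P) \<le> f (sc N v)"
proof -
  have cP: "1 \<le> real (card P)" using finP neP by (simp add: Suc_leI card_gt_0_iff)
  obtain N0 :: nat where N0: "2 * C2 / \<epsilon> < N0" using reals_Archimedean2 by blast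
  show ?thesis
    using eventually_ge_at_top[of "max 1 N0"]
  proof eventually_elim
    case (elim N)
    then have N: "1 \<le> N" "0 < real N" by auto
    have "2 * C2 / \<epsilon> \<le> N" using N0 elim by linarith
    then have C2: "2 * C2 \<le> \<epsilon> * N" using \<epsilon> by (simp add: pos_divide_le_eq mult.commute)
    show ?case
    proof
      fix v assume v: "v \<in> Hi \<epsilon> N"
      then have G: "v \<in> Gamma \<Omega> N" by (simp add: Hi_def)
      have "0 \<le> N * f (sc N v)" using f_nonneg G Gamma_sc[OF N(1)] by simp
      then have "\<epsilon> * N \<le> 2 * (card P * (N * f (sc N v)))" using fine_barrier[OF N(1) G] v C2 by (simp add: Hi_def)
      then have "\<epsilon> * N \<le> (2 * card P * f (sc N v)) * N" by (simp add: mult_ac)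
      then have "\<epsilon> \<le> 2 * card P * f (sc N v)" using N(2) mult_le_cancel_right_pos by blast
      then show "\<epsilon> / (2 * card P) \<le> f (sc N v)" using cP by (simp add: pos_divide_le_eq mult.commute)
    qed
  qed
qed

text \<open>Turns mean square smallness into smallness of the mean, the form required by the
  superharmonic crossing bound.\<close>

lemma abs_le_square: "0 < \<theta> \<Longrightarrow> \<bar>x\<bar> \<le> \<theta> + x\<^sup>2 / \<theta>" for x \<theta> :: real
proof -
  assume \<theta>: "0 < \<theta>"
  have "0 \<le> (\<bar>x\<bar> - \<theta>)\<^sup>2 + \<bar>x\<bar> * \<theta>" using \<theta> by simp
  then have "\<bar>x\<bar> * \<theta> \<le> \<theta>\<^sup>2 + x\<^sup>2" by (simp add: power2_diff mult.commute)
  then show ?thesis using \<theta> by (simp add: field_simps power2_eq_square)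
qed

text \<open>A large component would be a crossing of a box on which the superharmonic function
  \<open>min (T N - c2) (\<epsilon> N)\<close> attains its maximum, although its average is small.\<close>

lemma Hi_components_small:
  fixes \<epsilon> \<delta> :: real
  assumes \<epsilon>: "0 < \<epsilon>" and \<delta>: "0 < \<delta>"
  shows "\<forall>\<^sub>F N in sequentially. \<forall>c\<in>Hi \<epsilon> N. \<forall>v. conn (Hi \<epsilon> N) c v \<longrightarrow>
     \<bar>real_of_int (fst v - fst c)\<bar> \<le> \<delta> * N \<and> \<bar>real_of_int (snd v - snd c)\<bar> \<le> \<delta> * N"
proof -
  define \<kappa> where "\<kappa> = \<epsilon> / (2 * card P)"
  have \<kappa>: "0 < \<kappa>" using \<epsilon> finP neP by (simp add: \<kappa>_def card_gt_0_iff)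
  \<comment> \<open>The crossing bound produces 193 * 100 \<theta> = 19300 \<theta>, which must stay
    below 3\<epsilon>/4.\<close>
  define \<theta> where "\<theta> = \<epsilon> / 50000"
  have \<theta>: "0 < \<theta>" using \<epsilon> by (simp add: \<theta>_def)
  define s where "s = min \<delta> (min (\<kappa> / (64 * L)) (\<theta> / (4 * L)))"
  have s: "0 < s" using \<delta> \<kappa> \<theta> L_pos by (simp add: s_def)
  have s_le: "s \<le> \<delta>" "s \<le> \<kappa> / (64 * L)" "s \<le> \<theta> / (4 * L)" by (simp_all add: s_def)
  then have Ls: "64 * L * s \<le> \<kappa>" "4 * L * s \<le> \<theta>" using L_pos by (simp_all add: pos_le_divide_eq mult_ac)
  \<comment> \<open>3088 = 16 * 193, so that the mean square term in the crossing bound becomes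
    \<epsilon> N / 4.\<close>
  define \<tau> where "\<tau> = \<theta> * s\<^sup>2 * \<epsilon> / 3088"
  have \<tau>: "0 < \<tau>" using s \<epsilon> \<theta> by (simp add: \<tau>_def)
  show ?thesis
    using L2_small[OF \<kappa> \<tau>] floor_radius[OF s] lower_bound[OF \<theta>] Hi_deep[OF \<epsilon>] eventually_ge_at_top[of 1]
  proof eventually_elim
    case (elim N)
    note N = elim(5)
    define R where "R = \<lfloor>s * real N\<rfloor>"
    have R: "1 \<le> R" "s * N / 2 \<le> real_of_int R" using elim(2) by (auto simp: R_def)
    have Rs: "real_of_int R \<le> s * N" by (simp add: R_def)
    have LR0: "0 \<le> L * real_of_int R" using L_pos R(1) by simp
    have Lm: "L * R \<le> L * s * N" using mult_left_mono[OF Rs, of L] L_pos by (simp add: mult.assoc)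
    have LR: "64 * L * real_of_int R \<le> \<kappa> * N" "4 * (L * R) \<le> \<theta> * N"
      using Lm mult_right_mono[OF Ls(1), of "real N"] mult_right_mono[OF Ls(2), of "real N"] by (simp_all add: mult.assoc)
    have Rd: "real_of_int R \<le> \<delta> * N" using Rs mult_right_mono[OF s_le(1), of "real N"] by simp
    show ?case
    proof (intro ballI allI impI)
      fix c v assume c: "c \<in> Hi \<epsilon> N" and v: "conn (Hi \<epsilon> N) c v"
      have cG: "c \<in> Gamma \<Omega> N" using c by (simp add: Hi_def)
      have fc: "\<kappa> \<le> f (sc N c)" using elim(4) c by (simp add: \<kappa>_def)
      have "\<bar>fst v - fst c\<bar> < R \<and> \<bar>snd v - snd c\<bar> < R"
      proof (rule ccontr)
        assume "\<not> ?thesis"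
        then obtain v' where v': "conn {w \<in> lbox R. tr c w \<in> Hi \<epsilon> N} (0, 0) v'" "\<bar>fst v'\<bar> = R \<or> \<bar>snd v'\<bar> = R"
          using conn_exits_box[OF R(1) c v] by blast
        have "4 * L * real_of_int (2 * R) \<le> \<kappa> * N" using LR(1) LR0 by (simp add: mult.assoc)
        also have "\<dots> \<le> N * f (sc N c)" using mult_right_mono[OF fc, of "real N"] by (simp add: mult.commute)
        finally have dp: "4 * L * real_of_int (2 * R) \<le> N * f (sc N c)" .
        have f0: "0 < f (sc N c)" using fc \<kappa> by linarith
        note bd = box_deep[OF N cG f0 _ dp]
        have near: "\<bar>N * f (sc N (tr c w)) - N * f (sc N c)\<bar> \<le> \<theta> * N" if w: "w \<in> lbox (2 * R)" for w
        proof -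
          have "N * \<bar>f (sc N (tr c w)) - f (sc N c)\<bar> \<le> N * (2 * L * real_of_int (2 * R) / N)"
            by (rule mult_left_mono[OF bd(3)[OF w]]) simp
          also have "\<dots> = 4 * (L * R)" using N by simp
          also have "N * \<bar>f (sc N (tr c w)) - f (sc N c)\<bar> = \<bar>N * f (sc N (tr c w)) - N * f (sc N c)\<bar>"
            by (simp add: abs_mult right_diff_distrib[symmetric])
          finally show ?thesis using LR(2) by linarith
        qed
        \<comment> \<open>One \<theta> N covers the lower bound for \<open>T\<close>, the other the
          oscillation of \<open>f\<close> on the box; hence the truncated function \<open>g\<close>
          is nonnegative.\<close>
        define c2 where "c2 = N * f (sc N c) - 2 * (\<theta> * N)"
        define g where "g w = min (real_of_int (T N (tr c w)) - c2) (\<epsilon> * N)" for w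
        have eN: "0 \<le> \<epsilon> * N" "0 \<le> \<theta> * N" using \<epsilon> \<theta> by auto
        have g01: "0 \<le> g w \<and> g w \<le> \<epsilon> * N" if w: "w \<in> lbox (2 * R)" for w
        proof -
          have "N * f (sc N (tr c w)) - \<theta> * N \<le> T N (tr c w)" using elim(3) bd(1)[OF w] by blast
          then show ?thesis using near[OF w] eN by (simp add: g_def c2_def abs_le_iff)
        qed
        have g_super: "lap g w \<le> 0" if w: "w \<in> lbox (2 * R - 1)" for w
        proof (cases "real_of_int (T N (tr c w)) - c2 \<le> \<epsilon> * N")
          case True
          then have "lap g w \<le> lap (\<lambda>w. real_of_int (T N (tr c w)) - c2) w" by (intro lap_mono_at) (auto simp: g_def)
          also have "\<dots> = lap (\<lambda>w. real_of_int (T N w)) (tr c w)"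
            by (simp add: lap_diff lap_tr[of "\<lambda>w. real_of_int (T N w)"])
          also have "\<dots> \<le> 0" using w by (intro lap_T_nonpos[OF N] bd(1)) (auto simp: lbox_def)
          finally show ?thesis .
        next
          case False
          then have "lap g w \<le> lap (\<lambda>_. \<epsilon> * N) w" by (intro lap_mono_at) (auto simp: g_def)
          then show ?thesis by simp
        qed
        have g_hi: "\<epsilon> * N \<le> g w" if w: "w \<in> {w \<in> lbox R. tr c w \<in> Hi \<epsilon> N}" for w
        proof -
          have "w \<in> lbox (2 * R)" using w R(1) by (auto simp: lbox_def)
          from near[OF this] have "N * f (sc N c) - \<theta> * N \<le> N * f (sc N (tr c w))" by linarith
          moreover have "N * f (sc N (tr c w)) + \<epsilon> * N < T N (tr c w)" using w by (simp add: Hi_def)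
          ultimately show ?thesis using eN unfolding g_def c2_def min_def by (simp; linarith)
        qed
        have "\<epsilon> * N \<le> 193 / (real_of_int R)\<^sup>2 * (\<Sum>w\<in>lbox (2 * R). g w)"
          by (rule superharmonic_crossing_bound[OF R(1) g01 g_super _ g_hi _ v'])
            (use c R(1) in \<open>auto simp: lbox_def tr_def\<close>)
        also have "\<dots> \<le> 193 / (real_of_int R)\<^sup>2 * (100 * \<theta> * N * (real_of_int R)\<^sup>2 + \<tau> / \<theta> * (real N)\<^sup>2 * N)"
        proof (rule mult_left_mono)
          let ?x = "\<lambda>w. real_of_int (T N (tr c w)) / N - f (sc N (tr c w))"
          have "(\<Sum>w\<in>lbox (2 * R). g w) \<le> (\<Sum>w\<in>lbox (2 * R). 4 * (\<theta> * N) + N / \<theta> * (?x w)\<^sup>2)"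
          proof (rule sum_mono)
            fix w assume w: "w \<in> lbox (2 * R)"
            have "N * ?x w \<le> N * (\<theta> + (?x w)\<^sup>2 / \<theta>)"
              using abs_le_square[OF \<theta>, of "?x w"] by (intro mult_left_mono) auto
            also have "N * ?x w = T N (tr c w) - N * f (sc N (tr c w))" using N by (simp add: right_diff_distrib)
            finally have "T N (tr c w) - N * f (sc N (tr c w)) \<le> \<theta> * N + N / \<theta> * (?x w)\<^sup>2"
              by (simp add: distrib_left mult.commute)
            moreover have "g w \<le> T N (tr c w) - c2" by (simp add: g_def)
            ultimately show "g w \<le> 4 * (\<theta> * N) + N / \<theta> * (?x w)\<^sup>2"
              using near[OF w] unfolding c2_def by linarith
          qed
          also have "\<dots> = (4 * real_of_int R + 1)\<^sup>2 * (4 * (\<theta> * N)) + N / \<theta> * (\<Sum>w\<in>lbox (2 * R). (?x w)\<^sup>2)"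
            unfolding sum.distrib sum_distrib_left[symmetric] using R(1) by (simp add: card_lbox)
          also have "\<dots> \<le> (5 * real_of_int R)\<^sup>2 * (4 * (\<theta> * N)) + N / \<theta> * (\<tau> * (real N)\<^sup>2)"
            using R(1) \<theta> elim(1) cG fc LR(1) by (intro add_mono mult_right_mono mult_left_mono power_mono) auto
          also have "\<dots> = 100 * \<theta> * N * (real_of_int R)\<^sup>2 + \<tau> / \<theta> * (real N)\<^sup>2 * N"
            by (simp add: power_mult_distrib)
          finally show "(\<Sum>w\<in>lbox (2 * R). g w) \<le> 100 * \<theta> * N * (real_of_int R)\<^sup>2 + \<tau> / \<theta> * (real N)\<^sup>2 * N" .
        qed simp
        also have "\<dots> = 19300 * \<theta> * N + 193 / (real_of_int R)\<^sup>2 * (\<tau> / \<theta> * (real N)\<^sup>2 * N)"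
          using R(1) by (simp add: distrib_left)
        also have "\<dots> \<le> 19300 * \<theta> * N + 193 / (s * N / 2)\<^sup>2 * (\<tau> / \<theta> * (real N)\<^sup>2 * N)"
          using R s N \<tau> \<theta> by (intro add_left_mono mult_right_mono divide_left_mono power_mono) auto
        also have "193 / (s * N / 2)\<^sup>2 * (\<tau> / \<theta> * (real N)\<^sup>2 * N) = \<epsilon> * N / 4"
          using s N \<theta> by (simp add: \<tau>_def power_mult_distrib power_divide)
        also have "19300 * \<theta> * N + \<epsilon> * N / 4 < \<epsilon> * N" using \<epsilon> N by (simp add: \<theta>_def)
        finally show False by simp
      qed
      then have "\<bar>real_of_int (fst v - fst c)\<bar> \<le> R \<and> \<bar>real_of_int (snd v - snd c)\<bar> \<le> R" by linarith
      then show "\<bar>real_of_int (fst v - fst c)\<bar> \<le> \<delta> * N \<and> \<bar>real_of_int (snd v - snd c)\<bar> \<le> \<delta> * N" using Rd by linarith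
    qed
  qed
qed

lemma P_separated:
  obtains \<delta> where "0 < \<delta>" "\<And>p p'. p \<in> P \<Longrightarrow> p' \<in> P \<Longrightarrow> p \<noteq> p' \<Longrightarrow> \<delta> \<le> dist p p'"
proof -
  define X where "X = insert 1 ((\<lambda>(p, p'). dist p p') ` {z \<in> P \<times> P. fst z \<noteq> snd z})"
  have X: "finite X" "X \<noteq> {}" using finP by (auto simp: X_def)
  have "0 < Min X" using X by (subst Min_gr_iff) (auto simp: X_def)
  moreover have "Min X \<le> dist p p'" if "p \<in> P" "p' \<in> P" "p \<noteq> p'" for p p'
    using X(1) that by (intro Min_le) (auto simp: X_def)
  ultimately show ?thesis using that by blast
qed

text \<open>A component \<open>W\<close> of \<open>Hi\<close> contains at most one source, so lowering \<open>T N\<close> on \<open>W\<close> to a tropical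
  polynomial kinked at that source keeps it admissible, and \<open>T N\<close> is the least admissible function.\<close>

lemma upper_bound:
  fixes \<epsilon> :: real
  assumes \<epsilon>: "0 < \<epsilon>"
  shows "\<forall>\<^sub>F N in sequentially. \<forall>v\<in>Gamma \<Omega> N. T N v \<le> N * f (sc N v) + 2 * (\<epsilon> * N)"
proof -
  obtain \<delta> where \<delta>: "0 < \<delta>" "\<And>p p'. p \<in> P \<Longrightarrow> p' \<in> P \<Longrightarrow> p \<noteq> p' \<Longrightarrow> \<delta> \<le> dist p p'"
    using P_separated by blast
  have \<delta>8: "0 < \<delta> / 8" using \<delta>(1) by simp
  \<comment> \<open>The second bound lets \<epsilon> N absorb the rounding errors of the barrier and
    the slope \<open>L\<close> for neighbours outside \<Gamma>; the first makes the rounding of the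
    sources small against their separation.\<close>
  obtain N0 :: nat where N0: "max (8 / \<delta>) ((\<bar>C1\<bar> + 2 + L) / \<epsilon>) < N0" using reals_Archimedean2 by blast
  show ?thesis
    using Hi_components_small[OF \<epsilon> \<delta>8] eventually_ge_at_top[of "max 1 N0"]
  proof eventually_elim
    case (elim N)
    then have N: "1 \<le> N" "0 < real N" and N0N: "N0 \<le> N" by auto
    have "8 / \<delta> < N" "(\<bar>C1\<bar> + 2 + L) / \<epsilon> \<le> N" using N0 N0N by simp_all
    then have N8: "8 < \<delta> * N" and NC: "\<bar>C1\<bar> + 2 + L \<le> \<epsilon> * N"
      using \<delta>(1) \<epsilon> by (simp_all add: pos_divide_less_eq pos_divide_le_eq mult.commute)
    show ?case
    proof
      fix v0 assume v0: "v0 \<in> Gamma \<Omega> N"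
      show "T N v0 \<le> N * f (sc N v0) + 2 * (\<epsilon> * N)"
      proof (cases "v0 \<in> Hi \<epsilon> N")
        case False
        moreover have "0 \<le> \<epsilon> * N" using \<epsilon> by simp
        ultimately show ?thesis using v0 by (simp add: Hi_def not_less)
      next
        case True
        define W where "W = {v. conn (Hi \<epsilon> N) v0 v}"
        have v0W: "v0 \<in> W" by (simp add: W_def conn_refl)
        have WHi: "v \<in> Hi \<epsilon> N" if "v \<in> W" for v using that conn_in[OF _ True] by (simp add: W_def)
        have W_step: "v \<in> W" if "u \<in> W" "v \<in> neighbours u" "v \<in> Hi \<epsilon> N" for u v
          using that WHi[OF that(1)] conn_step[of "Hi \<epsilon> N" v0 u v] by (simp add: W_def)
        have one: "p = p'" if p: "p \<in> P" "p' \<in> P" "q N p \<in> W" "q N p' \<in> W" for p p'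
        proof (rule ccontr)
          assume "p \<noteq> p'"
          then have far: "\<delta> \<le> dist p p'" using \<delta>(2) p by blast
          have d: "\<bar>real_of_int (fst v - fst v0)\<bar> \<le> \<delta> / 8 * N \<and> \<bar>real_of_int (snd v - snd v0)\<bar> \<le> \<delta> / 8 * N"
            if "v \<in> W" for v using elim(1) True that unfolding W_def by blast
          have "\<bar>real_of_int (fst (q N p) - fst (q N p'))\<bar> + \<bar>real_of_int (snd (q N p) - snd (q N p'))\<bar> \<le> 4 * (\<delta> / 8 * N)"
            using d[OF p(3)] d[OF p(4)] unfolding of_int_diff by linarith
          then have "(\<bar>real_of_int (fst (q N p) - fst (q N p'))\<bar> + \<bar>real_of_int (snd (q N p) - snd (q N p'))\<bar>) / N \<le> \<delta> / 2"
            using N(2) by (simp add: pos_divide_le_eq)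
          then have "dist (sc N (q N p)) (sc N (q N p')) \<le> \<delta> / 2" using dist_sc[of N "q N p" "q N p'"] by linarith
          moreover have "dist (sc N (q N p)) p \<le> 2 / N" "dist (sc N (q N p')) p' \<le> 2 / N"
            unfolding q_def by (rule dist_sc_floor[OF N(1)])+
          moreover have "dist p p' \<le> dist (sc N (q N p)) p + dist (sc N (q N p)) (sc N (q N p')) + dist (sc N (q N p')) p'"
            using dist_triangle[of p p' "sc N (q N p)"] dist_triangle[of "sc N (q N p)" p' "sc N (q N p')"]
            by (simp add: dist_commute)
          ultimately have "\<delta> \<le> \<delta> / 2 + 4 / N" using far by linarith
          moreover have "4 / N < \<delta> / 2" using N8 N(2) by (simp add: pos_divide_less_eq)
          ultimately show False by linarith
        qed
        \<comment> \<open>If the component contains no source the condition is vacuous, and any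
          element of P may serve.\<close>
        obtain p where p: "p \<in> P" "\<And>p'. p' \<in> P \<Longrightarrow> q N p' \<in> W \<Longrightarrow> p' = p"
          using neP one by (cases "\<exists>p\<in>P. q N p \<in> W") blast+
        obtain Y :: "lattice \<Rightarrow> int" where Y: "\<And>v. lap Y v \<le> 0" "lap Y (q N p) \<le> -1"
          "\<And>v. N * f (sc N v) + \<lceil>\<epsilon> * N\<rceil> \<le> Y v" "\<And>v. Y v \<le> N * f (sc N v) + \<lceil>\<epsilon> * N\<rceil> + C1 + 1"
          using kinked_approximation[OF p(1) N(1), where ?E0.0 = "\<lceil>\<epsilon> * N\<rceil>"] by blast
        have Y3: "N * f (sc N v) + \<epsilon> * N \<le> Y v" for v using Y(3)[of v] by linarith
        have srcW: "lap Y v \<le> - src N v" if v: "v \<in> W" for v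
        proof -
          have "src N v = (\<Sum>p'\<in>{p}. delta (q N p') v)"
            unfolding src_def using p v finP by (intro sum.mono_neutral_right) (auto simp: delta_def)
          then show ?thesis using Y(1)[of v] Y(2) by (auto simp: delta_def)
        qed
        define H where "H v = (if v \<in> W then min (T N v) (Y v) else T N v)" for v
        have HT: "H v \<le> T N v" for v by (simp add: H_def)
        have "T N v0 \<le> H v0"
        proof (rule T_le[OF N(1) _ _ v0])
          have "0 \<le> Y v" if "v \<in> W" for v
          proof -
            have "v \<in> Gamma \<Omega> N" using WHi[OF that] by (simp add: Hi_def)
            then have "0 \<le> N * f (sc N v)" using f_nonneg Gamma_sc[OF N(1)] by simp
            moreover have "0 \<le> \<epsilon> * N" using \<epsilon> by simp
            ultimately have "0 \<le> real_of_int (Y v)" using Y3[of v] by linarith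
            then show ?thesis by simp
          qed
          then show "0 \<le> H v" for v using T_nonneg by (simp add: H_def)
          fix v assume v: "v \<in> Gamma \<Omega> N"
          show "lap H v \<le> - src N v"
          proof (cases "v \<in> W \<and> Y v < T N v")
            case False
            \<comment> \<open>Where \<open>H\<close> agrees with \<open>T\<close>, lowering the
              neighbouring values can only decrease the Laplacian, so admissibility is
              inherited.\<close>
            then have "H v = T N v" by (auto simp: H_def)
            then have "lap H v \<le> lap (T N) v" using HT by (intro lap_mono_at) auto
            then show ?thesis using T_properties(3)[OF N(1) v] by linarith
          next
            case VW: True
            have "lap H v \<le> lap Y v"
            proof (rule lap_mono_at)
              show "H v = Y v" using VW by (simp add: H_def)
              \<comment> \<open>Gluing condition: a neighbour of the component in \<Gamma> but
                outside the component is not in the excess set, so \<open>T\<close> lies below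
                \<open>Y\<close> there.\<close>
              fix z assume z: "z \<in> neighbours v"
              show "H z \<le> Y z"
              proof (cases "z \<in> W")
                case True
                then show ?thesis by (simp add: H_def)
              next
                case False
                have "T N z \<le> Y z"
                proof (cases "z \<in> Gamma \<Omega> N")
                  case True
                  moreover have "z \<notin> Hi \<epsilon> N" using W_step[of v z] VW z False by blast
                  ultimately have "real_of_int (T N z) \<le> N * f (sc N z) + \<epsilon> * N" by (simp add: Hi_def not_less)
                  then have "real_of_int (T N z) \<le> real_of_int (Y z)" using Y3[of z] by linarith
                  then show ?thesis by simp
                next
                  \<comment> \<open>Outside \<Gamma> the toppling function is zero, while
                    \<open>Y\<close> is still nonnegative: one step away from \<Gamma>, N f is at
                    least -L, and \<epsilon> N exceeds \<open>L\<close>.\<close>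
                  case zG: False
                  have "L * dist (sc N z) (sc N v) \<le> L * (1 / N)"
                    using dist_sc_neighbour[OF z, of N] L_pos by (intro mult_left_mono) auto
                  then have "- (L / N) \<le> f (sc N z)"
                    using f_lipschitz[of "sc N z" "sc N v"] f_nonneg[of "sc N v"] v Gamma_sc[OF N(1)] by simp
                  then have "N * - (L / N) \<le> N * f (sc N z)" by (rule mult_left_mono) simp
                  then have "- L \<le> N * f (sc N z)" using N(2) by simp
                  then have "0 \<le> real_of_int (Y z)" using Y3[of z] NC by linarith
                  then show ?thesis using T_properties(1)[OF N(1) zG] by simp
                qed
                then show ?thesis using False by (simp add: H_def)
              qed
            qed
            then show ?thesis using srcW[of v] VW by linarith
          qed
        qed
        then have "T N v0 \<le> Y v0" using v0W by (simp add: H_def)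
        then have "real_of_int (T N v0) \<le> real_of_int (Y v0)" by simp
        moreover have "real_of_int \<lceil>\<epsilon> * N\<rceil> \<le> \<epsilon> * N + 1" by linarith
        ultimately show ?thesis using Y(4)[of v0] NC L_pos by linarith
      qed
    qed
  qed
qed

lemma fN_tendsto:
  assumes x: "x \<in> \<Omega>"
  shows "(\<lambda>N. fN N x) \<longlonglongrightarrow> f x"
proof (rule tendstoI)
  fix e :: real assume e: "0 < e"
  then have e4: "0 < e / 4" by simp
  obtain N0 :: nat where N0: "8 * L / e < N0" using reals_Archimedean2 by blast
  show "\<forall>\<^sub>F N in sequentially. dist (fN N x) (f x) < e"
    using lower_bound[OF e4] upper_bound[OF e4] eventually_ge_at_top[of "max 1 N0"]
  proof eventually_elim
    case (elim N)
    then have N: "1 \<le> N" "0 < real N" and N0N: "N0 \<le> N" by auto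
    define v where "v = floor_pt (real N *\<^sub>R x)"
    have "8 * L / e < N" using N0 N0N by linarith
    then have "8 * L < e * N" using e by (simp add: pos_divide_less_eq mult.commute)
    then have LN: "L * (2 / N) < e / 4" using N(2) by (simp add: field_simps)
    have "L * dist (sc N v) x \<le> L * (2 / N)" using dist_sc_floor[OF N(1), of x] L_pos unfolding v_def by (intro mult_left_mono) auto
    then have d: "L * dist (sc N v) x < e / 4" using LN by linarith
    have fv: "fN N x = real_of_int (T N v) / N" by (simp add: fN_def v_def)
    show ?case
    proof (cases "v \<in> Gamma \<Omega> N")
      case True
      have "N * (f (sc N v) - e / 4) \<le> T N v" "T N v \<le> N * (f (sc N v) + e / 2)"
        using elim(1,2) True by (auto simp: algebra_simps)
      then have "f (sc N v) - e / 4 \<le> fN N x" "fN N x \<le> f (sc N v) + e / 2"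
        using N(2) by (simp_all add: fv pos_le_divide_eq pos_divide_le_eq mult.commute)
      then show ?thesis using f_lipschitz[of "sc N v" x] d e by (simp add: dist_real_def abs_less_iff abs_le_iff)
    next
      case False
      \<comment> \<open>The lattice point of \<open>x\<close> may miss \<Gamma> although
        \<open>x\<close> lies in \<Omega>. The frontier is then close to \<open>x\<close>, and
        \<open>f x\<close> itself is small.\<close>
      then have "fN N x = 0" using T_properties(1)[OF N(1)] by (simp add: fv)
      moreover have "sc N v \<notin> interior \<Omega>" using False Gamma_sc[OF N(1)] interior_subset by blast
      then have "f x \<le> L * dist (sc N v) x" using deep[OF x, of "sc N v"] by (force simp: dist_commute)
      ultimately show ?thesis using d e f_nonneg[OF x] by (simp add: dist_real_def)
    qed
  qed
qed

end

theorem theorem5: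
  fixes \<Omega> P V :: "plane set" and E :: "edge set" and m :: "edge \<Rightarrow> nat" and F :: "plane \<Rightarrow> real"
  assumes "lattice_polygon \<Omega>" and "measure lebesgue \<Omega> \<noteq> 0"
    and "finite P" and "P \<noteq> {}" and "P \<subseteq> interior \<Omega>"
    and "sandpile_curve \<Omega> P V E m"
    and "omega_tropical_polynomial \<Omega> V E m F"
  shows "\<forall>x\<in>\<Omega>. (\<lambda>N. scaled_toppling \<Omega> P N x) \<longlonglongrightarrow> F x"
proof -
  obtain S where S: "finite S" "\<Omega> = convex hull (of_lattice ` S)" using assms(1) by (auto simp: lattice_polygon_def)
  have "compact \<Omega>" unfolding S(2) using S(1) by (intro finite_imp_compact_convex_hull) simp
  moreover have "convex \<Omega>" unfolding S(2) by (rule convex_convex_hull)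
  moreover obtain F' where F': "tropical_polynomial F'" "\<And>x. x \<in> frontier \<Omega> \<Longrightarrow> F' x = 0"
    "corner_locus F' \<inter> \<Omega> = graph_support V E" "\<And>e. e \<in> E \<Longrightarrow> tropical_weight F' e (m e)"
    "\<And>x. x \<in> \<Omega> \<Longrightarrow> F x = F' x"
    using assms(7) unfolding omega_tropical_polynomial_def by blast
  moreover obtain A a where A: "finite A" "A \<noteq> {}" "F' = trop A a" using F'(1) unfolding tropical_polynomial_trop by blast
  moreover have "rational_planar_graph V E" using assms(6) by (simp add: sandpile_curve_def)
  \<comment> \<open>The tropical polynomial enters through a representation \<open>trop A a\<close>,
    and F agrees with it on \<Omega>; the hull representation of the polygon provides compactness
    and convexity.\<close>
  ultimately interpret sandpile_limit \<Omega> P V E m A a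
    using assms by unfold_locales auto
  show ?thesis using fN_tendsto F'(5) A(3) by (simp add: scaled_toppling_fN)
qed

end
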